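(* Let $X$ be a compact manifold of dimension $2n$ and $Z_X\subset X$ a hypersurface. Then $(X,Z_X)$ admits a log-symplectic structure $\pi$ if and only if $(X,Z_X)$ admits a folded-symplectic structure $\omega$ for which there exists a closed one-form $\theta\in\Omega^1(Z_X)$ satisfying $\theta\wedge\omega^{n-1}|_{Z_X}\neq0$ (nowhere vanishing on $Z_X$). Moreover, $\pi^{-1}=\omega$ outside a neighbourhood of $Z_X$; that is: given such a $\pi$, the form $\omega$ can be chosen with $\omega=\pi^{-1}$ outside a neighbourhood of $Z_X$, and given such an $\omega$ (admitting such a $\theta$), the structure $\pi$ can be chosen with $\pi=\omega^{-1}$ outside a neighbourhood of $Z_X$.
   Context: All manifolds are smooth, compact and without boundary, not necessarily orientable. A hypersurface is a smooth embedded closed codimension-one submanifold (possibly empty or disconnected). A log-symplectic structure on a $2n$-dimensional manifold $X$ is a Poisson bivector $\pi\in\Gamma(\bigwedge^2TX)$ (i.e. $[\pi,\pi]=0$ for the Schouten--Nijenhuis bracket) such that $\bigwedge^n\pi$ is transverse to the zero section in $\bigwedge^{2n}TX$; put $Z_\pi=(\bigwedge^n\pi)^{-1}(0)$. The pair $(X,Z_X)$ admits a log-symplectic structure if there is one with $Z_\pi=Z_X$. On $X\setminus Z_\pi$, $\pi$ is invertible and $\pi^{-1}$ is a symplectic form. A folded-symplectic structure on $X^{2n}$ is a closed two-form $\omega$ such that $\bigwedge^n\omega$ is transverse to the zero section in $\bigwedge^{2n}T^*X$ and such that the restriction (pullback) of $\omega^{n-1}$ to $Z_\omega=(\bigwedge^n\omega)^{-1}(0)$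 is nowhere vanishing. The pair $(X,Z_X)$ admits a folded-symplectic structure if there is one with $Z_\omega=Z_X$. On $X\setminus Z_\omega$, $\omega$ is symplectic and $\omega^{-1}$ denotes the corresponding Poisson bivector. *)

theory Defs
  imports "HOL-Analysis.Analysis" "HOL-Combinatorics.Permutations"
begin

section \<open>Smooth maps between open subsets of Euclidean spaces\<close>

primrec Ck_on ::
  "nat \<Rightarrow> 'e::euclidean_space set \<Rightarrow> ('e \<Rightarrow> 'f::real_normed_vector) \<Rightarrow> bool" where
  "Ck_on 0 S f \<longleftrightarrow> continuous_on S f"
| "Ck_on (Suc k) S f \<longleftrightarrow>
     (\<forall>x\<in>S. f differentiable (at x)) \<and>
     (\<forall>v. Ck_on k S (\<lambda>x. frechet_derivative f (at x) v))"

definition smooth_on ::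
  "'e::euclidean_space set \<Rightarrow> ('e \<Rightarrow> 'f::real_normed_vector) \<Rightarrow> bool" where
  "smooth_on S f \<longleftrightarrow> (\<forall>k. Ck_on k S f)"


section \<open>Smooth manifolds\<close>

text \<open>A chart is a pair of its domain and its coordinate map; only the values of the coordinate
  map on the domain matter. A manifold carries a maximal atlas.\<close>

type_synonym ('a, 'e) chart = "'a set \<times> ('a \<Rightarrow> 'e)"

record ('a, 'e) manifold =
  mtop :: "'a topology"
  charts :: "('a, 'e) chart set"

abbreviation points :: "('a, 'e) manifold \<Rightarrow> 'a set" where
  "points M \<equiv> topspace (mtop M)"

abbreviation dom_of :: "('a, 'e) chart \<Rightarrow> 'a set" where
  "dom_of c \<equiv> fst c"

abbreviation coord_image :: "('a, 'e) chart \<Rightarrow> 'e set" where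
  "coord_image c \<equiv> snd c ` fst c"

abbreviation point_of :: "('a, 'e) chart \<Rightarrow> 'e \<Rightarrow> 'a" where
  "point_of c \<equiv> inv_into (fst c) (snd c)"

definition is_chart :: "'a topology \<Rightarrow> ('a, 'e::euclidean_space) chart \<Rightarrow> bool" where
  "is_chart T c \<longleftrightarrow>
     openin T (dom_of c) \<and> open (coord_image c) \<and>
     homeomorphic_map (subtopology T (dom_of c)) (top_of_set (coord_image c)) (snd c)"

text \<open>The two charts may have different model spaces, so that the same notion serves for the
  coordinate expression of an inclusion map.\<close>

definition transition :: "('a, 'e) chart \<Rightarrow> ('a, 'f) chart \<Rightarrow> 'e \<Rightarrow> 'f" where
  "transition c d = snd d \<circ> point_of c"

definition overlap :: "('a, 'e) chart \<Rightarrow> ('a, 'f) chart \<Rightarrow> 'e set" where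
  "overlap c d = snd c ` (dom_of c \<inter> dom_of d)"

definition compatible ::
  "('a, 'e::euclidean_space) chart \<Rightarrow> ('a, 'e) chart \<Rightarrow> bool" where
  "compatible c d \<longleftrightarrow>
     smooth_on (overlap c d) (transition c d) \<and> smooth_on (overlap d c) (transition d c)"

definition smooth_manifold :: "('a, 'e::euclidean_space) manifold \<Rightarrow> bool" where
  "smooth_manifold M \<longleftrightarrow>
     Hausdorff_space (mtop M) \<and> second_countable (mtop M) \<and>
     (\<forall>c\<in>charts M. is_chart (mtop M) c) \<and>
     \<Union> (dom_of ` charts M) = points M \<and>
     (\<forall>c\<in>charts M. \<forall>d\<in>charts M. compatible c d) \<and>
     (\<forall>c. is_chart (mtop M) c \<and> (\<forall>d\<in>charts M. compatible c d) \<longrightarrow> c \<in> charts M)"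

definition compact_manifold :: "('a, 'e::euclidean_space) manifold \<Rightarrow> bool" where
  "compact_manifold M \<longleftrightarrow> smooth_manifold M \<and> compact_space (mtop M)"

text \<open>\<open>Z\<close> is a closed subset of \<open>M\<close> with the subspace topology and with a smooth structure
  for which the inclusion is an immersion; this smooth structure is determined by the subset.\<close>

definition hypersurface ::
  "('a, 'e::euclidean_space) manifold \<Rightarrow> ('a, 'f::euclidean_space) manifold \<Rightarrow> bool" where
  "hypersurface M Z \<longleftrightarrow>
     smooth_manifold Z \<and> DIM('e) = DIM('f) + 1 \<and>
     closedin (mtop M) (points Z) \<and> mtop Z = subtopology (mtop M) (points Z) \<and>
     (\<forall>d\<in>charts Z. \<forall>c\<in>charts M.
        smooth_on (overlap d c) (transition d c) \<and>
        (\<forall>y\<in>overlap d c. inj (frechet_derivative (transition d c) (at y))))"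


section \<open>Exterior algebra\<close>

text \<open>An alternating \<open>k\<close>-linear form on \<open>'v\<close> is a function of sequences in \<open>'v\<close> that depends on the
  first \<open>k\<close> entries only. A \<open>k\<close>-vector of a Euclidean space \<open>'e\<close> is an alternating
  \<open>k\<close>-linear form on the dual space \<^typ>\<open>'e \<Rightarrow>\<^sub>L real\<close>.\<close>

type_synonym 'v form = "(nat \<Rightarrow> 'v) \<Rightarrow> real"

definition alt_form :: "nat \<Rightarrow> 'v::real_vector form \<Rightarrow> bool" where
  "alt_form k f \<longleftrightarrow>
     (\<forall>v w. (\<forall>i<k. v i = w i) \<longrightarrow> f v = f w) \<and>
     (\<forall>v. \<forall>i<k. linear (\<lambda>x. f (v(i := x)))) \<and>
     (\<forall>v. \<forall>i<k. \<forall>j<k. i \<noteq> j \<and> v i = v j \<longrightarrow> f v = 0)"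

definition wedge :: "nat \<Rightarrow> nat \<Rightarrow> 'v form \<Rightarrow> 'v form \<Rightarrow> 'v form" where
  "wedge k l f g = (\<lambda>v.
     (\<Sum>\<sigma> | \<sigma> permutes {..<k + l}.
        of_int (sign \<sigma>) * f (\<lambda>i. v (\<sigma> i)) * g (\<lambda>i. v (\<sigma> (k + i))))
     / (fact k * fact l))"

primrec wedge_power :: "'v form \<Rightarrow> nat \<Rightarrow> 'v form" where
  "wedge_power f 0 = (\<lambda>_. 1)"
| "wedge_power f (Suc m) = wedge 2 (2 * m) f (wedge_power f m)"

definition pair :: "'v \<Rightarrow> 'v \<Rightarrow> nat \<Rightarrow> 'v" where
  "pair x y = (\<lambda>i. if i = 0 then x else y)"

text \<open>\<open>v \<mapsto> w(v, \<cdot>)\<close> for a two-form \<open>w\<close>, and \<open>a \<mapsto> p(a, \<cdot>)\<close> for a bivector \<open>p\<close>.\<close>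

definition flat :: "'e::euclidean_space form \<Rightarrow> 'e \<Rightarrow> ('e \<Rightarrow>\<^sub>L real)" where
  "flat w v = Blinfun (\<lambda>u. w (pair v u))"

definition sharp :: "('e::euclidean_space \<Rightarrow>\<^sub>L real) form \<Rightarrow> ('e \<Rightarrow>\<^sub>L real) \<Rightarrow> 'e" where
  "sharp p a = (\<Sum>b\<in>Basis. p (pair a (blinfun_inner_left b)) *\<^sub>R b)"

definition mutually_inverse ::
  "('e::euclidean_space \<Rightarrow>\<^sub>L real) form \<Rightarrow> 'e form \<Rightarrow> bool" where
  "mutually_inverse p w \<longleftrightarrow>
     (\<forall>v. sharp p (flat w v) = v) \<and> (\<forall>a. flat w (sharp p a) = a)"


section \<open>Differential forms and multivector fields\<close>

text \<open>A field of forms (or of multivectors) on a manifold is the family of its local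
  representatives: \<open>\<omega> c x\<close> is its value, in the coordinates of the chart \<open>c\<close>, at the point with
  coordinates \<open>x\<close>. The representatives are related by the usual transformation law.\<close>

type_synonym ('a, 'e, 'v) field = "('a, 'e) chart \<Rightarrow> 'e \<Rightarrow> 'v form"

definition tensor_field ::
  "nat \<Rightarrow> ('a, 'e::euclidean_space) manifold \<Rightarrow> ('a, 'e, 'v::real_vector) field \<Rightarrow> bool" where
  "tensor_field k M s \<longleftrightarrow>
     (\<forall>c\<in>charts M. (\<forall>x\<in>coord_image c. alt_form k (s c x)) \<and>
                   (\<forall>v. smooth_on (coord_image c) (\<lambda>x. s c x v)))"

definition diff_form ::
  "nat \<Rightarrow> ('a, 'e::euclidean_space) manifold \<Rightarrow> ('a, 'e, 'e) field \<Rightarrow> bool" where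
  "diff_form k M \<omega> \<longleftrightarrow>
     tensor_field k M \<omega> \<and>
     (\<forall>c\<in>charts M. \<forall>d\<in>charts M. \<forall>x\<in>overlap c d. \<forall>v.
        \<omega> c x v =
        \<omega> d (transition c d x) (\<lambda>i. frechet_derivative (transition c d) (at x) (v i)))"

definition multivector_field ::
  "nat \<Rightarrow> ('a, 'e::euclidean_space) manifold \<Rightarrow> ('a, 'e, 'e \<Rightarrow>\<^sub>L real) field \<Rightarrow> bool" where
  "multivector_field k M P \<longleftrightarrow>
     tensor_field k M P \<and>
     (\<forall>c\<in>charts M. \<forall>d\<in>charts M. \<forall>x\<in>overlap c d. \<forall>a.
        P d (transition c d x) a =
        P c x (\<lambda>i. a i o\<^sub>L Blinfun (frechet_derivative (transition c d) (at x))))"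

definition field_power :: "('a, 'e, 'v) field \<Rightarrow> nat \<Rightarrow> ('a, 'e, 'v) field" where
  "field_power s m = (\<lambda>c x. wedge_power (s c x) m)"

definition field_wedge ::
  "nat \<Rightarrow> nat \<Rightarrow> ('a, 'e, 'v) field \<Rightarrow> ('a, 'e, 'v) field \<Rightarrow> ('a, 'e, 'v) field" where
  "field_wedge k l s t = (\<lambda>c x. wedge k l (s c x) (t c x))"

definition zero_locus :: "('a, 'e) manifold \<Rightarrow> ('a, 'e, 'v) field \<Rightarrow> 'a set" where
  "zero_locus M s = {p. \<exists>c\<in>charts M. p \<in> dom_of c \<and> s c (snd c p) = (\<lambda>_. 0)}"

definition nowhere_vanishing :: "('a, 'e) manifold \<Rightarrow> ('a, 'e, 'v) field \<Rightarrow> bool" where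
  "nowhere_vanishing M s \<longleftrightarrow>
     (\<forall>c\<in>charts M. \<forall>x\<in>coord_image c. s c x \<noteq> (\<lambda>_. 0))"

text \<open>Transversality of a section of \<open>\<Lambda>\<^sup>kT\<^sup>*M\<close> or \<open>\<Lambda>\<^sup>kTM\<close> to the zero section. Over a chart the
  total space is \<open>U \<times> \<Lambda>\<close> with \<open>\<Lambda>\<close> the space of alternating \<open>k\<close>-linear forms; at a zero, the tangent
  spaces \<open>{(u, Ds u)}\<close> of the graph and \<open>{(w, 0)}\<close> of the zero section must span \<open>'e \<times> \<Lambda>\<close>.\<close>

definition transverse_to_zero ::
  "nat \<Rightarrow> ('a, 'e::euclidean_space) manifold \<Rightarrow> ('a, 'e, 'v::real_vector) field \<Rightarrow> bool" where
  "transverse_to_zero k M s \<longleftrightarrow>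
     (\<forall>c\<in>charts M. \<forall>x\<in>coord_image c. s c x = (\<lambda>_. 0) \<longrightarrow>
        (\<forall>z \<tau>. alt_form k \<tau> \<longrightarrow>
           (\<exists>u w. z = u + w \<and>
                  \<tau> = (\<lambda>v. frechet_derivative (\<lambda>y. s c y v) (at x) u))))"

text \<open>Exterior derivative of a \<open>k\<close>-form in coordinates, evaluated on constant vector fields.\<close>

definition ext_deriv :: "nat \<Rightarrow> ('e::euclidean_space \<Rightarrow> 'e form) \<Rightarrow> 'e \<Rightarrow> 'e form" where
  "ext_deriv k \<omega> x = (\<lambda>v. \<Sum>i\<le>k. (- 1) ^ i *
     frechet_derivative (\<lambda>y. \<omega> y (\<lambda>j. if j < i then v j else v (Suc j))) (at x) (v i))"

definition closed_form ::
  "nat \<Rightarrow> ('a, 'e::euclidean_space) manifold \<Rightarrow> ('a, 'e, 'e) field \<Rightarrow> bool" where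
  "closed_form k M \<omega> \<longleftrightarrow>
     diff_form k M \<omega> \<and>
     (\<forall>c\<in>charts M. \<forall>x\<in>coord_image c. ext_deriv k (\<omega> c) x = (\<lambda>_. 0))"

text \<open>Schouten--Nijenhuis bracket of a \<open>p\<close>-vector field \<open>P\<close> and a \<open>q\<close>-vector field \<open>Q\<close> in coordinates:
  \<open>[P, Q] = \<Sum>\<^sub>b (P \<lfloor> dx\<^sup>b) \<and> \<partial>\<^sub>bQ - (-1)\<^bsup>(p-1)(q-1)\<^esup> (Q \<lfloor> dx\<^sup>b) \<and> \<partial>\<^sub>bP\<close>, where \<open>\<lfloor>\<close> inserts a covector
  into the last slot. It extends the Lie bracket (\<open>p = q = 1\<close>) and satisfies
  \<open>[P, Q \<and> R] = [P, Q] \<and> R + (-1)\<^bsup>(p-1)q\<^esup> Q \<and> [P, R]\<close>. The exponent is written \<open>(p+1)(q+1)\<close>, which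
  has the same parity and avoids truncated subtraction.\<close>

definition contract_last ::
  "nat \<Rightarrow> ('e::euclidean_space \<Rightarrow>\<^sub>L real) form \<Rightarrow> 'e \<Rightarrow> ('e \<Rightarrow>\<^sub>L real) form" where
  "contract_last p P b =
     (\<lambda>a. if p = 0 then 0 else P (a(p - 1 := blinfun_inner_left b)))"

definition partial_deriv :: "('e::euclidean_space \<Rightarrow> 'v form) \<Rightarrow> 'e \<Rightarrow> 'e \<Rightarrow> 'v form" where
  "partial_deriv Q b x = (\<lambda>a. frechet_derivative (\<lambda>y. Q y a) (at x) b)"

definition schouten ::
  "nat \<Rightarrow> nat \<Rightarrow> ('e::euclidean_space \<Rightarrow> ('e \<Rightarrow>\<^sub>L real) form) \<Rightarrow> ('e \<Rightarrow> ('e \<Rightarrow>\<^sub>L real) form)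
     \<Rightarrow> 'e \<Rightarrow> ('e \<Rightarrow>\<^sub>L real) form" where
  "schouten p q P Q x = (\<lambda>a. \<Sum>b\<in>Basis.
     wedge (p - 1) q (contract_last p (P x) b) (partial_deriv Q b x) a
     - (- 1) ^ ((p + 1) * (q + 1)) *
       wedge (q - 1) p (contract_last q (Q x) b) (partial_deriv P b x) a)"

definition poisson ::
  "('a, 'e::euclidean_space) manifold \<Rightarrow> ('a, 'e, 'e \<Rightarrow>\<^sub>L real) field \<Rightarrow> bool" where
  "poisson M \<pi> \<longleftrightarrow>
     multivector_field 2 M \<pi> \<and>
     (\<forall>c\<in>charts M. \<forall>x\<in>coord_image c. schouten 2 2 (\<pi> c) (\<pi> c) x = (\<lambda>_. 0))"

text \<open>Pullback of a form on \<open>M\<close> along the inclusion of \<open>Z\<close>. For a form on \<open>M\<close> the result does not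
  depend on the chart of \<open>M\<close> that is used.\<close>

definition pullback_incl ::
  "('a, 'e::euclidean_space) manifold \<Rightarrow> ('a, 'e, 'e) field
     \<Rightarrow> ('a, 'f::euclidean_space, 'f) field" where
  "pullback_incl M \<eta> = (\<lambda>d y v.
     let c = (SOME c. c \<in> charts M \<and> point_of d y \<in> dom_of c)
     in \<eta> c (transition d c y) (\<lambda>i. frechet_derivative (transition d c) (at y) (v i)))"


section \<open>Log-symplectic and folded-symplectic structures\<close>

text \<open>\<open>M\<close> has dimension \<open>2 * n\<close>.\<close>

definition log_symplectic ::
  "nat \<Rightarrow> ('a, 'e::euclidean_space) manifold \<Rightarrow> ('a, 'e, 'e \<Rightarrow>\<^sub>L real) field \<Rightarrow> bool" where
  "log_symplectic n M \<pi> \<longleftrightarrow>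
     poisson M \<pi> \<and> transverse_to_zero (2 * n) M (field_power \<pi> n)"

definition log_symplectic_pair ::
  "nat \<Rightarrow> ('a, 'e::euclidean_space) manifold \<Rightarrow> ('a, 'f::euclidean_space) manifold
     \<Rightarrow> ('a, 'e, 'e \<Rightarrow>\<^sub>L real) field \<Rightarrow> bool" where
  "log_symplectic_pair n M Z \<pi> \<longleftrightarrow>
     log_symplectic n M \<pi> \<and> zero_locus M (field_power \<pi> n) = points Z"

text \<open>A folded-symplectic structure whose fold is the hypersurface \<open>Z\<close>; the smooth structure of \<open>Z\<close>
  enters only through the pullback to the fold.\<close>

definition folded_symplectic_pair ::
  "nat \<Rightarrow> ('a, 'e::euclidean_space) manifold \<Rightarrow> ('a, 'f::euclidean_space) manifold
     \<Rightarrow> ('a, 'e, 'e) field \<Rightarrow> bool" where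
  "folded_symplectic_pair n M Z \<omega> \<longleftrightarrow>
     closed_form 2 M \<omega> \<and>
     transverse_to_zero (2 * n) M (field_power \<omega> n) \<and>
     zero_locus M (field_power \<omega> n) = points Z \<and>
     nowhere_vanishing Z (pullback_incl M (field_power \<omega> (n - 1)))"

definition admits_fold_form ::
  "nat \<Rightarrow> ('a, 'e::euclidean_space) manifold \<Rightarrow> ('a, 'f::euclidean_space) manifold
     \<Rightarrow> ('a, 'e, 'e) field \<Rightarrow> bool" where
  "admits_fold_form n M Z \<omega> \<longleftrightarrow>
     (\<exists>\<theta>. closed_form 1 Z \<theta> \<and>
        nowhere_vanishing Z
          (field_wedge 1 (2 * (n - 1)) \<theta> (pullback_incl M (field_power \<omega> (n - 1)))))"

definition inverse_outside ::
  "('a, 'e::euclidean_space) manifold \<Rightarrow> 'a set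
     \<Rightarrow> ('a, 'e, 'e \<Rightarrow>\<^sub>L real) field \<Rightarrow> ('a, 'e, 'e) field \<Rightarrow> bool" where
  "inverse_outside M U \<pi> \<omega> \<longleftrightarrow>
     (\<forall>c\<in>charts M. \<forall>p\<in>dom_of c - U.
        mutually_inverse (\<pi> c (snd c p)) (\<omega> c (snd c p)))"

end

(* Away from Z a log-symplectic bivector is inverse to a closed two-form w, and both directions of the
   correspondence add to w an exact correction d f wedge d psi supported near Z. Here psi is a locally defined
   function whose differential extends to a neighbourhood of Z the closed one-form theta on Z (the residue
   of w in the log-symplectic case), and f is a function of a global r >= 0 that vanishes to second order
   exactly along Z. Adding (1/2) d log r wedge d psi to a folded form creates the logarithmic pole;
   subtracting it from a logarithmic form leaves a closed two-form B that is smooth across Z, and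
   B + d phi wedge d psi, with phi a regularisation of (1/2) log r corrected by the function
   g = Pf(B) / Pf(w), is folded. This avoids tubular neighbourhoods and Moser's method: all nondegeneracy
   questions concern the single scalar Pf, the Pfaffian-like coefficient of the top power, which is affine in
   rank-two perturbations a wedge b. *)
theory Submission
  imports Defs
begin

text \<open>Orientability is not assumed, so the top power has no well-defined sign: in a chart it
  is a scalar \<open>F\<close>, known only up to a nonvanishing factor between charts, and only
  \<open>F^2\<close> can be averaged into a global function. This is why \<open>r\<close> vanishes
  to second order and why half of its logarithm appears: near Z, \<open>r = F^2 * m\<close> with
  \<open>m > 0\<close>, so half of d log r is dF / F plus a smooth form. The closed form theta need
  not be exact, so it is carried by primitives that depend on a base point up to constants. Starting
  from a folded form, psi may be multiplied by a locally constant sign; the added term then has the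
  sign of the old Pfaffian and nondegeneracy is immediate. Starting from a logarithmic form the
  residue fixes psi. Now Pf(B) contributes a term of first order in \<open>F\<close> and of unknown
  sign, against which the second-order main term loses near Z; the correction by \<open>g\<close>
  removes it up to a remainder of order \<open>r\<close>. All small constants serve to dominate this
  remainder and the errors of the cutoffs.\<close>

abbreviation (input) cimg :: "('a, 'e) chart => 'e set" where "cimg c \<equiv> coord_image c"
abbreviation (input) pt :: "('a, 'e) chart => 'e => 'a" where "pt c \<equiv> point_of c"
abbreviation (input) smo :: "'e::euclidean_space set => ('e => 'f::real_normed_vector) => bool" where "smo \<equiv> smooth_on"
abbreviation (input) opn :: "('a, 'e) manifold => 'a set => bool" where "opn M \<equiv> openin (mtop M)"
abbreviation (input) trn :: "('a, 'e) chart => ('a, 'f) chart => 'e => 'f" where "trn c d \<equiv> transition c d"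

section \<open>Calculus of smooth maps\<close>

abbreviation FD :: "('a::real_normed_vector => 'b::real_normed_vector) => 'a => 'a => 'b" where
 "FD f x \<equiv> frechet_derivative f (at x)"

lemma FD_eqI: "(f has_derivative f') (at x) ==> FD f x = f'"
 by (metis frechet_derivative_at)

lemma FD_cong:
 assumes "open S" "x \<in> S" "!!y. y \<in> S ==> f y = g y"
 shows "FD f x = FD g x"
proof -
 have "(f has_derivative D) (at x) \<longleftrightarrow> (g has_derivative D) (at x)" for D
  using has_derivative_transform_within_open[of f D x UNIV S g]
   has_derivative_transform_within_open[of g D x UNIV S f] assms by auto
 then show ?thesis by (simp add: frechet_derivative_def)
qed

lemma differentiable_cong_open:
 assumes "open S" "x \<in> S" "!!y. y \<in> S ==> f y = g y"
 shows "f differentiable (at x) \<longleftrightarrow> g differentiable (at x)"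
 unfolding differentiable_def
  using has_derivative_transform_within_open[of f _ x UNIV S g]
   has_derivative_transform_within_open[of g _ x UNIV S f] assms by auto

lemma Ck_on_cong:
 assumes "open S" "!!x. x \<in> S ==> f x = g x"
 shows "Ck_on k S f \<longleftrightarrow> Ck_on k S g"
 using assms(2)
proof (induction k arbitrary: f g)
 case 0 then show ?case by (simp cong: continuous_on_cong)
next
 case (Suc k)
 have "Ck_on k S (%x. FD f x v) \<longleftrightarrow> Ck_on k S (%x. FD g x v)" for v
  by (rule Suc.IH) (metis FD_cong Suc.prems assms(1))
 then show ?case using differentiable_cong_open[OF assms(1) _ Suc.prems] by auto
qed

lemma Ck_on_subset: "Ck_on k S f ==> T \<subseteq> S ==> Ck_on k T f"
 by (induction k arbitrary: f) (auto intro: continuous_on_subset)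

lemma Ck_on_local:
 assumes "!!x. x \<in> S ==> \<exists>T. open T & x \<in> T & Ck_on k T f"
 shows "Ck_on k S f"
 using assms
proof (induction k arbitrary: f)
 case 0
 have "\<exists>T. open T & x \<in> T & continuous_on T f" if "x \<in> S" for x using 0[OF that] by simp
 then show ?case
  by (auto intro!: continuous_at_imp_continuous_on) (meson continuous_on_eq_continuous_at)
next
 case (Suc k)
 show ?case
 proof (simp, intro conjI ballI allI)
  fix x assume "x \<in> S" then show "f differentiable (at x)" using Suc.prems[of x] by auto
 next
  fix v show "Ck_on k S (%x. FD f x v)"
   by (rule Suc.IH) (use Suc.prems in fastforce)
 qed
qed

lemma Ck_on_Suc_D: "Ck_on (Suc k) S f ==> Ck_on k S f"
proof (induction k arbitrary: f)
 case 0 then show ?case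
  by (auto intro!: differentiable_imp_continuous_on simp: differentiable_on_def)
   (metis UNIV_I differentiable_within_subset subset_UNIV)
next
 case (Suc k) then show ?case by (metis Ck_on.simps(2))
qed

text \<open>The derivative may be any explicit family \<open>D\<close>, so that regularity proofs
  can differentiate a formula again instead of working with the opaque
  \<open>frechet_derivative\<close>.\<close>

lemma Ck_on_Suc_I:
 assumes "open S" "!!x. x \<in> S ==> (f has_derivative D x) (at x)" "!!v. Ck_on k S (%x. D x v)"
 shows "Ck_on (Suc k) S f"
proof -
 have "Ck_on k S (%x. FD f x v)" for v
  using Ck_on_cong[OF assms(1), of "%x. FD f x v" "%x. D x v" k] FD_eqI[OF assms(2)] assms(3) by auto
 then show ?thesis using assms(2) by (auto simp: differentiable_def)
qed

lemma Ck_on_has_derivative: "Ck_on (Suc k) S f ==> x \<in> S ==> (f has_derivative FD f x) (at x)"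
 by (rule iffD1[OF frechet_derivative_works]) simp

lemma Ck_on_const: "open S ==> Ck_on k S (%_. c)"
 by (induction k arbitrary: c) (auto simp: frechet_derivative_const)

lemma Ck_on_linear: "open S ==> bounded_linear f ==> Ck_on k S f"
proof (cases k)
 case 0 then show "bounded_linear f ==> ?thesis" by (simp add: linear_continuous_on)
next
 case (Suc j) assume "open S" "bounded_linear f"
 then show ?thesis unfolding Suc
  by (intro Ck_on_Suc_I[where D = "%_. f"]) (auto intro: Ck_on_const bounded_linear_imp_has_derivative)
qed

lemma Ck_on_add:
 assumes "open S" "Ck_on k S f" "Ck_on k S g" shows "Ck_on k S (%x. f x + g x)"
 using assms(2,3)
proof (induction k arbitrary: f g)
 case 0 then show ?case by (simp add: continuous_on_add)
next
 case (Suc k)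
 show ?case
  by (rule Ck_on_Suc_I[where D = "%x v. FD f x v + FD g x v", OF assms(1)])
   (use Suc in \<open>auto intro!: derivative_intros Ck_on_has_derivative\<close>)
qed

lemma (in bounded_bilinear) Ck_on:
 assumes "open S" "Ck_on k S f" "Ck_on k S g" shows "Ck_on k S (%x. prod (f x) (g x))"
 using assms(2,3)
proof (induction k arbitrary: f g)
 case 0 then show ?case by (simp add: continuous_on)
next
 case (Suc k)
 have "((%x. prod (f x) (g x)) has_derivative (%v. prod (f x) (FD g x v) + prod (FD f x v) (g x))) (at x)" if "x \<in> S" for x
  using FDERIV[OF Ck_on_has_derivative[OF Suc.prems(1) that] Ck_on_has_derivative[OF Suc.prems(2) that]] by simp
 then show ?case
  by (rule Ck_on_Suc_I[OF assms(1)])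
   (use Suc.prems in \<open>auto intro!: Ck_on_add[OF assms(1)] Suc.IH simp: Ck_on_Suc_D[OF Suc.prems(1)] Ck_on_Suc_D[OF Suc.prems(2)]\<close>)
qed

text \<open>The derivative contains \<open>inverse (f x)\<close> itself, whose regularity of order
  \<open>k\<close> is the induction hypothesis.\<close>

lemma Ck_on_inverse:
 fixes f :: "'a::euclidean_space => real"
 assumes "open S" "Ck_on k S f" "!!x. x \<in> S ==> f x ~= 0" shows "Ck_on k S (%x. inverse (f x))"
 using assms(2)
proof (induction k)
 case 0 then show ?case using assms(3) by (auto intro: continuous_on_inverse)
next
 case (Suc k)
 have "((%x. inverse (f x)) has_derivative (%v. - (inverse (f x) * FD f x v * inverse (f x)))) (at x)" if "x \<in> S" for x
  using Deriv.has_derivative_inverse[OF assms(3)[OF that] Ck_on_has_derivative[OF Suc.prems that]] .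
 then show ?case
 proof (rule Ck_on_Suc_I[OF assms(1)])
  fix v
  have i: "Ck_on k S (%x. inverse (f x))" using Suc Ck_on_Suc_D by blast
  have "Ck_on k S (%x. (- 1) * (inverse (f x) * FD f x v * inverse (f x)))"
   using Suc.prems by (intro bounded_bilinear.Ck_on[OF bounded_bilinear_mult assms(1)] Ck_on_const i assms(1)) auto
  then show "Ck_on k S (%x. - (inverse (f x) * FD f x v * inverse (f x)))" by simp
 qed
qed

lemma Ck_on_sum:
 assumes "open S" "!!i. i \<in> I ==> Ck_on k S (f i)" shows "Ck_on k S (%x. \<Sum>i\<in>I. f i x)"
 using assms(2) by (induction I rule: infinite_finite_induct) (auto intro!: Ck_on_const Ck_on_add assms(1))

lemma linear_basis_expand:
 fixes f :: "'a::euclidean_space => 'b::real_vector"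
 assumes "linear f" shows "f x = (\<Sum>b\<in>Basis. (x \<bullet> b) *\<^sub>R f b)"
 by (metis (no_types, lifting) assms euclidean_representation linear_scale linear_sum sum.cong)

text \<open>The derivative of a composite applies \<open>FD g (f x)\<close> to the moving vector
  \<open>FD f x v\<close>. Expanding that vector over \<open>Basis\<close> leaves derivatives of
  \<open>g\<close> in fixed directions, which are composites of lower order, with coefficients
  coming from \<open>f\<close>.\<close>

lemma Ck_on_compose:
 fixes f :: "'a::euclidean_space => 'b::euclidean_space" and g :: "'b => 'c::real_normed_vector"
 assumes "open S" "open T" "Ck_on k S f" "Ck_on k T g" "!!x. x \<in> S ==> f x \<in> T"
 shows "Ck_on k S (%x. g (f x))"
 using assms(3,4)
proof (induction k arbitrary: g)
 case 0 then show ?case using assms(5) by (auto intro: continuous_on_compose2)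
next
 case (Suc k)
 have d: "((%x. g (f x)) has_derivative (%v. FD g (f x) (FD f x v))) (at x)" if "x \<in> S" for x
  using diff_chain_at[OF Ck_on_has_derivative[OF Suc.prems(1) that] Ck_on_has_derivative[OF Suc.prems(2) assms(5)[OF that]]]
  by (simp add: o_def)
 have e: "FD g (f x) (FD f x v) = (\<Sum>b\<in>Basis. (FD f x v \<bullet> b) *\<^sub>R FD g (f x) b)" if "x \<in> S" for x v
  by (rule linear_basis_expand, rule has_derivative_linear, rule Ck_on_has_derivative[OF Suc.prems(2) assms(5)[OF that]])
 have c: "Ck_on k S (%x. \<Sum>b\<in>Basis. (FD f x v \<bullet> b) *\<^sub>R FD g (f x) b)" for v
  using Suc.prems Ck_on_Suc_D[OF Suc.prems(1)]
  by (intro Ck_on_sum bounded_bilinear.Ck_on[OF bounded_bilinear_scaleR] bounded_bilinear.Ck_on[OF bounded_bilinear_inner] Suc.IH Ck_on_const assms(1)) auto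
 show ?case
  by (rule Ck_on_Suc_I[OF assms(1) d]) (use c in \<open>simp_all add: Ck_on_cong[OF assms(1) e]\<close>)
qed

section \<open>Closure properties of smooth maps\<close>

lemma sm_subset: "smo S f ==> T \<subseteq> S ==> smo T f"
 unfolding smooth_on_def using Ck_on_subset by blast

lemma sm_cong:
 assumes "open S" "!!x. x \<in> S ==> f x = g x" shows "smo S f \<longleftrightarrow> smo S g"
 unfolding smooth_on_def using Ck_on_cong[OF assms] by auto

lemma sm_local:
 assumes "!!x. x \<in> S ==> \<exists>T. open T & x \<in> T & smo T f" shows "smo S f"
 unfolding smooth_on_def
proof
 fix k show "Ck_on k S f" by (rule Ck_on_local) (use assms in \<open>auto simp: smooth_on_def\<close>)
qed

lemma sm_has_derivative: "smo S f ==> x \<in> S ==> (f has_derivative FD f x) (at x)"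
 unfolding smooth_on_def by (rule Ck_on_has_derivative[of 0]) auto

lemma sm_diffble: "smo S f ==> x \<in> S ==> f differentiable (at x)"
 unfolding differentiable_def using sm_has_derivative[of S f x] by blast

lemma sm_linear_FD: "smo S f ==> x \<in> S ==> linear (FD f x)"
 using sm_has_derivative has_derivative_linear by blast

lemma sm_cont: "smo S f ==> continuous_on S f"
 unfolding smooth_on_def by (metis Ck_on.simps(1))

lemma sm_FD: "smo S f ==> smo S (%x. FD f x v)"
 unfolding smooth_on_def by (metis Ck_on.simps(2))

lemma sm_I:
 assumes "open S" "!!x. x \<in> S ==> (f has_derivative D x) (at x)" "!!v. smo S (%x. D x v)"
 shows "smo S f"
 unfolding smooth_on_def
proof
 fix k have "Ck_on (Suc k) S f" by (rule Ck_on_Suc_I[OF assms(1,2)]) (use assms(3) in \<open>auto simp: smooth_on_def\<close>)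
 then show "Ck_on k S f" by (rule Ck_on_Suc_D)
qed

named_theorems smooth

lemma sm_const [smooth]: "open S ==> smo S (%_. c)"
 by (simp add: smooth_on_def Ck_on_const)

lemma sm_linear: "open S ==> bounded_linear f ==> smo S f"
 by (simp add: smooth_on_def Ck_on_linear)

lemma sm_id [smooth]: "open S ==> smo S (%x. x)"
 by (rule sm_linear) (auto intro: bounded_linear_ident)

lemma sm_add [smooth]: "open S ==> smo S f ==> smo S g ==> smo S (%x. f x + g x)"
 unfolding smooth_on_def by (intro allI Ck_on_add) auto

lemma sm_bilinear: "bounded_bilinear p ==> open S ==> smo S f ==> smo S g ==> smo S (%x. p (f x) (g x))"
 unfolding smooth_on_def by (rule allI, rule bounded_bilinear.Ck_on) auto

lemmas sm_mult [smooth] = sm_bilinear[OF bounded_bilinear_mult]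
lemmas sm_scaleR [smooth] = sm_bilinear[OF bounded_bilinear_scaleR]
lemmas sm_inner [smooth] = sm_bilinear[OF bounded_bilinear_inner]

lemma sm_minus [smooth]: "open S ==> smo S f ==> smo S (%x. - f x)"
 using sm_scaleR[of S "%_. -1" f] sm_const[of S "-1::real"] by simp

lemma sm_diff [smooth]: "open S ==> smo S f ==> smo S g ==> smo S (%x. f x - g x)"
 using sm_add[of S f "%x. - g x"] sm_minus[of S g] by simp

lemma sm_sum [smooth]: "open S ==> (!!i. i \<in> I ==> smo S (f i)) ==> smo S (%x. \<Sum>i\<in>I. f i x)"
 unfolding smooth_on_def by (rule allI, rule Ck_on_sum) auto

lemma sm_prod [smooth]:
 fixes f :: "'i => 'a::euclidean_space => real"
 shows "open S ==> (!!i. i \<in> I ==> smo S (f i)) ==> smo S (%x. \<Prod>i\<in>I. f i x)"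
 by (induction I rule: infinite_finite_induct) (auto intro!: smooth)

lemma sm_power [smooth]:
 fixes f :: "'a::euclidean_space => real"
 shows "open S ==> smo S f ==> smo S (%x. f x ^ n)"
 by (induction n) (auto intro!: smooth)

lemma sm_inverse [smooth]:
 fixes f :: "'a::euclidean_space => real"
 shows "open S ==> smo S f ==> (!!x. x \<in> S ==> f x ~= 0) ==> smo S (%x. inverse (f x))"
 by (simp add: smooth_on_def Ck_on_inverse)

lemma sm_divide [smooth]:
 fixes f :: "'a::euclidean_space => real"
 shows "open S ==> smo S f ==> smo S g ==> (!!x. x \<in> S ==> g x ~= 0) ==> smo S (%x. f x / g x)"
 unfolding divide_inverse by (intro smooth) auto

lemma sm_compose:
 fixes f :: "'a::euclidean_space => 'b::euclidean_space" and g :: "'b => 'c::real_normed_vector"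
 shows "open S ==> open T ==> smo T g ==> smo S f ==> (!!x. x \<in> S ==> f x \<in> T) ==> smo S (%x. g (f x))"
 unfolding smooth_on_def by (rule allI, rule Ck_on_compose[of S T]) auto

lemma FD_compose:
 assumes "smo S f" "smo T g" "x \<in> S" "f x \<in> T"
 shows "FD (%x. g (f x)) x v = FD g (f x) (FD f x v)"
 using FD_eqI[OF diff_chain_at[OF sm_has_derivative[OF assms(1,3)] sm_has_derivative[OF assms(2,4)]]]
 by (simp add: o_def)

lemma sm_linear_family:
 fixes L :: "'a::euclidean_space => 'b::euclidean_space => 'c::real_normed_vector"
 assumes "open S" "!!x. x \<in> S ==> linear (L x)" "!!v. smo S (%x. L x v)" "smo S V"
 shows "smo S (%x. L x (V x))"
proof -
 have "smo S (%x. \<Sum>b\<in>Basis. (V x \<bullet> b) *\<^sub>R L x b)" using assms by (intro smooth) auto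
 then show ?thesis
  by (subst sm_cong[OF assms(1) linear_basis_expand[OF assms(2)]])
qed

lemma sm_FD_vec [smooth]:
 fixes f :: "'a::euclidean_space => 'c::real_normed_vector"
 assumes "open S" "smo S f" "smo S V" shows "smo S (%x. FD f x (V x))"
 by (rule sm_linear_family) (use assms sm_linear_FD sm_FD in auto)

lemma mvt_line:
 fixes g :: "'a::real_normed_vector => real"
 assumes "!!t. 0 <= t ==> t <= h ==> (g has_derivative G (x + t *\<^sub>R u)) (at (x + t *\<^sub>R u))" "h > 0"
 shows "\<exists>t. 0 < t & t < h & g (x + h *\<^sub>R u) - g x = h * G (x + t *\<^sub>R u) u"
proof -
 have "((%t. g (x + t *\<^sub>R u)) has_derivative (%s. G (x + t *\<^sub>R u) (s *\<^sub>R u))) (at t)" if "0 <= t" "t <= h" for t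
  by (rule has_derivative_compose[of "%t. x + t *\<^sub>R u" _ t _ g, OF _ assms(1)[OF that]])
    (auto intro!: derivative_eq_intros)
 moreover have "linear (G (x + t *\<^sub>R u))" if "0 <= t" "t <= h" for t
  using assms(1)[OF that] has_derivative_linear by blast
 ultimately have "((%t. g (x + t *\<^sub>R u)) has_derivative (%s. G (x + t *\<^sub>R u) u * s)) (at t)" if "0 <= t" "t <= h" for t
  using that by (simp add: linear_scale mult.commute)
 then have "((%t. g (x + t *\<^sub>R u)) has_real_derivative G (x + t *\<^sub>R u) u) (at t)" if "0 <= t" "t <= h" for t
  using that by (simp add: has_field_derivative_def)
 from MVT2[OF assms(2) this] show ?thesis by auto
qed

text \<open>The second difference of \<open>f\<close> over a parallelogram of size \<open>h\<close>
  is symmetric in \<open>u\<close> and \<open>v\<close>, and it equals \<open>h * h\<close> times a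
  mixed derivative at a nearby point, in either order of differentiation. Continuity of the mixed
  derivatives forces them to agree at \<open>x\<close>.\<close>

lemma second_derivative_symmetric:
 fixes f :: "'a::euclidean_space => real"
 assumes "open S" "smo S f" "x \<in> S"
 shows "FD (%y. FD f y v) x u = FD (%y. FD f y u) x v"
proof -
 define A where "A u v y = FD (%y. FD f y u) y v" for u v y
 have cA: "continuous_on S (A u v)" for u v
  unfolding A_def using assms by (intro sm_cont sm_FD) auto
 have key: "\<exists>z. norm (z - x) <= h * (norm u + norm v) &
   f (x + h *\<^sub>R u + h *\<^sub>R v) - f (x + h *\<^sub>R u) - f (x + h *\<^sub>R v) + f x = h * h * A u v z"
  if h: "h > 0" and b: "cball x (h * (norm u + norm v)) \<subseteq> S" for h u v
 proof -
  have inS: "x + s *\<^sub>R u + t *\<^sub>R v \<in> S & norm (s *\<^sub>R u + t *\<^sub>R v) <= h * (norm u + norm v)"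
   if "0 <= s" "s <= h" "0 <= t" "t <= h" for s t
  proof -
   have "norm (s *\<^sub>R u + t *\<^sub>R v) <= s * norm u + t * norm v"
    using norm_triangle_ineq[of "s *\<^sub>R u" "t *\<^sub>R v"] that by simp
   also have "... <= h * (norm u + norm v)" using that by (simp add: distrib_left add_mono mult_right_mono)
   finally have n: "norm (s *\<^sub>R u + t *\<^sub>R v) <= h * (norm u + norm v)" .
   have "dist x (x + w) = norm w" for w by (simp add: dist_norm)
   then have "dist x (x + (s *\<^sub>R u + t *\<^sub>R v)) <= h * (norm u + norm v)" using n by presburger
   then have "x + (s *\<^sub>R u + t *\<^sub>R v) \<in> S" using b by (meson mem_cball subset_iff)
   then show ?thesis using n by (simp add: add.assoc)
  qed
  \<comment> \<open>One mean value step in the direction \<open>u\<close> for this difference, then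
    one in the direction \<open>v\<close> for its derivative.\<close>
  define g where "g y = f (y + h *\<^sub>R v) - f y" for y
  have "(g has_derivative (%w. FD f ((x + t *\<^sub>R u) + h *\<^sub>R v) w - FD f (x + t *\<^sub>R u) w)) (at (x + t *\<^sub>R u))"
   if "0 <= t" "t <= h" for t
   unfolding g_def
   using inS[OF that, of h] inS[OF that, of 0] h
   by (intro has_derivative_diff has_derivative_compose[of "%y. y + h *\<^sub>R v" "%w. w" _ _ f] sm_has_derivative[OF assms(2)])
    (auto intro!: derivative_eq_intros)
  from mvt_line[where G = "%y w. FD f (y + h *\<^sub>R v) w - FD f y w", OF this h] obtain t where t: "0 < t" "t < h"
   and e1: "g (x + h *\<^sub>R u) - g x = h * (FD f (x + t *\<^sub>R u + h *\<^sub>R v) u - FD f (x + t *\<^sub>R u) u)" by auto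
  have "((%y. FD f y u) has_derivative FD (%y. FD f y u) (x + t *\<^sub>R u + s *\<^sub>R v)) (at (x + t *\<^sub>R u + s *\<^sub>R v))"
   if "0 <= s" "s <= h" for s
   using inS[of t s] t that by (intro sm_has_derivative[OF sm_FD[OF assms(2)]]) auto
  from mvt_line[of h _ "%z. FD (%y. FD f y u) z", OF this h] obtain s where s: "0 < s" "s < h"
   and e2: "FD f (x + t *\<^sub>R u + h *\<^sub>R v) u - FD f (x + t *\<^sub>R u) u = h * A u v (x + t *\<^sub>R u + s *\<^sub>R v)" by (auto simp: A_def)
  show ?thesis
   using inS[of t s] s t e1 e2 by (intro exI[of _ "x + t *\<^sub>R u + s *\<^sub>R v"]) (auto simp: g_def algebra_simps)
 qed
 have "A u v x = A v u x"
 proof (rule ccontr)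
  assume ne: "A u v x ~= A v u x"
  define e where "e = \<bar>A u v x - A v u x\<bar> / 2"
  have "e > 0" using ne by (simp add: e_def)
  have "\<exists>d>0. \<forall>z\<in>S. dist z x < d --> dist (A u v z) (A u v x) < e" for u v
   using cA[of u v] assms(3) \<open>e > 0\<close> unfolding continuous_on_iff by blast
  then obtain d1 d2 where d: "d1 > 0" "d2 > 0" "!!z. z \<in> S ==> dist z x < d1 ==> dist (A u v z) (A u v x) < e"
   "!!z. z \<in> S ==> dist z x < d2 ==> dist (A v u z) (A v u x) < e" by meson
  obtain d3 where d3: "d3 > 0" "cball x d3 \<subseteq> S" using assms open_contains_cball by blast
  define m where "m = min d3 (min d1 d2)"
  \<comment> \<open>The summand 1 keeps the denominator positive when
    \<open>u = v = 0\<close>.\<close>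
  define h where "h = m / (2 * (norm u + norm v + 1))"
  have "m > 0" using d d3 by (simp add: m_def)
  have nn: "norm u + norm v + 1 > 0" by (meson add_nonneg_pos add_nonneg_nonneg norm_ge_zero zero_less_one)
  then have h: "h > 0" using \<open>m > 0\<close> by (simp add: h_def)
  have "h * (norm u + norm v) <= h * (norm u + norm v + 1)" using h by simp
  also have "... = m / 2"
  proof -
   have "m / (2 * W) * W = m / 2" if "W > 0" for W :: real using that by simp
   then show ?thesis using nn unfolding h_def by blast
  qed
  finally have hm: "h * (norm u + norm v) < m" using \<open>m > 0\<close> by simp
  then have cb: "cball x (h * (norm u + norm v)) \<subseteq> S" using d3 by (auto simp: m_def subset_iff)
  obtain z1 where z1: "norm (z1 - x) <= h * (norm u + norm v)"
   "f (x + h *\<^sub>R u + h *\<^sub>R v) - f (x + h *\<^sub>R u) - f (x + h *\<^sub>R v) + f x = h * h * A u v z1"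
   using key[OF h cb] by blast
  obtain z2 where z2: "norm (z2 - x) <= h * (norm u + norm v)"
   "f (x + h *\<^sub>R v + h *\<^sub>R u) - f (x + h *\<^sub>R v) - f (x + h *\<^sub>R u) + f x = h * h * A v u z2"
   using key[OF h, of v u] cb by (auto simp: add.commute)
  have "A u v z1 = A v u z2" using z1(2) z2(2) h by (simp add: algebra_simps)
  moreover have "z1 \<in> S" "z2 \<in> S" using cb z1(1) z2(1) by (auto simp: dist_norm norm_minus_commute subset_iff)
  moreover have "dist z1 x < d1" "dist z2 x < d2" using z1(1) z2(1) hm by (auto simp: dist_norm m_def)
  ultimately show False using d(3)[of z1] d(4)[of z2] by (auto simp: dist_real_def e_def abs_if split: if_splits)
 qed
 then show ?thesis by (simp add: A_def)
qed

section \<open>Powers of two-forms\<close>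

lemma sum_affine_permutes:
 fixes N :: nat
 assumes "q permutes {..<N}"
 shows "(\<Sum>sig | sig permutes {..<N}. of_int (sign sig) * (f sig :: real)) =
    of_int (sign q) * (\<Sum>sig | sig permutes {..<N}. of_int (sign sig) * f (sig \<circ> q))"
proof -
 have "of_int (sign (sig \<circ> q)) * f (sig \<circ> q) = of_int (sign q) * (of_int (sign sig) * f (sig \<circ> q))"
  if "sig permutes {..<N}" for sig
  using sign_compose[OF permutes_imp_permutation[OF finite_lessThan that] permutes_imp_permutation[OF finite_lessThan assms]]
  by simp
 then show ?thesis
  by (subst sum_permutations_compose_right[OF assms]) (auto simp: sum_distrib_left intro!: sum.cong)
qed

definition shift_perm :: "nat => (nat => nat) => nat => nat" where
 "shift_perm k rho i = (if i < k then i else k + rho (i - k))"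

lemma shift_perm_simps [simp]: "shift_perm k rho (k + i) = k + rho i" "i < k ==> shift_perm k rho i = i"
 by (auto simp: shift_perm_def)

lemma shift_perm_eq_map_permutation:
 assumes "rho permutes {..<l}"
 shows "shift_perm k rho = map_permutation {..<l} ((+) k) rho"
proof
 fix i
 have im: "(+) k ` {..<l} = {k..<k + l}" by (simp add: lessThan_atLeast0 add.commute)
 show "shift_perm k rho i = map_permutation {..<l} ((+) k) rho i"
 proof (cases "i \<in> {k..<k + l}")
  case True
  then obtain j where j: "i = k + j" "j < l" by (metis atLeastLessThan_iff le_Suc_ex nat_add_left_cancel_less)
  then show ?thesis using map_permutation_apply[of "(+) k" "{..<l}" j rho] by simp
 next
  case False
  then have "map_permutation {..<l} ((+) k) rho i = i"
   unfolding map_permutation_def restrict_id_def im using False by auto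
  moreover have "shift_perm k rho i = i"
   using False permutes_not_in[OF assms, of "i - k"] by (auto simp: shift_perm_def)
  ultimately show ?thesis by simp
 qed
qed

lemma shift_perm_permutes:
 assumes "rho permutes {..<l}" shows "shift_perm k rho permutes {..<k + l}"
proof -
 have "bij_betw ((+) k) {..<l} ((+) k ` {..<l})" by (simp add: bij_betw_def)
 then have "shift_perm k rho permutes ((+) k ` {..<l})"
  unfolding shift_perm_eq_map_permutation[OF assms] using map_permutation_permutes assms by blast
 then show ?thesis by (rule permutes_subset) auto
qed

lemma sign_shift_perm: "rho permutes {..<l} ==> sign (shift_perm k rho) = sign rho"
 unfolding shift_perm_eq_map_permutation by (rule sign_map_permutation) auto

text \<open>An inner antisymmetrisation over the last \<open>l\<close> slots is swallowed by the
  outer one: reindexing the outer sum by composition with \<open>shift_perm k rho\<close> cancels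
  the inner sign, so each of the \<open>l!\<close> inner permutations contributes the same. This is
  what cancels \<open>fact l\<close> in \<open>wedge\<close>.\<close>

lemma sum_permutes_absorb:
 fixes Psi :: "(nat => nat) => real"
 shows "(\<Sum>sig | sig permutes {..<k + l}. of_int (sign sig) *
    (\<Sum>rho | rho permutes {..<l}. of_int (sign rho) * Psi (sig \<circ> shift_perm k rho)))
    = fact l * (\<Sum>sig | sig permutes {..<k + l}. of_int (sign sig) * Psi sig)" (is "?L = _ * ?R")
proof -
 have "?L = (\<Sum>rho | rho permutes {..<l}. of_int (sign rho) * (\<Sum>sig | sig permutes {..<k + l}. of_int (sign sig) * Psi (sig \<circ> shift_perm k rho)))"
  unfolding sum_distrib_left by (subst sum.swap) (simp add: mult_ac)
 also have "... = (\<Sum>rho | rho permutes {..<l}. ?R)"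
 proof (rule sum.cong)
  fix rho assume "rho \<in> {rho. rho permutes {..<l}}"
  then have r: "rho permutes {..<l}" by simp
  show "of_int (sign rho) * (\<Sum>sig | sig permutes {..<k + l}. of_int (sign sig) * Psi (sig \<circ> shift_perm k rho)) = ?R"
   using sum_affine_permutes[OF shift_perm_permutes[OF r, of k], where f = Psi] sign_shift_perm[OF r, of k] by simp
 qed simp
 also have "... = fact l * ?R" by (simp add: card_permutations[of _ l])
 finally show ?thesis .
qed

section \<open>Powers of alternating bilinear maps\<close>

definition bform :: "('v => 'v => real) => 'v form" where "bform w = (%v. w (v 0) (v 1))"

definition alt2 :: "('v::real_vector => 'v => real) => bool" where
 "alt2 w \<longleftrightarrow> (\<forall>x. linear (w x)) & (\<forall>y. linear (%x. w x y)) & (\<forall>x. w x x = 0)"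

lemma alt2D: "alt2 w ==> linear (w x)" "alt2 w ==> linear (%x. w x y)" "alt2 w ==> w x x = 0"
 by (auto simp: alt2_def)

lemma alt2_antisym: "alt2 w ==> w y x = - w x y"
proof -
 assume a: "alt2 w"
 have "w (x + y) (x + y) = w x x + w x y + w y x + w y y"
  using linear_add[OF alt2D(1)[OF a]] linear_add[OF alt2D(2)[OF a]] by simp
 then show ?thesis using alt2D(3)[OF a] by simp
qed

text \<open>In each step \<open>sum_permutes_absorb\<close> cancels \<open>fact (2 * m)\<close> and
  a factor 2 is left in the denominator, so only \<open>2 ^ m\<close> accumulates. There is no
  division by \<open>m!\<close>: this is the power itself.\<close>

lemma wedge_power_bform:
 "wedge_power (bform w) m v =
  (\<Sum>sig | sig permutes {..<2 * m}. of_int (sign sig) * (\<Prod>i<m. w (v (sig (2 * i))) (v (sig (2 * i + 1))))) / 2 ^ m"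
proof (induction m arbitrary: v)
 case 0 then show ?case by simp
next
 case (Suc m)
 define Psi where "Psi tau = w (v (tau 0)) (v (tau 1)) * (\<Prod>i<m. w (v (tau (2 + 2 * i))) (v (tau (2 + (2 * i + 1)))))" for tau
 have e: "Psi tau = (\<Prod>i<Suc m. w (v (tau (2 * i))) (v (tau (2 * i + 1))))" for tau
  unfolding Psi_def by (subst prod.lessThan_Suc_shift) simp
 have "wedge_power (bform w) (Suc m) v =
   (\<Sum>sig | sig permutes {..<2 + 2 * m}. of_int (sign sig) *
    (\<Sum>rho | rho permutes {..<2 * m}. of_int (sign rho) * Psi (sig \<circ> shift_perm 2 rho))) / 2 ^ m / (2 * fact (2 * m))"
  unfolding wedge_power.simps wedge_def Suc.IH unfolding Psi_def bform_def sum_divide_distrib sum_distrib_left o_def shift_perm_simps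
  by (intro sum.cong refl) (simp add: mult_ac sum_distrib_left sum_divide_distrib shift_perm_def)
 also have "... = (\<Sum>sig | sig permutes {..<2 + 2 * m}. of_int (sign sig) * Psi sig) / 2 ^ Suc m"
  unfolding sum_permutes_absorb by simp
 finally show ?case by (simp add: e)
qed

text \<open>What remains of the power \<open>Suc m\<close> of \<open>w\<close> after contraction
  with a vector, and also the shape of the form on the hypersurface whose nonvanishing is at
  issue.\<close>

definition wedge1 :: "nat => ('v => real) => ('v => 'v => real) => (nat => 'v) => real" where
 "wedge1 m g w v = wedge 1 (2 * m) (%v. g (v 0)) (wedge_power (bform w) m) v"

lemma wedge1_eq:
 "wedge1 m g w v = (\<Sum>sig | sig permutes {..<Suc (2 * m)}. of_int (sign sig) *
   (g (v (sig 0)) * (\<Prod>i<m. w (v (sig (Suc (2 * i)))) (v (sig (Suc (Suc (2 * i)))))))) / 2 ^ m"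
proof -
 define Psi where "Psi tau = g (v (tau 0)) * (\<Prod>i<m. w (v (tau (1 + 2 * i))) (v (tau (1 + (2 * i + 1)))))" for tau
 have "wedge1 m g w v =
   (\<Sum>sig | sig permutes {..<1 + 2 * m}. of_int (sign sig) *
    (\<Sum>rho | rho permutes {..<2 * m}. of_int (sign rho) * Psi (sig \<circ> shift_perm 1 rho))) / 2 ^ m / fact (2 * m)"
  unfolding wedge1_def wedge_def wedge_power_bform unfolding Psi_def bform_def sum_divide_distrib sum_distrib_left o_def shift_perm_simps
  by (intro sum.cong refl) (simp add: mult_ac sum_distrib_left sum_divide_distrib shift_perm_def)
 also have "... = (\<Sum>sig | sig permutes {..<1 + 2 * m}. of_int (sign sig) * Psi sig) / 2 ^ m"
  unfolding sum_permutes_absorb by simp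
 finally show ?thesis by (simp add: Psi_def)
qed

lemma permutes_fix0_eq_image:
 "{sig. sig permutes {..<Suc M} & sig 0 = 0} = shift_perm 1 ` {tau. tau permutes {..<M}}"
proof (intro equalityI subsetI)
 fix sig assume "sig \<in> {sig. sig permutes {..<Suc M} & sig 0 = 0}"
 then have s: "sig permutes {..<Suc M}" "sig 0 = 0" by auto
 then have s1: "sig permutes {1..<Suc M}" by (intro permutes_superset[OF s(1)]) (auto simp: Suc_le_eq)
 define tau where "tau i = sig (Suc i) - 1" for i
 have nz: "sig (Suc i) ~= 0" for i using permutes_inj[OF s(1)] s(2) by (metis injD nat.simps(3))
 have "tau permutes {..<M}"
 proof (rule bij_imp_permutes)
  have "tau i < M" if "i < M" for i
   using permutes_in_image[OF s(1), of "Suc i"] nz[of i] that by (simp add: tau_def)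
  then have "tau ` {..<M} \<subseteq> {..<M}" by auto
  moreover have "inj_on tau {..<M}"
  proof (rule inj_onI)
   fix i j assume "tau i = tau j"
   then have "sig (Suc i) = sig (Suc j)" using nz[of i] nz[of j] by (simp add: tau_def)
   then show "i = j" using injD[OF permutes_inj[OF s(1)]] by auto
  qed
  ultimately show "bij_betw tau {..<M} {..<M}" by (simp add: bij_betw_def endo_inj_surj)
  fix x assume "x \<notin> {..<M}" then show "tau x = x"
   unfolding tau_def using permutes_not_in[OF s(1), of "Suc x"] by auto
 qed
 moreover have "sig = shift_perm 1 tau"
 proof
  fix i show "sig i = shift_perm 1 tau i" using s(2) nz[of "i - 1"] by (cases i) (auto simp: tau_def shift_perm_def)
 qed
 ultimately show "sig \<in> shift_perm 1 ` {tau. tau permutes {..<M}}" by auto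
next
 fix sig assume "sig \<in> shift_perm 1 ` {tau. tau permutes {..<M}}"
 then show "sig \<in> {sig. sig permutes {..<Suc M} & sig 0 = 0}"
  using shift_perm_permutes[of _ M 1] by (auto simp: shift_perm_def)
qed

lemma inj_shift_perm: "inj (shift_perm k)"
proof (rule injI)
 fix rho tau assume "shift_perm k rho = shift_perm k tau"
 then have "shift_perm k rho (k + i) = shift_perm k tau (k + i)" for i by simp
 then show "rho = tau" by (intro ext) simp
qed

text \<open>Contraction is a derivation: \<open>\<iota>\<^sub>E(w\<^sup>m\<^sup>+\<^sup>1) = (m + 1) \<iota>\<^sub>Ew \<and> w\<^sup>m\<close>. Each of the \<open>2(m + 1)\<close> slots that
 \<open>E\<close> can occupy contributes the same amount.\<close>

lemma wedge_power_contract: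
 assumes w: "alt2 w"
 shows "wedge_power (bform w) (Suc m) x = real (Suc m) * wedge1 m (w (x 0)) w (%i. x (Suc i))"
proof -
 let ?M = "2 * Suc m"
 define h where "h sig = (\<Prod>i<Suc m. w (x (sig (2 * i))) (x (sig (2 * i + 1))))" for sig :: "nat => nat"
 define T where "T p = (\<Sum>sig | sig permutes {..<?M} & sig p = 0. of_int (sign sig) * h sig)" for p
 \<comment> \<open>\<open>b j\<close> exchanges the pairs of slots \<open>(0, 1)\<close> and
   \<open>(2 * j, 2 * j + 1)\<close>. It is even and only permutes the factors of \<open>h\<close>.
   Composed with the swap of 0 and 1 it reaches the odd slot, and there the sign of the swap cancels
   the sign from \<open>w\<close>.\<close>
 define b where "b j = Transposition.transpose 0 (2 * j) \<circ> Transposition.transpose 1 (2 * j + 1 :: nat)" for j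
 have bp: "b j permutes {..<?M}" if "j < Suc m" for j
  unfolding b_def using that by (intro permutes_compose permutes_swap_id) auto
 have b_eq: "b j (2 * i) = 2 * Transposition.transpose 0 j i" "b j (2 * i + 1) = 2 * Transposition.transpose 0 j i + 1" for i j
  unfolding b_def Transposition.transpose_def by (auto; presburger)+
 have sb: "sign (b j) = 1" for j
  unfolding b_def by (subst sign_compose) (auto simp: permutation_swap_id sign_swap_id)
 have hb: "h (sig \<circ> b j) = h sig" if "j < Suc m" for j sig
 proof -
  define Q where "Q i = w (x (sig (2 * i))) (x (sig (2 * i + 1)))" for i
  have tp: "Transposition.transpose 0 j permutes {..<Suc m}" using that by (intro permutes_swap_id) auto
  have "h (sig \<circ> b j) = (\<Prod>i<Suc m. Q (Transposition.transpose 0 j i))" unfolding h_def Q_def o_def b_eq ..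
  also have "... = h sig" using prod.permute[OF tp, of Q] unfolding h_def Q_def by (simp add: o_def)
  finally show ?thesis .
 qed
 have hs: "h (sig \<circ> Transposition.transpose 0 1) = - h sig" for sig
  unfolding h_def by (subst (1 2) prod.lessThan_Suc_shift) (auto simp: alt2_antisym[OF w, of "x (sig 0)"] Transposition.transpose_def)
 have T_eq: "T p = (\<Sum>sig | sig permutes {..<?M}. of_int (sign sig) * (if sig p = 0 then h sig else 0))" for p
  unfolding T_def by (rule sum.mono_neutral_cong_left) (auto simp: finite_permutations)
 have reduce: "T 0 = T (q 0)"
  if q: "q permutes {..<?M}" and hq: "!!sig. of_int (sign q) * h (sig \<circ> q) = h sig" for q
 proof -
  have "of_int (sign q) * (of_int (sign sig) * (if (sig \<circ> q) 0 = 0 then h (sig \<circ> q) else 0)) =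
    of_int (sign sig) * (if sig (q 0) = 0 then h sig else 0)" for sig
   using hq[of sig] by (simp add: mult.left_commute)
  then show ?thesis
   unfolding T_eq sum_affine_permutes[OF q, where f = "%sig. if sig 0 = 0 then h sig else 0"] sum_distrib_left
   by (rule sum.cong[OF refl])
 qed
 have T_const: "T p = T 0" if p: "p < ?M" for p
 proof -
  obtain j where j: "j < Suc m" "p = 2 * j \<or> p = 2 * j + 1" 
  proof (rule that[of "p div 2"])
   show "p div 2 < Suc m" by (rule less_mult_imp_div_less) (use p in simp)
   show "p = 2 * (p div 2) \<or> p = 2 * (p div 2) + 1" by presburger
  qed
  show ?thesis
  proof (cases "p = 2 * j")
   case True then show ?thesis using reduce[OF bp[OF j(1)]] hb[OF j(1)] sb b_eq(1)[of j 0] by (simp add: Transposition.transpose_def)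
  next
   case False
   have q: "b j \<circ> Transposition.transpose 0 1 permutes {..<?M}" by (intro permutes_compose bp j permutes_swap_id) auto
   have "sign (b j \<circ> Transposition.transpose 0 1) = - 1"
    using sign_compose[OF permutes_imp_permutation[OF finite_lessThan bp[OF j(1)]] permutation_swap_id[of 0 1]] sb
    by (simp add: sign_swap_id)
   moreover have "h (sig \<circ> (b j \<circ> Transposition.transpose 0 1)) = - h sig" for sig
    using hs[of "sig \<circ> b j"] hb[OF j(1)] by (simp add: o_assoc)
   moreover have "(b j \<circ> Transposition.transpose 0 1) 0 = p" using False j b_eq(2)[of j 0] by (simp add: Transposition.transpose_def)
   ultimately show ?thesis using reduce[OF q] by simp
  qed
 qed
 have "(\<Sum>sig | sig permutes {..<?M}. of_int (sign sig) * h sig) = (\<Sum>p<?M. T p)"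
 proof -
  have "(\<Sum>p<?M. T p) = (\<Sum>sig | sig permutes {..<?M}. \<Sum>p<?M. of_int (sign sig) * (if sig p = 0 then h sig else 0))"
   unfolding T_eq by (rule sum.swap)
  also have "... = (\<Sum>sig | sig permutes {..<?M}. of_int (sign sig) * h sig)"
  proof (rule sum.cong)
   fix sig assume "sig \<in> {sig. sig permutes {..<?M}}"
   then have s: "sig permutes {..<?M}" by simp
   have "sig p = 0 \<longleftrightarrow> inv sig 0 = p" for p using permutes_inv_eq[OF s] by metis
   moreover have "inv sig 0 \<in> {..<?M}" using permutes_in_image[OF permutes_inv[OF s], of 0] by simp
   ultimately show "(\<Sum>p<?M. of_int (sign sig) * (if sig p = 0 then h sig else 0)) = of_int (sign sig) * h sig"
    by (simp flip: sum_distrib_left)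
  qed simp
  finally show ?thesis by simp
 qed
 also have "... = (\<Sum>p<?M. T 0)" by (rule sum.cong[OF refl], rule T_const) simp
 also have "... = real ?M * T 0" by simp
 finally have tot: "(\<Sum>sig | sig permutes {..<?M}. of_int (sign sig) * h sig) = real ?M * T 0" .
 \<comment> \<open>Permutations that keep 0 in slot 0 are permutations of the remaining
   \<open>2 * m + 1\<close> slots.\<close>
 have "T 0 = (\<Sum>tau | tau permutes {..<Suc (2 * m)}. of_int (sign (shift_perm 1 tau)) * h (shift_perm 1 tau))"
  using permutes_fix0_eq_image[of "Suc (2 * m)"] unfolding T_def
  by (simp add: sum.reindex[OF inj_on_subset[OF inj_shift_perm]])
 also have "... = 2 ^ m * wedge1 m (w (x 0)) w (%i. x (Suc i))"
  unfolding wedge1_eq h_def by (subst prod.lessThan_Suc_shift) (simp add: sign_shift_perm shift_perm_def)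
 finally have "T 0 = 2 ^ m * wedge1 m (w (x 0)) w (%i. x (Suc i))" .
 then show ?thesis using tot unfolding wedge_power_bform h_def by (simp add: field_simps)
qed

section \<open>Alternating forms of top degree\<close>

lemma alt_formD:
 assumes "alt_form k f"
 shows "(!!i. i < k ==> v i = w i) ==> f v = f w"
  and "i < k ==> linear (%x. f (v(i := x)))"
  and "i < k ==> j < k ==> i ~= j ==> v i = v j ==> f v = 0"
 using assms unfolding alt_form_def by blast+

lemma alt_form_combine:
 assumes "alt_form k f" "alt_form k g"
 shows "alt_form k (%v. a * f v + b * g v)"
proof -
 have "linear (%x. a * f (v(i := x)) + b * g (v(i := x)))" if "i < k" for v i
  using alt_formD(2)[OF assms(1) that, of v] alt_formD(2)[OF assms(2) that, of v]
  unfolding linear_iff by (simp add: algebra_simps)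
 moreover have "a * f v + b * g v = a * f w + b * g w" if "\<forall>i<k. v i = w i" for v w
  using alt_formD(1)[OF assms(1), of v w] alt_formD(1)[OF assms(2), of v w] that by auto
 moreover have "a * f v + b * g v = 0" if "i < k" "j < k" "i ~= j" "v i = v j" for v i j
  using alt_formD(3)[OF assms(1) that] alt_formD(3)[OF assms(2) that] by simp
 ultimately show ?thesis unfolding alt_form_def by blast
qed

lemma linear_mult_right: "linear f ==> linear (%x. c * f x :: real)"
 by (simp add: linear_iff algebra_simps)

lemma linear_mult_left: "linear f ==> linear (%x. f x * c :: real)"
 by (simp add: linear_iff algebra_simps)

text \<open>If two arguments agree, composing every permutation with the transposition of their
  positions leaves the values of \<open>Phi\<close> alone and flips all signs, so the sum is its own
  negative.\<close>

lemma alt_form_antisymmetrize: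
 fixes Phi :: "(nat => 'v::real_vector) => real"
 assumes dep: "!!v w. (!!i. i < N ==> v i = w i) ==> Phi v = Phi w"
  and lin: "!!v i. i < N ==> linear (%x. Phi (v(i := x)))"
 shows "alt_form N (%v. \<Sum>sig | sig permutes {..<N}. of_int (sign sig) * Phi (%i. v (sig i)))"
proof -
 let ?A = "%v. \<Sum>sig | sig permutes {..<N}. of_int (sign sig) * Phi (%i. v (sig i))"
 have inN: "sig i < N" if "sig permutes {..<N}" "i < N" for sig i using permutes_in_image[OF that(1), of i] that(2) by simp
 have 1: "?A v = ?A w" if "\<forall>i<N. v i = w i" for v w
  by (intro sum.cong arg_cong2[where f = "(*)"] dep refl) (use that inN in auto)
 have 2: "linear (%x. ?A (v(i := x)))" if i: "i < N" for v i
 proof (rule linear_compose_sum)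
  have "linear (%x. of_int (sign sig) * Phi (%j. (v(i := x)) (sig j)))" if s: "sig permutes {..<N}" for sig
  proof -
   have "(%j. (v(i := x)) (sig j)) = (%j. v (sig j))(inv sig i := x)" for x
   proof
    fix j have "sig j = i \<longleftrightarrow> j = inv sig i" using permutes_inv_eq[OF s, of i j] by auto
    then show "(v(i := x)) (sig j) = ((%j. v (sig j))(inv sig i := x)) j" by simp
   qed
   moreover have "inv sig i < N" using inN[OF permutes_inv[OF s] i] .
   ultimately show ?thesis using lin[of "inv sig i" "%j. v (sig j)"]
    by (simp add: linear_mult_right)
  qed
  then show "\<forall>sig\<in>{sig. sig permutes {..<N}}. linear (%x. of_int (sign sig) * Phi (%j. (v(i := x)) (sig j)))" by simp
 qed
 have 3: "?A v = 0" if ij: "i < N" "j < N" "i ~= j" "v i = v j" for v i j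
 proof -
  let ?t = "Transposition.transpose i j"
  have t: "?t permutes {..<N}" using ij by (intro permutes_swap_id) auto
  have v: "v (?t k) = v k" for k using ij by (auto simp: Transposition.transpose_def)
  have "?A v = (\<Sum>sig | sig permutes {..<N}. of_int (sign (?t \<circ> sig)) * Phi (%i. v ((?t \<circ> sig) i)))"
   by (rule setum_permutations_compose_left[OF t])
  also have "... = (\<Sum>sig | sig permutes {..<N}. - (of_int (sign sig) * Phi (%i. v (sig i))))"
  proof (rule sum.cong[OF refl])
   fix sig assume "sig \<in> {sig. sig permutes {..<N}}"
   then have s: "permutation sig" by (auto intro: permutes_imp_permutation[OF finite_lessThan])
   have "sign (?t \<circ> sig) = - sign sig" by (subst sign_compose[OF permutation_swap_id s]) (use ij in \<open>simp add: sign_swap_id\<close>)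
   then show "of_int (sign (?t \<circ> sig)) * Phi (%i. v ((?t \<circ> sig) i)) = - (of_int (sign sig) * Phi (%i. v (sig i)))"
    by (simp add: v)
  qed
  also have "... = - ?A v" by (simp add: sum_negf)
  finally show ?thesis by simp
 qed
 show ?thesis unfolding alt_form_def using 1 2 3 by blast
qed

lemma linear_prod_slot:
 fixes q :: "nat => 'v::real_vector => real"
 assumes "i < N" "!!k. linear (q k)"
 shows "linear (%x. \<Prod>k<N. q k ((v(i := x)) k))"
proof -
 have "(\<Prod>k<N. q k ((v(i := x)) k)) = (\<Prod>k\<in>{..<N} - {i}. q k (v k)) * q i x" for x
  using assms(1) by (subst prod.remove[of _ i]) (auto intro!: prod.cong)
 then show ?thesis using assms(2)[of i] by (simp add: linear_iff algebra_simps)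
qed

lemma alt_form_wedge_power:
 assumes w: "alt2 w"
 shows "alt_form (2 * m) (wedge_power (bform w) m)"
proof -
 let ?P = "%v::nat => 'a. \<Prod>i<m. w (v (2 * i)) (v (2 * i + 1))"
 have "alt_form (2 * m) (%v. \<Sum>sig | sig permutes {..<2 * m}. of_int (sign sig) * ?P (%i. v (sig i)))"
 proof (rule alt_form_antisymmetrize)
  show "?P v = ?P v'" if "!!i. i < 2 * m ==> v i = v' i" for v v'
   by (intro prod.cong refl) (use that in auto)
  fix v :: "nat => 'a" and i assume i: "i < 2 * m"
  define j where "j = i div 2"
  have j: "j < m" unfolding j_def by (rule less_mult_imp_div_less) (use i in simp)
  have ij: "i = 2 * j \<or> i = 2 * j + 1" unfolding j_def by presburger
  define C where "C = (\<Prod>k\<in>{..<m} - {j}. w (v (2 * k)) (v (2 * k + 1)))"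
  have C: "(\<Prod>k\<in>{..<m} - {j}. w ((v(i := x)) (2 * k)) ((v(i := x)) (2 * k + 1))) = C" for x
   unfolding C_def
  proof (rule prod.cong[OF refl])
   fix k assume "k \<in> {..<m} - {j}"
   then have "k ~= j" by simp
   then have "2 * k ~= i" "2 * k + 1 ~= i" using ij by presburger+
   then show "w ((v(i := x)) (2 * k)) ((v(i := x)) (2 * k + 1)) = w (v (2 * k)) (v (2 * k + 1))" by simp
  qed
  have e: "?P (v(i := x)) = w ((v(i := x)) (2 * j)) ((v(i := x)) (2 * j + 1)) * C" for x
   using j by (subst prod.remove[of _ j]) (auto simp only: C finite_lessThan lessThan_iff)
  show "linear (%x. ?P (v(i := x)))"
  proof (cases "i = 2 * j")
   case True
   then show ?thesis unfolding e by (intro linear_mult_left) (simp add: alt2D[OF w])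
  next
   case False
   then have "i = 2 * j + 1" "2 * j ~= i" using ij by auto
   then show ?thesis unfolding e by (intro linear_mult_left) (simp add: alt2D[OF w])
  qed
 qed
 from alt_form_combine[OF this this, of "1 / 2 ^ m" 0] show ?thesis
  by (simp add: wedge_power_bform[abs_def])
qed

lemma alt_form_swap:
 assumes f: "alt_form k f" and ij: "i < k" "j < k" "i ~= j"
 shows "f (%l. v (Transposition.transpose i j l)) = - f v"
proof -
 define g where "g x y = f (v(i := x, j := y))" for x y
 have l1: "linear (%y. g x y)" for x using alt_formD(2)[OF f ij(2), of "v(i := x)"] by (simp add: g_def)
 have l2: "linear (%x. g x y)" for y using alt_formD(2)[OF f ij(1), of "v(j := y)"] ij by (simp add: g_def fun_upd_twist)
 have z: "g x x = 0" for x using alt_formD(3)[OF f ij] ij by (simp add: g_def)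
 have "g (v i + v j) (v i + v j) = g (v i) (v i) + g (v i) (v j) + g (v j) (v i) + g (v j) (v j)"
  using linear_add[OF l1] linear_add[OF l2] by simp
 then have "g (v j) (v i) = - g (v i) (v j)" using z by simp
 moreover have "(%l. v (Transposition.transpose i j l)) = v(i := v j, j := v i)" using ij by (auto simp: Transposition.transpose_def)
 moreover have "v(i := v i, j := v j) = v" by auto
 ultimately show ?thesis by (simp add: g_def)
qed

lemma alt_form_permute:
 assumes f: "alt_form k f" and s: "sig permutes {..<k}"
 shows "f (%i. v (sig i)) = of_int (sign sig) * f v"
 using s finite_lessThan
proof (induction arbitrary: v rule: permutes_induct)
 case id then show ?case by simp
next
 case (swap a b p)
 have "f (%i. v ((Transposition.transpose a b \<circ> p) i)) = of_int (sign p) * f (%i. v (Transposition.transpose a b i))"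
  using swap.IH[of "%i. v (Transposition.transpose a b i)"] by simp
 also have "... = - of_int (sign p) * f v" using alt_form_swap[OF f, of a b v] swap by simp
 also have "- of_int (sign p) = (of_int (sign (Transposition.transpose a b \<circ> p)) :: real)"
  by (subst sign_compose[OF permutation_swap_id permutes_imp_permutation[OF finite_lessThan swap.hyps(4)]]) (use swap in \<open>simp add: sign_swap_id\<close>)
 finally show ?case .
qed

section \<open>Forms of top degree and determinants\<close>

definition bas :: "nat => 'e::euclidean_space" where
 "bas = (SOME b. bij_betw b {..<DIM('e)} (Basis :: 'e set))"

lemma bas_bij: "bij_betw (bas :: nat => 'e::euclidean_space) {..<DIM('e)} Basis"
proof -
 have "\<exists>b. bij_betw b {..<DIM('e)} (Basis :: 'e set)"
  using ex_bij_betw_nat_finite[OF finite_Basis] by (simp add: atLeast0LessThan)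
 then show ?thesis unfolding bas_def by (rule someI_ex)
qed

lemma bas_Basis: "i < DIM('e) ==> (bas i :: 'e::euclidean_space) \<in> Basis"
 using bas_bij bij_betwE by fastforce

lemma inner_bas: "i < DIM('e) ==> j < DIM('e) ==> (bas i :: 'e::euclidean_space) \<bullet> bas j = (if i = j then 1 else 0)"
 using bas_Basis inner_Basis bij_betw_imp_inj_on[OF bas_bij] by (metis inj_on_contraD lessThan_iff)

lemma bas_expand: "(x :: 'e::euclidean_space) = (\<Sum>i<DIM('e). (x \<bullet> bas i) *\<^sub>R bas i)"
 using sum.reindex_bij_betw[OF bas_bij, of "%b. (x \<bullet> b) *\<^sub>R b"] euclidean_representation[of x] by simp

text \<open>Induction on the number \<open>k\<close> of leading slots not yet known to hold basis
  vectors; linearity in slot \<open>k\<close> replaces its entry by basis vectors. Once all slots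
  hold basis vectors, either two coincide or they form a permutation of \<open>bas\<close>.\<close>

lemma top_form_eq_0:
 fixes h :: "(nat => 'e::euclidean_space) => real"
 assumes h: "alt_form DIM('e) h" and z: "h bas = 0"
 shows "h v = 0"
proof -
 let ?N = "DIM('e)"
 have "h v = 0" if "k <= ?N" "!!i. k <= i ==> i < ?N ==> v i \<in> Basis" for k v
  using that
 proof (induction k arbitrary: v)
  case 0
  show ?case
  proof (cases "inj_on v {..<?N}")
   case True
   have "v ` {..<?N} = Basis" using True 0 by (intro card_subset_eq) (auto simp: card_image)
   then have bv: "bij_betw v {..<?N} Basis" using True by (simp add: bij_betw_def)
   define sig where "sig i = (if i < ?N then the_inv_into {..<?N} bas (v i) else i)" for i
   have bb: "bij_betw (the_inv_into {..<?N} bas \<circ> v) {..<?N} {..<?N}"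
    using bij_betw_trans[OF bv bij_betw_the_inv_into[OF bas_bij]] .
   have "sig permutes {..<?N}"
   proof (rule bij_imp_permutes)
    show "bij_betw sig {..<?N} {..<?N}" using bb by (rule bij_betw_cong[THEN iffD1, rotated]) (auto simp: sig_def)
   qed (auto simp: sig_def)
   moreover have "bas (sig i) = v i" if "i < ?N" for i
    using f_the_inv_into_f_bij_betw[OF bas_bij, of "v i"] 0 that by (auto simp: sig_def)
   ultimately show ?thesis using alt_form_permute[OF h, of sig bas] z alt_formD(1)[OF h, of v "%i. bas (sig i)"] by simp
  next
   case False
   then obtain i j where "i < ?N" "j < ?N" "i ~= j" "v i = v j" by (auto simp: inj_on_def)
   then show ?thesis using alt_formD(3)[OF h] by blast
  qed
 next
  case (Suc k)
  have "h (v(k := b)) = 0" if "b \<in> Basis" for b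
   by (rule Suc.IH) (use Suc.prems that in \<open>auto simp: not_less_eq_eq le_Suc_eq\<close>)
  then show ?case
   using linear_basis_expand[OF alt_formD(2)[OF h, of k v], of "v k"] Suc.prems by simp
 qed
 from this[of ?N v] show ?thesis by simp
qed

lemma top_form_proportional:
 fixes f g :: "(nat => 'e::euclidean_space) => real"
 assumes "alt_form DIM('e) f" "alt_form DIM('e) g"
 shows "f bas * g v = g bas * f v"
 using top_form_eq_0[OF alt_form_combine[OF assms, of "g bas" "- f bas"], of v] by simp

text \<open>The determinant of the matrix of inner products of \<open>a\<close> with
  \<open>v\<close>; \<open>gram bas\<close> is the standard volume form.\<close>

definition gram :: "(nat => 'e::euclidean_space) => (nat => 'e) => real" where
 "gram a v = (\<Sum>sig | sig permutes {..<DIM('e)}. of_int (sign sig) * (\<Prod>i<DIM('e). a i \<bullet> v (sig i)))"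

lemma alt_form_gram: "alt_form DIM('e) (gram (a :: nat => 'e::euclidean_space))"
 unfolding gram_def[abs_def]
proof (rule alt_form_antisymmetrize[where Phi = "%v. \<Prod>i<DIM('e). a i \<bullet> v i"])
 show "linear (%x. \<Prod>k<DIM('e). a k \<bullet> (v(i := x)) k)" if "i < DIM('e)" for v :: "nat => 'e" and i
  by (rule linear_prod_slot[OF that, of "%k x. a k \<bullet> x"]) (rule bounded_linear.linear[OF bounded_linear_inner_right])
qed (rule prod.cong; simp)

text \<open>A matrix and its transpose have the same determinant: pass to inverse
  permutations.\<close>

lemma gram_commute: "gram a v = gram v (a :: nat => 'e::euclidean_space)"
proof -
 have "gram a v = (\<Sum>sig | sig permutes {..<DIM('e)}. of_int (sign (inv sig)) * (\<Prod>i<DIM('e). a i \<bullet> v (inv sig i)))"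
  unfolding gram_def by (rule sum_permutations_inverse)
 also have "... = gram v a"
  unfolding gram_def
 proof (rule sum.cong[OF refl])
  fix sig assume "sig \<in> {sig. sig permutes {..<DIM('e)}}"
  then have s: "sig permutes {..<DIM('e)}" by simp
  have "(\<Prod>i<DIM('e). a i \<bullet> v (inv sig i)) = (\<Prod>i<DIM('e). a (sig i) \<bullet> v (inv sig (sig i)))"
   using prod.permute[OF s, of "%i. a i \<bullet> v (inv sig i)"] by (simp add: o_def)
  also have "... = (\<Prod>i<DIM('e). v i \<bullet> a (sig i))" using permutes_inverses(2)[OF s] by (simp add: inner_commute)
  finally show "of_int (sign (inv sig)) * (\<Prod>i<DIM('e). a i \<bullet> v (inv sig i)) = of_int (sign sig) * (\<Prod>i<DIM('e). v i \<bullet> a (sig i))"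
   using sign_inverse[OF permutes_imp_permutation[OF finite_lessThan s]] by simp
 qed
 finally show ?thesis .
qed

lemma gram_bas: "gram bas (bas :: nat => 'e::euclidean_space) = 1"
proof -
 have "gram bas (bas :: nat => 'e) = (\<Sum>sig \<in> {id}. of_int (sign sig) * (\<Prod>i<DIM('e). (bas i :: 'e) \<bullet> bas (sig i)))"
  unfolding gram_def
 proof (rule sum.mono_neutral_right)
  show "\<forall>sig\<in>{sig. sig permutes {..<DIM('e)}} - {id}. of_int (sign sig) * (\<Prod>i<DIM('e). (bas i :: 'e) \<bullet> bas (sig i)) = 0"
  proof
   fix sig assume s: "sig \<in> {sig. sig permutes {..<DIM('e)}} - {id}"
   then obtain i where i: "sig i ~= i" by (auto simp: fun_eq_iff)
   then have "i < DIM('e)" using s permutes_not_in[of sig "{..<DIM('e)}" i] by auto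
   moreover then have "sig i < DIM('e)" using s permutes_in_image[of sig "{..<DIM('e)}" i] by auto
   ultimately have "(bas i :: 'e) \<bullet> bas (sig i) = 0" using inner_bas[of i "sig i"] i by simp
   then show "of_int (sign sig) * (\<Prod>i<DIM('e). (bas i :: 'e) \<bullet> bas (sig i)) = 0"
    using \<open>i < DIM('e)\<close> by auto
  qed
 qed (auto simp: finite_permutations permutes_id)
 then show ?thesis by (simp add: inner_bas)
qed

lemma top_form_eq: "alt_form DIM('e) f ==> f v = f bas * gram bas (v :: nat => 'e::euclidean_space)"
 using top_form_proportional[of f "gram bas" v, OF _ alt_form_gram] gram_bas[where 'e = 'e] by simp

section \<open>Bases adapted to a linear functional\<close>

lemma alt_form_shear:
 assumes f: "alt_form N f" and k: "k <= N" "0 < N"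
 shows "f (%i. if 0 < i & i < k then v i + c i *\<^sub>R v 0 else v i) = f v"
 using k(1)
proof (induction k)
 case 0 then show ?case by simp
next
 case (Suc k)
 let ?u = "%i. if 0 < i & i < k then v i + c i *\<^sub>R v 0 else v i"
 show ?case
 proof (cases "k = 0")
  case True then show ?thesis by (intro arg_cong[where f = f]) (auto simp: fun_eq_iff)
 next
  case False
  have l: "linear (%x. f (?u(k := x)))" using alt_formD(2)[OF f] Suc.prems by simp
  have "(%i. if 0 < i & i < Suc k then v i + c i *\<^sub>R v 0 else v i) = ?u(k := v k + c k *\<^sub>R v 0)"
   using False by (auto simp: fun_eq_iff less_Suc_eq)
  then have "f (%i. if 0 < i & i < Suc k then v i + c i *\<^sub>R v 0 else v i) = f (?u(k := v k)) + c k * f (?u(k := v 0))"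
   using linear_add[OF l] linear_scale[OF l] by simp
  moreover have "f (?u(k := v 0)) = 0" by (rule alt_formD(3)[OF f, of 0 k]) (use Suc.prems False in auto)
  moreover have "?u(k := v k) = ?u" by auto
  ultimately show ?thesis using Suc by simp
 qed
qed

text \<open>Starting from \<open>bas\<close>, a vector on which \<open>a\<close> is nonzero is
  brought to the front and scaled, and \<open>a\<close> is cleared from the others by shears, which
  leave top forms unchanged; \<open>s\<close> records the sign of the swap and the scaling. In such
  a basis a perturbation with the factor \<open>a\<close> is felt only through the vector in
  front.\<close>

lemma adapted_basis:
 fixes a :: "'e::euclidean_space => real"
 assumes a: "linear a" "a z ~= 0"
 obtains x s where "s ~= 0" "a (x 0) = 1" "!!j. 0 < j ==> j < DIM('e) ==> a (x j) = 0"
  "!!f. alt_form DIM('e) f ==> f x = s * f bas"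
  "!!y. y - a y *\<^sub>R x 0 \<in> span (x ` {1..<DIM('e)})"
proof -
 let ?N = "DIM('e)"
 have "\<exists>k<?N. a (bas k) ~= 0"
 proof (rule ccontr)
  assume "~  ?thesis"
  then have "a b = 0" if "b \<in> Basis" for b using that bas_bij unfolding bij_betw_def by (metis imageE lessThan_iff)
  then show False using linear_basis_expand[OF a(1), of z] a(2) by simp
 qed
 then obtain k where k: "k < ?N" "a (bas k) ~= 0" by blast
 let ?t = "Transposition.transpose 0 k"
 have t: "?t permutes {..<?N}" using k by (intro permutes_swap_id) auto
 define y where "y i = (bas (?t i) :: 'e)" for i
 define x0 where "x0 = y 0 /\<^sub>R a (y 0)"
 define x where "x i = (if i = 0 then x0 else y i - a (y i) *\<^sub>R x0)" for i
 have ay: "a (y 0) ~= 0" using k by (simp add: y_def)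
 have ax0: "a x0 = 1" using ay linear_scale[OF a(1)] by (simp add: x0_def)
 show thesis
 proof
  show "of_int (sign ?t) / a (y 0) ~= (0::real)" using ay by (simp add: sign_def)
  show "a (x 0) = 1" by (simp add: x_def ax0)
  show "a (x j) = 0" if "0 < j" "j < ?N" for j
   using that ax0 by (simp add: x_def linear_diff[OF a(1)] linear_scale[OF a(1)])
  show "f x = of_int (sign ?t) / a (y 0) * f bas" if f: "alt_form ?N f" for f
  proof -
   let ?y = "y(0 := x0)"
   have "f x = f (%i. if 0 < i & i < ?N then ?y i + (- a (y i)) *\<^sub>R ?y 0 else ?y i)"
    by (rule alt_formD(1)[OF f]) (auto simp: x_def)
   also have "... = f ?y" by (rule alt_form_shear[OF f]) auto
   also have "... = f y / a (y 0)"
    using linear_scale[OF alt_formD(2)[OF f, of 0 y], of "inverse (a (y 0))" "y 0"] by (simp add: x0_def field_simps)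
   also have "f y = of_int (sign ?t) * f bas" unfolding y_def[abs_def] by (rule alt_form_permute[OF f t])
   finally show ?thesis by simp
  qed
  show "z - a z *\<^sub>R x 0 \<in> span (x ` {1..<?N})" for z
  proof -
   have zz: "z = (\<Sum>i<?N. (z \<bullet> y i) *\<^sub>R y i)"
    by (subst bas_expand) (simp add: y_def o_def sum.permute[OF t, of "%i. (z \<bullet> bas i) *\<^sub>R (bas i :: 'e)"])
   have az: "a z = (\<Sum>i<?N. (z \<bullet> y i) * a (y i))"
    by (subst zz) (simp add: linear_sum[OF a(1)] linear_scale[OF a(1)])
   have "z - a z *\<^sub>R x0 = (\<Sum>i<?N. (z \<bullet> y i) *\<^sub>R (y i - a (y i) *\<^sub>R x0))"
    unfolding az by (subst zz) (simp add: scaleR_sum_left scaleR_diff_right sum_subtractf)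
   also have "... \<in> span (x ` {1..<?N})"
   proof (intro span_sum span_scale)
    fix i assume i: "i \<in> {..<?N}"
    show "y i - a (y i) *\<^sub>R x0 \<in> span (x ` {1..<?N})"
    proof (cases "i = 0")
    case True then show ?thesis using ay by (simp add: x0_def span_zero)
    next
    case False then have "y i - a (y i) *\<^sub>R x0 = x i" by (simp add: x_def)
    then show ?thesis using False i by (auto intro!: span_base imageI)
    qed
   qed
   finally show ?thesis by (simp add: x_def)
  qed
 qed
qed

lemma top_form_replace_first:
 fixes x :: "nat => 'e::euclidean_space"
 assumes f: "alt_form DIM('e) f" and s: "u - c *\<^sub>R x 0 \<in> span (x ` {1..<DIM('e)})"
 shows "f (x(0 := u)) = c * f x"
proof -
 have l: "linear (%u. f (x(0 := u)))" using alt_formD(2)[OF f] by simp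
 have "f (x(0 := y)) = 0" if "y \<in> span (x ` {1..<DIM('e)})" for y
 proof (rule linear_eq_0_on_span[OF l _ that])
  fix z assume "z \<in> x ` {1..<DIM('e)}"
  then obtain j where "z = x j" "0 < j" "j < DIM('e)" by auto
  then show "f (x(0 := z)) = 0" using alt_formD(3)[OF f, of 0 j "x(0 := z)"] by simp
 qed
 from this[OF s] show ?thesis using linear_diff[OF l] linear_scale[OF l] by simp
qed

section \<open>The Pfaffian of a two-form\<close>

text \<open>The coefficient of the \<open>n\<close>-th power of \<open>w\<close> relative to the
  volume form, that is \<open>n!\<close> times the classical Pfaffian of the matrix of
  \<open>w\<close>.\<close>

definition Pf :: "nat => ('e::euclidean_space => 'e => real) => real" where
 "Pf n w = wedge_power (bform w) n bas"

definition upd :: "('e => 'e => real) => real => ('e => real) => ('e => real) => 'e => 'e => real" where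
 "upd w l a b = (%u v. w u v + l * (a u * b v - a v * b u))"

text \<open>In dimension \<open>2 * n\<close> this is the coefficient of \<open>n\<close> times a
  wedge b wedge w^(n-1), because a wedge b squares to zero. The definition as a difference avoids
  products of three factors.\<close>

definition dPf :: "nat => ('e::euclidean_space => 'e => real) => ('e => real) => ('e => real) => real" where
 "dPf n w a b = Pf n (upd w 1 a b) - Pf n w"

definition dualv :: "('e::euclidean_space => real) => 'e" where "dualv a = (\<Sum>b\<in>Basis. a b *\<^sub>R b)"

lemma inner_dualv: "linear a ==> dualv a \<bullet> y = a y"
proof -
 assume a: "linear a"
 have "dualv a \<bullet> y = (\<Sum>b\<in>Basis. a b * (b \<bullet> y))" by (simp add: dualv_def inner_sum_left)
 also have "... = a y" by (subst linear_basis_expand[OF a]) (simp add: inner_commute mult.commute)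
 finally show ?thesis .
qed

lemma alt2_upd: "alt2 w ==> linear a ==> linear b ==> alt2 (upd w l a b)"
 unfolding alt2_def upd_def by (auto simp: linear_iff algebra_simps)

lemma upd_commute: "upd w l b a = upd w (- l) a b"
 unfolding upd_def by (auto simp: algebra_simps)

lemma upd_swap: "upd (upd w l c d) k a b = upd (upd w k a b) l c d"
 unfolding upd_def by (auto simp: algebra_simps)

lemma wedge_power_top: 
 fixes w :: "'e::euclidean_space => 'e => real"
 assumes "DIM('e) = 2 * n" "alt2 w"
 shows "wedge_power (bform w) n v = Pf n w * gram bas v"
 unfolding Pf_def by (rule top_form_eq) (metis assms alt_form_wedge_power)

text \<open>Top forms pull back by the determinant. For transition maps the factor is nonzero, so
  the zeros of \<open>Pf\<close> do not depend on the chart.\<close>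

lemma Pf_pullback:
 fixes w :: "'e::euclidean_space => 'e => real"
 assumes "DIM('e) = 2 * n" "alt2 w"
 shows "Pf n (%u v. w (T u) (T v)) = gram bas (%i. T (bas i)) * Pf n w"
proof -
 have "Pf n (%u v. w (T u) (T v)) = wedge_power (bform w) n (%i. T (bas i))"
  unfolding Pf_def wedge_power_bform ..
 then show ?thesis using wedge_power_top[OF assms] by simp
qed

lemma wedge1_add: "wedge1 m (%u. g u + l * h u) w v = wedge1 m g w v + l * wedge1 m h w v"
 unfolding wedge1_eq by (simp add: algebra_simps sum.distrib sum_distrib_left add_divide_distrib)

lemma wedge1_cong:
 assumes "!!i. i < Suc (2 * m) ==> g (v i) = g' (v i)"
  "!!i j. i < Suc (2 * m) ==> j < Suc (2 * m) ==> w (v i) (v j) = w' (v i) (v j)"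
 shows "wedge1 m g w v = wedge1 m g' w' v"
proof -
 have "sig i < Suc (2 * m)" if "sig permutes {..<Suc (2 * m)}" "i < Suc (2 * m)" for sig i
  using permutes_in_image[OF that(1), of i] that(2) by simp
 then show ?thesis unfolding wedge1_eq
  by (intro arg_cong2[where f = "(/)"] sum.cong arg_cong2[where f = "(*)"] prod.cong refl assms) auto
qed

text \<open>Contract with \<open>x 0\<close>. On the remaining vectors \<open>a\<close> vanishes, so
  the perturbed form restricts to \<open>w\<close> there, while its contraction differs from that of
  \<open>w\<close> by \<open>l * b\<close>. The power is therefore affine in
  \<open>l\<close>.\<close>

lemma wedge_power_upd:
 assumes w: "alt2 w" "linear a" "linear b" and a: "a (x 0) = 1" "!!j. 0 < j ==> j < 2 * Suc m ==> a (x j) = 0"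
 shows "wedge_power (bform (upd w l a b)) (Suc m) x =
  wedge_power (bform w) (Suc m) x + l * real (Suc m) * wedge1 m b w (%i. x (Suc i))"
proof -
 have "wedge1 m (upd w l a b (x 0)) (upd w l a b) (%i. x (Suc i)) =
   wedge1 m (%u. w (x 0) u + l * b u) w (%i. x (Suc i))"
  by (rule wedge1_cong) (auto simp: upd_def a)
 then show ?thesis
  unfolding wedge_power_contract[OF alt2_upd[OF w]] wedge_power_contract[OF w(1)] wedge1_add by (simp add: algebra_simps)
qed

text \<open>For fixed \<open>a\<close> all statements about \<open>dPf\<close> reduce to
  \<open>wedge1\<close> in one basis. The last clause contracts with an arbitrary \<open>u\<close>:
  only its component \<open>a u\<close> along \<open>x 0\<close> counts, the rest lying in the span
  of the other basis vectors.\<close>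

lemma Pf_adapted:
 fixes a :: "'e::euclidean_space => real"
 assumes dim: "DIM('e) = 2 * Suc m" and a: "linear a" "a z ~= 0"
 obtains x s where "s ~= 0" "a (x 0) = 1" "!!j. 0 < j ==> j < DIM('e) ==> a (x j) = 0"
  "!!w b l. alt2 w ==> linear b ==>
    s * Pf (Suc m) (upd w l a b) = s * Pf (Suc m) w + l * real (Suc m) * wedge1 m b w (%i. x (Suc i))"
  "!!w u. alt2 w ==> real (Suc m) * wedge1 m (w u) w (%i. x (Suc i)) = a u * s * Pf (Suc m) w"
proof -
 obtain x s where x: "s ~= 0" "a (x 0) = 1" "!!j. 0 < j ==> j < DIM('e) ==> a (x j) = 0"
  "!!f. alt_form DIM('e) f ==> f x = s * f bas" "!!y. y - a y *\<^sub>R x 0 \<in> span (x ` {1..<DIM('e)})"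
  by (rule adapted_basis[OF a], rule that)
 have top: "wedge_power (bform w) (Suc m) x = s * Pf (Suc m) w" if "alt2 w" for w
  using x(4)[of "wedge_power (bform w) (Suc m)"] alt_form_wedge_power[OF that, of "Suc m"] dim by (simp add: Pf_def)
 show thesis
 proof (rule that)
  show "s ~= 0" "a (x 0) = 1" by fact+
  show "a (x j) = 0" if "0 < j" "j < DIM('e)" for j using x(3)[OF that] .
  show "s * Pf (Suc m) (upd w l a b) = s * Pf (Suc m) w + l * real (Suc m) * wedge1 m b w (%i. x (Suc i))"
   if "alt2 w" "linear b" for w b l
   using wedge_power_upd[of w a b x m l, OF that(1) a(1) that(2) x(2)] x(3) dim top[OF that(1)] top[OF alt2_upd[OF that(1) a(1) that(2)]] by simp
  show "real (Suc m) * wedge1 m (w u) w (%i. x (Suc i)) = a u * s * Pf (Suc m) w" if "alt2 w" for w u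
   using wedge_power_contract[OF that, of m "x(0 := u)"] top_form_replace_first[OF _ x(5)[of u], of "wedge_power (bform w) (Suc m)"]
    alt_form_wedge_power[OF that, of "Suc m"] dim top[OF that] by simp
 qed
qed

section \<open>Algebra of \<open>Pf\<close> and \<open>dPf\<close>\<close>

lemma dim_Suc: "DIM('e::euclidean_space) = 2 * n ==> \<exists>m. n = Suc m"
 using DIM_positive[where 'a = 'e] by (cases n) auto

context
 fixes n :: nat and w :: "'e::euclidean_space => 'e => real"
 assumes dim: "DIM('e) = 2 * n" and w: "alt2 w"
begin

lemma Pf_upd:
 assumes "linear a" "linear b"
 shows "Pf n (upd w l a b) = Pf n w + l * dPf n w a b"
proof (cases "\<exists>z. a z ~= 0")
 case False then show ?thesis by (simp add: upd_def dPf_def)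
next
 case True
 obtain m where m: "n = Suc m" using dim_Suc[OF dim] by blast
 from True obtain z where z: "a z ~= 0" by blast
 obtain x s where s0: "s ~= 0" "a (x 0) = 1" "!!j. 0 < j ==> j < DIM('e) ==> a (x j) = 0"
  "!!w b l. alt2 w ==> linear b ==>
    s * Pf (Suc m) (upd w l a b) = s * Pf (Suc m) w + l * real (Suc m) * wedge1 m b w (%i. x (Suc i))"
  "!!w u. alt2 w ==> real (Suc m) * wedge1 m (w u) w (%i. x (Suc i)) = a u * s * Pf (Suc m) w"
  by (rule Pf_adapted[OF dim[unfolded m] assms(1) z], rule that)
 note s = s0(1) s0(4)[OF w assms(2)]
 have "s * Pf n (upd w l a b) = s * (Pf n w + l * dPf n w a b)"
  unfolding m dPf_def using s(2)[of l] s(2)[of 1] by (simp add: algebra_simps)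
 then show ?thesis using s(1) by simp
qed

lemma dPf_linear:
 assumes "linear a" "linear b" "linear c"
 shows "dPf n w a (%u. b u + k * c u) = dPf n w a b + k * dPf n w a c"
proof (cases "\<exists>z. a z ~= 0")
 case False then show ?thesis by (simp add: upd_def dPf_def)
next
 case True
 obtain m where m: "n = Suc m" using dim_Suc[OF dim] by blast
 from True obtain z where z: "a z ~= 0" by blast
 obtain x s where s0: "s ~= 0" "a (x 0) = 1" "!!j. 0 < j ==> j < DIM('e) ==> a (x j) = 0"
  "!!w b l. alt2 w ==> linear b ==>
    s * Pf (Suc m) (upd w l a b) = s * Pf (Suc m) w + l * real (Suc m) * wedge1 m b w (%i. x (Suc i))"
  "!!w u. alt2 w ==> real (Suc m) * wedge1 m (w u) w (%i. x (Suc i)) = a u * s * Pf (Suc m) w"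
  by (rule Pf_adapted[OF dim[unfolded m] assms(1) z], rule that)
 note s = s0(1) s0(4)[OF w]
 have bc: "linear (%u. b u + k * c u)" using assms by (simp add: linear_iff algebra_simps)
 have "s * dPf n w a (%u. b u + k * c u) = s * (dPf n w a b + k * dPf n w a c)"
  unfolding m dPf_def using s(2)[OF bc, of 1] s(2)[OF assms(2), of 1] s(2)[OF assms(3), of 1] wedge1_add[of m b k c w]
  by (simp add: algebra_simps)
 then show ?thesis using s(1) by simp
qed

lemma dPf_antisym: "linear a ==> linear b ==> dPf n w b a = - dPf n w a b"
 using Pf_upd[of a b "-1"] unfolding dPf_def upd_commute[of w 1 b a] by simp

lemma dPf_self: "dPf n w a a = 0"
 unfolding dPf_def upd_def by (simp add: mult.commute)

text \<open>Conceptually, a wedge w^n vanishes for reasons of degree, and contracting it with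
  \<open>u\<close> gives the identity. It is the source of the formula for the inverse of
  \<open>w\<close>.\<close>

lemma dPf_contract:
 assumes "linear a" "!!y. w u y = b y"
 shows "dPf n w a b = a u * Pf n w"
proof (cases "\<exists>z. a z ~= 0")
 case False then show ?thesis by (simp add: upd_def dPf_def)
next
 case True
 have wu: "w u = b" using assms(2) by blast
 then have wb: "w u = b" "linear b" using alt2D(1)[OF w, of u] by auto
 obtain m where m: "n = Suc m" using dim_Suc[OF dim] by blast
 from True obtain z where z: "a z ~= 0" by blast
 obtain x s where s0: "s ~= 0" "a (x 0) = 1" "!!j. 0 < j ==> j < DIM('e) ==> a (x j) = 0"
  "!!w b l. alt2 w ==> linear b ==>
    s * Pf (Suc m) (upd w l a b) = s * Pf (Suc m) w + l * real (Suc m) * wedge1 m b w (%i. x (Suc i))"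
  "!!w u. alt2 w ==> real (Suc m) * wedge1 m (w u) w (%i. x (Suc i)) = a u * s * Pf (Suc m) w"
  by (rule Pf_adapted[OF dim[unfolded m] assms(1) z], rule that)
 note s = s0(1) s0(4)[OF w wb(2), of 1] s0(5)[OF w, of u]
 have "s * dPf n w a b = s * (a u * Pf n w)"
  unfolding m dPf_def using s(2) s(3) wb by (simp add: algebra_simps)
 then show ?thesis using s(1) by simp
qed

text \<open>Take the functional given by \<open>u\<close> itself in \<open>dPf_contract\<close>: it
  has the value \<open>u \<bullet> u \<noteq> 0\<close> at \<open>u\<close>, while the contraction
  of \<open>w\<close> with \<open>u\<close> is zero.\<close>

lemma Pf_degenerate:
 assumes "u ~= 0" "!!y. w u y = 0" shows "Pf n w = 0"
proof -
 have "dPf n w (%y. u \<bullet> y) (%_. 0) = (u \<bullet> u) * Pf n w"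
  by (rule dPf_contract) (use assms(2) in \<open>auto intro: bounded_linear.linear[OF bounded_linear_inner_right]\<close>)
 moreover have "dPf n w (%y. u \<bullet> y) (%_. 0) = 0" by (simp add: dPf_def upd_def)
 ultimately show ?thesis using assms(1) by simp
qed

text \<open>A nonzero Pfaffian makes the map from \<open>u\<close> to the covector
  \<open>w u\<close> injective, hence surjective by dimension.\<close>

lemma ex_contract:
 assumes nz: "Pf n w ~= 0" and a: "linear a"
 obtains u where "!!y. w u y = a y"
proof -
 define L where "L u = dualv (w u)" for u
 have L: "L u \<bullet> y = w u y" for u y unfolding L_def by (rule inner_dualv) (rule alt2D(1)[OF w])
 have lin: "linear L"
 proof (rule linearI)
  show "L (u + v) = L u + L v" for u v
   by (rule vector_eq_rdot[THEN iffD1]) (simp add: L inner_add_left linear_add[OF alt2D(2)[OF w]])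
  show "L (c *\<^sub>R u) = c *\<^sub>R L u" for c u
   by (rule vector_eq_rdot[THEN iffD1]) (simp add: L linear_scale[OF alt2D(2)[OF w]])
 qed
 have "u = 0" if "L u = 0" for u
  using Pf_degenerate[of u] nz L[of u] that by fastforce
 then have "inj L" using linear_injective_0[OF lin] by blast
 then have "surj L" using linear_inj_imp_surj[OF lin] by blast
 then obtain u where "L u = dualv a" by (metis surjD)
 then have "w u y = a y" for y using L[of u y] inner_dualv[OF a, of y] by simp
 then show thesis by (rule that)
qed

end

text \<open>The two perturbations commute, so affinity of \<open>Pf\<close> in each of them makes
  \<open>dPf\<close> affine as well. With a large factor \<open>l\<close> this isolates the pole of
  \<open>dPf\<close> of a logarithmic form.\<close>

lemma dPf_upd:
 fixes w :: "'e::euclidean_space => 'e => real"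
 assumes "DIM('e) = 2 * n" "alt2 w" "linear a" "linear b" "linear c" "linear d"
 shows "dPf n (upd w l c d) a b = dPf n w a b + l * (dPf n (upd w 1 c d) a b - dPf n w a b)"
proof -
 note ab = alt2_upd[OF assms(2,3,4)]
 have "dPf n (upd w l c d) a b = Pf n (upd (upd w 1 a b) l c d) - Pf n (upd w l c d)" for l
  by (simp add: dPf_def upd_swap)
 then show ?thesis
  unfolding Pf_upd[OF assms(1,2,5,6)] Pf_upd[OF assms(1) ab assms(5,6)] by (simp add: dPf_def upd_swap[of w 1 c d 1 a b] algebra_simps)
qed

subsection \<open>Mutually inverse forms and bivectors\<close>

text \<open>\<open>P\<close> and \<open>w\<close> are inverse to each other, with covectors
  represented by vectors through the inner product: \<open>w\<close> sends \<open>u\<close> to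
  \<open>x\<close> exactly when \<open>P\<close> sends \<open>x\<close> to \<open>u\<close>. As a
  relation this is symmetric in \<open>P\<close> and \<open>w\<close>.\<close>

definition ipair :: "('e::euclidean_space => 'e => real) => ('e => 'e => real) => bool" where
 "ipair P w \<longleftrightarrow> (\<forall>x u. (\<forall>y. w u y = x \<bullet> y) \<longleftrightarrow> (\<forall>y. P x y = u \<bullet> y))"

lemma ipair_sym: "ipair P w ==> ipair w P"
 unfolding ipair_def by blast

text \<open>Cramer's rule for two-forms. Numerator and denominator are polynomials in the entries of
  \<open>w\<close>, so smoothness is visible, and the numerator stays smooth where \<open>Pf\<close>
  vanishes.\<close>

definition pinv :: "nat => ('e::euclidean_space => 'e => real) => 'e => 'e => real" where
 "pinv n w x y = - dPf n w (%z. x \<bullet> z) (%z. y \<bullet> z) / Pf n w"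

lemma linear_inner: "linear (%z. x \<bullet> z)"
 by (rule bounded_linear.linear[OF bounded_linear_inner_right])

text \<open>When \<open>w u\<close> is the covector of \<open>x\<close>, \<open>dPf_contract\<close>
  evaluates the numerator of \<open>pinv\<close> as \<open>u \<bullet> y\<close> times
  \<open>Pf n w\<close>, after one use of antisymmetry, which accounts for the sign in
  \<open>pinv\<close>. The converse holds because \<open>x\<close> has some preimage
  \<open>u'\<close>.\<close>

lemma ipair_pinv:
 fixes w :: "'e::euclidean_space => 'e => real"
 assumes dim: "DIM('e) = 2 * n" and w: "alt2 w" and nz: "Pf n w ~= 0"
 shows "ipair (pinv n w) w"
proof -
 have A: "pinv n w x y = u \<bullet> y" if "!!y. w u y = x \<bullet> y" for x u y
 proof -
  have "dPf n w (%z. y \<bullet> z) (%z. x \<bullet> z) = (y \<bullet> u) * Pf n w"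
   by (rule dPf_contract[OF dim w linear_inner]) (rule that)
  then have A: "dPf n w (%z. x \<bullet> z) (%z. y \<bullet> z) = - ((y \<bullet> u) * Pf n w)"
   using dPf_antisym[OF dim w linear_inner linear_inner, of y x] by simp
  then show ?thesis unfolding pinv_def A using nz by (simp add: inner_commute)
 qed
 have "\<forall>y. w u y = x \<bullet> y" if B: "\<forall>y. pinv n w x y = u \<bullet> y" for x u
 proof -
  obtain u' where u': "!!y. w u' y = x \<bullet> y" using ex_contract[OF dim w nz linear_inner] by blast
  have "u' \<bullet> y = u \<bullet> y" for y using A[OF u', of y] B by simp
  then have "u' = u" by (metis vector_eq_rdot)
  then show ?thesis using u' by simp
 qed
 then show ?thesis unfolding ipair_def using A by blast
qed

lemma alt2_pinv:
 fixes w :: "'e::euclidean_space => 'e => real"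
 assumes dim: "DIM('e) = 2 * n" and w: "alt2 w"
 shows "alt2 (pinv n w)"
proof -
 have 1: "linear (pinv n w x)" for x
 proof (rule linearI)
  show "pinv n w x (y + z) = pinv n w x y + pinv n w x z" for y z
   using dPf_linear[OF dim w linear_inner[of x] linear_inner[of y] linear_inner[of z], of 1]
   by (simp add: pinv_def inner_add_left add_divide_distrib diff_divide_distrib)
  have "linear (%_. 0 :: real)" by (simp add: linear_iff)
  from dPf_linear[OF dim w linear_inner[of x] this linear_inner]
  show "pinv n w x (c *\<^sub>R y) = c *\<^sub>R pinv n w x y" for c y
   by (simp add: pinv_def) (simp add: dPf_def upd_def)
 qed
 have eq: "pinv n w x y = - pinv n w y x" for x y
  using dPf_antisym[OF dim w linear_inner linear_inner, of x y] by (simp add: pinv_def)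
 have "linear (%x. - pinv n w y x)" for y using linear_mult_right[OF 1, of "-1" y] by simp
 moreover have "(%x. pinv n w x y) = (%x. - pinv n w y x)" for y by (rule ext) (rule eq)
 ultimately have "linear (%x. pinv n w x y)" for y by simp
 moreover have "pinv n w x x = 0" for x unfolding pinv_def dPf_self[OF dim w] by simp
 ultimately show ?thesis unfolding alt2_def using 1 by blast
qed

text \<open>The standard symplectic matrix with conjugate indices \<open>2 * i\<close> and
  \<open>2 * i + 1\<close>.\<close>

definition J :: "nat => nat => real" where
 "J i j = (if even i & j = Suc i then 1 else if even j & i = Suc j then -1 else 0)"

lemma J_simps: "J (2 * i) (2 * j) = 0" "J (2 * i) (Suc (2 * j)) = (if i = j then 1 else 0)"
 "J (Suc (2 * i)) (2 * j) = (if i = j then -1 else 0)" "J (Suc (2 * i)) (Suc (2 * j)) = 0"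
 unfolding J_def by (auto; presburger)+

text \<open>Symplectic Gram-Schmidt: each new conjugate pair is taken in the
  \<open>w\<close>-orthogonal complement of the pairs already built.\<close>

lemma symplectic_basis:
 fixes w :: "'e::euclidean_space => 'e => real"
 assumes dim: "DIM('e) = 2 * n" and w: "alt2 w" and nd: "!!u. u ~= 0 ==> \<exists>y. w u y ~= 0"
 shows "k <= n ==> \<exists>e. \<forall>i<2 * k. \<forall>j<2 * k. w (e i) (e j) = J i j"
proof (induction k)
 case 0 then show ?case by simp
next
 case (Suc k)
 then obtain e where e: "!!i j. i < 2 * k ==> j < 2 * k ==> w (e i) (e j) = J i j" by auto
 note l1 = alt2D(1)[OF w] and l2 = alt2D(2)[OF w]
 \<comment> \<open>The projection to the \<open>w\<close>-orthogonal complement of \<open>e\<close>;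
   each vector of a pair is multiplied by the pairing with its conjugate, with opposite signs as in
   \<open>J\<close>.\<close>
 define pr where "pr v = v - (\<Sum>i<k. w v (e (Suc (2 * i))) *\<^sub>R e (2 * i) - w v (e (2 * i)) *\<^sub>R e (Suc (2 * i)))" for v
 have pr0: "w (pr v) (e j) = 0" if j: "j < 2 * k" for v j
 proof -
  define l where "l = j div 2"
  have l: "l < k" unfolding l_def by (rule less_mult_imp_div_less) (use j in simp)
  have jl: "j = 2 * l \<or> j = Suc (2 * l)" unfolding l_def by presburger
  have "w (pr v) (e j) = w v (e j) - (\<Sum>i<k. w v (e (Suc (2 * i))) * w (e (2 * i)) (e j) - w v (e (2 * i)) * w (e (Suc (2 * i))) (e j))"
   unfolding pr_def by (simp add: linear_diff[OF l2] linear_sum[OF l2] linear_scale[OF l2])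
  also have "... = w v (e j) - (\<Sum>i<k. w v (e (Suc (2 * i))) * J (2 * i) j - w v (e (2 * i)) * J (Suc (2 * i)) j)"
   using j by (simp add: e)
  also have "... = 0" using jl l by (auto simp: J_simps sum_negf if_distrib[where f = "%x. c * x" for c] cong: if_cong)
  finally show ?thesis .
 qed
 \<comment> \<open>Fewer than \<open>DIM('e)\<close> vectors cannot span, so some vector has a
   nonzero projection.\<close>
 have ds: "dim (span (e ` {..<2 * k})) < DIM('e)"
 proof -
  have "dim (span (e ` {..<2 * k})) <= card (e ` {..<2 * k})" by (simp add: dim_le_card')
  also have "... <= 2 * k" using card_image_le[of "{..<2 * k}" e] by simp
  finally show ?thesis using Suc.prems dim by simp
 qed
 then have "span (e ` {..<2 * k}) ~= UNIV" by (metis dim_UNIV less_irrefl)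
 then obtain v where v: "v \<notin> span (e ` {..<2 * k})" by blast
 have "pr v ~= 0"
 proof
  assume "pr v = 0"
  then have "v = (\<Sum>i<k. w v (e (Suc (2 * i))) *\<^sub>R e (2 * i) - w v (e (2 * i)) *\<^sub>R e (Suc (2 * i)))" by (simp add: pr_def)
  also have "... \<in> span (e ` {..<2 * k})" by (intro span_sum span_diff span_scale span_base imageI) auto
  finally show False using v by simp
 qed
 then obtain u where u: "w (pr v) u ~= 0" using nd by blast
 \<comment> \<open>\<open>pr v\<close> is orthogonal to \<open>e\<close>, so projecting
   \<open>u\<close> does not change the pairing and only a scaling remains to be done.\<close>
 have pu: "w (pr v) (pr u) = w (pr v) u"
  unfolding pr_def[of u] by (simp add: linear_diff[OF l1] linear_sum[OF l1] linear_scale[OF l1] pr0)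
 define f where "f = e(2 * k := pr v, Suc (2 * k) := pr u /\<^sub>R w (pr v) u)"
 have f1: "w (f (2 * k)) (f (Suc (2 * k))) = 1" using u pu by (simp add: f_def linear_scale[OF l1])
 have f2: "w (f (2 * k)) (f j) = 0" "w (f (Suc (2 * k))) (f j) = 0" if "j < 2 * k" for j
  using that pr0[OF that] by (simp_all add: f_def linear_scale[OF l2])
 note anti = alt2_antisym[OF w] and zz = alt2D(3)[OF w]
 have "w (f i) (f j) = J i j" if "i < 2 * Suc k" "j < 2 * Suc k" for i j
 proof -
  have ij: "i < Suc (Suc (2 * k))" "j < Suc (Suc (2 * k))" using that by simp_all
  consider "i < 2 * k" | "i = 2 * k" | "i = Suc (2 * k)" using ij by linarith
  then show ?thesis
  proof cases
   case 1
   consider "j < 2 * k" | "j = 2 * k" | "j = Suc (2 * k)" using ij by linarith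
   then show ?thesis
   proof cases
    case 1 with \<open>i < 2 * k\<close> show ?thesis using e by (simp add: f_def)
   next
    case 2 with \<open>i < 2 * k\<close> show ?thesis using f2(1)[of i] anti[of "f (2 * k)" "f i"] by (auto simp: J_def; presburger)
   next
    case 3 with \<open>i < 2 * k\<close> show ?thesis using f2(2)[of i] anti[of "f (Suc (2 * k))" "f i"] by (auto simp: J_def; presburger)
   qed
  next
   case 2
   consider "j < 2 * k" | "j = 2 * k" | "j = Suc (2 * k)" using ij by linarith
   then show ?thesis using 2 f2(1)[of j] zz f1 by (cases; auto simp: J_def; presburger)
  next
   case 3
   consider "j < 2 * k" | "j = 2 * k" | "j = Suc (2 * k)" using ij by linarith
   then show ?thesis using 3 f2(2)[of j] zz f1 anti[of "f (2 * k)" "f (Suc (2 * k))"] by (cases; auto simp: J_def; presburger)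
  qed
 qed
 then show ?case by blast
qed

definition J_det :: "nat => real" where
 "J_det n = (\<Sum>sig | sig permutes {..<2 * n}. of_int (sign sig) * (\<Prod>i<2 * n. J i (sig i)))"

text \<open>Each row of \<open>J\<close> has exactly one nonzero entry, so only the permutation
  \<open>p\<close> that exchanges conjugate indices contributes.\<close>

lemma J_det_nonzero: "J_det n ~= 0"
proof -
 define p where "p i = (if i < 2 * n then (if even i then Suc i else i - 1) else i)" for i :: nat
 have pp: "p (p i) = i" for i unfolding p_def by (auto; presburger)
 have pn: "p i < 2 * n" if "i < 2 * n" for i using that unfolding p_def by (auto; presburger)
 have perm: "p permutes {..<2 * n}"
 proof (rule bij_imp_permutes)
  show "bij_betw p {..<2 * n} {..<2 * n}" by (rule bij_betwI[where g = p]) (use pp pn in auto)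
 qed (simp add: p_def)
 have Jp: "J i j ~= 0 \<longleftrightarrow> j = p i" if "i < 2 * n" for i j using that unfolding J_def p_def by (auto; presburger)
 have "J_det n = (\<Sum>sig\<in>{p}. of_int (sign sig) * (\<Prod>i<2 * n. J i (sig i)))"
  unfolding J_det_def
 proof (rule sum.mono_neutral_right)
  show "\<forall>sig\<in>{sig. sig permutes {..<2 * n}} - {p}. of_int (sign sig) * (\<Prod>i<2 * n. J i (sig i)) = 0"
  proof
   fix sig assume s: "sig \<in> {sig. sig permutes {..<2 * n}} - {p}"
   then obtain i where i: "sig i ~= p i" by (auto simp: fun_eq_iff)
   then have "i < 2 * n" using s permutes_not_in[of sig "{..<2 * n}" i] by (auto simp: p_def)
   then show "of_int (sign sig) * (\<Prod>i<2 * n. J i (sig i)) = 0" using Jp[of i "sig i"] i by auto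
  qed
 qed (use perm in \<open>auto simp: finite_permutations\<close>)
 then show ?thesis using Jp by (auto simp: sign_def)
qed

text \<open>In a symplectic basis of \<open>w\<close> and its dual basis both Pfaffians are read off from \<open>J\<close>, up to the
 determinant of the base change, which cancels in the product.\<close>

lemma Pf_mult_inverse:
 assumes dim: "DIM('e::euclidean_space) = 2 * n"
 obtains C where "!!P w :: 'e => 'e => real. alt2 P ==> alt2 w ==> ipair P w ==> Pf n w ~= 0 ==> Pf n P * Pf n w = C & C ~= 0"
proof -
 define c0 where "c0 = wedge_power (bform J) n (%i. i)"
 have main: "Pf n P * Pf n w = (-1) ^ n * c0 ^ 2 / J_det n & (-1) ^ n * c0 ^ 2 / J_det n ~= 0"
  if P: "alt2 P" and w: "alt2 w" and ip: "ipair P w" and nz: "Pf n w ~= 0" for P w :: "'e => 'e => real"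
 proof -
  have "\<exists>y. w u y ~= 0" if "u ~= 0" for u using Pf_degenerate[OF dim w that] nz by blast
  from symplectic_basis[OF dim w this, of n] obtain e where e: "!!i j. i < 2 * n ==> j < 2 * n ==> w (e i) (e j) = J i j"
   by auto
  \<comment> \<open>\<open>a\<close> is the image of the symplectic basis under \<open>w\<close>. On
    it \<open>P\<close> has the matrix \<open>- J\<close>, and \<open>gram a e\<close> has the value
    \<open>J_det n\<close>.\<close>
  define a where "a i = dualv (w (e i))" for i
  have a: "a i \<bullet> y = w (e i) y" for i y unfolding a_def by (rule inner_dualv[OF alt2D(1)[OF w]])
  have Pa: "P (a i) y = e i \<bullet> y" for i y using ip a[of i] unfolding ipair_def by metis
  have lt: "sig i < 2 * n" if "sig permutes {..<2 * n}" "i < 2 * n" for sig i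
   using permutes_in_image[OF that(1), of i] that(2) by simp
  have we: "wedge_power (bform w) n e = c0"
   unfolding c0_def wedge_power_bform
   by (intro arg_cong2[where f = "(/)"] sum.cong arg_cong2[where f = "(*)"] prod.cong refl e) (auto intro: lt)
  have Paa: "P (a i) (a j) = - J i j" if "i < 2 * n" "j < 2 * n" for i j
  proof -
   have "P (a i) (a j) = w (e j) (e i)" using Pa[of i "a j"] a[of j "e i"] by (simp add: inner_commute)
   then show ?thesis using alt2_antisym[OF w, of "e j" "e i"] e[OF that] by simp
  qed
  have Pe: "wedge_power (bform P) n a = (-1) ^ n * c0"
  proof -
   have "(\<Prod>i<n. P (a (sig (2 * i))) (a (sig (2 * i + 1)))) = (-1) ^ n * (\<Prod>i<n. J (sig (2 * i)) (sig (2 * i + 1)))"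
    if s: "sig permutes {..<2 * n}" for sig
   proof -
    have "(\<Prod>i<n. P (a (sig (2 * i))) (a (sig (2 * i + 1)))) = (\<Prod>i<n. (-1) * J (sig (2 * i)) (sig (2 * i + 1)))"
    by (rule prod.cong[OF refl], subst Paa) (auto intro!: lt[OF s])
    then show ?thesis by (simp only: prod.distrib) simp
   qed
   then show ?thesis unfolding c0_def wedge_power_bform
    by (simp add: sum_distrib_left mult.left_commute)
  qed
  have Da: "gram a e = J_det n"
   unfolding gram_def J_det_def dim
   by (intro sum.cong arg_cong2[where f = "(*)"] prod.cong refl) (auto simp: a e lt)
  have 1: "Pf n w * J_det n = gram a bas * c0"
   using top_form_proportional[of "wedge_power (bform w) n" "gram a" e] alt_form_wedge_power[OF w, of n] alt_form_gram[of a] dim we Da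
   by (simp add: Pf_def)
  have 2: "Pf n P * gram bas a = (-1) ^ n * c0"
   using wedge_power_top[OF dim P, of a] Pe by simp
  have c: "c0 ~= 0" using 1 nz J_det_nonzero[of n] by auto
  have "Pf n P * Pf n w * J_det n = (Pf n P * gram bas a) * c0" using 1 gram_commute[of a bas] by (simp add: mult_ac)
  then have "Pf n P * Pf n w * J_det n = (-1) ^ n * c0 ^ 2" using 2 by (simp add: power2_eq_square)
  then show ?thesis using J_det_nonzero[of n] c by (simp add: field_simps)
 qed
 show thesis by (rule that) (use main in blast)
qed

section \<open>Bump functions\<close>

text \<open>The powers of \<open>inverse x\<close> make the family closed under differentiation, so
  that smoothness is one induction over all \<open>k\<close> at once.\<close>

definition flat_exp :: "nat => real => real" where
 "flat_exp k x = (if x > 0 then exp (- inverse x) * inverse x ^ k else 0)"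

lemma flat_exp_tendsto_0: "(flat_exp k \<longlongrightarrow> 0) (at 0)"
proof -
 have l: "(flat_exp k \<longlongrightarrow> 0) (at_left 0)"
  by (rule tendsto_eventually) (auto simp: eventually_at_filter flat_exp_def)
 have "((%x. inverse x ^ k / exp (inverse x)) \<longlongrightarrow> (0::real)) (at_right 0)"
  by (rule filterlim_compose[OF tendsto_power_div_exp_0 filterlim_inverse_at_top_right])
 moreover have "eventually (%x. inverse x ^ k / exp (inverse x) = flat_exp k x) (at_right 0)"
  by (auto simp: eventually_at_filter flat_exp_def exp_minus field_simps)
 ultimately have "(flat_exp k \<longlongrightarrow> 0) (at_right 0)" by (rule Lim_transform_eventually)
 then show ?thesis using l by (simp add: filterlim_split_at)
qed

lemma flat_exp_deriv:
 "(flat_exp k has_real_derivative (flat_exp (k + 2) x - real k * flat_exp (k + 1) x)) (at x)"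
proof -
 consider "x > 0" | "x < 0" | "x = 0" by linarith
 then show ?thesis
 proof cases
  case 1
  have "((%x. exp (- inverse x) * inverse x ^ k) has_real_derivative (flat_exp (k + 2) x - real k * flat_exp (k + 1) x)) (at x)"
  proof -
   have "((%x. exp (- inverse x) * inverse x ^ k) has_real_derivative
    exp (- inverse x) * (inverse x * inverse x) * inverse x ^ k +
    (real k * inverse x ^ (k - 1) * - (inverse x * inverse x)) * exp (- inverse x)) (at x)"
    using 1 by (auto intro!: derivative_eq_intros simp: power2_eq_square)
   moreover have "exp (- inverse x) * (inverse x * inverse x) * inverse x ^ k +
    (real k * inverse x ^ (k - 1) * - (inverse x * inverse x)) * exp (- inverse x) =
    flat_exp (k + 2) x - real k * flat_exp (k + 1) x"
    using 1 by (cases k) (simp_all add: flat_exp_def algebra_simps)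
   ultimately show ?thesis by simp
  qed
  then show ?thesis
   by (rule has_field_derivative_transform_within_open[where S = "{0<..}"]) (use 1 in \<open>auto simp: flat_exp_def\<close>)
 next
  case 2
  have "((%_. 0) has_real_derivative 0) (at x)" by simp
  then have "(flat_exp k has_real_derivative 0) (at x)"
   by (rule has_field_derivative_transform_within_open[where S = "{..<0}"]) (use 2 in \<open>auto simp: flat_exp_def\<close>)
  then show ?thesis using 2 by (simp add: flat_exp_def)
 next
  case 3
  have "((%h. (flat_exp k (0 + h) - flat_exp k 0) / h) \<longlongrightarrow> 0) (at 0)"
   by (rule Lim_transform_eventually[OF flat_exp_tendsto_0[of "k + 1"]])
    (auto simp: eventually_at_filter flat_exp_def field_simps)
  then show ?thesis using 3 by (simp add: DERIV_def flat_exp_def)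
 qed
qed

lemma smooth_flat_exp: "smo UNIV (flat_exp k)"
proof -
 have "Ck_on j UNIV (flat_exp k)" for j k
 proof (induction j arbitrary: k)
  case 0
  show ?case using DERIV_continuous_on[OF has_field_derivative_at_within[OF flat_exp_deriv[of k]], of UNIV] by simp
 next
  case (Suc j)
  show ?case
  proof (rule Ck_on_Suc_I)
   show "(flat_exp k has_derivative (*) (flat_exp (k + 2) x - real k * flat_exp (k + 1) x)) (at x)" for x
    using flat_exp_deriv[of k x] by (simp add: has_field_derivative_def)
   have 1: "Ck_on j UNIV (%x. (- real k) * flat_exp (k + 1) x)"
    by (rule bounded_bilinear.Ck_on[OF bounded_bilinear_mult]) (auto intro: Ck_on_const Suc.IH)
   have "Ck_on j UNIV (%x. (flat_exp (k + 2) x + (- real k) * flat_exp (k + 1) x) * v)" for v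
    by (rule bounded_bilinear.Ck_on[OF bounded_bilinear_mult], simp, rule Ck_on_add)
    (auto intro: Ck_on_const Suc.IH 1[simplified])
   then show "Ck_on j UNIV (%x. (flat_exp (k + 2) x - real k * flat_exp (k + 1) x) * v)" for v by simp
  qed simp
 qed
 then show ?thesis by (simp add: smooth_on_def)
qed

definition cutoff :: "real => real" where
 "cutoff t = flat_exp 0 (1 - t) / (flat_exp 0 (1 - t) + flat_exp 0 (t - 1/2))"

lemma cutoff_denominator: "flat_exp 0 (1 - t) + flat_exp 0 (t - 1/2) > 0"
 by (auto simp: flat_exp_def intro: add_pos_pos)

lemma smooth_cutoff: "smo UNIV cutoff"
 unfolding cutoff_def[abs_def] using cutoff_denominator
 by (intro smooth sm_compose[OF _ open_UNIV smooth_flat_exp] open_UNIV) (auto simp: less_imp_neq[symmetric])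

lemma cutoff_eq_1: "t <= 1/2 ==> cutoff t = 1"
 by (simp add: cutoff_def flat_exp_def)

lemma cutoff_eq_0: "t >= 1 ==> cutoff t = 0"
 by (simp add: cutoff_def flat_exp_def)

lemma cutoff_bounds: "0 <= cutoff t" "cutoff t <= 1"
 using cutoff_denominator[of t] by (auto simp: cutoff_def flat_exp_def divide_simps)

section \<open>The smooth inverse function theorem\<close>

lemma alt_form_linear_image:
 assumes f: "alt_form k f" and A: "linear A" shows "alt_form k (%v. f (%i. A (v i)))"
proof -
 have e: "(%j. A ((v(i := x)) j)) = (%j. A (v j))(i := A x)" for v i x by auto
 have "linear (%x. f (%j. A ((v(i := x)) j)))" if "i < k" for v i
  unfolding e using linear_compose[OF A alt_formD(2)[OF f that, of "%j. A (v j)"]] by (simp add: o_def)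
 moreover have "f (%i. A (v i)) = f (%i. A (w i))" if "\<forall>i<k. v i = w i" for v w
  by (rule alt_formD(1)[OF f]) (use that in auto)
 moreover have "f (%i. A (v i)) = 0" if "i < k" "j < k" "i ~= j" "v i = v j" for v i j
  by (rule alt_formD(3)[OF f that(1-3)]) (use that in simp)
 ultimately show ?thesis unfolding alt_form_def by blast
qed

text \<open>The determinants of \<open>A\<close> and of a right inverse \<open>B\<close> multiply to
  1.\<close>

lemma gram_image_nonzero:
 fixes A :: "'e::euclidean_space => 'e"
 assumes A: "linear A" "inj A" shows "gram bas (%i. A (bas i)) ~= 0"
proof -
 obtain B where B: "A \<circ> B = id" using linear_inj_imp_surj[OF A] by (metis surj_iff)
 have "gram bas (%i. A (B (bas i))) = gram bas (%i. A (bas i)) * gram bas (%i. B (bas i))"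
  by (rule top_form_eq[OF alt_form_linear_image[OF alt_form_gram A(1)]])
 moreover have "A (B x) = x" for x using B by (metis comp_apply id_apply)
 ultimately show ?thesis using gram_bas[where 'e = 'e] by auto
qed

text \<open>Cramer's rule. It exhibits the inverse of a derivative as a smooth function of the
  point, which bootstraps the regularity of a local inverse.\<close>

lemma cramer:
 fixes A :: "'e::euclidean_space => 'e"
 assumes A: "linear A" "inj A"
 shows "u = (\<Sum>i<DIM('e). (gram bas ((%j. A (bas j))(i := A u)) / gram bas (%i. A (bas i))) *\<^sub>R bas i)"
proof -
 let ?v = "%j. A (bas j :: 'e)"
 have "gram bas (?v(i := A u)) = (u \<bullet> bas i) * gram bas ?v" if i: "i < DIM('e)" for i
 proof -
  have l: "linear (%x. gram bas (?v(i := x)))" by (rule alt_formD(2)[OF alt_form_gram i])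
  have z: "gram bas (?v(i := A (bas j))) = (if j = i then gram bas ?v else 0)" if "j < DIM('e)" for j
  proof (cases "j = i")
   case True then show ?thesis by (simp add: fun_upd_idem)
  next
   case False then show ?thesis using alt_formD(3)[OF alt_form_gram[of bas] i that, of "?v(i := A (bas j))"] by simp
  qed
  have "A u = (\<Sum>j<DIM('e). (u \<bullet> bas j) *\<^sub>R A (bas j))"
   by (subst bas_expand[of u]) (simp add: linear_sum[OF A(1)] linear_scale[OF A(1)])
  then have "gram bas (?v(i := A u)) = (\<Sum>j<DIM('e). (u \<bullet> bas j) * gram bas (?v(i := A (bas j))))"
   by (simp add: linear_sum[OF l] linear_scale[OF l])
  also have "... = (\<Sum>j<DIM('e). if j = i then (u \<bullet> bas j) * gram bas ?v else 0)"
   by (rule sum.cong) (auto simp: z)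
  also have "... = (u \<bullet> bas i) * gram bas ?v" using i by simp
  finally show ?thesis .
 qed
 then show ?thesis using gram_image_nonzero[OF A] by (subst bas_expand[of u]) simp
qed

lemma sm_gram:
 fixes v :: "nat => 'a::euclidean_space => 'e::euclidean_space"
 assumes "open S" "!!i. smo S (v i)"
 shows "smo S (%x. gram bas (%i. v i x))"
 unfolding gram_def by (intro sm_sum sm_mult sm_prod sm_inner sm_const assms)

text \<open>The derivative of the local inverse is \<open>M v (g y)\<close>, with \<open>M v\<close>
  smooth by Cramer's rule. So if \<open>g\<close> is of class \<open>k\<close>, its derivative is of
  class \<open>k\<close> and \<open>g\<close> is of class \<open>k + 1\<close>.\<close>

lemma smooth_inverse_function:
 fixes f :: "'e::euclidean_space => 'e"
 assumes U: "open U" and f: "smo U f" and x0: "x0 \<in> U" and inj: "inj (FD f x0)"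
 obtains U' V g where "open U'" "U' \<subseteq> U" "x0 \<in> U'" "open V" "f x0 \<in> V" "homeomorphism U' V f g" "smo V g"
proof -
 have bl: "bounded_linear (FD f x)" if "x \<in> U" for x
  using sm_has_derivative[OF f that] has_derivative_bounded_linear by blast
 define f' where "f' x = Blinfun (FD f x)" for x
 have f': "blinfun_apply (f' x) = FD f x" if "x \<in> U" for x
  unfolding f'_def using bl[OF that] by (simp add: bounded_linear_Blinfun_apply)
 have c: "continuous_on U f'"
 proof (rule continuous_on_blinfun_componentwise)
  fix i :: 'e
  have "continuous_on U (%x. FD f x i)" using sm_cont[OF sm_FD[OF f]] .
  then show "continuous_on U (%x. blinfun_apply (f' x) i)" by (simp add: f' cong: continuous_on_cong)
 qed
 have lin: "linear (FD f x0)" by (rule sm_linear_FD[OF f x0])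
 obtain B where B: "linear B" "B \<circ> FD f x0 = id" using linear_injective_left_inverse[OF lin inj] by blast
 have fd: "(f has_derivative blinfun_apply (f' x)) (at x)" if "x \<in> U" for x
  using sm_has_derivative[OF f that] f'[OF that] by simp
 have Bi: "Blinfun B o\<^sub>L f' x0 = id_blinfun"
  by (rule blinfun_eqI) (use B f'[OF x0] in \<open>auto simp: bounded_linear_Blinfun_apply linear_conv_bounded_linear fun_eq_iff\<close>)
 obtain U' V g g' where U': "open U'" "U' \<subseteq> U" "x0 \<in> U'" "open V" "f x0 \<in> V" and h: "homeomorphism U' V f g"
  and g: "!!y. y \<in> V ==> (g has_derivative (g' y)) (at y)"
  and g': "!!y. y \<in> V ==> g' y = inv (blinfun_apply (f' (g y)))" "!!y. y \<in> V ==> bij (blinfun_apply (f' (g y)))"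
  by (rule inverse_function_theorem[OF U fd c x0 Bi], assumption, rule that)
 have gU: "g y \<in> U'" if "y \<in> V" for y using h that by (auto simp: homeomorphism_def)
 \<comment> \<open>The part of \<open>U'\<close> where the derivative is invertible; on it the
   quotients in Cramer's rule are smooth.\<close>
 define R where "R = {x \<in> U'. gram bas (%i. FD f x (bas i)) ~= 0}"
 have sm: "smo U' (%x. gram bas (%i. FD f x (bas i)))"
  by (rule sm_gram[OF U'(1)]) (rule sm_subset[OF sm_FD[OF f] U'(2)])
 have R: "open R"
  unfolding R_def using continuous_open_preimage[OF sm_cont[OF sm] U'(1), of "- {0}"]
  by (auto simp: vimage_def Int_def)
 define M where "M v x = (\<Sum>i<DIM('e). (gram bas (%j. if j = i then v else FD f x (bas j)) / gram bas (%i. FD f x (bas i))) *\<^sub>R (bas i :: 'e))" for v x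
 have M: "smo R (M v)" for v
  unfolding M_def
 proof (intro sm_sum sm_scaleR sm_divide sm_const sm_gram R)
  have *: "smo R (%x. FD f x w)" for w
   by (rule sm_subset[OF sm_FD[OF f]]) (use U'(2) in \<open>auto simp: R_def\<close>)
  show "smo R (%x. if j = i then v else FD f x (bas j))" for i j
   using * sm_const[OF R] by (cases "j = i") auto
  show "smo R (%x. FD f x (bas i))" for i by (rule *)
 qed (simp add: R_def)
 have key: "g y \<in> R" "g' y v = M v (g y)" if y: "y \<in> V" for y v
 proof -
  have gy: "g y \<in> U" using gU[OF y] U'(2) by blast
  have b: "bij (FD f (g y))" using g'(2)[OF y] f'[OF gy] by simp
  have l: "linear (FD f (g y))" by (rule sm_linear_FD[OF f gy])
  have i: "inj (FD f (g y))" using b by (simp add: bij_def)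
  show "g y \<in> R" using gram_image_nonzero[OF l i] gU[OF y] by (simp add: R_def)
  have "FD f (g y) (g' y v) = v" using g'(1)[OF y] f'[OF gy] b by (simp add: surj_f_inv_f bij_is_surj)
  then have "g' y v = (\<Sum>i<DIM('e). (gram bas ((%j. FD f (g y) (bas j))(i := v)) / gram bas (%i. FD f (g y) (bas i))) *\<^sub>R bas i)"
   using cramer[OF l i, of "g' y v"] by simp
  then show "g' y v = M v (g y)" by (simp add: M_def fun_upd_def)
 qed
 have "Ck_on k V g" for k
 proof (induction k)
  case 0
  show ?case using h by (simp add: homeomorphism_def)
 next
  case (Suc k)
  show ?case
  proof (rule Ck_on_Suc_I[OF U'(4) g])
   fix v
   have "Ck_on k V (%y. M v (g y))"
    by (rule Ck_on_compose[OF U'(4) R Suc.IH]) (use M key in \<open>auto simp: smooth_on_def\<close>)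
   then show "Ck_on k V (%y. g' y v)" by (subst Ck_on_cong[OF U'(4) key(2)])
  qed
 qed
 then have "smo V g" by (simp add: smooth_on_def)
 with U' h show thesis using that by blast
qed

section \<open>Integrals along lines: the Poincare lemma and Hadamard's lemma\<close>

text \<open>\<open>A t y\<close> moves from \<open>A 0 y\<close> to \<open>y\<close> in the
  direction of \<open>P (y - y0)\<close>. With the identity for \<open>P\<close> it is the radial
  contraction of the Poincare lemma, with the projection to a line it is the contraction to a
  hyperplane in Hadamard's lemma. The weight \<open>c\<close> serves the induction on the order:
  differentiation in \<open>y\<close> produces a factor \<open>1 - t\<close>, which joins
  it.\<close>

lemma line_integral_smooth:
 fixes m :: "'e::euclidean_space => real" and P :: "'e => 'e" and y0 :: 'e
 defines "A \<equiv> %t y. y0 + ((y - y0) - (1 - t) *\<^sub>R P (y - y0))"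
 assumes S: "open S" "convex S" and P: "bounded_linear P"
  and A: "!!t y. t \<in> {0..1} ==> y \<in> S ==> A t y \<in> S"
  and m: "smo S m" and c: "continuous_on {0..1} c"
 shows "!!y. y \<in> S ==> ((%y. integral {0..1} (%t. c t * m (A t y))) has_derivative
    (%v. integral {0..1} (%t. c t * FD m (A t y) (v - (1 - t) *\<^sub>R P v)))) (at y)"
  and "smo S (%y. integral {0..1} (%t. c t * m (A t y)))"
proof -
 have cA: "continuous_on (S \<times> {0..1}) (%(y, t). A t y)"
  unfolding A_def split_beta
  by (intro continuous_intros bounded_linear.continuous_on[OF P])
 have cont: "continuous_on (S \<times> {0..1}) (%(y, t). c t * m (A t y))"
  if "smo S m" "continuous_on {0..1} c" for m c :: "_ => real"
 proof -
  have a: "continuous_on (S \<times> {0..1}) (%z. m (case z of (y, t) => A t y))"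
   by (rule continuous_on_compose2[OF sm_cont[OF that(1)] cA]) (use A in auto)
  have b: "continuous_on (S \<times> {0..1}) (%z. c (snd z))"
   by (rule continuous_on_compose2[OF that(2) continuous_on_snd[OF continuous_on_id]]) auto
  from continuous_on_mult[OF b a] show ?thesis by (simp add: split_beta)
 qed
 have int: "(%t. c t * m (A t y)) integrable_on {0..1}"
  if "smo S m" "continuous_on {0..1} c" "y \<in> S" for m c :: "_ => real" and y
 proof (rule integrable_continuous_real)
  have "continuous_on {0..1} (%t. (%(y, t). c t * m (A t y)) (y, t))"
   by (rule continuous_on_compose2[OF cont[OF that(1,2)]]) (use that(3) in \<open>auto intro!: continuous_intros\<close>)
  then show "continuous_on {0..1} (%t. c t * m (A t y))" by simp
 qed
 have der: "((%y. integral {0..1} (%t. c t * m (A t y))) has_derivative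
    (%v. integral {0..1} (%t. c t * FD m (A t y) (v - (1 - t) *\<^sub>R P v)))) (at y)"
  if m: "smo S m" and c: "continuous_on {0..1} c" and y: "y \<in> S" for m c :: "_ => real" and y
 proof -
  define D where "D y t v = c t * FD m (A t y) (v - (1 - t) *\<^sub>R P v)" for y t v
  have lin: "linear (FD m (A t y))" if "t \<in> {0..1}" "y \<in> S" for t y
   by (rule sm_linear_FD[OF m A[OF that]])
  have bl: "bounded_linear (D y t)" if "t \<in> {0..1}" "y \<in> S" for t y
  proof -
   have l: "linear (%v. v - (1 - t) *\<^sub>R P v)"
    using bounded_linear.linear[OF P] by (simp add: linear_iff algebra_simps)
   have "linear (D y t)" unfolding D_def
    by (rule linear_mult_right[OF linear_compose[OF l lin[OF that], unfolded o_def]])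
   then show ?thesis by (simp add: linear_conv_bounded_linear)
  qed
  have ap: "blinfun_apply (Blinfun (D y t)) = D y t" if "t \<in> {0..1}" "y \<in> S" for t y
   using bl[OF that] by (simp add: bounded_linear_Blinfun_apply)
  have dA: "((%y. c t * m (A t y)) has_derivative D y t) (at y)" if "t \<in> {0..1}" "y \<in> S" for t y
  proof -
   have "(A t has_derivative (%v. v - (1 - t) *\<^sub>R P v)) (at y)"
    unfolding A_def by (auto intro!: derivative_eq_intros bounded_linear.has_derivative[OF P])
   from has_derivative_compose[OF this sm_has_derivative[OF m A[OF that]]]
   show ?thesis unfolding D_def by (rule has_derivative_mult_right)
  qed
  have c1: "continuous_on {0..1} (%t. c t * (1 - t))" by (intro continuous_intros c)
  have cD: "continuous_on (S \<times> {0..1}) (%z. Blinfun (D (fst z) (snd z)))"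
  proof (rule continuous_on_blinfun_componentwise)
   fix i :: 'e
   have "continuous_on (S \<times> {0..1}) (%z. (%(y, t). c t * FD m (A t y) i) z - (%(y, t). (c t * (1 - t)) * FD m (A t y) (P i)) z)"
    by (intro continuous_on_diff cont sm_FD m c c1)
   moreover have "blinfun_apply (Blinfun (D (fst z) (snd z))) i =
    (%(y, t). c t * FD m (A t y) i) z - (%(y, t). (c t * (1 - t)) * FD m (A t y) (P i)) z"
    if zz: "z \<in> S \<times> {0..1}" for z
   proof -
    obtain y t where z: "z = (y, t)" "y \<in> S" "t \<in> {0..1}" using zz by (cases z) auto
    note l = lin[OF z(3,2)]
    have "D y t i = c t * FD m (A t y) i - (c t * (1 - t)) * FD m (A t y) (P i)"
    unfolding D_def linear_diff[OF l] linear_scale[OF l] real_scaleR_def by algebra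
    then show ?thesis using ap[OF z(3,2)] by (simp add: z(1))
   qed
   ultimately show "continuous_on (S \<times> {0..1}) (%z. blinfun_apply (Blinfun (D (fst z) (snd z))) i)"
    by (simp cong: continuous_on_cong)
  qed
  have "((%y. integral (cbox 0 1) (%t. c t * m (A t y))) has_derivative integral (cbox 0 1) (%t. Blinfun (D y t))) (at y within S)"
  proof (rule leibniz_rule)
   show "((%y. c t * m (A t y)) has_derivative blinfun_apply (Blinfun (D y t))) (at y within S)"
    if "y \<in> S" "t \<in> cbox 0 1" for y t
    using dA[of t y] ap[of t y] that has_derivative_at_withinI by fastforce
   show "continuous_on (S \<times> cbox 0 1) (%(y, t). Blinfun (D y t))" using cD by (simp add: split_beta)
  qed (use int[OF m c] y S in auto)
  moreover have "blinfun_apply (integral (cbox 0 1) (%t. Blinfun (D y t))) = (%v. integral {0..1} (%t. D y t v))"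
  proof
   fix v
   have "continuous_on {0..1} (%t. Blinfun (D (fst (y, t)) (snd (y, t))))"
    by (rule continuous_on_compose2[OF cD, of _ "%t. (y, t)"]) (use y in \<open>auto intro!: continuous_on_Pair\<close>)
   then have "continuous_on {0..1} (%t. Blinfun (D y t))" by simp
   then have "(%t. Blinfun (D y t)) integrable_on {0..1}" by (rule integrable_continuous_real)
   from blinfun_apply_integral[OF this, of v]
   have "blinfun_apply (integral {0..1} (%t. Blinfun (D y t))) v = integral {0..1} (%t. blinfun_apply (Blinfun (D y t)) v)" .
   also have "... = integral {0..1} (%t. D y t v)" by (rule integral_cong) (use ap y in auto)
   finally show "blinfun_apply (integral (cbox 0 1) (%t. Blinfun (D y t))) v = integral {0..1} (%t. D y t v)" by simp
  qed
  ultimately show ?thesis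
   using y S at_within_open[of y S] by (simp add: D_def)
 qed
 show "!!y. y \<in> S ==> ((%y. integral {0..1} (%t. c t * m (A t y))) has_derivative
    (%v. integral {0..1} (%t. c t * FD m (A t y) (v - (1 - t) *\<^sub>R P v)))) (at y)"
  by (rule der[OF m c])
 have "Ck_on k S (%y. integral {0..1} (%t. c t * m (A t y)))" if "smo S m" "continuous_on {0..1} c" for k and m c :: "_ => real"
  using that
 proof (induction k arbitrary: m c)
  case 0
  have "continuous_on S (%y. integral (cbox 0 1) (%t. c t * m (A t y)))"
   by (rule integral_continuous_on_param) (use cont[OF 0] in simp)
  then show ?case by simp
 next
  case (Suc k)
  show ?case
  proof (rule Ck_on_Suc_I[OF S(1) der[OF Suc.prems]])
   fix v
   have c1: "continuous_on {0..1} (%t. c t * (1 - t))" by (intro continuous_intros Suc.prems)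
   have main: "Ck_on k S (%y. integral {0..1} (%t. c t * FD m (A t y) v) + (-1) * integral {0..1} (%t. (c t * (1 - t)) * FD m (A t y) (P v)))"
    by (intro Ck_on_add bounded_bilinear.Ck_on[OF bounded_bilinear_mult] Ck_on_const Suc.IH S sm_FD Suc.prems c1)
   have eq: "integral {0..1} (%t. c t * FD m (A t y) v) + (-1) * integral {0..1} (%t. (c t * (1 - t)) * FD m (A t y) (P v))
    = integral {0..1} (%t. c t * FD m (A t y) (v - (1 - t) *\<^sub>R P v))" if y: "y \<in> S" for y
   proof -
    have "integral {0..1} (%t. c t * FD m (A t y) (v - (1 - t) *\<^sub>R P v)) =
    integral {0..1} (%t. c t * FD m (A t y) v - (c t * (1 - t)) * FD m (A t y) (P v))"
    proof (rule integral_cong)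
    fix t :: real assume "t \<in> {0..1}"
    note l = sm_linear_FD[OF Suc.prems(1) A[OF this y]]
    show "c t * FD m (A t y) (v - (1 - t) *\<^sub>R P v) = c t * FD m (A t y) v - (c t * (1 - t)) * FD m (A t y) (P v)"
    unfolding linear_diff[OF l] linear_scale[OF l] real_scaleR_def by algebra
    qed
    also have "... = integral {0..1} (%t. c t * FD m (A t y) v) - integral {0..1} (%t. (c t * (1 - t)) * FD m (A t y) (P v))"
    by (rule integral_diff) (intro int sm_FD Suc.prems c1 y)+
    finally show ?thesis by simp
   qed
   show "Ck_on k S (%y. integral {0..1} (%t. c t * FD m (A t y) (v - (1 - t) *\<^sub>R P v)))"
    by (rule iffD1[OF Ck_on_cong[OF S(1) eq] main])
  qed
 qed
 then show "smo S (%y. integral {0..1} (%t. c t * m (A t y)))"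
  using m c by (simp add: smooth_on_def)
qed

text \<open>\<open>phi y\<close> integrates \<open>theta\<close> along the segment from
  \<open>y0\<close> to \<open>y\<close>. By closedness the integrand of its derivative in the
  direction \<open>v\<close> is the derivative of \<open>t * theta (A t y) v\<close> with respect to
  \<open>t\<close>.\<close>

lemma poincare_one_form:
 fixes theta :: "'e::euclidean_space => 'e => real"
 assumes S: "open S" "convex S" and y0: "y0 \<in> S"
  and lin: "!!y. y \<in> S ==> linear (theta y)" and sm: "!!v. smo S (%y. theta y v)"
  and cl: "!!y u v. y \<in> S ==> FD (%y. theta y v) y u = FD (%y. theta y u) y v"
 obtains phi where "smo S phi" "!!y. y \<in> S ==> (phi has_derivative theta y) (at y)"
proof -
 define A where "A t y = y0 + ((y - y0) - (1 - t) *\<^sub>R (y - y0))" for t :: real and y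
 have A_alt: "A t y = (1 - t) *\<^sub>R y0 + t *\<^sub>R y" for t y unfolding A_def by (simp add: algebra_simps)
 have AS: "A t y \<in> S" if "t \<in> {0..1}" "y \<in> S" for t y
  unfolding A_alt using that S(2) y0 by (simp add: convex_alt)
 define k where "k b y = integral {0..1} (%t. 1 * theta (A t y) b)" for b y
 note L = line_integral_smooth[OF S bounded_linear_ident AS[unfolded A_def] sm, of "%_. 1", folded A_def]
 have dk: "(k b has_derivative (%v. integral {0..1} (%t. 1 * FD (%y. theta y b) (A t y) (v - (1 - t) *\<^sub>R v)))) (at y)"
  if "y \<in> S" for b y
  unfolding k_def by (rule L(1)) (use that in auto)
 have smk: "smo S (k b)" for b unfolding k_def by (rule L(2)) auto
 define phi where "phi y = (\<Sum>b\<in>Basis. ((y - y0) \<bullet> b) * k b y)" for y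
 have "(phi has_derivative theta y) (at y)" if y: "y \<in> S" for y
 proof -
  let ?z = "y - y0"
  have "(phi has_derivative (%v. \<Sum>b\<in>Basis. (?z \<bullet> b) * integral {0..1} (%t. 1 * FD (%y. theta y b) (A t y) (v - (1 - t) *\<^sub>R v)) + (v \<bullet> b) * k b y)) (at y)"
   unfolding phi_def by (intro has_derivative_sum has_derivative_mult dk[OF y]) (auto intro!: derivative_eq_intros)
  moreover have "(\<Sum>b\<in>Basis. (?z \<bullet> b) * integral {0..1} (%t. 1 * FD (%y. theta y b) (A t y) (v - (1 - t) *\<^sub>R v)) + (v \<bullet> b) * k b y) = theta y v" for v
  proof -
   have cA: "continuous_on {0..1} (%t. A t y)" unfolding A_alt by (intro continuous_intros)
   have i1: "(%t. FD (%y. theta y b) (A t y) (t *\<^sub>R v)) integrable_on {0..1}" for b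
   proof (rule integrable_continuous_real)
    have "continuous_on {0..1} (%t. t * FD (%y. theta y b) (A t y) v)"
    by (intro continuous_intros continuous_on_compose2[OF sm_cont[OF sm_FD[OF sm]] cA]) (use AS y in auto)
    moreover have "FD (%y. theta y b) (A t y) (t *\<^sub>R v) = t * FD (%y. theta y b) (A t y) v" if "t \<in> {0..1}" for t
    using linear_scale[OF sm_linear_FD[OF sm AS[OF that y]]] by simp
    ultimately show "continuous_on {0..1} (%t. FD (%y. theta y b) (A t y) (t *\<^sub>R v))"
    by (subst continuous_on_cong[OF refl])
   qed
   have i2: "(%t. theta (A t y) b) integrable_on {0..1}" for b
    by (intro integrable_continuous_real continuous_on_compose2[OF sm_cont[OF sm] cA]) (use AS y in auto)
   have e: "v - (1 - t) *\<^sub>R v = t *\<^sub>R v" for t by (simp add: algebra_simps)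
   have "(\<Sum>b\<in>Basis. (?z \<bullet> b) * integral {0..1} (%t. 1 * FD (%y. theta y b) (A t y) (v - (1 - t) *\<^sub>R v)) + (v \<bullet> b) * k b y)
    = (\<Sum>b\<in>Basis. integral {0..1} (%t. (?z \<bullet> b) * FD (%y. theta y b) (A t y) (t *\<^sub>R v) + (v \<bullet> b) * theta (A t y) b))"
    unfolding k_def e by (intro sum.cong refl) (simp add: integral_add i1 i2 integrable_on_mult_right)
   also have "... = integral {0..1} (%t. \<Sum>b\<in>Basis. (?z \<bullet> b) * FD (%y. theta y b) (A t y) (t *\<^sub>R v) + (v \<bullet> b) * theta (A t y) b)"
    by (intro integral_sum[symmetric] integrable_add integrable_on_mult_right i1 i2) auto
   also have "... = integral {0..1} (%t. FD (%y. theta y v) (A t y) (t *\<^sub>R ?z) + theta (A t y) v)"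
   proof (rule integral_cong)
    fix t :: real assume t: "t \<in> {0..1}"
    note a = AS[OF t y]
    have "(\<Sum>b\<in>Basis. (?z \<bullet> b) * FD (%y. theta y b) (A t y) (t *\<^sub>R v)) = t * (\<Sum>b\<in>Basis. (?z \<bullet> b) *\<^sub>R FD (%y. theta y v) (A t y) b)"
    using sm_linear_FD[OF sm a] cl[OF a, of _ v] by (simp add: linear_scale sum_distrib_left mult.left_commute)
    also have "... = FD (%y. theta y v) (A t y) (t *\<^sub>R ?z)"
    using linear_basis_expand[OF sm_linear_FD[OF sm a], of v ?z] linear_scale[OF sm_linear_FD[OF sm a], of v t ?z] by simp
    finally show "(\<Sum>b\<in>Basis. (?z \<bullet> b) * FD (%y. theta y b) (A t y) (t *\<^sub>R v) + (v \<bullet> b) * theta (A t y) b)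
    = FD (%y. theta y v) (A t y) (t *\<^sub>R ?z) + theta (A t y) v"
    using linear_basis_expand[OF lin[OF a], of v] by (simp add: sum.distrib)
   qed
   also have "... = theta y v"
   proof (rule integral_unique)
    have d: "((%t. t * theta (A t y) v) has_vector_derivative (FD (%y. theta y v) (A t y) (t *\<^sub>R ?z) + theta (A t y) v)) (at t within {0..1})"
    if t: "t \<in> {0..1}" for t
    proof -
    have "((%t. A t y) has_derivative (%s. s *\<^sub>R ?z)) (at t within {0..1})"
    unfolding A_alt by (auto intro!: derivative_eq_intros simp: algebra_simps)
    from has_derivative_compose[OF this sm_has_derivative[OF sm AS[OF t y]]]
    have "((%t. theta (A t y) v) has_derivative (%s. FD (%y. theta y v) (A t y) (s *\<^sub>R ?z))) (at t within {0..1})" .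
    from has_derivative_mult[OF has_derivative_ident this]
    have d: "((%t. t * theta (A t y) v) has_derivative (%h. t * FD (%y. theta y v) (A t y) (h *\<^sub>R ?z) + h * theta (A t y) v)) (at t within {0..1})" .
    have s: "FD (%y. theta y v) (A t y) (h *\<^sub>R ?z) = h * FD (%y. theta y v) (A t y) ?z" for h
    using linear_scale[OF sm_linear_FD[OF sm AS[OF t y]], of v h ?z] by simp
    have "(%h. t * FD (%y. theta y v) (A t y) (h *\<^sub>R ?z) + h * theta (A t y) v) =
    (%h. h *\<^sub>R (FD (%y. theta y v) (A t y) (t *\<^sub>R ?z) + theta (A t y) v))"
    unfolding s real_scaleR_def by (rule ext) algebra
    with d show ?thesis unfolding has_vector_derivative_def by simp
    qed
    have "((%t. FD (%y. theta y v) (A t y) (t *\<^sub>R ?z) + theta (A t y) v) has_integral (1 * theta (A 1 y) v - 0 * theta (A 0 y) v)) {0..1}"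
    by (rule fundamental_theorem_of_calculus) (auto intro: d)
    then show "((%t. FD (%y. theta y v) (A t y) (t *\<^sub>R ?z) + theta (A t y) v) has_integral theta y v) {0..1}" by (simp add: A_alt)
   qed
   finally show ?thesis .
  qed
  ultimately show ?thesis by simp
 qed
 then have d: "!!y. y \<in> S ==> (phi has_derivative theta y) (at y)" .
 show thesis by (rule that[OF sm_I[OF S(1) d sm] d])
qed

text \<open>After a change of coordinates that makes \<open>F\<close> a linear coordinate,
  \<open>N\<close> vanishes on a hyperplane, and the fundamental theorem of calculus along the
  normal direction divides it by that coordinate.\<close>

lemma hadamard:
 fixes F N :: "'e::euclidean_space => real"
 assumes S: "open S" "x0 \<in> S" and F: "smo S F" and N: "smo S N"
  and z: "F x0 = 0" "FD F x0 e0 ~= 0" and v: "!!x. x \<in> S ==> F x = 0 ==> N x = 0"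
 obtains T q where "open T" "x0 \<in> T" "T \<subseteq> S" "smo T q" "!!x. x \<in> T ==> N x = F x * q x"
proof -
 have linF: "linear (FD F x0)" by (rule sm_linear_FD[OF F S(2)])
 have "\<exists>e\<in>Basis. FD F x0 e ~= 0"
  using linear_basis_expand[OF linF, of e0] z(2) by (metis (no_types, lifting) scale_zero_right sum.neutral)
 then obtain e where e: "e \<in> Basis" "FD F x0 e ~= 0" by blast
 have ee: "e \<bullet> e = 1" using e(1) by (simp add: inner_same_Basis)
 \<comment> \<open>\<open>f\<close> replaces the coordinate along \<open>e\<close> by
   \<open>F\<close>. Since \<open>F\<close> has a nonzero derivative along \<open>e\<close>, this is
   a local diffeomorphism.\<close>
 define f where "f x = x + (F x - x \<bullet> e) *\<^sub>R e" for x
 have smf: "smo S f" unfolding f_def by (intro smooth S(1) F)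
 have fe: "f x \<bullet> e = F x" for x by (simp add: f_def inner_add_left ee)
 have df: "FD f x0 = (%h. h + (FD F x0 h - h \<bullet> e) *\<^sub>R e)"
  by (rule FD_eqI) (unfold f_def, auto intro!: derivative_eq_intros sm_has_derivative[OF F S(2)])
 have "inj (FD f x0)"
  unfolding linear_injective_0[OF sm_linear_FD[OF smf S(2)]]
 proof (intro allI impI)
  fix h assume "FD f x0 h = 0"
  then have h: "h = (h \<bullet> e - FD F x0 h) *\<^sub>R e" unfolding df by (simp add: algebra_simps add_eq_0_iff)
  then obtain c where c: "h = c *\<^sub>R e" by blast
  have "h \<bullet> e = h \<bullet> e - FD F x0 h" using arg_cong[OF h, of "%z. z \<bullet> e"] ee by simp
  then have "c * FD F x0 e = 0" using c linear_scale[OF linF, of c e] by simp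
  then show "h = 0" using e(2) c by simp
 qed
 from smooth_inverse_function[OF S(1) smf S(2) this] obtain U V g where
  U: "open U" "U \<subseteq> S" "x0 \<in> U" "open V" "f x0 \<in> V" "homeomorphism U V f g" "smo V g" by metis
 obtain r where r: "r > 0" "ball (f x0) r \<subseteq> V" using U(4,5) open_contains_ball by blast
 define B where "B = ball (f x0) r"
 have B: "open B" "convex B" "f x0 \<in> B" using r(1) by (auto simp: B_def)
 define P where "P y = (y \<bullet> e) *\<^sub>R e" for y
 have blP: "bounded_linear P" unfolding P_def by (rule bounded_linear_scaleR_const[OF bounded_linear_inner_left])
 let ?y0 = "f x0"
 define A where "A t y = ?y0 + ((y - ?y0) - (1 - t) *\<^sub>R P (y - ?y0))" for t :: real and y
 have y0e: "?y0 \<bullet> e = 0" using fe z(1) by simp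
 have P': "P (y - ?y0) = (y \<bullet> e) *\<^sub>R e" for y using y0e by (simp add: P_def inner_diff_left)
 \<comment> \<open>The centre \<open>f x0\<close> lies on the hyperplane, so orthogonal projection
   to the hyperplane does not leave the ball; convexity gives the points in between.\<close>
 have AB: "A t y \<in> B" if "t \<in> {0..1}" "y \<in> B" for t y
 proof -
  have "?y0 + ((y - ?y0) - P (y - ?y0)) \<in> B"
  proof -
   have o: "orthogonal ((y - ?y0) - P (y - ?y0)) (P (y - ?y0))"
    unfolding orthogonal_def P_def by (simp add: inner_diff_left inner_diff_right ee algebra_simps)
   have "norm ((y - ?y0) - P (y - ?y0)) <= norm (y - ?y0)"
   proof -
    have "norm (((y - ?y0) - P (y - ?y0)) + P (y - ?y0)) ^ 2 = norm ((y - ?y0) - P (y - ?y0)) ^ 2 + norm (P (y - ?y0)) ^ 2"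
    by (rule norm_add_Pythagorean[OF o])
    then have "norm ((y - ?y0) - P (y - ?y0)) ^ 2 <= norm (y - ?y0) ^ 2" by simp
    then show ?thesis by (rule power2_le_imp_le) simp
   qed
   moreover have d: "dist ?y0 (?y0 + w) = norm w" for w by (simp add: dist_norm)
   moreover have "norm (y - ?y0) < r" using that(2) by (simp add: B_def dist_norm norm_minus_commute)
   ultimately show ?thesis unfolding B_def mem_ball d by linarith
  qed
  moreover have "A t y = (1 - t) *\<^sub>R (?y0 + ((y - ?y0) - P (y - ?y0))) + t *\<^sub>R y"
   unfolding A_def by (simp add: algebra_simps)
  ultimately show ?thesis using B(2) that by (simp add: convex_alt)
 qed
 define M where "M y = N (g y)" for y
 have gV: "g ` V = U" using U(6) by (simp add: homeomorphism_def)
 have gS: "g y \<in> S" if "y \<in> B" for y using U(2) gV r(2) that unfolding B_def by blast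
 have fg: "f (g y) = y" if "y \<in> B" for y using U(6) r(2) that by (auto simp: homeomorphism_def B_def)
 have M: "smo B M"
  unfolding M_def using sm_compose[OF B(1) S(1) N sm_subset[OF U(7)]] r(2) gS by (auto simp: B_def)
 define q where "q y = integral {0..1} (%t. 1 * FD M (A t y) e)" for y
 have q: "smo B q"
  unfolding q_def A_def
  by (rule line_integral_smooth(2)[OF B(1,2) blP AB[unfolded A_def] sm_FD[OF M]]) auto
 have Mq: "M y = (y \<bullet> e) * q y" if y: "y \<in> B" for y
 proof -
  have d: "((%t. M (A t y)) has_vector_derivative ((y \<bullet> e) * FD M (A t y) e)) (at t within {0..1})" if t: "t \<in> {0..1}" for t
  proof -
   have "((%t. A t y) has_derivative (%s. s *\<^sub>R (y \<bullet> e) *\<^sub>R e)) (at t within {0..1})"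
    unfolding A_def P' by (auto intro!: derivative_eq_intros simp: algebra_simps)
   from has_derivative_compose[OF this sm_has_derivative[OF M AB[OF t y]]]
   show ?thesis unfolding has_vector_derivative_def
    using linear_scale[OF sm_linear_FD[OF M AB[OF t y]]] by (simp add: mult.assoc)
  qed
  have "((%t. (y \<bullet> e) * FD M (A t y) e) has_integral (M (A 1 y) - M (A 0 y))) {0..1}"
   by (rule fundamental_theorem_of_calculus) (auto intro: d)
  moreover have "A 1 y = y" by (simp add: A_def)
  moreover have "M (A 0 y) = 0"
  proof -
   have a: "A 0 y \<in> B" using AB[of 0 y] y by simp
   have "F (g (A 0 y)) = A 0 y \<bullet> e" using fe[of "g (A 0 y)"] fg[OF a] by simp
   also have "... = 0" unfolding A_def P' using y0e ee by (simp add: inner_diff_left)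
   finally show ?thesis unfolding M_def by (rule v[OF gS[OF a]])
  qed
  ultimately have "((%t. (y \<bullet> e) * FD M (A t y) e) has_integral M y) {0..1}" by simp
  then have "integral {0..1} (%t. (y \<bullet> e) * FD M (A t y) e) = M y" by (rule integral_unique)
  then show ?thesis by (simp add: q_def)
 qed
 define T where "T = U \<inter> f -` B"
 have "open T" unfolding T_def
  by (rule continuous_open_preimage[OF continuous_on_subset[OF sm_cont[OF smf] U(2)] U(1) B(1)])
 moreover have "x0 \<in> T" "T \<subseteq> S" using U(2,3) B(3) by (auto simp: T_def)
 moreover have "smo T (%x. q (f x))"
  by (rule sm_compose[OF \<open>open T\<close> B(1) q sm_subset[OF smf]]) (use U(2) in \<open>auto simp: T_def\<close>)
 moreover have "N x = F x * q (f x)" if "x \<in> T" for x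
 proof -
  have "g (f x) = x" using that U(6) by (auto simp: T_def homeomorphism_def)
  then show ?thesis using Mq[of "f x"] fe[of x] that by (simp add: M_def T_def)
 qed
 ultimately show thesis using that by blast
qed

lemma sm_eq:
 assumes "open S" "smo S f" "!!x. x \<in> S ==> g x = f x" shows "smo S g"
 using assms(2) sm_cong[of S g f, OF assms(1,3)] by simp

section \<open>Charts and smooth functions\<close>

definition cset :: "('a, 'e) chart => 'a set => 'e set" where
 "cset c W = {x \<in> cimg c. pt c x \<in> W}"

locale smooth_mfd =
 fixes M :: "('a, 'e::euclidean_space) manifold"
 assumes smooth_manifold: "smooth_manifold M"
begin

lemma hausdorff: "Hausdorff_space (mtop M)" using smooth_manifold by (simp add: smooth_manifold_def)

context
 fixes c assumes c: "c \<in> charts M"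
begin

lemma is_chart: "is_chart (mtop M) c" using smooth_manifold c by (simp add: smooth_manifold_def)

lemma open_dom: "opn M (dom_of c)" using is_chart by (simp add: is_chart_def)

lemma dom_subset: "dom_of c \<subseteq> points M" using openin_subset[OF open_dom] .

lemma open_coord: "open (cimg c)" using is_chart by (simp add: is_chart_def)

lemma chart_homeo: "homeomorphic_map (subtopology (mtop M) (dom_of c)) (top_of_set (cimg c)) (snd c)"
 using is_chart by (simp add: is_chart_def)

lemma inj_on_chart: "inj_on (snd c) (dom_of c)"
 using homeomorphic_imp_injective_map[OF chart_homeo] dom_subset by (simp add: inf.absorb2)

lemma pt_chart [simp]: "p \<in> dom_of c ==> pt c (snd c p) = p"
 using inj_on_chart by simp

lemma chart_point_of [simp]: "x \<in> cimg c ==> snd c (pt c x) = x"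
 by (rule f_inv_into_f)

lemma pt_dom [simp]: "x \<in> cimg c ==> pt c x \<in> dom_of c"
 by (rule inv_into_into)

lemma pt_points: "x \<in> cimg c ==> pt c x \<in> points M"
 using pt_dom dom_subset by blast

lemma cset_eq: "cset c W = snd c ` (W \<inter> dom_of c)"
proof (intro equalityI subsetI)
 fix x assume "x \<in> cset c W"
 then have "pt c x \<in> W \<inter> dom_of c" "x = snd c (pt c x)" by (auto simp: cset_def)
 then show "x \<in> snd c ` (W \<inter> dom_of c)" by blast
qed (auto simp: cset_def)

lemma open_cset: assumes "opn M W" shows "open (cset c W)"
proof -
 have "open_map (subtopology (mtop M) (dom_of c)) (top_of_set (cimg c)) (snd c)"
  by (rule homeomorphic_imp_open_map[OF chart_homeo])
 moreover have "openin (subtopology (mtop M) (dom_of c)) (dom_of c \<inter> W)"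
  by (rule openin_subtopology_Int2[OF assms])
 ultimately have "openin (top_of_set (cimg c)) (snd c ` (dom_of c \<inter> W))" unfolding open_map_def by blast
 then show ?thesis using open_coord by (simp add: cset_eq Int_commute openin_open_eq)
qed

lemma openin_chart_preimage: assumes "open V" shows "opn M {p \<in> dom_of c. snd c p \<in> V}"
proof -
 have "continuous_map (subtopology (mtop M) (dom_of c)) (top_of_set (cimg c)) (snd c)"
  by (rule homeomorphic_imp_continuous_map[OF chart_homeo])
 then have "openin (subtopology (mtop M) (dom_of c)) {p \<in> topspace (subtopology (mtop M) (dom_of c)). snd c p \<in> cimg c \<inter> V}"
  using assms by (intro openin_continuous_map_preimage) (auto simp: openin_open)
 then have "opn M {p \<in> topspace (subtopology (mtop M) (dom_of c)). snd c p \<in> cimg c \<inter> V}"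
  using openin_open_subtopology[OF open_dom] by blast
 moreover have "{p \<in> topspace (subtopology (mtop M) (dom_of c)). snd c p \<in> cimg c \<inter> V} = {p \<in> dom_of c. snd c p \<in> V}"
  using dom_subset by auto
 ultimately show ?thesis by simp
qed

lemma continuous_point_of: "continuous_map (top_of_set (cimg c)) (mtop M) (pt c)"
 unfolding continuous_map
proof (intro conjI allI impI)
 show "pt c ` topspace (top_of_set (cimg c)) \<subseteq> points M"
  using pt_points by auto
 fix U assume U: "opn M U"
 have "{x \<in> topspace (top_of_set (cimg c)). pt c x \<in> U} = cset c U" by (auto simp: cset_def)
 then show "openin (top_of_set (cimg c)) {x \<in> topspace (top_of_set (cimg c)). pt c x \<in> U}"
  using open_cset[OF U] open_coord by (auto simp: openin_open_eq cset_def)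
qed

end

lemma cset_subset: "cset c W \<subseteq> cimg c" by (auto simp: cset_def)

lemma ex_chart: "p \<in> points M ==> \<exists>c\<in>charts M. p \<in> dom_of c"
proof -
 have "\<Union> (dom_of ` charts M) = points M" using smooth_manifold by (simp add: smooth_manifold_def)
 then show "p \<in> points M ==> ?thesis" by blast
qed

lemma overlap_eq: "c \<in> charts M ==> overlap c d = cset c (dom_of d)"
 by (simp add: overlap_def cset_eq Int_commute)

lemma open_ov: "c \<in> charts M ==> d \<in> charts M ==> open (overlap c d)"
 by (simp add: overlap_eq open_cset open_dom)

lemma sm_trn: "c \<in> charts M ==> d \<in> charts M ==> smo (overlap c d) (trn c d)"
 using smooth_manifold unfolding smooth_manifold_def compatible_def by blast

lemma trn_ov:
 assumes "c \<in> charts M" "d \<in> charts M" "x \<in> overlap c d"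
 shows "trn c d x \<in> overlap d c" "trn d c (trn c d x) = x"
  "pt d (trn c d x) = pt c x" "x \<in> cimg c" "trn c d x \<in> cimg d"
  "pt c x \<in> dom_of d"
proof -
 have x: "x \<in> cimg c" "pt c x \<in> dom_of d" using assms(3) unfolding overlap_eq[OF assms(1)] by (auto simp: cset_def)
 show p: "pt d (trn c d x) = pt c x" using x assms by (simp add: transition_def)
 show "trn d c (trn c d x) = x" using x assms p unfolding transition_def[of d] by simp
 show y: "trn c d x \<in> cimg d" using x by (simp add: transition_def)
 show "trn c d x \<in> overlap d c" unfolding overlap_eq[OF assms(2)] using x y p assms by (simp add: cset_def)
qed (use assms in \<open>auto simp: overlap_eq cset_def\<close>)

lemma transition_inverse_FD:
 assumes "c \<in> charts M" "d \<in> charts M" "x \<in> overlap c d"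
 shows "FD (trn d c) (trn c d x) (FD (trn c d) x v) = v"
proof -
 have "FD (%y. trn d c (trn c d y)) x v = FD (trn d c) (trn c d x) (FD (trn c d) x v)"
  by (rule FD_compose[OF sm_trn[OF assms(1,2)] sm_trn[OF assms(2,1)] assms(3) trn_ov(1)[OF assms]])
 moreover have "FD (%y. trn d c (trn c d y)) x = FD (%y. y) x"
  by (rule FD_cong[OF open_ov[OF assms(1,2)] assms(3)]) (rule trn_ov(2)[OF assms(1,2)])
 ultimately show ?thesis by simp
qed

section \<open>Smooth functions on open subsets of a manifold\<close>

definition sfun :: "'a set => ('a => real) => bool" where
 "sfun W f \<longleftrightarrow> (\<forall>c\<in>charts M. smo (cset c W) (%x. f (pt c x)))"

lemma sfunD: "sfun W f ==> c \<in> charts M ==> smo (cset c W) (%x. f (pt c x))"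
 by (simp add: sfun_def)

lemma cset_points: "c \<in> charts M ==> cset c (points M) = cimg c"
 using pt_points[of c] unfolding cset_def by blast

text \<open>One chart around each point suffices, since any other chart differs from it by a smooth
  transition.\<close>

lemma sfun_local:
 assumes "!!p. p \<in> W ==> \<exists>c\<in>charts M. \<exists>V. opn M V & p \<in> V & p \<in> dom_of c & smo (cset c V) (%x. f (pt c x))"
 shows "sfun W f"
 unfolding sfun_def
proof
 fix d assume d: "d \<in> charts M"
 show "smo (cset d W) (%x. f (pt d x))"
 proof (rule sm_local)
  fix x assume x: "x \<in> cset d W"
  then have xd: "x \<in> cimg d" "pt d x \<in> W" by (auto simp: cset_def)
  obtain c V where c: "c \<in> charts M" "opn M V" "pt d x \<in> V" "pt d x \<in> dom_of c"
   and s: "smo (cset c V) (%x. f (pt c x))" using assms[OF xd(2)] by blast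
  define T where "T = cset d (V \<inter> dom_of c)"
  have T: "open T" unfolding T_def by (intro open_cset d openin_Int c open_dom)
  have sub: "T \<subseteq> overlap d c" unfolding T_def overlap_eq[OF d] by (auto simp: cset_def)
  have 1: "smo T (%y. f (pt c (trn d c y)))"
  proof (rule sm_compose[OF T open_cset[OF c(1,2)] s])
   show "smo T (trn d c)" by (rule sm_subset[OF sm_trn[OF d c(1)] sub])
   fix y assume "y \<in> T"
   then show "trn d c y \<in> cset c V"
    using sub trn_ov[OF d c(1), of y] unfolding T_def by (auto simp: cset_def)
  qed
  have "f (pt d y) = f (pt c (trn d c y))" if "y \<in> T" for y
   using trn_ov(3)[OF d c(1), of y] sub that by auto
  with 1 have "smo T (%y. f (pt d y))" by (rule sm_eq[OF T])
  then show "\<exists>T. open T & x \<in> T & smo T (%y. f (pt d y))"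
   using T xd c by (auto simp: T_def cset_def)
 qed
qed

lemma sfun_subset:
 assumes "sfun W f" "V \<subseteq> W" shows "sfun V f"
 unfolding sfun_def
proof
 fix c assume "c \<in> charts M"
 moreover have "cset c V \<subseteq> cset c W" using assms(2) by (auto simp: cset_def)
 ultimately show "smo (cset c V) (%x. f (pt c x))" using sm_subset sfunD[OF assms(1)] by blast
qed

lemma sfun_const: "opn M W ==> sfun W (%_. k)"
 unfolding sfun_def using sm_const open_cset by blast

lemma sfun_add: "opn M W ==> sfun W f ==> sfun W g ==> sfun W (%p. f p + g p)"
 unfolding sfun_def using sm_add open_cset by blast

lemma sfun_mult: "opn M W ==> sfun W f ==> sfun W g ==> sfun W (%p. f p * g p)"
 unfolding sfun_def using sm_mult open_cset by blast

lemma sfun_diff: "opn M W ==> sfun W f ==> sfun W g ==> sfun W (%p. f p - g p)"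
 unfolding sfun_def using sm_diff open_cset by blast

lemma sfun_divide: "opn M W ==> sfun W f ==> sfun W g ==> (!!p. p \<in> W ==> g p ~= 0) ==> sfun W (%p. f p / g p)"
proof -
 assume a: "opn M W" "sfun W f" "sfun W g" "!!p. p \<in> W ==> g p ~= 0"
 show ?thesis unfolding sfun_def
 proof
  fix c assume c: "c \<in> charts M"
  show "smo (cset c W) (%x. f (pt c x) / g (pt c x))"
   by (rule sm_divide[OF open_cset[OF c a(1)] sfunD[OF a(2) c] sfunD[OF a(3) c]])
    (use a(4) in \<open>simp add: cset_def\<close>)
 qed
qed

lemma sfun_sum: "opn M W ==> (!!i. i \<in> I ==> sfun W (f i)) ==> sfun W (%p. \<Sum>i\<in>I. f i p)"
 by (induction I rule: infinite_finite_induct) (auto intro: sfun_const sfun_add)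

text \<open>Extension by zero from a chart: \<open>K\<close> is closed, so its complement is an open
  set on which \<open>f\<close> vanishes, and it contains all points outside
  \<open>W\<close>.\<close>

lemma sfun_extend:
 assumes c: "c \<in> charts M" and K: "closedin (mtop M) K" "K \<subseteq> W" "W \<subseteq> dom_of c" "opn M W"
  and s: "smo (cset c W) (%x. f (pt c x))" and z: "!!p. p \<in> points M ==> p \<notin> K ==> f p = 0"
 shows "sfun (points M) f"
proof (rule sfun_local)
 fix p assume p: "p \<in> points M"
 show "\<exists>c\<in>charts M. \<exists>V. opn M V & p \<in> V & p \<in> dom_of c & smo (cset c V) (%x. f (pt c x))"
 proof (cases "p \<in> W")
  case True then show ?thesis using c K s by blast
 next
  case False
  obtain d where d: "d \<in> charts M" "p \<in> dom_of d" using ex_chart[OF p] by blast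
  let ?V = "points M - K"
  have V: "opn M ?V" by (rule openin_diff[OF openin_topspace K(1)])
  have "f (pt d x) = 0" if "x \<in> cset d ?V" for x using that z by (auto simp: cset_def)
  with sm_const[OF open_cset[OF d(1) V]] have "smo (cset d ?V) (%x. f (pt d x))"
   by (rule sm_eq[OF open_cset[OF d(1) V]])
  then show ?thesis using d V p False K(2) by blast
 qed
qed

text \<open>The cutoff of the squared distance in a chart, extended by zero. \<open>K\<close> is the
  image of a closed ball, hence compact, hence closed because the manifold is Hausdorff.\<close>

lemma ex_bump:
 assumes p: "p \<in> points M" and U: "opn M U" "p \<in> U"
 obtains eta K c where "c \<in> charts M" "sfun (points M) eta" "eta p = 1" "!!q. 0 <= eta q" "closedin (mtop M) K" "K \<subseteq> U" "K \<subseteq> dom_of c"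
  "!!q. q \<in> points M ==> q \<notin> K ==> eta q = 0"
proof -
 obtain c where c: "c \<in> charts M" "p \<in> dom_of c" using ex_chart[OF p] by blast
 define x0 where "x0 = snd c p"
 have "x0 \<in> cset c U" using c U by (auto simp: cset_def x0_def)
 then obtain r where r: "r > 0" "cball x0 r \<subseteq> cset c U" using open_cset[OF c(1) U(1)] open_contains_cball by blast
 define K where "K = pt c ` cball x0 r"
 have rc: "cball x0 r \<subseteq> cimg c" using r(2) by (auto simp: cset_def)
 have "compactin (top_of_set (cimg c)) (cball x0 r)" using rc by (simp add: compactin_subtopology)
 then have "compactin (mtop M) K" unfolding K_def by (rule image_compactin[OF _ continuous_point_of[OF c(1)]])
 then have K: "closedin (mtop M) K" by (rule compactin_imp_closedin[OF hausdorff])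
 define eta where "eta q = (if q \<in> dom_of c then cutoff (((snd c q - x0) \<bullet> (snd c q - x0)) / r\<^sup>2) else 0)" for q
 have KU: "K \<subseteq> U" "K \<subseteq> dom_of c" using r(2) c(1) by (auto simp: K_def cset_def)
 have z: "eta q = 0" if "q \<in> points M" "q \<notin> K" for q
 proof (cases "q \<in> dom_of c")
  case True
  then have "snd c q \<notin> cball x0 r" using that(2) pt_chart[OF c(1) True] unfolding K_def by (metis imageI)
  then have "norm (snd c q - x0) > r" by (simp add: dist_norm norm_minus_commute)
  then have "(snd c q - x0) \<bullet> (snd c q - x0) > r\<^sup>2" using r(1) by (simp add: power2_norm_eq_inner[symmetric] power_strict_mono)
  then show ?thesis using True r(1) by (simp add: eta_def cutoff_eq_0)
 qed (simp add: eta_def)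
 have "smo (cset c (dom_of c)) (%x. eta (pt c x))"
 proof -
  have o: "open (cset c (dom_of c))" by (rule open_cset[OF c(1) open_dom[OF c(1)]])
  have 1: "smo (cset c (dom_of c)) (%x. cutoff (((x - x0) \<bullet> (x - x0)) / r\<^sup>2))"
   by (rule sm_compose[OF o open_UNIV smooth_cutoff]) (use r(1) o in \<open>auto intro!: smooth\<close>)
  have 2: "eta (pt c x) = cutoff (((x - x0) \<bullet> (x - x0)) / r\<^sup>2)" if "x \<in> cset c (dom_of c)" for x
   using that pt_dom[OF c(1), of x] chart_point_of[OF c(1), of x] unfolding cset_def by (simp add: eta_def)
  show ?thesis by (rule sm_eq[OF o 1 2])
 qed
 then have "sfun (points M) eta" using sfun_extend[OF c(1) K KU(2) order_refl open_dom[OF c(1)]] z by blast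
 moreover have "eta p = 1" using c(2) by (simp add: eta_def x0_def cutoff_eq_1)
 moreover have "0 <= eta q" for q using cutoff_bounds by (simp add: eta_def)
 ultimately show thesis using that c(1) K KU z by blast
qed

text \<open>Finitely many bumps, indexed by points of the manifold, are divided by their sum. Each
  \<open>K i\<close> lies in the prescribed \<open>U i\<close> and also in the domain of one chart
  \<open>C i\<close>, so that functions known only in that chart can be multiplied by
  \<open>zeta i\<close> and extended by zero.\<close>

lemma partition_of_unity:
 assumes comp: "compact_space (mtop M)" and O: "!!p. p \<in> points M ==> opn M (U p) & p \<in> U p"
 obtains I :: "'a set" and zeta K C where "finite I" "I \<subseteq> points M"
  "!!i. i \<in> I ==> sfun (points M) (zeta i)" "!!i q. i \<in> I ==> q \<in> points M ==> 0 <= zeta i q"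
  "!!i. i \<in> I ==> closedin (mtop M) (K i)" "!!i. i \<in> I ==> K i \<subseteq> U i"
  "!!i. i \<in> I ==> C i \<in> charts M" "!!i. i \<in> I ==> K i \<subseteq> dom_of (C i)"
  "!!i q. i \<in> I ==> q \<in> points M ==> q \<notin> K i ==> zeta i q = 0"
  "!!q. q \<in> points M ==> (\<Sum>i\<in>I. zeta i q) = 1"
proof -
 have "\<exists>eta K c. c \<in> charts M & sfun (points M) eta & eta p = 1 & (\<forall>q. 0 <= eta q) & closedin (mtop M) K & K \<subseteq> U p & K \<subseteq> dom_of c &
  (\<forall>q\<in>points M. q \<notin> K --> eta q = 0)" if p: "p \<in> points M" for p
 proof -
  from O[OF p] have "opn M (U p)" "p \<in> U p" by auto
  from ex_bump[OF p this] show ?thesis by metis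
 qed
 then obtain eta K C where eta: "!!p. p \<in> points M ==> C p \<in> charts M & sfun (points M) (eta p) & eta p p = 1 & (\<forall>q. 0 <= eta p q) &
   closedin (mtop M) (K p) & K p \<subseteq> U p & K p \<subseteq> dom_of (C p) & (\<forall>q\<in>points M. q \<notin> K p --> eta p q = (0::real))"
  by metis
 \<comment> \<open>With the threshold 1/2 these sets are open and still cover, and the sum of the
   selected bumps is positive everywhere.\<close>
 define V where "V p = {q \<in> points M. eta p q > 1/2}" for p
 have V: "opn M (V p)" if p: "p \<in> points M" for p
 proof (subst openin_subopen, intro ballI)
  fix q assume q: "q \<in> V p"
  have "q \<in> points M" using q by (simp add: V_def)
  from ex_chart[OF this] obtain c where c: "c \<in> charts M" "q \<in> dom_of c" by blast
  have "sfun (points M) (eta p)" using eta[OF p] by blast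
  from sfunD[OF this c(1)] have s: "smo (cimg c) (%x. eta p (pt c x))" unfolding cset_points[OF c(1)] .
  have "open {x \<in> cimg c. eta p (pt c x) \<in> {1/2<..}}"
   using continuous_open_preimage[OF sm_cont[OF s] open_coord[OF c(1)] open_greaterThan, of "1/2"]
   by (simp only: vimage_def Int_def mem_Collect_eq)
  from openin_chart_preimage[OF c(1) this]
  have "opn M {p' \<in> dom_of c. snd c p' \<in> {x \<in> cimg c. eta p (pt c x) \<in> {1/2<..}}}" .
  moreover have "(snd c p' \<in> {x \<in> cimg c. eta p (pt c x) \<in> {1/2<..}}) \<longleftrightarrow> p' \<in> V p" if "p' \<in> dom_of c" for p'
   using pt_chart[OF c(1) that] dom_subset[OF c(1)] that unfolding V_def by (simp add: subset_iff)
  then have "{p' \<in> dom_of c. snd c p' \<in> {x \<in> cimg c. eta p (pt c x) \<in> {1/2<..}}} = V p \<inter> dom_of c" by blast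
  ultimately show "\<exists>T. opn M T & q \<in> T & T \<subseteq> V p" using q c(2) by (metis IntI Int_lower1)
 qed
 have "\<exists>F. finite F & F \<subseteq> V ` points M & points M \<subseteq> \<Union>F"
 proof -
  have "p \<in> V p" if "p \<in> points M" for p using eta[OF that] that by (simp add: V_def)
  then have "(\<forall>U\<in>V ` points M. opn M U) & points M \<subseteq> \<Union> (V ` points M)" using V by auto
  then show ?thesis by (rule comp[unfolded compact_space_alt, rule_format])
 qed
 then obtain I where I: "finite I" "I \<subseteq> points M" "points M \<subseteq> \<Union> (V ` I)" by (metis finite_subset_image)
 define s where "s q = (\<Sum>i\<in>I. eta i q)" for q
 have pos: "s q > 0" if q: "q \<in> points M" for q
 proof -
  obtain i where i: "i \<in> I" "q \<in> V i" using I(3) q by blast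
  have "eta i q <= s q" unfolding s_def using eta I i by (intro member_le_sum) auto
  then show ?thesis using i(2) by (simp add: V_def)
 qed
 have o: "opn M (points M)" by simp
 have sf: "sfun (points M) (%q. eta i q / s q)" if "i \<in> I" for i
  unfolding s_def by (intro sfun_divide sfun_sum o) (use eta I that pos in \<open>auto simp: s_def less_imp_neq[symmetric]\<close>)
 show thesis
 proof (rule that[of I "%i q. eta i q / s q" K C])
  show "0 <= eta i q / s q" if "i \<in> I" "q \<in> points M" for i q using eta[of i] I that pos[OF that(2)] by (auto intro!: divide_nonneg_pos)
  show "(\<Sum>i\<in>I. eta i q / s q) = 1" if "q \<in> points M" for q using pos[OF that] by (simp add: sum_divide_distrib[symmetric] s_def)
  show "eta i q / s q = 0" if "i \<in> I" "q \<in> points M" "q \<notin> K i" for i q using eta[of i] I that by auto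
 qed (use eta I sf in auto)
qed

end

section \<open>Extending closed one-forms from a hypersurface\<close>

locale hypersurface_in = X: smooth_mfd X + Z: smooth_mfd Z
 for X :: "('a, 'e::euclidean_space) manifold" and Z :: "('a, 'f::euclidean_space) manifold" +
 assumes hypersurface: "hypersurface X Z" and compact: "compact_space (mtop X)"
begin

lemma dims: "DIM('e) = DIM('f) + 1" using hypersurface by (simp add: hypersurface_def)

lemma closed_Z: "closedin (mtop X) (points Z)" using hypersurface by (simp add: hypersurface_def)

lemma Z_subset: "points Z \<subseteq> points X" using closedin_subset[OF closed_Z] .

lemma openin_Z: "opn X W ==> opn Z (points Z \<inter> W)"
proof -
 assume "opn X W"
 moreover have "mtop Z = subtopology (mtop X) (points Z)" using hypersurface unfolding hypersurface_def by blast
 ultimately show ?thesis using openin_subtopology_Int2 by metis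
qed

lemma openin_Z_ex: assumes "opn Z G" obtains W where "opn X W" "G = points Z \<inter> W"
proof -
 have "mtop Z = subtopology (mtop X) (points Z)" using hypersurface unfolding hypersurface_def by blast
 then obtain W where "opn X W" "G = W \<inter> points Z" using assms openin_subtopology by metis
 then show thesis using that by (metis Int_commute)
qed

context
 fixes d c assumes d: "d \<in> charts Z" and c: "c \<in> charts X"
begin

lemma smooth_incl: "smo (overlap d c) (trn d c)"
 using hypersurface d c unfolding hypersurface_def by blast

lemma inj_incl: "y \<in> overlap d c ==> inj (FD (trn d c) y)"
 using hypersurface d c unfolding hypersurface_def by blast

lemma overlap_incl: "overlap d c = cset d (dom_of c)"
 by (simp add: overlap_def Z.cset_eq[OF d] Int_commute)

lemma incl_facts:
 assumes "y \<in> overlap d c"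
 shows "pt c (trn d c y) = pt d y" "trn d c y \<in> cimg c" "y \<in> cimg d"
  "pt d y \<in> dom_of c"
proof -
 have y: "y \<in> cimg d" "pt d y \<in> dom_of c" using assms unfolding overlap_incl by (auto simp: cset_def)
 show "pt c (trn d c y) = pt d y" unfolding transition_def using X.pt_chart[OF c y(2)] by simp
 show "trn d c y \<in> cimg c" unfolding transition_def using y(2) by simp
qed (use assms in \<open>auto simp: overlap_incl cset_def\<close>)

end

lemma open_cset_Z: assumes "d \<in> charts Z" "opn X W" shows "open (cset d W)"
proof -
 have "cset d W = cset d (points Z \<inter> W)"
  using Z.pt_points[OF assms(1)] unfolding cset_def by blast
 then show ?thesis using Z.open_cset[OF assms(1) openin_Z[OF assms(2)]] by simp
qed

lemma open_ovi: "d \<in> charts Z ==> c \<in> charts X ==> open (overlap d c)"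
 by (simp add: overlap_incl open_cset_Z X.open_dom)

lemma smooth_restrict:
 assumes W: "opn X W" and f: "X.sfun W f" and d: "d \<in> charts Z"
 shows "smo (cset d W) (%y. f (pt d y))"
proof (rule sm_local)
 fix y assume y: "y \<in> cset d W"
 then have yd: "y \<in> cimg d" "pt d y \<in> W" by (auto simp: cset_def)
 have "pt d y \<in> points X" using yd(2) openin_subset[OF W] by blast
 from X.ex_chart[OF this] obtain c where c: "c \<in> charts X" "pt d y \<in> dom_of c" by blast
 define T where "T = cset d (W \<inter> dom_of c)"
 have T: "open T" unfolding T_def by (rule open_cset_Z[OF d openin_Int[OF W X.open_dom[OF c(1)]]])
 have sub: "T \<subseteq> overlap d c" unfolding T_def overlap_incl[OF d c(1)] by (auto simp: cset_def)
 have 1: "smo T (%y. f (pt c (trn d c y)))"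
 proof (rule sm_compose[OF T X.open_cset[OF c(1) W] X.sfunD[OF f c(1)] sm_subset[OF smooth_incl[OF d c(1)] sub]])
  fix z assume z: "z \<in> T"
  then have "pt d z \<in> W" by (simp add: T_def cset_def)
  moreover have "z \<in> overlap d c" using sub z by blast
  ultimately show "trn d c z \<in> cset c W" using incl_facts[OF d c(1), of z] by (simp add: cset_def)
 qed
 have 2: "f (pt d z) = f (pt c (trn d c z))" if "z \<in> T" for z
  using incl_facts(1)[OF d c(1), of z] sub that by auto
 show "\<exists>T. open T & y \<in> T & smo T (%y. f (pt d y))"
  using T sm_eq[OF T 1 2] yd c by (intro exI[of _ T]) (simp add: T_def cset_def)
qed

definition one_form :: "('a, 'f, 'f) field => ('a, 'f) chart => 'f => 'f => real" where
 "one_form theta d y v = theta d y (%_. v)"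

lemma closed_one_form:
 assumes theta: "closed_form 1 Z theta" and d: "d \<in> charts Z"
 shows "y \<in> cimg d ==> linear (one_form theta d y)"
  "smo (cimg d) (%y. one_form theta d y v)"
  "y \<in> cimg d ==> FD (%y. one_form theta d y v) y u = FD (%y. one_form theta d y u) y v"
  "y \<in> cimg d ==> theta d y w = one_form theta d y (w 0)"
  "d' \<in> charts Z ==> y \<in> overlap d d' ==> one_form theta d y v = one_form theta d' (trn d d' y) (FD (trn d d') y v)"
proof -
 have df: "diff_form 1 Z theta" and ext: "!!y. y \<in> cimg d ==> ext_deriv 1 (theta d) y = (%_. 0)"
  using theta d unfolding closed_form_def by blast+
 then have tf: "!!y. y \<in> cimg d ==> alt_form 1 (theta d y)" "!!v. smo (cimg d) (%y. theta d y v)"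
  using d unfolding diff_form_def tensor_field_def by blast+
 show eq: "theta d y w = one_form theta d y (w 0)" if "y \<in> cimg d" for y w
  unfolding one_form_def by (rule alt_formD(1)[OF tf(1)[OF that]]) simp
 show "linear (one_form theta d y)" if y: "y \<in> cimg d" for y
 proof -
  have "linear (%x. theta d y ((%_. 0)(0 := x)))" by (rule alt_formD(2)[OF tf(1)[OF y]]) simp
  then show ?thesis by (simp add: eq[OF y])
 qed
 show "smo (cimg d) (%y. one_form theta d y v)" unfolding one_form_def by (rule tf(2))
 show "FD (%y. one_form theta d y v) y u = FD (%y. one_form theta d y u) y v" if y: "y \<in> cimg d" for y u v
 proof -
  define w :: "nat => 'f" where "w i = (if i = 0 then u else v)" for i
  have *: "FD (%y. theta d y w') y x = FD (%y. one_form theta d y (w' 0)) y x" for w' x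
   by (rule fun_cong[OF FD_cong[OF Z.open_coord[OF d] y eq]])
  have "ext_deriv 1 (theta d) y w = 0" using ext[OF y] by simp
  then show ?thesis unfolding ext_deriv_def by (simp add: * atMost_Suc w_def)
 qed
 show "one_form theta d y v = one_form theta d' (trn d d' y) (FD (trn d d') y v)"
  if "d' \<in> charts Z" "y \<in> overlap d d'"
  using df d that unfolding diff_form_def one_form_def by blast
qed

text \<open>A primitive of \<open>theta\<close> near \<open>p\<close> in \<open>Z\<close> is made
  constant along the fibres of a local projection \<open>Q\<close> onto \<open>Z\<close>. The
  projection is part of the conclusion because it supplies base points on \<open>Z\<close> when
  several extensions are glued.\<close>

lemma local_extension:
 assumes theta: "closed_form 1 Z theta" and p: "p \<in> points Z"
 obtains U Phi Q where "opn X U" "p \<in> U" "X.sfun U Phi" "!!x. x \<in> U ==> Q x \<in> points Z"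
  "!!G. opn Z G ==> opn X {x \<in> U. Q x \<in> G}" "!!z. z \<in> U ==> z \<in> points Z ==> Q z = z"
  "!!d y v. d \<in> charts Z ==> y \<in> cset d U ==> FD (%y. Phi (pt d y)) y v = one_form theta d y v"
proof -
 from Z.ex_chart[OF p] obtain d where d: "d \<in> charts Z" "p \<in> dom_of d" by blast
 have "p \<in> points X" using p Z_subset by blast
 from X.ex_chart[OF this] obtain c where c: "c \<in> charts X" "p \<in> dom_of c" by blast
 define y0 where "y0 = snd d p"
 define j where "j = trn d c"
 have ptd: "pt d y0 = p" using Z.pt_chart[OF d] by (simp add: y0_def)
 have y0: "y0 \<in> overlap d c" using c d ptd unfolding overlap_incl[OF d(1) c(1)] cset_def by (simp add: y0_def)
 obtain rho where rho: "rho > 0" "ball y0 rho \<subseteq> overlap d c"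
  using open_ovi[OF d(1) c(1)] y0 open_contains_ball by blast
 define B where "B = ball y0 rho"
 have B: "open B" "convex B" "y0 \<in> B" "B \<subseteq> overlap d c" using rho by (auto simp: B_def)
 have Bc: "B \<subseteq> cimg d" using B(4) incl_facts(3)[OF d(1) c(1)] by blast
 note cf = closed_one_form[OF theta d(1)]
 obtain phi where phi: "smo B phi" "!!y. y \<in> B ==> (phi has_derivative one_form theta d y) (at y)"
  by (rule poincare_one_form[OF B(1-3), of "one_form theta d"])
   (use Bc cf(1) cf(3) sm_subset[OF cf(2) Bc] in blast)+
 have sj: "smo B j" unfolding j_def by (rule sm_subset[OF smooth_incl[OF d(1) c(1)] B(4)])
 define D where "D = FD j y0"
 have linD: "linear D" unfolding D_def by (rule sm_linear_FD[OF sj B(3)])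
 have injD: "inj D" unfolding D_def j_def by (rule inj_incl[OF d(1) c(1) y0])
 have dimD: "dim (range D) = DIM('f)"
  using dim_image_eq[OF linD, of UNIV] injD by simp
 then have "dim (range D) < DIM('e)" using dims by simp
 then obtain a where a: "a ~= 0" "!!y. y \<in> span (range D) ==> orthogonal a y"
  using orthogonal_to_subspace_exists by blast
 \<comment> \<open>A unit normal to the tangent space of \<open>Z\<close> in the chart; by the
   dimension count that tangent space is the whole hyperplane orthogonal to
   \<open>e\<close>.\<close>
 define e where "e = a /\<^sub>R norm a"
 have ee: "e \<bullet> e = 1" using a(1) by (simp add: e_def power2_norm_eq_inner[symmetric] power2_eq_square field_simps)
 have De: "D u \<bullet> e = 0" for u
  using a(2)[OF span_base[of "D u"]] by (simp add: e_def orthogonal_def inner_commute)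
 have hyp: "x \<in> range D" if "x \<bullet> e = 0" for x
 proof -
  have "e ~= 0" using ee by auto
  have "range D = {x. e \<bullet> x = 0}"
  proof (rule subspace_dim_equal)
   show "subspace (range D)" using linear_subspace_image[OF linD subspace_UNIV] .
   show "range D \<subseteq> {x. e \<bullet> x = 0}" using De by (auto simp: inner_commute)
   show "dim {x. e \<bullet> x = 0} <= dim (range D)" using dim_hyperplane[OF \<open>e ~= 0\<close>] dimD dims by simp
  qed (rule subspace_hyperplane)
  then show ?thesis using that by (simp add: inner_commute)
 qed
 obtain L0 where L0: "linear L0" "L0 \<circ> D = id" using linear_injective_left_inverse[OF linD injD] by blast
 have L0D: "L0 (D u) = u" for u using fun_cong[OF L0(2), of u] by simp
 have blL: "bounded_linear L0" using L0(1) by (simp add: linear_conv_bounded_linear)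
 define U where "U = {x. y0 + L0 x \<in> B}"
 have U: "open U"
 proof -
  have "continuous_on UNIV (%x. y0 + L0 x)" by (intro continuous_intros bounded_linear.continuous_on[OF blL])
  from open_vimage[OF B(1) this] show ?thesis by (simp add: U_def vimage_def)
 qed
 \<comment> \<open>Local product coordinates: the tangent part of \<open>x\<close>, read off by
   \<open>L0\<close>, moves along \<open>Z\<close> through \<open>j\<close>, and the normal part is
   added as a multiple of \<open>e\<close>.\<close>
 define f where "f x = j (y0 + L0 x) + (x \<bullet> e) *\<^sub>R e" for x
 have smL: "smo U (%x. y0 + L0 x)" by (intro sm_add sm_const sm_linear U blL)
 have f: "smo U f" unfolding f_def
  by (intro sm_add sm_scaleR sm_inner sm_const sm_id U sm_compose[OF U B(1) sj smL])
   (simp add: U_def)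
 have L00: "L0 0 = 0" using linear_0[OF L0(1)] .
 have U0: "0 \<in> U" using B(3) L00 by (simp add: U_def)
 have "FD f 0 = (%h. D (L0 h) + (h \<bullet> e) *\<^sub>R e)"
 proof (rule FD_eqI)
  have "((%x. y0 + L0 x) has_derivative L0) (at 0)"
   by (auto intro!: derivative_eq_intros bounded_linear.has_derivative[OF blL])
  moreover have "(j has_derivative D) (at (y0 + L0 0))" using sm_has_derivative[OF sj B(3)] L00 by (simp add: D_def)
  ultimately have "((%x. j (y0 + L0 x)) has_derivative (%h. D (L0 h))) (at 0)"
   by (rule has_derivative_compose)
  then show "(f has_derivative (%h. D (L0 h) + (h \<bullet> e) *\<^sub>R e)) (at 0)"
   unfolding f_def by (auto intro!: derivative_eq_intros)
 qed
 then have dfE: "FD f 0 h = D (L0 h) + (h \<bullet> e) *\<^sub>R e" for h by simp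
 have "inj (FD f 0)"
  unfolding linear_injective_0[OF sm_linear_FD[OF f U0]]
 proof (intro allI impI)
  fix h assume h: "FD f 0 h = 0"
  have "(D (L0 h) + (h \<bullet> e) *\<^sub>R e) \<bullet> e = h \<bullet> e" using De ee by (simp add: inner_add_left)
  then have he: "h \<bullet> e = 0" using h dfE[of h] by simp
  then obtain u where u: "h = D u" using hyp by blast
  then show "h = 0" using h he dfE[of h] L0D by simp
 qed
 from smooth_inverse_function[OF U f U0 this] obtain U' V g where
  UV: "open U'" "U' \<subseteq> U" "0 \<in> U'" "open V" "f 0 \<in> V" "homeomorphism U' V f g" "smo V g" by metis
 have gV: "g x \<in> U'" if "x \<in> V" for x using UV(6) that unfolding homeomorphism_def by blast
 have gf: "g (f x) = x" if "x \<in> U'" for x using UV(6) that unfolding homeomorphism_def by blast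
 have fj: "f (D (y - y0)) = j y" for y using L0D De by (simp add: f_def)
 have f0: "f 0 = snd c p" using fj[of y0] ptd linear_0[OF linD] by (simp add: j_def transition_def)
 define B' where "B' = {y \<in> B. D (y - y0) \<in> U'}"
 have oB': "open B'"
 proof -
  have "continuous_on B (%y. D (y - y0))"
   by (rule bounded_linear.continuous_on[OF linD[unfolded linear_conv_bounded_linear]]) (intro continuous_intros)
  from continuous_open_preimage[OF this B(1) UV(1)] show ?thesis by (simp add: B'_def vimage_def Int_def)
 qed
 \<comment> \<open>\<open>Z\<close> carries the subspace topology, so intersecting with
   \<open>W\<close> excludes other sheets of \<open>Z\<close>: every point of \<open>Z\<close> in
   \<open>N\<close> is seen by the chart \<open>d\<close> with coordinates in
   \<open>B'\<close>.\<close>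
 have "opn Z {z \<in> dom_of d. snd d z \<in> B'}" by (rule Z.openin_chart_preimage[OF d(1) oB'])
 then obtain W where W: "opn X W" "{z \<in> dom_of d. snd d z \<in> B'} = points Z \<inter> W" by (rule openin_Z_ex)
 define N where "N = {x \<in> dom_of c. snd c x \<in> V} \<inter> W"
 have oN: "opn X N" unfolding N_def by (intro openin_Int X.openin_chart_preimage c UV W)
 have pN: "p \<in> N"
 proof -
  have "p \<in> {z \<in> dom_of d. snd d z \<in> B'}" using d B(3) UV(3) linear_0[OF linD] by (simp add: B'_def y0_def)
  then show ?thesis using W c f0 UV(5) by (simp add: N_def)
 qed
 define q where "q x = y0 + L0 (g (snd c x))" for x
 have qB: "q x \<in> B" if "x \<in> N" for x
  using gV[of "snd c x"] UV(2) that by (auto simp: N_def q_def U_def)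
 have qz: "z \<in> dom_of d" "q z = snd d z" if "z \<in> N" "z \<in> points Z" for z
 proof -
  have z: "z \<in> dom_of d" "snd d z \<in> B'" using W(2) that by (auto simp: N_def)
  show "z \<in> dom_of d" by fact
  have "snd c z = j (snd d z)" using Z.pt_chart[OF d(1) z(1)] by (simp add: j_def transition_def)
  also have "... = f (D (snd d z - y0))" using fj by simp
  finally have "g (snd c z) = D (snd d z - y0)" using gf z(2) by (simp add: B'_def)
  then show "q z = snd d z" using L0D by (simp add: q_def)
 qed
 define Phi where "Phi x = phi (q x)" for x
 have oc: "open (cset c N)" by (rule X.open_cset[OF c(1) oN])
 have cN: "x \<in> cimg c" "pt c x \<in> N" "snd c (pt c x) = x" "x \<in> V" if "x \<in> cset c N" for x
 proof -
  show x: "x \<in> cimg c" "pt c x \<in> N" using that by (auto simp: cset_def)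
  show "snd c (pt c x) = x" by (rule X.chart_point_of[OF c(1) x(1)])
  then show "x \<in> V" using x(2) by (simp add: N_def)
 qed
 have smq: "smo (cset c N) (%x. y0 + L0 (g x))"
 proof -
  have "smo (cset c N) g" by (rule sm_subset[OF UV(7)]) (use cN in blast)
  then have "smo (cset c N) (%x. L0 (g x))"
   by (rule sm_compose[OF oc open_UNIV sm_linear[OF open_UNIV blL]]) simp
  then show ?thesis by (intro sm_add sm_const oc)
 qed
 have smPhi: "smo (cset c N) (%x. Phi (pt c x))"
 proof (rule sm_eq[OF oc])
  show "smo (cset c N) (%x. phi (y0 + L0 (g x)))"
   by (rule sm_compose[OF oc B(1) phi(1) smq]) (use qB cN in \<open>force simp: q_def\<close>)
  show "Phi (pt c x) = phi (y0 + L0 (g x))" if "x \<in> cset c N" for x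
   using cN(3)[OF that] by (simp add: Phi_def q_def)
 qed
 have "X.sfun N Phi"
 proof (rule X.sfun_local)
  fix p assume "p \<in> N"
  then have "p \<in> dom_of c" by (simp add: N_def)
  then show "\<exists>c\<in>charts X. \<exists>V. opn X V & p \<in> V & p \<in> dom_of c & smo (cset c V) (%x. Phi (pt c x))"
   using c(1) oN \<open>p \<in> N\<close> smPhi by blast
 qed
 moreover have "opn X {x \<in> N. pt d (q x) \<in> G}" if G: "opn Z G" for G
 proof -
  have o1: "open (cset d G)" by (rule Z.open_cset[OF d(1) G])
  have "open (cset c N \<inter> (%x. y0 + L0 (g x)) -` cset d G)"
   by (rule continuous_open_preimage[OF sm_cont[OF smq] oc o1])
  from openin_Int[OF oN X.openin_chart_preimage[OF c(1) this]]
  have "opn X (N \<inter> {p \<in> dom_of c. snd c p \<in> cset c N \<inter> (%x. y0 + L0 (g x)) -` cset d G})" .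
  moreover have "N \<inter> {p \<in> dom_of c. snd c p \<in> cset c N \<inter> (%x. y0 + L0 (g x)) -` cset d G} = {x \<in> N. pt d (q x) \<in> G}"
  proof (intro equalityI subsetI)
   fix x assume "x \<in> {x \<in> N. pt d (q x) \<in> G}"
   then have x: "x \<in> N" "pt d (q x) \<in> G" "x \<in> dom_of c" by (auto simp: N_def)
   have "q x \<in> cimg d" using qB[OF x(1)] Bc by blast
   then show "x \<in> N \<inter> {p \<in> dom_of c. snd c p \<in> cset c N \<inter> (%x. y0 + L0 (g x)) -` cset d G}"
    using x X.pt_chart[OF c(1) x(3)] by (simp add: cset_def q_def)
  qed (auto simp: cset_def q_def)
  ultimately show ?thesis by simp
 qed
 moreover have "pt d (q z) = z" if "z \<in> N" "z \<in> points Z" for z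
  using qz[OF that] Z.pt_chart[OF d(1)] by simp
 moreover have "pt d (q x) \<in> points Z" if "x \<in> N" for x
  using qB[OF that] Bc Z.pt_points[OF d(1)] by blast
 moreover have "FD (%y. Phi (pt d' y)) y v = one_form theta d' y v" if d': "d' \<in> charts Z" and y: "y \<in> cset d' N" for d' y v
 proof -
  have o: "open (cset d' N)" by (rule open_cset_Z[OF d' oN])
  have in_ov: "y \<in> overlap d' d" "Phi (pt d' y) = phi (trn d' d y)" "trn d' d y \<in> B" if "y \<in> cset d' N" for y
  proof -
   have 1: "y \<in> cimg d'" "pt d' y \<in> N" using that by (auto simp: cset_def)
   have 2: "pt d' y \<in> points Z" by (rule Z.pt_points[OF d' 1(1)])
   show "y \<in> overlap d' d" unfolding Z.overlap_eq[OF d'] using 1 qz(1)[OF 1(2) 2] by (simp add: cset_def)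
   show "Phi (pt d' y) = phi (trn d' d y)" using qz(2)[OF 1(2) 2] by (simp add: Phi_def transition_def)
   show "trn d' d y \<in> B" using qB[OF 1(2)] qz(2)[OF 1(2) 2] by (simp add: transition_def)
  qed
  have "FD (%y. Phi (pt d' y)) y v = FD (%y. phi (trn d' d y)) y v"
   by (rule fun_cong[OF FD_cong[OF o y in_ov(2)]])
  also have "... = FD phi (trn d' d y) (FD (trn d' d) y v)"
   by (rule FD_compose[OF Z.sm_trn[OF d' d(1)] phi(1) in_ov(1)[OF y] in_ov(3)[OF y]])
  also have "FD phi (trn d' d y) = one_form theta d (trn d' d y)" by (rule FD_eqI[OF phi(2)[OF in_ov(3)[OF y]]])
  also have "one_form theta d (trn d' d y) (FD (trn d' d) y v) = one_form theta d' y v"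
   by (rule closed_one_form(5)[OF theta d' d(1) in_ov(1)[OF y], symmetric])
  finally show ?thesis .
 qed
 ultimately show thesis using that[of N Phi "%x. pt d (q x)"] oN pN by blast
qed

end

text \<open>A closed one-form on an open set \<open>W\<close> is encoded by local primitives: \<open>\<psi> p\<close> is a primitive near \<open>p\<close>.\<close>

context smooth_mfd
begin

lemma sfun_eq:
 assumes "opn M W" "sfun W f" "!!p. p \<in> W ==> g p = f p" shows "sfun W g"
 unfolding sfun_def
proof
 fix c assume c: "c \<in> charts M"
 show "smo (cset c W) (%x. g (pt c x))"
  by (rule sm_eq[OF open_cset[OF c assms(1)] sfunD[OF assms(2) c]]) (simp add: cset_def assms(3))
qed

definition lexact :: "'a set => ('a => 'a => real) => bool" where
 "lexact W psi \<longleftrightarrow> (\<forall>p\<in>W. \<exists>N. opn M N & p \<in> N & N \<subseteq> W & sfun N (psi p) &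
   (\<forall>q\<in>N. \<exists>k. \<forall>y\<in>N. psi q y = psi p y + k))"

text \<open>The primitive based at the point itself is differentiated there. Moving the base point
  nearby only adds a constant, so near each point this is the differential of a single
  function.\<close>

definition dform :: "('a => 'a => real) => ('a, 'e) chart => 'e => 'e => real" where
 "dform psi c x v = FD (%y. psi (pt c x) (pt c y)) x v"

lemma lexactE:
 assumes "lexact W psi" "p \<in> W"
 obtains N where "opn M N" "p \<in> N" "N \<subseteq> W" "sfun N (psi p)" "!!q. q \<in> N ==> \<exists>k. \<forall>y\<in>N. psi q y = psi p y + k"
proof -
 from bspec[OF assms(1)[unfolded lexact_def] assms(2)] obtain N where "opn M N & p \<in> N & N \<subseteq> W & sfun N (psi p) &
   (\<forall>q\<in>N. \<exists>k. \<forall>y\<in>N. psi q y = psi p y + k)" by (rule exE)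
 then show thesis by (intro that[of N]) simp_all
qed

lemma dform_local:
 assumes L: "lexact W psi" and c: "c \<in> charts M" and x: "x \<in> cset c W"
 obtains S Psi where "open S" "x \<in> S" "S \<subseteq> cset c W" "smo S Psi" "!!y. y \<in> S ==> dform psi c y = FD Psi y"
proof -
 let ?p = "pt c x"
 have "?p \<in> W" using x by (simp add: cset_def)
 obtain N where N: "opn M N" "?p \<in> N" "N \<subseteq> W" "sfun N (psi ?p)" "!!q. q \<in> N ==> \<exists>k. \<forall>y\<in>N. psi q y = psi ?p y + k"
  by (rule lexactE[OF L \<open>?p \<in> W\<close>], rule that)
 define S where "S = cset c N"
 define Psi where "Psi y = psi ?p (pt c y)" for y
 have S: "open S" unfolding S_def by (rule open_cset[OF c N(1)])
 have sm: "smo S Psi" unfolding S_def Psi_def by (rule sfunD[OF N(4) c])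
 have "dform psi c y = FD Psi y" if y: "y \<in> S" for y
 proof -
  have "pt c y \<in> N" using y by (simp add: S_def cset_def)
  from N(5)[OF this] obtain k where k: "!!z. z \<in> N ==> psi (pt c y) z = psi ?p z + k" by blast
  have "FD (%z. psi (pt c y) (pt c z)) y = FD (%z. Psi z + k) y"
   by (rule FD_cong[OF S y]) (simp add: k Psi_def S_def cset_def)
  also have "... = FD Psi y"
   by (rule FD_eqI) (auto intro!: derivative_eq_intros sm_has_derivative[OF sm y])
  finally show ?thesis by (simp add: dform_def fun_eq_iff)
 qed
 moreover have "x \<in> S" "S \<subseteq> cset c W" using x N(2,3) by (auto simp: S_def cset_def)
 ultimately show thesis using that S sm by blast
qed

lemma dform_smooth:
 assumes L: "lexact W psi" and c: "c \<in> charts M"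
 shows "x \<in> cset c W ==> linear (dform psi c x)" "smo (cset c W) (%x. dform psi c x v)"
proof -
 show "linear (dform psi c x)" if x: "x \<in> cset c W"
 proof -
  obtain S Psi where S: "open S" "x \<in> S" "S \<subseteq> cset c W" "smo S Psi" "!!y. y \<in> S ==> dform psi c y = FD Psi y"
   by (rule dform_local[OF L c x], rule that)
  show ?thesis using S(5)[OF S(2)] sm_linear_FD[OF S(4,2)] by simp
 qed
 show "smo (cset c W) (%x. dform psi c x v)"
 proof (rule sm_local)
  fix x assume x: "x \<in> cset c W"
  obtain S Psi where S: "open S" "x \<in> S" "S \<subseteq> cset c W" "smo S Psi" "!!y. y \<in> S ==> dform psi c y = FD Psi y"
   by (rule dform_local[OF L c x], rule that)
  have "smo S (%x. dform psi c x v)" by (rule sm_eq[OF S(1) sm_FD[OF S(4)]]) (simp add: S(5))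
  then show "\<exists>T. open T & x \<in> T & smo T (%x. dform psi c x v)" using S by blast
 qed
qed

lemma dform_transition:
 assumes L: "lexact W psi" and c: "c \<in> charts M" "d \<in> charts M" and x: "x \<in> overlap c d" "x \<in> cset c W"
 shows "dform psi c x v = dform psi d (trn c d x) (FD (trn c d) x v)"
proof -
 let ?p = "pt c x"
 have "?p \<in> W" using x by (simp add: cset_def)
 obtain N where N: "opn M N" "?p \<in> N" "sfun N (psi ?p)"
  by (rule lexactE[OF L \<open>?p \<in> W\<close>], rule that)
 define S where "S = cset c (N \<inter> dom_of d)"
 have S: "open S" unfolding S_def by (intro open_cset c openin_Int N open_dom)
 have Sov: "S \<subseteq> overlap c d" unfolding overlap_eq[OF c(1)] S_def by (auto simp: cset_def)
 have xS: "x \<in> S" using x(1) N(2) unfolding overlap_eq[OF c(1)] S_def by (simp add: cset_def)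
 note tr = trn_ov[OF c x(1)]
 have "dform psi c x v = FD (%y. psi ?p (pt d (trn c d y))) x v"
  unfolding dform_def by (rule fun_cong[OF FD_cong[OF S xS]]) (use Sov trn_ov(3)[OF c] in auto)
 also have "... = FD (%y. psi ?p (pt d y)) (trn c d x) (FD (trn c d) x v)"
  by (rule FD_compose[OF sm_trn[OF c] sfunD[OF N(3) c(2)] x(1)]) (use tr N(2) in \<open>simp add: cset_def\<close>)
 finally show ?thesis using tr by (simp add: dform_def)
qed

text \<open>A locally constant factor keeps the primitives coherent. It is used to correct the sign
  of an extended form.\<close>

lemma lexact_mult:
 assumes L: "lexact W psi" and s: "!!p. p \<in> W ==> \<exists>N. opn M N & p \<in> N & (\<forall>q\<in>N. s q = s p)"
 shows "lexact W (%p y. s p * psi p y)"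
 unfolding lexact_def
proof
 fix p assume p: "p \<in> W"
 obtain N where N: "opn M N" "p \<in> N" "N \<subseteq> W" "sfun N (psi p)" "!!q. q \<in> N ==> \<exists>k. \<forall>y\<in>N. psi q y = psi p y + k"
  by (rule lexactE[OF L p], rule that)
 obtain N' where N': "opn M N'" "p \<in> N'" "!!q. q \<in> N' ==> s q = s p" using s[OF p] by blast
 have o: "opn M (N \<inter> N')" using N N' by blast
 have A: "\<exists>k. \<forall>y\<in>N \<inter> N'. s q * psi q y = s p * psi p y + k" if q: "q \<in> N \<inter> N'" for q
 proof -
  obtain k where "!!y. y \<in> N ==> psi q y = psi p y + k" using N(5) q by blast
  then show ?thesis using N'(3)[of q] q by (intro exI[of _ "s p * k"]) (simp add: distrib_left)
 qed
 have B: "sfun (N \<inter> N') (%y. s p * psi p y)"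
  by (intro sfun_mult sfun_const o sfun_subset[OF N(4)]) simp
 show "\<exists>N. opn M N & p \<in> N & N \<subseteq> W & sfun N (%y. s p * psi p y) &
   (\<forall>q\<in>N. \<exists>k. \<forall>y\<in>N. s q * psi q y = s p * psi p y + k)"
  by (intro exI[of _ "N \<inter> N'"] conjI ballI o B A) (use N(2,3) N'(2) in auto)
qed

lemma dform_mult: "lexact W psi ==> c \<in> charts M ==> x \<in> cset c W ==>
  dform (%p y. s p * psi p y) c x v = s (pt c x) * dform psi c x v"
proof -
 assume L: "lexact W psi" and c: "c \<in> charts M" and x: "x \<in> cset c W"
 have "pt c x \<in> W" using x by (simp add: cset_def)
 obtain N where N: "opn M N" "pt c x \<in> N" "sfun N (psi (pt c x))"
  by (rule lexactE[OF L \<open>pt c x \<in> W\<close>], rule that)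
 have xN: "x \<in> cset c N" using x N(2) by (simp add: cset_def)
 have "FD (%y. s (pt c x) * psi (pt c x) (pt c y)) x = (%v. s (pt c x) * FD (%y. psi (pt c x) (pt c y)) x v)"
  by (rule FD_eqI) (rule has_derivative_mult_right[OF sm_has_derivative[OF sfunD[OF N(3) c] xN]])
 then show ?thesis by (simp add: dform_def)
qed

end

context hypersurface_in
begin

text \<open>The local extensions \<open>\<Phi> i\<close> are normalised at a base point \<open>b x\<close> of \<open>Z\<close> close to \<open>x\<close> and averaged with
 a partition of unity. Moving the base point inside the connected set \<open>G p\<close> changes all of them by the
 same constant.\<close>

lemma closed_extension:
 assumes theta: "closed_form 1 Z theta"
 obtains W psi where "opn X W" "points Z \<subseteq> W" "X.lexact W psi"
  "!!d y v. d \<in> charts Z ==> y \<in> cimg d ==> FD (%y'. psi (pt d y) (pt d y')) y v = one_form theta d y v"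
proof -
 define good where "good p U Phi Q \<longleftrightarrow> opn X U & p \<in> U & X.sfun U Phi & (\<forall>x\<in>U. Q x \<in> points Z) &
  (\<forall>G. opn Z G --> opn X {x \<in> U. Q x \<in> G}) & (\<forall>z\<in>U. z \<in> points Z --> Q z = z) &
  (\<forall>d\<in>charts Z. \<forall>y\<in>cset d U. \<forall>v. FD (%y. Phi (pt d y)) y v = one_form theta d y v)" for p U Phi Q
 have "\<exists>U Phi Q. good p U Phi Q" if p: "p \<in> points Z" for p
 proof -
  obtain U Phi Q where h: "opn X U" "p \<in> U" "X.sfun U Phi" "!!x. x \<in> U ==> Q x \<in> points Z"
   "!!G. opn Z G ==> opn X {x \<in> U. Q x \<in> G}" "!!z. z \<in> U ==> z \<in> points Z ==> Q z = z"
   "!!d y v. d \<in> charts Z ==> y \<in> cset d U ==> FD (%y. Phi (pt d y)) y v = one_form theta d y v"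
   by (rule local_extension[OF theta p], rule that)
  show ?thesis unfolding good_def
  proof (intro exI conjI)
   show "\<forall>x\<in>U. Q x \<in> points Z" using h(4) by blast
   show "\<forall>G. opn Z G --> opn X {x \<in> U. Q x \<in> G}" using h(5) by blast
   show "\<forall>z\<in>U. z \<in> points Z --> Q z = z" using h(6) by blast
   show "\<forall>d\<in>charts Z. \<forall>y\<in>cset d U. \<forall>v. FD (%y. Phi (pt d y)) y v = one_form theta d y v" using h(7) by blast
  qed (rule h)+
 qed
 then obtain U Phi Q where UQ: "!!p. p \<in> points Z ==> good p (U p) (Phi p) (Q p)" by metis
 have U: "opn X (U p)" "p \<in> U p" "X.sfun (U p) (Phi p)" if "p \<in> points Z" for p using UQ[OF that] unfolding good_def by simp_all
 have QG: "opn X {x \<in> U p. Q p x \<in> G}" if "p \<in> points Z" "opn Z G" for p G using UQ[OF that(1)] that(2) unfolding good_def by simp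
 have Qz: "Q p z = z" if "p \<in> points Z" "z \<in> U p" "z \<in> points Z" for p z using UQ[OF that(1)] that(2,3) unfolding good_def by simp
 have dPhi: "FD (%y. Phi p (pt d y)) y v = one_form theta d y v" if "p \<in> points Z" "d \<in> charts Z" "y \<in> cset d (U p)" for p d y v
  using UQ[OF that(1)] that(2,3) unfolding good_def by simp
 \<comment> \<open>Away from \<open>Z\<close> the cover uses the complement of \<open>Z\<close>, so
   that at points of \<open>Z\<close> only extensions centred on \<open>Z\<close> are
   active.\<close>
 define U' where "U' p = (if p \<in> points Z then U p else points X - points Z)" for p
 have U'o: "opn X (U' p) & p \<in> U' p" if "p \<in> points X" for p
  using U that closed_Z by (auto simp: U'_def)
 obtain I :: "'a set" and zeta K C where I: "finite I" "I \<subseteq> points X"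
  and zeta: "!!i. i \<in> I ==> X.sfun (points X) (zeta i)" "!!i q. i \<in> I ==> q \<in> points X ==> (0::real) <= zeta i q"
  and K: "!!i. i \<in> I ==> closedin (mtop X) (K i)" "!!i. i \<in> I ==> K i \<subseteq> U' i"
  and C: "!!i. i \<in> I ==> C i \<in> charts X" "!!i. i \<in> I ==> K i \<subseteq> dom_of (C i)"
  and zeta0: "!!i q. i \<in> I ==> q \<in> points X ==> q \<notin> K i ==> zeta i q = 0"
  and zeta1: "!!q. q \<in> points X ==> (\<Sum>i\<in>I. zeta i q) = 1"
  by (rule X.partition_of_unity[OF compact U'o], assumption, rule that)
 define A where "A x = {i \<in> I. x \<in> K i}" for x
 have finA: "finite (A x)" "A x \<subseteq> I" for x using I by (auto simp: A_def)
 have neA: "A x ~= {}" if "x \<in> points X" for x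
 proof
  assume "A x = {}"
  then have "zeta i x = 0" if "i \<in> I" for i using zeta0[OF that \<open>x \<in> points X\<close>] that by (auto simp: A_def)
  then show False using zeta1[OF that] by simp
 qed
 have AZ: "i \<in> points Z" "p \<in> U i" if "p \<in> points Z" "i \<in> A p" for p i
 proof -
  have "p \<in> U' i" using that K(2) by (auto simp: A_def)
  then show "i \<in> points Z" "p \<in> U i" using that(1) by (auto simp: U'_def split: if_splits)
 qed
 \<comment> \<open>A coordinate ball in \<open>Z\<close> around \<open>p\<close> will serve as
   \<open>G\<close>: on it the active extensions have the same differential, hence the same
   differences of values.\<close>
 define goodG where "goodG p G \<longleftrightarrow> opn Z G & p \<in> G & (\<forall>i\<in>A p. G \<subseteq> U i) &
   (\<forall>i\<in>A p. \<forall>j\<in>A p. \<forall>z\<in>G. \<forall>z'\<in>G. Phi i z - Phi i z' = Phi j z - Phi j z')" for p G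
 have "\<exists>G. goodG p G" if p: "p \<in> points Z" for p
 proof -
  from Z.ex_chart[OF p] obtain d where d: "d \<in> charts Z" "p \<in> dom_of d" by blast
  define V where "V = points X \<inter> (\<Inter>i\<in>A p. U i)"
  have V: "opn X V"
  proof (cases "A p = {}")
   case False
   have "opn X (\<Inter>i\<in>A p. U i)"
    by (rule openin_Inter) (use False finA[of p] U(1) AZ(1)[OF p] in auto)
   then show ?thesis unfolding V_def by (intro openin_Int openin_topspace)
  qed (simp add: V_def)
  have pV: "p \<in> V" using AZ[OF p] p Z_subset by (auto simp: V_def)
  have "snd d p \<in> cset d V" using d pV Z.pt_chart[OF d] by (simp add: cset_def)
  then obtain rho where rho: "rho > 0" "ball (snd d p) rho \<subseteq> cset d V"
   using open_cset_Z[OF d(1) V] open_contains_ball by blast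
  define B where "B = ball (snd d p) rho"
  define G where "G = {z \<in> dom_of d. snd d z \<in> B}"
  have BV: "B \<subseteq> cset d V" using rho(2) by (simp add: B_def)
  have Gd: "z \<in> dom_of d" "snd d z \<in> B" "pt d (snd d z) = z" "z \<in> V" if "z \<in> G" for z
  proof -
   show z: "z \<in> dom_of d" "snd d z \<in> B" using that by (auto simp: G_def)
   show "pt d (snd d z) = z" by (rule Z.pt_chart[OF d(1) z(1)])
   with BV z show "z \<in> V" unfolding cset_def by force
  qed
  have "Phi i z - Phi i z' = Phi j z - Phi j z'" if ij: "i \<in> A p" "j \<in> A p" and z: "z \<in> G" "z' \<in> G" for i j z z'
  proof -
   have sub: "B \<subseteq> cset d (U k)" if "k \<in> A p" for k using BV that by (auto simp: cset_def V_def)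
   have hd: "((%y. Phi k (pt d y)) has_derivative one_form theta d y) (at y)" if k: "k \<in> A p" and y: "y \<in> B" for k y
   proof -
    have yk: "y \<in> cset d (U k)" using sub[OF k] y by blast
    have "((%y. Phi k (pt d y)) has_derivative FD (%y. Phi k (pt d y)) y) (at y)"
    by (rule sm_has_derivative[OF smooth_restrict[OF U(1) U(3) d(1)] yk]) (use AZ(1)[OF p k] in auto)
    moreover have "FD (%y. Phi k (pt d y)) y = one_form theta d y"
    by (rule ext) (rule dPhi[OF AZ(1)[OF p k] d(1) yk])
    ultimately show ?thesis by simp
   qed
   have "\<exists>k. \<forall>y\<in>B. Phi i (pt d y) - Phi j (pt d y) = k"
   proof (rule has_derivative_zero_constant)
    show "convex B" by (simp add: B_def)
    fix y assume "y \<in> B"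
    from has_derivative_diff[OF hd[OF ij(1) this] hd[OF ij(2) this]]
    show "((%y. Phi i (pt d y) - Phi j (pt d y)) has_derivative (%h. 0)) (at y within B)"
    by (simp add: has_derivative_at_withinI)
   qed
   then obtain k where "!!y. y \<in> B ==> Phi i (pt d y) - Phi j (pt d y) = k" by blast
   from this[OF Gd(2)[OF z(1)]] this[OF Gd(2)[OF z(2)]] show ?thesis using Gd(3) z by simp
  qed
  then have A: "\<forall>i\<in>A p. \<forall>j\<in>A p. \<forall>z\<in>G. \<forall>z'\<in>G. Phi i z - Phi i z' = Phi j z - Phi j z'" by blast
  have B: "opn Z G" unfolding G_def by (rule Z.openin_chart_preimage[OF d(1)]) (simp add: B_def)
  have C: "p \<in> G" using d rho(1) by (simp add: G_def B_def)
  have "G \<subseteq> U i" if "i \<in> A p" for i using Gd(4) that by (auto simp: V_def)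
  then show ?thesis unfolding goodG_def by (intro exI[of _ G] conjI ballI B C, blast) (use A in blast)
 qed
 then obtain G where G': "!!p. p \<in> points Z ==> goodG p (G p)" by metis
 note G = G'[unfolded goodG_def]
 have Gc: "Phi i z - Phi i z' = Phi j z - Phi j z'" if "p \<in> points Z" "i \<in> A p" "j \<in> A p" "z \<in> G p" "z' \<in> G p" for p i j z z'
  using G[OF that(1)] that(2-) by blast
 \<comment> \<open>Near \<open>p\<close> no further index becomes active, and all active projections
   land in \<open>G p\<close>, where differences of values do not depend on the index.\<close>
 define N where "N p = points X \<inter> (\<Inter>i\<in>A p. {x \<in> U i. Q i x \<in> G p}) \<inter> (\<Inter>i\<in>I - A p. points X - K i)" for p
 have oN: "opn X (N p)" if p: "p \<in> points Z" for p
 proof -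
  have 1: "opn X (points X \<inter> (\<Inter>i\<in>A p. {x \<in> U i. Q i x \<in> G p}))"
  proof (cases "A p = {}")
   case False
   have "opn X (\<Inter>i\<in>A p. {x \<in> U i. Q i x \<in> G p})"
    by (rule openin_Inter) (use False finA[of p] QG[OF AZ(1)[OF p]] G[OF p] in auto)
   then show ?thesis by (intro openin_Int openin_topspace)
  qed simp
  show ?thesis
  proof (cases "I - A p = {}")
   case False
   have "opn X (\<Inter>i\<in>I - A p. points X - K i)"
    by (rule openin_Inter) (use False I(1) K(1) in auto)
   then show ?thesis unfolding N_def by (rule openin_Int[OF 1])
  qed (use 1 in \<open>simp add: N_def\<close>)
 qed
 have pN: "p \<in> N p" if p: "p \<in> points Z" for p
  using AZ[OF p] Qz[OF AZ(1)[OF p] AZ(2)[OF p] p] G[OF p] p Z_subset by (auto simp: N_def A_def)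
 have NK: "x \<notin> K i" if "x \<in> N p" "i \<in> I" "i \<notin> A p" for x p i using that unfolding N_def by blast
 have NA: "A x \<subseteq> A p" "x \<in> points X" if x: "x \<in> N p" for x p
 proof
  fix i assume "i \<in> A x"
  then show "i \<in> A p" using NK[OF x, of i] by (auto simp: A_def)
 next
  show "x \<in> points X" using x unfolding N_def by blast
 qed
 have NU: "x \<in> U i" "Q i x \<in> G p" if "x \<in> N p" "i \<in> A p" for x p i using that by (auto simp: N_def)
 \<comment> \<open>The projection is an arbitrary active one; what matters is that its value lies in
   \<open>G p\<close> for every \<open>p\<close> with \<open>x\<close> in
   \<open>N p\<close>.\<close>
 define b where "b x = Q (SOME j. j \<in> A x) x" for x
 have bG: "b x \<in> G p" if "x \<in> N p" for x p
 proof -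
  have "(SOME j. j \<in> A x) \<in> A x" using neA[OF NA(2)[OF that]] by (simp add: some_in_eq)
  then show ?thesis unfolding b_def using NU(2)[OF that] NA(1)[OF that] by blast
 qed
 \<comment> \<open>Subtracting the value at the base point makes the summands equal to each other on
   \<open>Z\<close> near the base point, so that no derivatives of the partition of unity appear in
   the restriction to \<open>Z\<close>.\<close>
 define psi where "psi x y = (\<Sum>i\<in>I \<inter> points Z. zeta i y * (Phi i y - Phi i (b x)))" for x y
 have psiN: "psi x y = (\<Sum>i\<in>A p. zeta i y * (Phi i y - Phi i (b x)))" if p: "p \<in> points Z" and y: "y \<in> N p" for p x y
  unfolding psi_def
 proof (rule sum.mono_neutral_right)
  show "A p \<subseteq> I \<inter> points Z" using AZ(1)[OF p] finA by blast
  show "\<forall>i\<in>I \<inter> points Z - A p. zeta i y * (Phi i y - Phi i (b x)) = 0"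
  proof
   fix i assume i: "i \<in> I \<inter> points Z - A p"
   then have "y \<notin> K i" "y \<in> points X" using NK[OF y] NA(2)[OF y] by blast+
   then show "zeta i y * (Phi i y - Phi i (b x)) = 0" using zeta0[of i y] i by simp
  qed
 qed (use I in simp)
 have zetaN: "(\<Sum>i\<in>A p. zeta i y) = 1" if y: "y \<in> N p" for p y
 proof -
  have "(\<Sum>i\<in>I. zeta i y) = (\<Sum>i\<in>A p. zeta i y)"
   by (rule sum.mono_neutral_right[OF I(1) finA(2)]) (use zeta0 NK[OF y] NA(2)[OF y] in blast)
  then show ?thesis using zeta1[OF NA(2)[OF y]] by simp
 qed
 define W where "W = (\<Union>p\<in>points Z. N p)"
 have W: "opn X W" unfolding W_def by (rule openin_Union) (use oN in auto)
 have sfN: "X.sfun (N p) (psi x)" if p: "p \<in> points Z" for p x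
 proof -
  have 1: "X.sfun (N p) (%y. \<Sum>i\<in>A p. zeta i y * (Phi i y - Phi i (b x)))"
  proof (intro X.sfun_sum X.sfun_mult X.sfun_diff X.sfun_const oN[OF p])
   fix i assume i: "i \<in> A p"
   show "X.sfun (N p) (zeta i)" by (rule X.sfun_subset[OF zeta(1)]) (use i finA(2) NA(2) in blast)+
   show "X.sfun (N p) (Phi i)" by (rule X.sfun_subset[OF U(3)[OF AZ(1)[OF p i]]]) (use NU(1) i in blast)
  qed
  show ?thesis by (rule X.sfun_eq[OF oN[OF p] 1 psiN[OF p]])
 qed
 have lex: "X.lexact W psi"
  unfolding X.lexact_def
 proof
  fix x assume "x \<in> W"
  then obtain p where p: "p \<in> points Z" "x \<in> N p" by (auto simp: W_def)
  have A: "\<exists>k. \<forall>y\<in>N p. psi q y = psi x y + k" if q: "q \<in> N p" for q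
  proof -
   obtain i0 where i0: "i0 \<in> A p" using neA[of p] p Z_subset by blast
   have "psi q y = psi x y + (Phi i0 (b x) - Phi i0 (b q))" if y: "y \<in> N p" for y
   proof -
    have "psi q y - psi x y = (\<Sum>i\<in>A p. zeta i y * (Phi i (b x) - Phi i (b q)))"
    unfolding psiN[OF p(1) y] by (simp add: sum_subtractf[symmetric] algebra_simps)
    also have "... = (\<Sum>i\<in>A p. zeta i y * (Phi i0 (b x) - Phi i0 (b q)))"
    by (rule sum.cong[OF refl]) (simp add: Gc[OF p(1) _ i0 bG[OF p(2)] bG[OF q]])
    also have "... = Phi i0 (b x) - Phi i0 (b q)" using zetaN[OF y] by (simp add: sum_distrib_right[symmetric])
    finally show ?thesis by simp
   qed
   then show ?thesis by blast
  qed
  have "N p \<subseteq> W" using p(1) by (auto simp: W_def)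
  then show "\<exists>N. opn X N & x \<in> N & N \<subseteq> W & X.sfun N (psi x) & (\<forall>q\<in>N. \<exists>k. \<forall>y\<in>N. psi q y = psi x y + k)"
   by (intro exI[of _ "N p"] conjI ballI A oN[OF p(1)] p(2) sfN[OF p(1)])
 qed
 have R: "FD (%y'. psi (pt d y) (pt d y')) y v = one_form theta d y v" if d: "d \<in> charts Z" and y: "y \<in> cimg d" for d y v
 proof -
  let ?p = "pt d y"
  have p: "?p \<in> points Z" by (rule Z.pt_points[OF d y])
  obtain i where i: "i \<in> A ?p" using neA[of ?p] p Z_subset by blast
  define k where "k = Phi i (b ?p)"
  have eq: "psi ?p z = Phi i z - k" if z: "z \<in> N ?p" "z \<in> points Z" for z
  proof -
   have zG: "z \<in> G ?p" if "i \<in> A ?p" for i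
    using NU[OF z(1) that] Qz[OF AZ(1)[OF p that] _ z(2)] by simp
   have "psi ?p z = (\<Sum>j\<in>A ?p. zeta j z * (Phi i z - Phi i (b ?p)))"
    unfolding psiN[OF p z(1)] by (rule sum.cong[OF refl]) (simp add: Gc[OF p _ i zG[OF i] bG[OF pN[OF p]]])
   then show ?thesis using zetaN[OF z(1)] by (simp add: sum_distrib_right[symmetric] k_def)
  qed
  have o: "open (cset d (N ?p))" by (rule open_cset_Z[OF d oN[OF p]])
  have yN: "y \<in> cset d (N ?p)" using y pN[OF p] by (simp add: cset_def)
  have yU: "y \<in> cset d (U i)" using y AZ(2)[OF p i] by (simp add: cset_def)
  have "FD (%y'. psi ?p (pt d y')) y = FD (%y'. Phi i (pt d y') - k) y"
  proof (rule FD_cong[OF o yN])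
   fix y' assume "y' \<in> cset d (N ?p)"
   then show "psi ?p (pt d y') = Phi i (pt d y') - k"
    using eq Z.pt_points[OF d, of y'] by (simp add: cset_def)
  qed
  also have "... = FD (%y'. Phi i (pt d y')) y"
  proof (rule FD_eqI)
   have "((%y'. Phi i (pt d y')) has_derivative FD (%y'. Phi i (pt d y')) y) (at y)"
    by (rule sm_has_derivative[OF smooth_restrict[OF U(1) U(3) d] yU]) (use AZ(1)[OF p i] in auto)
   from has_derivative_diff[OF this has_derivative_const[of k]]
   show "((%y'. Phi i (pt d y') - k) has_derivative FD (%y'. Phi i (pt d y')) y) (at y)" by simp
  qed
  finally show ?thesis using dPhi[OF AZ(1)[OF p i] d yU] by simp
 qed
 have ZW: "points Z \<subseteq> W" using pN by (auto simp: W_def)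
 show thesis by (rule that[OF W ZW lex R])
qed

end

section \<open>Two-forms and bivectors as bilinear maps\<close>

lemma pair_simps [simp]: "pair x y 0 = x" "pair x y (Suc i) = y" by (simp_all add: pair_def)

lemma alt_form_2:
 assumes f: "alt_form 2 f" shows "alt2 (%u v. f (pair u v))" "f = bform (%u v. f (pair u v))"
proof -
 have less2: "i = 0 \<or> i = Suc 0" if "i < 2" for i :: nat using that by linarith
 have "linear (%x. f (pair u x))" for u
 proof -
  have "f ((pair u u)(1 := x)) = f (pair u x)" for x by (rule alt_formD(1)[OF f]) (auto dest!: less2)
  then show ?thesis using alt_formD(2)[OF f, of 1 "pair u u"] by simp
 qed
 moreover have "linear (%x. f (pair x u))" for u
 proof -
  have "f ((pair u u)(0 := x)) = f (pair x u)" for x by (rule alt_formD(1)[OF f]) (auto dest!: less2)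
  then show ?thesis using alt_formD(2)[OF f, of 0 "pair u u"] by simp
 qed
 moreover have "f (pair u u) = 0" for u using alt_formD(3)[OF f, of 0 1 "pair u u"] by simp
 ultimately show "alt2 (%u v. f (pair u v))" unfolding alt2_def by blast
 show "f = bform (%u v. f (pair u v))"
 proof
  fix v show "f v = bform (%u v. f (pair u v)) v"
   unfolding bform_def by (rule alt_formD(1)[OF f]) (auto dest!: less2)
 qed
qed

lemma alt_form_bform: assumes w: "alt2 w" shows "alt_form 2 (bform w)"
proof -
 have less2: "i = 0 \<or> i = Suc 0" if "i < 2" for i :: nat using that by linarith
 have "linear (%x. bform w (v(i := x)))" if "i < 2" for v i
  using less2[OF that] alt2D(1,2)[OF w] by (auto simp: bform_def)
 moreover have "bform w v = 0" if "i < 2" "j < 2" "i ~= j" "v i = v j" for v i j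
  using less2[OF that(1)] less2[OF that(2)] that(3,4) alt2D(3)[OF w] by (auto simp: bform_def)
 ultimately show ?thesis unfolding alt_form_def by (auto simp: bform_def)
qed

lemma dualv_inner [simp]: "dualv (%y. x \<bullet> y) = x"
 unfolding dualv_def by (rule euclidean_representation)

lemma dualv_blinfun_inner_left [simp]: "dualv (blinfun_apply (blinfun_inner_left x)) = x"
 by (simp add: dualv_def inner_commute[of _ x] euclidean_representation)

lemma linear_blinfun: "linear (blinfun_apply f)" by (rule bounded_linear.linear[OF blinfun.bounded_linear_right])

lemma inner_dualv_blinfun: "dualv (blinfun_apply a) \<bullet> y = blinfun_apply a y"
 by (rule inner_dualv[OF linear_blinfun])

lemma blinfun_inner_left_dualv [simp]: "blinfun_inner_left (dualv (blinfun_apply a)) = a"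
 by (rule blinfun_eqI) (simp add: inner_commute[of _ "dualv (blinfun_apply a)"] inner_dualv_blinfun)

lemma linear_dualv: "linear (%a. dualv (blinfun_apply a))"
 by (rule linearI) (simp_all add: dualv_def blinfun.add_left blinfun.scaleR_left scaleR_left_distrib sum.distrib scaleR_sum_right)

lemma linear_blinfun_inner_left: "linear blinfun_inner_left"
 by (rule linearI) (auto intro!: blinfun_eqI simp: inner_add_left inner_add_right blinfun.add_left blinfun.scaleR_left)

lemma alt2_compose: "alt2 w ==> linear T ==> alt2 (%u v. w (T u) (T v))"
 unfolding alt2_def by (auto simp: linear_iff)

lemma bform_dualv:
 assumes "alt_form 2 (f :: ('e::euclidean_space \<Rightarrow>\<^sub>L real) form)"
 shows "alt2 (%u v. f (pair (blinfun_inner_left u) (blinfun_inner_left v)))"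
  "f a = f (pair (blinfun_inner_left (dualv (blinfun_apply (a 0)))) (blinfun_inner_left (dualv (blinfun_apply (a 1)))))"
proof -
 show "alt2 (%u v. f (pair (blinfun_inner_left u) (blinfun_inner_left v)))"
  by (rule alt2_compose[OF alt_form_2(1)[OF assms] linear_blinfun_inner_left])
 show "f a = f (pair (blinfun_inner_left (dualv (blinfun_apply (a 0)))) (blinfun_inner_left (dualv (blinfun_apply (a 1)))))"
  using alt_form_2(2)[OF assms] by (simp add: bform_def) metis
qed

lemma wedge_power_dual:
 "wedge_power (%a. P (dualv (blinfun_apply (a 0))) (dualv (blinfun_apply (a 1)))) m a =
  wedge_power (bform P) m (%i. dualv (blinfun_apply (a i)))"
proof -
 have "(%a. P (dualv (blinfun_apply (a 0))) (dualv (blinfun_apply (a 1)))) = bform (%a b. P (dualv (blinfun_apply a)) (dualv (blinfun_apply b)))"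
  by (simp add: bform_def)
 then show ?thesis unfolding wedge_power_bform by (simp add: wedge_power_bform)
qed

lemma linear_FD: "f differentiable (at x) ==> linear (FD f x)"
 by (rule has_derivative_linear[OF iffD1[OF frechet_derivative_works]])

lemma FD_sum_coeffs:
 fixes f :: "'i => 'a::real_normed_vector => real"
 assumes "!!i. i \<in> I ==> f i differentiable (at x)"
 shows "FD (%y. \<Sum>i\<in>I. c i * f i y) x h = (\<Sum>i\<in>I. c i * FD (f i) x h)"
 using FD_eqI[OF has_derivative_sum[of I "%i y. c i * f i y" "%i h. c i * FD (f i) x h" "at x"]]
  has_derivative_mult_right[OF iffD1[OF frechet_derivative_works[of _ "at x"] assms]] by fastforce

lemma FD_linear_slot:
 fixes Q :: "'e::euclidean_space => 'e => real"
 assumes "open S" "x \<in> S" "!!y. y \<in> S ==> linear (Q y)" "!!v. (%y. Q y v) differentiable (at x)"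
 shows "FD (%y. Q y v) x h = (\<Sum>b\<in>Basis. (v \<bullet> b) * FD (%y. Q y b) x h)"
proof -
 have "FD (%y. Q y v) x = FD (%y. \<Sum>b\<in>Basis. (v \<bullet> b) * Q y b) x"
  by (rule FD_cong[OF assms(1,2)]) (use linear_basis_expand[OF assms(3)] in simp)
 then show ?thesis by (simp add: FD_sum_coeffs assms(4))
qed

lemma FD_linear:
 fixes Q :: "'e::euclidean_space => 'e => real"
 assumes "open S" "x \<in> S" "!!y. y \<in> S ==> linear (Q y)" "!!v. (%y. Q y v) differentiable (at x)"
 shows "linear (%v. FD (%y. Q y v) x h)"
proof -
 have "(%v. FD (%y. Q y v) x h) = (%v. \<Sum>b\<in>Basis. (v \<bullet> b) * FD (%y. Q y b) x h)"
  by (rule ext, rule FD_linear_slot[OF assms])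
 moreover have "linear (%v. \<Sum>b\<in>Basis. (v \<bullet> b) * k b)" for k :: "'e => real"
  by (rule linearI) (simp_all add: inner_add_left algebra_simps sum.distrib sum_distrib_left)
 ultimately show ?thesis by simp
qed

text \<open>The pairing of the vector \<open>Q y a1\<close> with \<open>u2\<close> under
  \<open>w y\<close> is constantly \<open>a1 \<bullet> u2\<close>, as \<open>Q\<close> and
  \<open>w\<close> are inverse. Its derivative at \<open>x\<close>, where \<open>u1\<close> and
  \<open>u2\<close> correspond to \<open>a1\<close> and \<open>a2\<close>, is the claim.\<close>

lemma FD_inverse_pair:
 fixes Q w :: "'e::euclidean_space => 'e => 'e => real"
 assumes S: "open S" "x \<in> S" and alt: "!!y. y \<in> S ==> alt2 (Q y)" "!!y. y \<in> S ==> alt2 (w y)"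
  and ip: "!!y. y \<in> S ==> ipair (Q y) (w y)"
  and sm: "!!u v. smo S (%y. Q y u v)" "!!u v. smo S (%y. w y u v)"
  and u: "!!z. w x u1 z = a1 \<bullet> z" "!!z. w x u2 z = a2 \<bullet> z"
 shows "FD (%y. w y u1 u2) x h = FD (%y. Q y a1 a2) x h"
proof -
 have dQ: "(%y. Q y a b) differentiable (at x)" and dw: "(%y. w y a b) differentiable (at x)" for a b
  using sm_diffble[OF sm(1) S(2)] sm_diffble[OF sm(2) S(2)] by auto
 have Qu: "Q x a1 z = u1 \<bullet> z" for z using ip[OF S(2)] u(1) unfolding ipair_def by blast
 have const: "(\<Sum>b\<in>Basis. Q y a1 b * w y b u2) = a1 \<bullet> u2" if y: "y \<in> S" for y
 proof -
  define s where "s = dualv (Q y a1)"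
  have s: "Q y a1 z = s \<bullet> z" for z unfolding s_def by (rule inner_dualv[OF alt2D(1)[OF alt(1)[OF y]], symmetric])
  then have "w y s u2 = a1 \<bullet> u2" using ip[OF y] unfolding ipair_def by blast
  moreover have "w y s u2 = (\<Sum>b\<in>Basis. Q y a1 b * w y b u2)"
   using linear_basis_expand[OF alt2D(2)[OF alt(2)[OF y], of u2], of s] s by simp
  ultimately show ?thesis by simp
 qed
 have "((%y. \<Sum>b\<in>Basis. Q y a1 b * w y b u2) has_derivative
   (%h. \<Sum>b\<in>Basis. Q x a1 b * FD (%y. w y b u2) x h + FD (%y. Q y a1 b) x h * w x b u2)) (at x)"
  by (intro has_derivative_sum has_derivative_mult iffD1[OF frechet_derivative_works] dQ dw)
 then have "FD (%y. \<Sum>b\<in>Basis. Q y a1 b * w y b u2) x h =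
   (\<Sum>b\<in>Basis. Q x a1 b * FD (%y. w y b u2) x h + FD (%y. Q y a1 b) x h * w x b u2)"
  by (simp add: FD_eqI)
 moreover have "FD (%y. \<Sum>b\<in>Basis. Q y a1 b * w y b u2) x = FD (%_. a1 \<bullet> u2) x" by (rule FD_cong[OF S const])
 moreover have "(\<Sum>b\<in>Basis. Q x a1 b * FD (%y. w y b u2) x h) = FD (%y. w y u1 u2) x h"
  using FD_linear_slot[OF S, of "%y u. w y u u2" u1 h] alt2D(2)[OF alt(2)] dw Qu by simp
 moreover have "w x b u2 = - (a2 \<bullet> b)" for b using alt2_antisym[OF alt(2)[OF S(2)], of u2 b] u(2) by simp
 moreover have "(\<Sum>b\<in>Basis. FD (%y. Q y a1 b) x h * (- (a2 \<bullet> b))) = - FD (%y. Q y a1 a2) x h"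
  using FD_linear_slot[OF S, of "%y. Q y a1" a2 h] alt2D(1)[OF alt(1)] dQ by (simp add: sum_negf mult.commute)
 ultimately show ?thesis by (simp add: sum.distrib sum_subtractf sum_negf)
qed

definition dext :: "('e::euclidean_space => 'e => 'e => real) => 'e => 'e => 'e => 'e => real" where
 "dext w x a b c = FD (%y. w y b c) x a - FD (%y. w y a c) x b + FD (%y. w y a b) x c"

lemma ext_deriv_bform: "ext_deriv 2 (%y. bform (w y)) x v = dext w x (v 0) (v 1) (v 2)"
 unfolding ext_deriv_def dext_def bform_def by (simp add: numeral_2_eq_2 atMost_Suc)

text \<open>The Jacobiator of the bracket defined by \<open>Q\<close>, half of the Schouten bracket
  of \<open>Q\<close> with itself.\<close>

definition jac :: "('e::euclidean_space => 'e => 'e => real) => 'e => 'e => 'e => 'e => real" where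
 "jac Q x a b c = (\<Sum>e\<in>Basis. Q x a e * FD (%y. Q y b c) x e + Q x b e * FD (%y. Q y c a) x e + Q x c e * FD (%y. Q y a b) x e)"

lemma FD_antisym:
 fixes w :: "'e::euclidean_space => 'e => 'e => real"
 assumes "open S" "x \<in> S" "!!y. y \<in> S ==> alt2 (w y)" "(%y. w y a b) differentiable (at x)"
 shows "FD (%y. w y b a) x h = - FD (%y. w y a b) x h"
proof -
 have "FD (%y. w y b a) x = FD (%y. - w y a b) x"
  by (rule FD_cong[OF assms(1,2)]) (rule alt2_antisym[OF assms(3)])
 moreover have "FD (%y. - w y a b) x = (%h. - FD (%y. w y a b) x h)"
  by (rule FD_eqI[OF has_derivative_minus[OF iffD1[OF frechet_derivative_works assms(4)]]])
 ultimately show ?thesis by simp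
qed

text \<open>\<open>Q x a0\<close> is the vector \<open>u0\<close>, so contracting derivatives of
  \<open>Q\<close> with it is differentiation along \<open>u0\<close>; then
  \<open>FD_inverse_pair\<close> trades derivatives of \<open>Q\<close> for those of
  \<open>w\<close>. The Jacobi identity for \<open>Q\<close> and the closedness of \<open>w\<close>
  thus become the same condition.\<close>

lemma jac_eq_dext:
 fixes Q w :: "'e::euclidean_space => 'e => 'e => real"
 assumes S: "open S" "x \<in> S" and alt: "!!y. y \<in> S ==> alt2 (Q y)" "!!y. y \<in> S ==> alt2 (w y)"
  and ip: "!!y. y \<in> S ==> ipair (Q y) (w y)"
  and sm: "!!u v. smo S (%y. Q y u v)" "!!u v. smo S (%y. w y u v)"
  and u: "!!z. w x u0 z = a0 \<bullet> z" "!!z. w x u1 z = a1 \<bullet> z" "!!z. w x u2 z = a2 \<bullet> z"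
 shows "jac Q x a0 a1 a2 = dext w x u0 u1 u2"
proof -
 have F: "FD (%y. w y v z) x h = FD (%y. Q y b c) x h" if "!!y. w x v y = b \<bullet> y" "!!y. w x z y = c \<bullet> y" for v z b c h
  by (rule FD_inverse_pair[OF S alt ip sm that])
 have key: "(\<Sum>e\<in>Basis. Q x a e * FD (%y. Q y b c) x e) = FD (%y. w y v z) x u"
  if "!!z. w x u z = a \<bullet> z" "!!z. w x v z = b \<bullet> z" "!!y. w x z y = c \<bullet> y" for a b c u v z
 proof -
  have Qu: "Q x a y = u \<bullet> y" for y using ip[OF S(2)] that(1) unfolding ipair_def by blast
  have l: "linear (FD (%y. Q y b c) x)" by (rule linear_FD[OF sm_diffble[OF sm(1) S(2)]])
  have "(\<Sum>e\<in>Basis. Q x a e * FD (%y. Q y b c) x e) = FD (%y. Q y b c) x u"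
   using linear_basis_expand[OF l, of u] Qu by simp
  also have "... = FD (%y. w y v z) x u" by (rule F[OF that(2,3), symmetric])
  finally show ?thesis .
 qed
 have "jac Q x a0 a1 a2 = FD (%y. w y u1 u2) x u0 + FD (%y. w y u2 u0) x u1 + FD (%y. w y u0 u1) x u2"
  unfolding jac_def sum.distrib key[OF u(1,2,3)] key[OF u(2,3,1)] key[OF u(3,1,2)] ..
 moreover have "FD (%y. w y u2 u0) x u1 = - FD (%y. w y u0 u2) x u1"
  by (rule FD_antisym[OF S alt(2) sm_diffble[OF sm(2) S(2)]])
 ultimately show ?thesis by (simp add: dext_def)
qed

text \<open>The six permutations agree in pairs that differ by exchanging the arguments of
  \<open>g\<close>, which absorbs the factor \<open>fact 2\<close>.\<close>

lemma wedge_1_2_cyclic: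
 assumes f: "!!a. f a = f' (a 0)" and g: "!!a. g a = g' (a 0) (a 1)" "!!x y. g' y x = - g' x y"
 shows "wedge 1 2 f g a = f' (a 0) * g' (a 1) (a 2) + f' (a 1) * g' (a 2) (a 0) + f' (a 2) * g' (a 0) (a 1)"
proof -
 have s: "{..<1 + 2 :: nat} = insert 0 (insert 1 {2})" by auto
 have "wedge 1 2 f g a = (\<Sum>sig | sig permutes insert 0 (insert 1 {2}). of_int (sign sig) * f' (a (sig 0)) * g' (a (sig 1)) (a (sig 2))) / 2"
  unfolding wedge_def s by (simp add: f g(1) numeral_2_eq_2)
 also have "... = f' (a 0) * g' (a 1) (a 2) + f' (a 1) * g' (a 2) (a 0) + f' (a 2) * g' (a 0) (a 1)"
  unfolding sum_over_permutations_insert[of "insert 1 {2::nat}" 0] 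
  by (simp add: sum_over_permutations_insert sign_swap_id permutation_swap_id sign_compose sign_id swap_id_eq permutes_sing
    g(2)[of "a 2" "a (Suc 0)"] g(2)[of "a 0" "a 2"] g(2)[of "a (Suc 0)" "a 0"] Transposition.transpose_def)
 finally show ?thesis .
qed

lemma alt2_dPf:
 fixes w :: "'e::euclidean_space => 'e => real"
 assumes dim: "DIM('e) = 2 * n" and w: "alt2 w"
 shows "alt2 (%x y. dPf n w (%z. x \<bullet> z) (%z. y \<bullet> z))"
proof -
 let ?d = "%x y. dPf n w (%z. x \<bullet> z) (%z. y \<bullet> z)"
 have 1: "linear (?d x)" for x
 proof (rule linearI)
  show "?d x (y + z) = ?d x y + ?d x z" for y z
   using dPf_linear[OF dim w linear_inner[of x] linear_inner[of y] linear_inner[of z], of 1] by (simp add: inner_add_left)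
  have "linear (%_. 0 :: real)" by (simp add: linear_iff)
  from dPf_linear[OF dim w linear_inner[of x] this linear_inner]
  have "?d x (c *\<^sub>R y) = dPf n w (%z. x \<bullet> z) (%_. 0) + c * ?d x y" for c y by simp
  moreover have "dPf n w (%z. x \<bullet> z) (%_. 0) = 0" by (simp add: dPf_def upd_def)
  ultimately show "?d x (c *\<^sub>R y) = c *\<^sub>R ?d x y" for c y by simp
 qed
 have eq: "?d x y = - ?d y x" for x y by (rule dPf_antisym[OF dim w linear_inner linear_inner])
 have "linear (%x. - ?d y x)" for y using linear_mult_right[OF 1, of "-1" y] by simp
 moreover have "(%x. ?d x y) = (%x. - ?d y x)" for y by (rule ext) (rule eq)
 ultimately have "linear (%x. ?d x y)" for y by simp
 moreover have "?d x x = 0" for x by (rule dPf_self[OF dim w])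
 ultimately show ?thesis unfolding alt2_def using 1 by blast
qed

lemma sm_Pf:
 fixes w :: "'a::euclidean_space => 'e::euclidean_space => 'e => real"
 assumes "open S" "!!u v. smo S (%x. w x u v)" shows "smo S (%x. Pf n (w x))"
 unfolding Pf_def wedge_power_bform
 by (intro sm_divide sm_sum sm_mult sm_prod sm_const assms) simp

lemma sm_dPf:
 fixes w :: "'a::euclidean_space => 'e::euclidean_space => 'e => real"
 assumes "open S" "!!u v. smo S (%x. w x u v)" "!!u. smo S (%x. a x u)" "!!u. smo S (%x. b x u)"
 shows "smo S (%x. dPf n (w x) (a x) (b x))"
 unfolding dPf_def upd_def
 by (intro sm_diff sm_Pf sm_add sm_mult sm_const assms)

text \<open>\<open>F\<close> has nonzero derivative at its zeros, so the zero set contains no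
  nonempty open set, and a continuous function that vanishes off it vanishes on it too.\<close>

lemma zero_dense:
 fixes F :: "'a::euclidean_space => real" and f :: "'a => real"
 assumes S: "open S" and nd: "!!x. x \<in> S ==> F x = 0 ==> \<exists>e. FD F x e ~= 0"
  and f: "continuous_on S f" and z: "!!x. x \<in> S ==> F x ~= 0 ==> f x = 0" and x: "x \<in> S"
 shows "f x = 0"
proof (rule ccontr)
 assume ne: "f x ~= 0"
 define T where "T = S \<inter> f -` (- {0})"
 have T: "open T" unfolding T_def by (rule continuous_open_preimage[OF f S]) auto
 have xT: "x \<in> T" using x ne by (simp add: T_def)
 have F0: "F y = 0" if "y \<in> T" for y using that z by (auto simp: T_def)
 then have "FD F x = FD (%_. 0) x" by (intro FD_cong[OF T xT])
 then have "FD F x e = 0" for e by simp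
 then show False using nd[OF x F0[OF xT]] by blast
qed

section \<open>Fields of two-forms and bivectors on a manifold\<close>

context smooth_mfd
begin

definition cur :: "('a, 'e, 'e) field => ('a, 'e) chart => 'e => 'e => 'e => real" where
 "cur omega c x u v = omega c x (pair u v)"

definition unc :: "(('a, 'e) chart => 'e => 'e => 'e => real) => ('a, 'e, 'e) field" where
 "unc w c x = bform (w c x)"

definition curp :: "('a, 'e, 'e \<Rightarrow>\<^sub>L real) field => ('a, 'e) chart => 'e => 'e => 'e => real" where
 "curp \<pi> c x u v = \<pi> c x (pair (blinfun_inner_left u) (blinfun_inner_left v))"

definition uncp :: "(('a, 'e) chart => 'e => 'e => 'e => real) => ('a, 'e, 'e \<Rightarrow>\<^sub>L real) field" where
 "uncp P c x a = P c x (dualv (blinfun_apply (a 0))) (dualv (blinfun_apply (a 1)))"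

definition two_field :: "(('a, 'e) chart => 'e => 'e => 'e => real) => bool" where
 "two_field w \<longleftrightarrow> (\<forall>c\<in>charts M. (\<forall>x\<in>cimg c. alt2 (w c x)) & (\<forall>u v. smo (cimg c) (%x. w c x u v)))"

definition covariant :: "(('a, 'e) chart => 'e => 'e => 'e => real) => bool" where
 "covariant w \<longleftrightarrow> (\<forall>c\<in>charts M. \<forall>d\<in>charts M. \<forall>x\<in>overlap c d. \<forall>u v.
   w c x u v = w d (trn c d x) (FD (trn c d) x u) (FD (trn c d) x v))"

text \<open>The \<open>dualv\<close> terms are the images of the covectors \<open>a\<close> and
  \<open>b\<close> under the transpose of the derivative of the transition.\<close>

definition contravariant :: "(('a, 'e) chart => 'e => 'e => 'e => real) => bool" where
 "contravariant P \<longleftrightarrow> (\<forall>c\<in>charts M. \<forall>d\<in>charts M. \<forall>x\<in>overlap c d. \<forall>a b.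
   P d (trn c d x) a b =
   P c x (dualv (%u. a \<bullet> FD (trn c d) x u)) (dualv (%u. b \<bullet> FD (trn c d) x u)))"

definition regular_zeros :: "nat => (('a, 'e) chart => 'e => 'e => 'e => real) => bool" where
 "regular_zeros n w \<longleftrightarrow> (\<forall>c\<in>charts M. \<forall>x\<in>cimg c. Pf n (w c x) = 0 --> (\<exists>e. FD (%y. Pf n (w c y)) x e ~= 0))"

definition zeros_at :: "nat => (('a, 'e) chart => 'e => 'e => 'e => real) => 'a set => bool" where
 "zeros_at n w A \<longleftrightarrow> (\<forall>c\<in>charts M. \<forall>x\<in>cimg c. Pf n (w c x) = 0 \<longleftrightarrow> pt c x \<in> A)"

lemma diff_form_2D:
 assumes "diff_form 2 M omega"
 shows "two_field (cur omega)" "covariant (cur omega)" "c \<in> charts M ==> x \<in> cimg c ==> omega c x = bform (cur omega c x)"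
proof -
 have tf: "!!c x. c \<in> charts M ==> x \<in> cimg c ==> alt_form 2 (omega c x)"
  "!!c v. c \<in> charts M ==> smo (cimg c) (%x. omega c x v)"
  using assms unfolding diff_form_def tensor_field_def by blast+
 show b: "omega c x = bform (cur omega c x)" if "c \<in> charts M" "x \<in> cimg c" for c x
  using alt_form_2(2)[OF tf(1)[OF that]] by (simp add: cur_def[abs_def])
 show "two_field (cur omega)" unfolding two_field_def
  using alt_form_2(1)[OF tf(1)] tf(2) by (simp add: cur_def[abs_def])
 show "covariant (cur omega)" unfolding covariant_def
 proof (intro ballI allI)
  fix c d x u v assume c: "c \<in> charts M" "d \<in> charts M" and x: "x \<in> overlap c d"
  have "cur omega c x u v = omega d (trn c d x) (%i. FD (trn c d) x (pair u v i))"
   using assms c x unfolding diff_form_def cur_def by blast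
  then show "cur omega c x u v = cur omega d (trn c d x) (FD (trn c d) x u) (FD (trn c d) x v)"
   unfolding b[OF c(2) trn_ov(5)[OF c x]] by (simp add: bform_def)
 qed
qed

lemma diff_form_2I:
 assumes w: "two_field w" "covariant w"
 shows "diff_form 2 M (unc w)"
 unfolding diff_form_def tensor_field_def
proof (intro conjI ballI allI)
 fix c assume c: "c \<in> charts M"
 show "alt_form 2 (unc w c x)" if "x \<in> cimg c" for x
  using w(1) c that alt_form_bform unfolding two_field_def unc_def by blast
 show "smo (cimg c) (%x. unc w c x v)" for v
  using w(1) c unfolding two_field_def unc_def bform_def by blast
 show "unc w c x v = unc w d (trn c d x) (%i. FD (trn c d) x (v i))"
  if "d \<in> charts M" "x \<in> overlap c d" for d x v
  using w(2) c that unfolding covariant_def unc_def bform_def by blast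
qed

lemma cur_unc [simp]: "cur (unc w) = w"
 by (simp add: cur_def unc_def bform_def fun_eq_iff)

lemma closed_form_2:
 assumes "diff_form 2 M omega"
 shows "closed_form 2 M omega \<longleftrightarrow> (\<forall>c\<in>charts M. \<forall>x\<in>cimg c. \<forall>a b e. dext (cur omega c) x a b e = 0)"
proof -
 have "ext_deriv 2 (omega c) x v = dext (cur omega c) x (v 0) (v 1) (v 2)" if c: "c \<in> charts M" and x: "x \<in> cimg c" for c x v
 proof -
  have "FD (%y. omega c y u) x = FD (%y. bform (cur omega c y) u) x" for u
   by (rule FD_cong[OF open_coord[OF c] x]) (simp add: diff_form_2D(3)[OF assms c])
  then show ?thesis unfolding ext_deriv_bform[symmetric] unfolding ext_deriv_def by simp
 qed
 moreover have "\<exists>v :: nat => 'e. v 0 = a & v 1 = b & v 2 = e" for a b e :: 'e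
  by (rule exI[of _ "%i::nat. if i = 0 then a else if i = 1 then b else e"]) simp
 ultimately show ?thesis using assms unfolding closed_form_def fun_eq_iff by (metis (no_types, opaque_lifting))
qed

end

lemma dualv_inner' [simp]: "dualv (%y. y \<bullet> x) = x"
 by (simp add: dualv_def inner_commute[of _ x] euclidean_representation)

context smooth_mfd
begin

lemma linear_transition_FD: "c \<in> charts M ==> d \<in> charts M ==> x \<in> overlap c d ==> linear (FD (trn c d) x)"
 by (rule sm_linear_FD[OF sm_trn])

lemma Blinfun_transition:
 assumes "c \<in> charts M" "d \<in> charts M" "x \<in> overlap c d"
 shows "blinfun_apply (Blinfun (FD (trn c d) x)) = FD (trn c d) x"
 using linear_transition_FD[OF assms] by (simp add: bounded_linear_Blinfun_apply linear_conv_bounded_linear)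

lemma inj_transition_FD:
 assumes "c \<in> charts M" "d \<in> charts M" "x \<in> overlap c d" shows "inj (FD (trn c d) x)"
 by (rule injI) (metis transition_inverse_FD[OF assms])

lemma multivector_2D:
 assumes "multivector_field 2 M \<pi>"
 shows "two_field (curp \<pi>)" "contravariant (curp \<pi>)"
  "c \<in> charts M ==> x \<in> cimg c ==> \<pi> c x a = curp \<pi> c x (dualv (blinfun_apply (a 0))) (dualv (blinfun_apply (a 1)))"
proof -
 have tf: "!!c x. c \<in> charts M ==> x \<in> cimg c ==> alt_form 2 (\<pi> c x)"
  "!!c v. c \<in> charts M ==> smo (cimg c) (%x. \<pi> c x v)"
  using assms unfolding multivector_field_def tensor_field_def by blast+
 show b: "\<pi> c x a = curp \<pi> c x (dualv (blinfun_apply (a 0))) (dualv (blinfun_apply (a 1)))"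
  if "c \<in> charts M" "x \<in> cimg c" for c x a
  unfolding curp_def by (rule bform_dualv(2)[OF tf(1)[OF that]])
 show "two_field (curp \<pi>)" unfolding two_field_def
  using bform_dualv(1)[OF tf(1)] tf(2) by (simp add: curp_def[abs_def])
 show "contravariant (curp \<pi>)" unfolding contravariant_def
 proof (intro ballI allI)
  fix c d x and a a' :: 'e assume c: "c \<in> charts M" "d \<in> charts M" and x: "x \<in> overlap c d"
  let ?p = "pair (blinfun_inner_left a) (blinfun_inner_left a')"
  have "curp \<pi> d (trn c d x) a a' = \<pi> c x (%i. ?p i o\<^sub>L Blinfun (FD (trn c d) x))"
   using assms c x unfolding multivector_field_def curp_def by blast
  also have "... = curp \<pi> c x (dualv (blinfun_apply (?p 0 o\<^sub>L Blinfun (FD (trn c d) x)))) (dualv (blinfun_apply (?p 1 o\<^sub>L Blinfun (FD (trn c d) x))))"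
   by (rule b[OF c(1) trn_ov(4)[OF c x]])
  also have "blinfun_apply (?p 0 o\<^sub>L Blinfun (FD (trn c d) x)) = (%u. a \<bullet> FD (trn c d) x u)"
   by (auto simp: Blinfun_transition[OF c x] inner_commute)
  also have "blinfun_apply (?p 1 o\<^sub>L Blinfun (FD (trn c d) x)) = (%u. a' \<bullet> FD (trn c d) x u)"
   by (auto simp: Blinfun_transition[OF c x] inner_commute)
  finally show "curp \<pi> d (trn c d x) a a' =
   curp \<pi> c x (dualv (%u. a \<bullet> FD (trn c d) x u)) (dualv (%u. a' \<bullet> FD (trn c d) x u))" .
 qed
qed

lemma multivector_2I:
 assumes P: "two_field P" "contravariant P"
 shows "multivector_field 2 M (uncp P)"
 unfolding multivector_field_def tensor_field_def
proof (intro conjI ballI allI)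
 fix c assume c: "c \<in> charts M"
 show "alt_form 2 (uncp P c x)" if x: "x \<in> cimg c" for x
 proof -
  have "alt2 (P c x)" using P(1) c x unfolding two_field_def by blast
  from alt_form_bform[OF alt2_compose[OF this linear_dualv]]
  show ?thesis by (simp add: bform_def uncp_def[abs_def])
 qed
 show "smo (cimg c) (%x. uncp P c x v)" for v
  using P(1) c unfolding two_field_def uncp_def by blast
 show "uncp P d (trn c d x) a = uncp P c x (%i. a i o\<^sub>L Blinfun (FD (trn c d) x))"
  if d: "d \<in> charts M" and x: "x \<in> overlap c d" for d x a
 proof -
  have e: "blinfun_apply (a i o\<^sub>L Blinfun (FD (trn c d) x)) = (%u. dualv (blinfun_apply (a i)) \<bullet> FD (trn c d) x u)" for i
   by (auto simp: Blinfun_transition[OF c d x] inner_dualv_blinfun)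
  show ?thesis using P(2) c d x unfolding contravariant_def uncp_def e by blast
 qed
qed

lemma curp_uncp [simp]: "curp (uncp P) = P"
 by (simp add: curp_def uncp_def fun_eq_iff)

lemma two_fieldD:
 assumes "two_field w" "c \<in> charts M"
 shows "x \<in> cimg c ==> alt2 (w c x)" "smo (cimg c) (%x. w c x u v)"
 using assms unfolding two_field_def by blast+

text \<open>For a bivector with itself the two terms of the Schouten bracket coincide, and the odd
  exponent 9 turns their difference into a sum; each term is the cyclic sum in
  \<open>jac\<close>.\<close>

lemma poisson_iff:
 assumes mv: "multivector_field 2 M \<pi>"
 shows "poisson M \<pi> \<longleftrightarrow> (\<forall>c\<in>charts M. \<forall>x\<in>cimg c. \<forall>a b e. jac (curp \<pi> c) x a b e = 0)"
proof -
 note D = multivector_2D[OF mv]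
 have key: "schouten 2 2 (\<pi> c) (\<pi> c) x a = 2 * jac (curp \<pi> c) x (dualv (blinfun_apply (a 0))) (dualv (blinfun_apply (a 1))) (dualv (blinfun_apply (a 2)))"
  if c: "c \<in> charts M" and x: "x \<in> cimg c" for c x a
 proof -
  define P where "P = curp \<pi> c"
  let ?v = "%i. dualv (blinfun_apply (a i))"
  have pd: "partial_deriv (\<pi> c) b x a = FD (%y. P y (dualv (blinfun_apply (a 0))) (dualv (blinfun_apply (a 1)))) x b" for b a
   unfolding partial_deriv_def P_def by (rule fun_cong[OF FD_cong[OF open_coord[OF c] x D(3)[OF c]]])
  have cl: "contract_last 2 (\<pi> c x) b a = P x (dualv (blinfun_apply (a 0))) b" for b a
   unfolding contract_last_def P_def D(3)[OF c x] by simp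
  have "wedge 1 2 (contract_last 2 (\<pi> c x) b) (partial_deriv (\<pi> c) b x) a =
   P x (?v 0) b * FD (%y. P y (?v 1) (?v 2)) x b + P x (?v 1) b * FD (%y. P y (?v 2) (?v 0)) x b + P x (?v 2) b * FD (%y. P y (?v 0) (?v 1)) x b" for b
  proof (rule wedge_1_2_cyclic[where f' = "%a. P x (dualv (blinfun_apply a)) b" and g' = "%a a'. FD (%y. P y (dualv (blinfun_apply a)) (dualv (blinfun_apply a'))) x b"])
   show "contract_last 2 (\<pi> c x) b a = P x (dualv (blinfun_apply (a 0))) b" for a by (rule cl)
   show "partial_deriv (\<pi> c) b x a = FD (%y. P y (dualv (blinfun_apply (a 0))) (dualv (blinfun_apply (a 1)))) x b" for a by (rule pd)
   show "FD (%y. P y (dualv (blinfun_apply a')) (dualv (blinfun_apply a))) x b = - FD (%y. P y (dualv (blinfun_apply a)) (dualv (blinfun_apply a'))) x b" for a a'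
    unfolding P_def
    by (rule FD_antisym[OF open_coord[OF c] x two_fieldD(1)[OF D(1) c] sm_diffble[OF two_fieldD(2)[OF D(1) c] x]])
  qed
  then show ?thesis unfolding schouten_def jac_def P_def[symmetric]
   by (simp add: sum_distrib_left distrib_left add_ac)
 qed
 have ex: "\<exists>v :: nat => 'e \<Rightarrow>\<^sub>L real. dualv (blinfun_apply (v 0)) = a & dualv (blinfun_apply (v 1)) = b & dualv (blinfun_apply (v 2)) = e" for a b e :: 'e
  by (rule exI[of _ "%i::nat. blinfun_inner_left (if i = 0 then a else if i = 1 then b else e)"]) simp
 have "(schouten 2 2 (\<pi> c) (\<pi> c) x = (%_. 0)) \<longleftrightarrow> (\<forall>a b e. jac (curp \<pi> c) x a b e = 0)"
  if "c \<in> charts M" "x \<in> cimg c" for c x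
 proof
  assume z: "schouten 2 2 (\<pi> c) (\<pi> c) x = (%_. 0)"
  show "\<forall>a b e. jac (curp \<pi> c) x a b e = 0"
  proof (intro allI)
   fix a b e
   obtain v :: "nat => 'e \<Rightarrow>\<^sub>L real" where v: "dualv (blinfun_apply (v 0)) = a" "dualv (blinfun_apply (v 1)) = b" "dualv (blinfun_apply (v 2)) = e"
    using ex by blast
   show "jac (curp \<pi> c) x a b e = 0" using key[OF that, of v] fun_cong[OF z, of v] unfolding v by simp
  qed
 next
  assume "\<forall>a b e. jac (curp \<pi> c) x a b e = 0"
  then show "schouten 2 2 (\<pi> c) (\<pi> c) x = (%_. 0)" by (intro ext) (simp add: key[OF that])
 qed
 then show ?thesis unfolding poisson_def using mv by simp
qed

text \<open>Forms of top degree are multiples of a single form \<open>g\<close>, so the section is a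
  scalar \<open>F\<close> times \<open>g\<close>, and transversality says that \<open>F\<close> has
  nonzero derivative at its zeros. The abstract \<open>g\<close> covers top forms and top
  multivectors alike.\<close>

lemma transverse_line:
 fixes g :: "(nat => 'v::real_vector) => real"
 assumes s: "!!c x v. c \<in> charts M ==> x \<in> cimg c ==> s c x v = F c x * g v"
  and g: "g vb = 1" "alt_form k g" "!!tau v. alt_form k tau ==> tau v = tau vb * g v"
  and F: "!!c. c \<in> charts M ==> smo (cimg c) (F c)"
 shows "transverse_to_zero k M s \<longleftrightarrow> (\<forall>c\<in>charts M. \<forall>x\<in>cimg c. F c x = 0 --> (\<exists>e. FD (F c) x e ~= 0))"
  "c \<in> charts M ==> x \<in> cimg c ==> s c x = (%_. 0) \<longleftrightarrow> F c x = 0"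
proof -
 show z: "s c x = (%_. 0) \<longleftrightarrow> F c x = 0" if "c \<in> charts M" "x \<in> cimg c" for c x
  using s[OF that] g(1) by (auto simp: fun_eq_iff)
 have d: "FD (%y. s c y v) x u = FD (F c) x u * g v" if c: "c \<in> charts M" and x: "x \<in> cimg c" for c x v u
 proof -
  have "FD (%y. s c y v) x = FD (%y. F c y * g v) x" by (rule FD_cong[OF open_coord[OF c] x]) (rule s[OF c])
  also have "... = (%u. FD (F c) x u * g v)"
   by (rule FD_eqI[OF has_derivative_mult_left[OF sm_has_derivative[OF F[OF c] x]]])
  finally show ?thesis by simp
 qed
 have eqv: "(\<forall>z tau. alt_form k tau --> (\<exists>u w. z = u + w & tau = (%v. FD (%y. s c y v) x u))) \<longleftrightarrow> (\<exists>e. FD (F c) x e ~= 0)"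
  if c: "c \<in> charts M" and x: "x \<in> cimg c" for c x
 proof
  assume "\<forall>z tau. alt_form k tau --> (\<exists>u w. z = u + w & tau = (%v. FD (%y. s c y v) x u))"
  then obtain u where "g = (%v. FD (%y. s c y v) x u)" using g(2) by blast
  then have "g vb = FD (F c) x u * g vb" using d[OF c x, of vb u] by metis
  then show "\<exists>e. FD (F c) x e ~= 0" using g(1) by (intro exI[of _ u]) simp
 next
  assume "\<exists>e. FD (F c) x e ~= 0"
  then obtain e where e: "FD (F c) x e ~= 0" by blast
  show "\<forall>z tau. alt_form k tau --> (\<exists>u w. z = u + w & tau = (%v. FD (%y. s c y v) x u))"
  proof (intro allI impI)
   fix z and tau :: "'v form" assume t: "alt_form k tau"
   define u where "u = (tau vb / FD (F c) x e) *\<^sub>R e"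
   have fu: "FD (F c) x u = tau vb" using e linear_scale[OF sm_linear_FD[OF F[OF c] x]] by (simp add: u_def)
   have "tau = (%v. FD (%y. s c y v) x u)" unfolding d[OF c x] fu by (rule ext) (rule g(3)[OF t])
   then show "\<exists>u w. z = u + w & tau = (%v. FD (%y. s c y v) x u)" by (intro exI[of _ u] exI[of _ "z - u"]) simp
  qed
 qed
 show "transverse_to_zero k M s \<longleftrightarrow> (\<forall>c\<in>charts M. \<forall>x\<in>cimg c. F c x = 0 --> (\<exists>e. FD (F c) x e ~= 0))"
  unfolding transverse_to_zero_def by (intro ball_cong refl) (simp only: z eqv)
qed

text \<open>A section of a line bundle in local trivialisations: its zeros have a meaning, its
  values and signs do not.\<close>

definition density :: "(('a, 'e) chart => 'e => real) => bool" where
 "density F \<longleftrightarrow> (\<forall>c\<in>charts M. smo (cimg c) (F c)) &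
   (\<forall>c\<in>charts M. \<forall>d\<in>charts M. \<exists>J. smo (overlap c d) J & (\<forall>x\<in>overlap c d. J x ~= 0 & F d (trn c d x) = J x * F c x))"

lemma densityE:
 assumes "density F" "c \<in> charts M" "d \<in> charts M"
 obtains J where "smo (overlap c d) J" "!!x. x \<in> overlap c d ==> J x ~= 0" "!!x. x \<in> overlap c d ==> F d (trn c d x) = J x * F c x"
proof -
 have "\<exists>J. smo (overlap c d) J & (\<forall>x\<in>overlap c d. J x ~= 0 & F d (trn c d x) = J x * F c x)"
  using assms unfolding density_def by blast
 then show thesis using that by blast
qed

context
 fixes n :: nat assumes dim: "DIM('e) = 2 * n"
begin

lemma density_covariant:
 assumes w: "two_field w" "covariant w" shows "density (%c x. Pf n (w c x))"
 unfolding density_def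
proof (intro conjI ballI)
 fix c assume c: "c \<in> charts M"
 show "smo (cimg c) (%x. Pf n (w c x))" by (rule sm_Pf[OF open_coord[OF c] two_fieldD(2)[OF w(1) c]])
 fix d assume d: "d \<in> charts M"
 let ?J = "%x. gram bas (%i. FD (trn c d) x (bas i))"
 have nz: "?J x ~= 0" if "x \<in> overlap c d" for x
  by (rule gram_image_nonzero[OF linear_transition_FD[OF c d that] inj_transition_FD[OF c d that]])
 have sm: "smo (overlap c d) ?J"
  by (rule sm_gram[OF open_ov[OF c d] sm_FD[OF sm_trn[OF c d]]])
 have "Pf n (w d (trn c d x)) = inverse (?J x) * Pf n (w c x)" if x: "x \<in> overlap c d" for x
 proof -
  have "w c x = (%u v. w d (trn c d x) (FD (trn c d) x u) (FD (trn c d) x v))"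
   using w(2) c d x unfolding covariant_def by blast
  then have "Pf n (w c x) = ?J x * Pf n (w d (trn c d x))"
   using Pf_pullback[OF dim two_fieldD(1)[OF w(1) d trn_ov(5)[OF c d x]], of "FD (trn c d) x"] by simp
  then show ?thesis using nz[OF x] by simp
 qed
 then show "\<exists>J. smo (overlap c d) J & (\<forall>x\<in>overlap c d. J x ~= 0 & Pf n (w d (trn c d x)) = J x * Pf n (w c x))"
  using nz sm by (intro exI[of _ "%x. inverse (?J x)"] conjI sm_inverse open_ov c d) auto
qed

text \<open>The factor is the determinant of the transposed derivative, the reciprocal of the factor
  for two-forms.\<close>

lemma density_contravariant:
 assumes P: "two_field P" "contravariant P" shows "density (%c x. Pf n (P c x))"
 unfolding density_def
proof (intro conjI ballI)
 fix c assume c: "c \<in> charts M"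
 show "smo (cimg c) (%x. Pf n (P c x))" by (rule sm_Pf[OF open_coord[OF c] two_fieldD(2)[OF P(1) c]])
 fix d assume d: "d \<in> charts M"
 define A where "A x a = dualv (%u. a \<bullet> FD (trn c d) x u)" for x a
 let ?J = "%x. gram bas (%i. A x (bas i))"
 have Au: "A x a \<bullet> u = a \<bullet> FD (trn c d) x u" if "x \<in> overlap c d" for x a u
  unfolding A_def
  by (rule inner_dualv) (rule linear_compose[OF linear_transition_FD[OF c d that] linear_inner, unfolded o_def])
 have nz: "?J x ~= 0" if x: "x \<in> overlap c d" for x
 proof (rule gram_image_nonzero)
  show lin: "linear (A x)"
   by (rule linearI) (simp_all add: A_def dualv_def inner_add_left scaleR_left_distrib sum.distrib scaleR_sum_right)
  have "surj (FD (trn c d) x)"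
   by (rule linear_inj_imp_surj[OF linear_transition_FD[OF c d x] inj_transition_FD[OF c d x]])
  then have "a = 0" if "A x a = 0" for a
  proof -
   obtain u where "a = FD (trn c d) x u" using \<open>surj _\<close> by (rule surjE)
   then have "a \<bullet> a = 0" using Au[OF x, of a u] that by simp
   then show ?thesis by simp
  qed
  then show "inj (A x)" using linear_injective_0[OF lin] by blast
 qed
 have sm: "smo (overlap c d) ?J"
  unfolding A_def dualv_def
  by (intro sm_gram sm_sum sm_scaleR sm_inner sm_const open_ov[OF c d] sm_FD[OF sm_trn[OF c d]])
 have "Pf n (P d (trn c d x)) = ?J x * Pf n (P c x)" if x: "x \<in> overlap c d" for x
 proof -
  have "P d (trn c d x) = (%a b. P c x (A x a) (A x b))"
   using P(2) c d x unfolding contravariant_def A_def by blast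
  then show ?thesis
   using Pf_pullback[OF dim two_fieldD(1)[OF P(1) c trn_ov(4)[OF c d x]], of "A x"] by simp
 qed
 then show "\<exists>J. smo (overlap c d) J & (\<forall>x\<in>overlap c d. J x ~= 0 & Pf n (P d (trn c d x)) = J x * Pf n (P c x))"
  using nz sm by (intro exI[of _ ?J]) simp
qed

lemma density_zero_locus:
 assumes F: "density F" and A: "A \<subseteq> points M"
  and s: "!!c x. c \<in> charts M ==> x \<in> cimg c ==> s c x = (%_. 0) \<longleftrightarrow> F c x = 0"
 shows "zero_locus M s = A \<longleftrightarrow> (\<forall>c\<in>charts M. \<forall>x\<in>cimg c. F c x = 0 \<longleftrightarrow> pt c x \<in> A)"
proof
 assume z: "zero_locus M s = A"
 show "\<forall>c\<in>charts M. \<forall>x\<in>cimg c. F c x = 0 \<longleftrightarrow> pt c x \<in> A"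
 proof (intro ballI iffI)
  fix c x assume c: "c \<in> charts M" and x: "x \<in> cimg c"
  show "pt c x \<in> A" if "F c x = 0"
  proof -
   have "s c (snd c (pt c x)) = (%_. 0)" using s[OF c x] that chart_point_of[OF c x] by simp
   then have "pt c x \<in> zero_locus M s" unfolding zero_locus_def using c pt_dom[OF c x] by blast
   then show ?thesis using z by simp
  qed
  assume "pt c x \<in> A"
  then obtain d where d: "d \<in> charts M" "pt c x \<in> dom_of d" "s d (snd d (pt c x)) = (%_. 0)"
   using z unfolding zero_locus_def by blast
  have ov: "x \<in> overlap c d" unfolding overlap_eq[OF c] using x d(2) by (simp add: cset_def)
  have "F d (trn c d x) = 0" using s[OF d(1) trn_ov(5)[OF c d(1) ov]] d(3) by (simp add: transition_def)
  moreover obtain J where "!!x. x \<in> overlap c d ==> J x ~= 0" "!!x. x \<in> overlap c d ==> F d (trn c d x) = J x * F c x"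
   by (rule densityE[OF F c d(1)], rule that)
  ultimately show "F c x = 0" using ov by (metis mult_eq_0_iff)
 qed
next
 assume z: "\<forall>c\<in>charts M. \<forall>x\<in>cimg c. F c x = 0 \<longleftrightarrow> pt c x \<in> A"
 show "zero_locus M s = A"
 proof (intro equalityI subsetI)
  fix p assume "p \<in> zero_locus M s"
  then obtain c where c: "c \<in> charts M" "p \<in> dom_of c" "s c (snd c p) = (%_. 0)" unfolding zero_locus_def by blast
  have i: "snd c p \<in> cimg c" using c(2) by blast
  then have "F c (snd c p) = 0" using s[OF c(1) i] c(3) by blast
  then have "pt c (snd c p) \<in> A" using z c(1) i by blast
  then show "p \<in> A" using c by simp
 next
  fix p assume p: "p \<in> A"
  then have "p \<in> points M" using A by blast
  from ex_chart[OF this] obtain c where c: "c \<in> charts M" "p \<in> dom_of c" by blast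
  have i: "snd c p \<in> cimg c" using c(2) by blast
  have "pt c (snd c p) \<in> A" using p c by simp
  then have "F c (snd c p) = 0" using z c(1) i by blast
  then show "p \<in> zero_locus M s" unfolding zero_locus_def using s[OF c(1) i] c by blast
 qed
qed

lemma fold_conditions:
 assumes omega: "diff_form 2 M omega" and A: "A \<subseteq> points M"
 shows "transverse_to_zero (2 * n) M (field_power omega n) \<longleftrightarrow> regular_zeros n (cur omega)"
  "zero_locus M (field_power omega n) = A \<longleftrightarrow> zeros_at n (cur omega) A"
proof -
 note D = diff_form_2D[OF omega]
 let ?F = "%c x. Pf n (cur omega c x)"
 have den: "density ?F" by (rule density_covariant[OF D(1,2)])
 have s: "field_power omega n c x v = ?F c x * gram bas v" if "c \<in> charts M" "x \<in> cimg c" for c x v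
  unfolding field_power_def D(3)[OF that] by (rule wedge_power_top[OF dim two_fieldD(1)[OF D(1) that]])
 have g: "alt_form (2 * n) (gram bas :: (nat => 'e) => real)" using alt_form_gram[of "bas :: nat => 'e"] dim by simp
 have sm: "smo (cimg c) (?F c)" if "c \<in> charts M" for c using den that unfolding density_def by blast
 have top: "tau v = tau bas * gram bas v" if "alt_form (2 * n) tau" for tau and v :: "nat => 'e"
  using top_form_eq[of tau v] that dim by simp
 note T = transverse_line[where s = "field_power omega n" and F = ?F, OF s gram_bas g top sm]
 show "transverse_to_zero (2 * n) M (field_power omega n) \<longleftrightarrow> regular_zeros n (cur omega)"
  unfolding regular_zeros_def by (rule T(1))
 show "zero_locus M (field_power omega n) = A \<longleftrightarrow> zeros_at n (cur omega) A"
  unfolding zeros_at_def by (rule density_zero_locus[OF den A T(2)])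
qed

lemma log_conditions:
 assumes \<pi>: "multivector_field 2 M \<pi>" and A: "A \<subseteq> points M"
 shows "transverse_to_zero (2 * n) M (field_power \<pi> n) \<longleftrightarrow> regular_zeros n (curp \<pi>)"
  "zero_locus M (field_power \<pi> n) = A \<longleftrightarrow> zeros_at n (curp \<pi>) A"
proof -
 note D = multivector_2D[OF \<pi>]
 let ?F = "%c x. Pf n (curp \<pi> c x)"
 let ?g = "%a. gram bas (%i. dualv (blinfun_apply (a i :: 'e \<Rightarrow>\<^sub>L real)))"
 let ?v0 = "%i. blinfun_inner_left (bas i :: 'e)"
 have den: "density ?F" by (rule density_contravariant[OF D(1,2)])
 have s: "field_power \<pi> n c x a = ?F c x * ?g a" if c: "c \<in> charts M" and x: "x \<in> cimg c" for c x a
 proof -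
  have "\<pi> c x = (%a. curp \<pi> c x (dualv (blinfun_apply (a 0))) (dualv (blinfun_apply (a 1))))"
   by (rule ext) (rule D(3)[OF c x])
  then have "field_power \<pi> n c x a = wedge_power (%a. curp \<pi> c x (dualv (blinfun_apply (a 0))) (dualv (blinfun_apply (a 1)))) n a"
   unfolding field_power_def by simp
  also have "... = ?F c x * ?g a"
   unfolding wedge_power_dual by (rule wedge_power_top[OF dim two_fieldD(1)[OF D(1) c x]])
  finally show ?thesis .
 qed
 have comp: "alt_form k (%v. f (%i. A (v i)))" if f: "alt_form k f" and A: "linear A" for k f and A :: "'u::real_vector => 'v::real_vector"
 proof -
  have e: "(%j. A ((v(i := x)) j)) = (%j. A (v j))(i := A x)" for v i x by auto
  have "linear (%x. f (%j. A ((v(i := x)) j)))" if "i < k" for v i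
   unfolding e using linear_compose[OF A alt_formD(2)[OF f that, of "%j. A (v j)"]] by (simp add: o_def)
  moreover have "f (%i. A (v i)) = f (%i. A (w i))" if "\<forall>i<k. v i = w i" for v w
   by (rule alt_formD(1)[OF f]) (use that in auto)
  moreover have "f (%i. A (v i)) = 0" if "i < k" "j < k" "i ~= j" "v i = v j" for v i j
   by (rule alt_formD(3)[OF f that(1-3)]) (use that in simp)
  ultimately show ?thesis unfolding alt_form_def by blast
 qed
 have g: "alt_form (2 * n) ?g" using comp[OF alt_form_gram[of "bas :: nat => 'e"] linear_dualv] dim by simp
 have sm: "smo (cimg c) (?F c)" if "c \<in> charts M" for c using den that unfolding density_def by blast
 have g1: "?g ?v0 = 1" by (simp add: gram_bas)
 have top: "tau v = tau ?v0 * ?g v" if t: "alt_form (2 * n) tau" for tau and v :: "nat => 'e \<Rightarrow>\<^sub>L real"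
 proof -
  have a: "alt_form DIM('e) (%v. tau (%i. blinfun_inner_left (v i)))" using comp[OF t linear_blinfun_inner_left] dim by simp
  from top_form_eq[OF a, of "%i. dualv (blinfun_apply (v i))"] show ?thesis by simp
 qed
 note T = transverse_line[where s = "field_power \<pi> n" and F = ?F and vb = ?v0, OF s g1 g top sm]
 show "transverse_to_zero (2 * n) M (field_power \<pi> n) \<longleftrightarrow> regular_zeros n (curp \<pi>)"
  unfolding regular_zeros_def by (rule T(1))
 show "zero_locus M (field_power \<pi> n) = A \<longleftrightarrow> zeros_at n (curp \<pi>) A"
  unfolding zeros_at_def by (rule density_zero_locus[OF den A T(2)])
qed

end

lemma mutually_inverse_ipair:
 assumes P: "alt2 P" and w: "alt2 w" and ip: "ipair P w"
  and p: "!!a. p a = P (dualv (blinfun_apply (a 0))) (dualv (blinfun_apply (a 1)))" and f: "!!v. f v = w (v 0) (v 1)"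
 shows "mutually_inverse p (f :: 'e form)"
proof -
 have fl: "blinfun_apply (flat f v) u = w v u" for v u
  unfolding flat_def f using alt2D(1)[OF w, of v] by (simp add: bounded_linear_Blinfun_apply linear_conv_bounded_linear)
 have sh: "sharp p a \<bullet> y = P (dualv (blinfun_apply a)) y" for a y
  unfolding sharp_def p using inner_dualv[OF alt2D(1)[OF P], of "dualv (blinfun_apply a)" y] by (simp add: dualv_def)
 have "sharp p (flat f v) = v" for v
 proof -
  have "w v y = dualv (blinfun_apply (flat f v)) \<bullet> y" for y by (simp add: inner_dualv_blinfun fl)
  then have "P (dualv (blinfun_apply (flat f v))) y = v \<bullet> y" for y using ip unfolding ipair_def by blast
  then have "sharp p (flat f v) \<bullet> y = v \<bullet> y" for y by (simp add: sh)
  then show ?thesis by (metis vector_eq_rdot)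
 qed
 moreover have "flat f (sharp p a) = a" for a
 proof (rule blinfun_eqI)
  fix u
  have "\<forall>y. P (dualv (blinfun_apply a)) y = sharp p a \<bullet> y" by (simp add: sh)
  then have "w (sharp p a) u = dualv (blinfun_apply a) \<bullet> u" using ip unfolding ipair_def by blast
  then show "blinfun_apply (flat f (sharp p a)) u = blinfun_apply a u" by (simp add: fl inner_dualv_blinfun)
 qed
 ultimately show ?thesis unfolding mutually_inverse_def by blast
qed

end

section \<open>Defining functions of the hypersurface\<close>

lemma openin_finite_Inter:
 assumes "finite I" "!!i. i \<in> I ==> openin T (B i)"
 shows "openin T (topspace T \<inter> (\<Inter>i\<in>I. B i))"
 using assms
proof (induction I rule: finite_induct)
 case (insert i I)
 have "topspace T \<inter> (\<Inter>j\<in>insert i I. B j) = B i \<inter> (topspace T \<inter> (\<Inter>j\<in>I. B j))" by auto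
 then show ?case using insert by (metis insertCI openin_Int)
qed simp

lemma dPf_pullback:
 fixes w :: "'e::euclidean_space => 'e => real"
 assumes dim: "DIM('e) = 2 * n" and w: "alt2 w" and ab: "linear a" "linear b"
 shows "dPf n (%u v. w (T u) (T v)) (%u. a (T u)) (%u. b (T u)) = gram bas (%i. T (bas i)) * dPf n w a b"
proof -
 have "upd (%u v. w (T u) (T v)) 1 (%u. a (T u)) (%u. b (T u)) = (%u v. upd w 1 a b (T u) (T v))"
  by (simp add: upd_def)
 then show ?thesis unfolding dPf_def
  using Pf_pullback[OF dim w, of T] Pf_pullback[OF dim alt2_upd[OF w ab, of 1], of T] by (simp add: right_diff_distrib)
qed

lemma dPf_scale2:
 fixes w :: "'e::euclidean_space => 'e => real"
 assumes dim: "DIM('e) = 2 * n" and w: "alt2 w" and ab: "linear a" "linear b"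
 shows "dPf n w a (%u. k * b u) = k * dPf n w a b" "dPf n w (%u. k * a u) b = k * dPf n w a b"
proof -
 have "upd w 1 a (%u. k * b u) = upd w k a b" "upd w 1 (%u. k * a u) b = upd w k a b"
  unfolding upd_def by (auto simp: algebra_simps)
 then show "dPf n w a (%u. k * b u) = k * dPf n w a b" "dPf n w (%u. k * a u) b = k * dPf n w a b"
  using Pf_upd[OF dim w ab, of k] by (simp_all add: dPf_def)
qed

lemma wedge1_cong_vec:
 assumes "!!i. i < Suc (2 * m) ==> v i = v' i"
 shows "wedge1 m g w v = wedge1 m g w v'"
proof -
 have "v (sig i) = v' (sig i)" if "sig permutes {..<Suc (2 * m)}" "i < Suc (2 * m)" for sig i
  using assms permutes_in_image[OF that(1), of i] that(2) by auto
 then show ?thesis unfolding wedge1_eq by (auto intro!: sum.cong prod.cong arg_cong2[where f = "(/)"] arg_cong2[where f = "(*)"])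
qed

text \<open>kappa wedge Theta wedge w^m is nonzero exactly when Theta wedge w^m is nonzero on the
  kernel of \<open>kappa\<close>, which \<open>D\<close> parametrises. With \<open>kappa\<close> the
  differential of a defining function, the condition on the hypersurface becomes one on
  \<open>dPf\<close> in the ambient chart.\<close>

lemma dPf_nonzero_iff:
 fixes w :: "'e::euclidean_space => 'e => real" and D :: "'f::euclidean_space => 'e"
 assumes dim: "DIM('e) = 2 * Suc m" and w: "alt2 w" and k: "linear kappa" "kappa z ~= 0" and Theta: "linear Theta"
  and D: "!!v. kappa (D v) = 0" "!!u. kappa u = 0 ==> \<exists>v. u = D v"
 shows "dPf (Suc m) w kappa Theta ~= 0 \<longleftrightarrow> (\<exists>v. wedge1 m Theta w (%i. D (v i)) ~= 0)"
proof
 obtain x s where x: "s ~= 0" "kappa (x 0) = 1" "!!j. 0 < j ==> j < DIM('e) ==> kappa (x j) = 0"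
  "!!w b l. alt2 w ==> linear b ==>
    s * Pf (Suc m) (upd w l kappa b) = s * Pf (Suc m) w + l * real (Suc m) * wedge1 m b w (%i. x (Suc i))"
  "!!w u. alt2 w ==> real (Suc m) * wedge1 m (w u) w (%i. x (Suc i)) = kappa u * s * Pf (Suc m) w"
  by (rule Pf_adapted[OF dim k], rule that)
 assume nz: "dPf (Suc m) w kappa Theta ~= 0"
 have "s * dPf (Suc m) w kappa Theta = real (Suc m) * wedge1 m Theta w (%i. x (Suc i))"
  unfolding dPf_def using x(4)[OF w Theta, of 1] by (simp add: right_diff_distrib)
 then have nz: "wedge1 m Theta w (%i. x (Suc i)) ~= 0" using nz x(1) by auto
 have "\<exists>v. x (Suc i) = D v" if "i < Suc (2 * m)" for i using D(2) x(3)[of "Suc i"] that dim by simp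
 then obtain v where v: "!!i. i < Suc (2 * m) ==> x (Suc i) = D (v i)" by metis
 have "wedge1 m Theta w (%i. D (v i)) = wedge1 m Theta w (%i. x (Suc i))"
  by (rule wedge1_cong_vec) (simp add: v)
 then show "\<exists>v. wedge1 m Theta w (%i. D (v i)) ~= 0" using nz by metis
next
 assume "\<exists>v. wedge1 m Theta w (%i. D (v i)) ~= 0"
 then obtain v where v: "wedge1 m Theta w (%i. D (v i)) ~= 0" by blast
 define x where "x i = (case i of 0 => z /\<^sub>R kappa z | Suc i => D (v i))" for i
 have x0: "kappa (x 0) = 1" using k linear_scale[OF k(1)] by (simp add: x_def)
 have "kappa (x j) = 0" if "0 < j" for j using that D(1) by (cases j) (auto simp: x_def)
 from wedge_power_upd[OF w k(1) Theta, of x m 1, OF x0 this]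
 have "Pf (Suc m) (upd w 1 kappa Theta) * gram bas x = Pf (Suc m) w * gram bas x + real (Suc m) * wedge1 m Theta w (%i. D (v i))"
  unfolding wedge_power_top[OF dim alt2_upd[OF w k(1) Theta]] wedge_power_top[OF dim w] by (simp add: x_def)
 then have "dPf (Suc m) w kappa Theta * gram bas x = real (Suc m) * wedge1 m Theta w (%i. D (v i))"
  by (simp add: dPf_def left_diff_distrib)
 then show "dPf (Suc m) w kappa Theta ~= 0" using v by auto
qed

context smooth_mfd
begin

lemma sfun_open:
 assumes f: "sfun (points M) f" and V: "open V" shows "opn M {p \<in> points M. f p \<in> V}"
proof (subst openin_subopen, intro ballI)
 fix q assume q: "q \<in> {p \<in> points M. f p \<in> V}"
 then have "q \<in> points M" by simp
 from ex_chart[OF this] obtain c where c: "c \<in> charts M" "q \<in> dom_of c" by blast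
 from sfunD[OF f c(1)] have s: "smo (cimg c) (%x. f (pt c x))" unfolding cset_points[OF c(1)] .
 have "open (cimg c \<inter> (%x. f (pt c x)) -` V)"
  by (rule continuous_open_preimage[OF sm_cont[OF s] open_coord[OF c(1)] V])
 from openin_chart_preimage[OF c(1) this]
 have "opn M {p \<in> dom_of c. snd c p \<in> cimg c \<inter> (%x. f (pt c x)) -` V}" .
 moreover have "(snd c p \<in> cimg c \<inter> (%x. f (pt c x)) -` V) \<longleftrightarrow> f p \<in> V" if "p \<in> dom_of c" for p
  using pt_chart[OF c(1) that] that by simp
 then have "{p \<in> dom_of c. snd c p \<in> cimg c \<inter> (%x. f (pt c x)) -` V} = {p \<in> dom_of c. f p \<in> V}" by blast
 ultimately show "\<exists>T. opn M T & q \<in> T & T \<subseteq> {p \<in> points M. f p \<in> V}"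
  using q c(2) dom_subset[OF c(1)] by (intro exI[of _ "{p \<in> dom_of c. f p \<in> V}"]) auto
qed

lemma FD_global:
 assumes f: "sfun (points M) f" and c: "c \<in> charts M" "d \<in> charts M" "x \<in> overlap c d"
 shows "FD (%y. f (pt c y)) x v = FD (%y. f (pt d y)) (trn c d x) (FD (trn c d) x v)"
proof -
 have "FD (%y. f (pt c y)) x v = FD (%y. f (pt d (trn c d y))) x v"
  by (rule fun_cong[OF FD_cong[OF open_ov[OF c(1,2)] c(3)]]) (simp add: trn_ov(3)[OF c(1,2)])
 also have "FD (%y. f (pt d (trn c d y))) x v = FD (%y. f (pt d y)) (trn c d x) (FD (trn c d) x v)"
  by (rule FD_compose[OF sm_trn[OF c(1,2)] sfunD[OF f c(2)] c(3)])
   (simp add: cset_points[OF c(2)] trn_ov(5)[OF c])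
 finally show ?thesis .
qed

end

context hypersurface_in
begin

text \<open>Between charts \<open>F^2\<close> is multiplied by a positive square, so the local
  squares can be averaged by a partition of unity. In any chart the average is \<open>F^2\<close>
  times the weighted sum \<open>m\<close> of those factors, which is positive.\<close>

lemma squared_defining_function:
 assumes F: "X.density F" and Z: "!!c x. c \<in> charts X ==> x \<in> cimg c ==> F c x = 0 \<longleftrightarrow> pt c x \<in> points Z"
 obtains r where "X.sfun (points X) r" "!!p. p \<in> points X ==> r p >= 0" "!!p. p \<in> points X ==> r p = 0 \<longleftrightarrow> p \<in> points Z"
  "!!c x. c \<in> charts X ==> x \<in> cimg c ==> \<exists>S m. open S & x \<in> S & S \<subseteq> cimg c & smo S m &
    (\<forall>y\<in>S. m y > 0 & r (pt c y) = (F c y)\<^sup>2 * m y)"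
proof -
 have U'o: "opn X (points X) & p \<in> points X" if "p \<in> points X" for p using that by simp
 obtain I :: "'a set" and zeta K C where I: "finite I" "I \<subseteq> points X"
  and zeta: "!!i. i \<in> I ==> X.sfun (points X) (zeta i)" "!!i q. i \<in> I ==> q \<in> points X ==> (0::real) <= zeta i q"
  and K: "!!i. i \<in> I ==> closedin (mtop X) (K i)" "!!i. i \<in> I ==> K i \<subseteq> points X"
  and C: "!!i. i \<in> I ==> C i \<in> charts X" "!!i. i \<in> I ==> K i \<subseteq> dom_of (C i)"
  and zeta0: "!!i q. i \<in> I ==> q \<in> points X ==> q \<notin> K i ==> zeta i q = 0"
  and zeta1: "!!q. q \<in> points X ==> (\<Sum>i\<in>I. zeta i q) = 1"
  by (rule X.partition_of_unity[OF compact U'o], assumption, rule that)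
 define t where "t i p = (if p \<in> dom_of (C i) then zeta i p * (F (C i) (snd (C i) p))\<^sup>2 else 0)" for i p
 define r where "r p = (\<Sum>i\<in>I. t i p)" for p
 have t0: "t i p = 0" if "i \<in> I" "p \<in> points X" "p \<notin> K i" for i p using zeta0[OF that] by (simp add: t_def)
 have "X.sfun (points X) (t i)" if i: "i \<in> I" for i
 proof (rule X.sfun_extend[OF C(1)[OF i] K(1)[OF i] C(2)[OF i] order_refl X.open_dom[OF C(1)[OF i]] _ t0[OF i]])
  note c = C(1)[OF i]
  have o: "open (cset (C i) (dom_of (C i)))" by (rule X.open_cset[OF c X.open_dom[OF c]])
  have sub: "cset (C i) (dom_of (C i)) \<subseteq> cimg (C i)" by (rule X.cset_subset)
  have z: "smo (cimg (C i)) (%x. zeta i (pt (C i) x))" using X.sfunD[OF zeta(1)[OF i] c] X.cset_points[OF c] by simp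
  have f: "smo (cimg (C i)) (F (C i))" using F c unfolding X.density_def by blast
  have "smo (cset (C i) (dom_of (C i))) (%x. zeta i (pt (C i) x) * (F (C i) x)\<^sup>2)"
   by (intro sm_mult sm_power o sm_subset[OF z sub] sm_subset[OF f sub])
  then show "smo (cset (C i) (dom_of (C i))) (%x. t i (pt (C i) x))"
  proof (rule sm_eq[OF o])
   fix x assume "x \<in> cset (C i) (dom_of (C i))"
   then have "x \<in> cimg (C i)" using sub by blast
   then show "t i (pt (C i) x) = zeta i (pt (C i) x) * (F (C i) x)\<^sup>2"
    using X.pt_dom[OF c] X.chart_point_of[OF c] by (simp add: t_def)
  qed
 qed
 then have 1: "X.sfun (points X) r" unfolding r_def by (intro X.sfun_sum) simp_all
 have t_nonneg: "t i p >= 0" if "i \<in> I" "p \<in> points X" for i p using zeta(2)[OF that] by (simp add: t_def)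
 then have 2: "r p >= 0" if "p \<in> points X" for p using that unfolding r_def by (intro sum_nonneg) blast
 have 4: "\<exists>S m. open S & x \<in> S & S \<subseteq> cimg c & smo S m &
    (\<forall>y\<in>S. m y > 0 & r (pt c y) = (F c y)\<^sup>2 * m y)" if c: "c \<in> charts X" and x: "x \<in> cimg c" for c x
 proof -
  let ?p = "pt c x"
  define A where "A = {i \<in> I. ?p \<in> K i}"
  have A: "finite A" "A \<subseteq> I" using I by (auto simp: A_def)
  \<comment> \<open>On \<open>N\<close> only the indices in \<open>A\<close> contribute, and all
    their charts are defined there.\<close>
  define N where "N = (points X \<inter> (\<Inter>i\<in>A. dom_of (C i))) \<inter> (points X \<inter> (\<Inter>i\<in>I - A. points X - K i))"
  have N: "opn X N" unfolding N_def
   by (intro openin_Int openin_finite_Inter openin_diff openin_topspace K X.open_dom C A(1) finite_Diff I(1)) (use A in auto)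
  have NK: "q \<notin> K i" if "q \<in> N" "i \<in> I - A" for q i using that unfolding N_def by blast
  have NC: "q \<in> dom_of (C i)" if "q \<in> N" "i \<in> A" for q i using that unfolding N_def by blast
  have pN: "?p \<in> N" using X.pt_points[OF c x] C(2) A by (auto simp: N_def A_def)
  define S where "S = cset c N"
  have S: "open S" unfolding S_def by (rule X.open_cset[OF c N])
  have SN: "y \<in> cimg c" "pt c y \<in> N" "pt c y \<in> points X" if "y \<in> S" for y
   using that X.pt_points[OF c] by (auto simp: S_def cset_def)
  have ov: "y \<in> overlap c (C i)" if "y \<in> S" "i \<in> A" for y i
   unfolding X.overlap_eq[OF c] cset_def using SN(1)[OF that(1)] NC[OF SN(2)[OF that(1)] that(2)] by simp
  have "\<exists>J. smo (overlap c (C i)) J & (\<forall>x\<in>overlap c (C i). J x ~= 0 & F (C i) (trn c (C i) x) = J x * F c x)" if "i \<in> I" for i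
   using F c C(1)[OF that] unfolding X.density_def by blast
  then obtain J where J: "!!i. i \<in> I ==> smo (overlap c (C i)) (J i)" "!!i x. i \<in> I ==> x \<in> overlap c (C i) ==> J i x ~= 0"
   "!!i x. i \<in> I ==> x \<in> overlap c (C i) ==> F (C i) (trn c (C i) x) = J i x * F c x" by metis
  define m where "m y = (\<Sum>i\<in>A. zeta i (pt c y) * (J i y)\<^sup>2)" for y
  have smm: "smo S m" unfolding m_def
  proof (intro sm_sum sm_mult sm_power S)
   fix i assume i: "i \<in> A"
   show "smo S (%y. zeta i (pt c y))"
    by (rule sm_subset[OF X.sfunD[OF zeta(1) c]]) (use i A SN in \<open>auto simp: X.cset_points[OF c]\<close>)
   show "smo S (J i)" by (rule sm_subset[OF J(1)]) (use i A ov in auto)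
  qed
  have mpos: "m y > 0" if y: "y \<in> S" for y
  proof -
   have nn: "zeta i (pt c y) * (J i y)\<^sup>2 >= 0" if "i \<in> A" for i
    using zeta(2)[of i "pt c y"] that A SN[OF y] by auto
   have "m y ~= 0"
   proof
    assume "m y = 0"
    then have "zeta i (pt c y) * (J i y)\<^sup>2 = 0" if "i \<in> A" for i
    using that nn unfolding m_def by (subst (asm) sum_nonneg_eq_0_iff[OF A(1)]) auto
    then have "zeta i (pt c y) = 0" if "i \<in> A" for i using J(2)[OF _ ov[OF y that]] that A by auto
    moreover have "zeta i (pt c y) = 0" if "i \<in> I - A" for i
    by (rule zeta0[OF _ SN(3)[OF y] NK[OF SN(2)[OF y] that]]) (use that in simp)
    ultimately have "(\<Sum>i\<in>I. zeta i (pt c y)) = 0" by (intro sum.neutral) blast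
    then show False using zeta1[OF SN(3)[OF y]] by simp
   qed
   moreover have "m y >= 0" unfolding m_def by (rule sum_nonneg[OF nn])
   ultimately show ?thesis by simp
  qed
  have rm: "r (pt c y) = (F c y)\<^sup>2 * m y" if y: "y \<in> S" for y
  proof -
   have "r (pt c y) = (\<Sum>i\<in>A. t i (pt c y))"
    unfolding r_def by (rule sum.mono_neutral_right[OF I(1) A(2)]) (use t0[OF _ SN(3)[OF y] NK[OF SN(2)[OF y]]] in blast)
   also have "... = (\<Sum>i\<in>A. (F c y)\<^sup>2 * (zeta i (pt c y) * (J i y)\<^sup>2))"
   proof (rule sum.cong[OF refl])
    fix i assume i: "i \<in> A"
    then have iI: "i \<in> I" using A by blast
    note o = ov[OF y i]
    have "snd (C i) (pt c y) = trn c (C i) y" by (simp add: transition_def)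
    then show "t i (pt c y) = (F c y)\<^sup>2 * (zeta i (pt c y) * (J i y)\<^sup>2)"
    using J(3)[OF iI o] X.trn_ov(6)[OF c C(1)[OF iI] o] by (simp add: t_def power_mult_distrib)
   qed
   finally show ?thesis by (simp add: m_def sum_distrib_left)
  qed
  have "x \<in> S" unfolding S_def cset_def using x pN by simp
  moreover have "S \<subseteq> cimg c" by (rule subsetI, rule SN(1))
  ultimately show ?thesis by (intro exI[of _ S] exI[of _ m] conjI ballI S smm mpos rm)
 qed
 have 3: "r p = 0 \<longleftrightarrow> p \<in> points Z" if p: "p \<in> points X" for p
 proof -
  from X.ex_chart[OF p] obtain c where c: "c \<in> charts X" "p \<in> dom_of c" by blast
  have i: "snd c p \<in> cimg c" using c(2) by blast
  from 4[OF c(1) i] obtain S m where "snd c p \<in> S" "\<forall>y\<in>S. m y > 0 & r (pt c y) = (F c y)\<^sup>2 * m y" by blast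
  then have "m (snd c p) > 0" "r p = (F c (snd c p))\<^sup>2 * m (snd c p)" using X.pt_chart[OF c] by auto
  then show ?thesis using Z[OF c(1) i] X.pt_chart[OF c] by simp
 qed
 show thesis by (rule that[OF 1 2 3 4])
qed

text \<open>The sets where \<open>r > 1 / (k + 1)\<close> cover the compact manifold together with
  \<open>V\<close>; the largest index in a finite subcover determines \<open>delta\<close>.\<close>

lemma small_values_near_Z:
 assumes r: "X.sfun (points X) r" "!!p. p \<in> points X ==> r p >= 0" "!!p. p \<in> points X ==> r p = 0 \<longleftrightarrow> p \<in> points Z"
  and V: "opn X V" "points Z \<subseteq> V"
 obtains delta where "delta > 0" "!!p. p \<in> points X ==> r p < delta ==> p \<in> V"
proof -
 define R where "R k = {p \<in> points X. r p \<in> {1 / real (Suc k)<..}}" for k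
 have R: "opn X (R k)" for k unfolding R_def by (rule X.sfun_open[OF r(1) open_greaterThan])
 have "p \<in> V \<or> (\<exists>k. p \<in> R k)" if p: "p \<in> points X" for p
 proof (cases "p \<in> points Z")
  case False
  then have "r p > 0" using r(2,3)[OF p] by fastforce
  then obtain k where "1 / real (Suc k) < r p" using nat_approx_posE by blast
  then show ?thesis using p by (auto simp: R_def)
 qed (use V in blast)
 then have cov: "points X \<subseteq> \<Union> (insert V (range R))" by blast
 have "\<forall>U\<in>insert V (range R). opn X U" using V(1) R by simp
 note FF = compact[unfolded compact_space_alt, rule_format, OF conjI[OF this cov]]
 obtain \<F> where F: "finite \<F>" "\<F> \<subseteq> insert V (range R)" "points X \<subseteq> \<Union> \<F>" using FF by (elim exE conjE)
 have "finite (\<F> - {V})" "\<F> - {V} \<subseteq> range R" using F by auto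
 then obtain k where k: "finite k" "\<F> - {V} = R ` k" by (meson finite_subset_image)
 define N where "N = Max (insert 0 k)"
 show thesis
 proof (rule that[of "1 / real (Suc N)"])
  fix p assume p: "p \<in> points X" "r p < 1 / real (Suc N)"
  show "p \<in> V"
  proof (rule ccontr)
   assume "p \<notin> V"
   then obtain i where i: "i \<in> k" "p \<in> R i" using p(1) F(3) k(2) by blast
   have "i <= N" unfolding N_def using i(1) k(1) by simp
   then have "1 / real (Suc N) <= 1 / real (Suc i)" by (simp add: frac_le)
   then show False using i(2) p(2) by (simp add: R_def)
  qed
 qed simp
qed

text \<open>\<open>F\<close> vanishes along \<open>Z\<close>, so its differential kills the tangent
  space of \<open>Z\<close>. Where the differential is nonzero its kernel has the same dimension as
  the tangent space, and the two agree.\<close>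

lemma tangent_kernel:
 assumes F: "X.density F" and Z: "!!c x. c \<in> charts X ==> x \<in> cimg c ==> F c x = 0 \<longleftrightarrow> pt c x \<in> points Z"
  and d: "d \<in> charts Z" and c: "c \<in> charts X" and y: "y \<in> overlap d c"
 shows "FD (F c) (trn d c y) (FD (trn d c) y v) = 0"
  "FD (F c) (trn d c y) e ~= 0 ==> FD (F c) (trn d c y) u = 0 ==> \<exists>v. u = FD (trn d c) y v"
proof -
 have f: "smo (cimg c) (F c)" using F c unfolding X.density_def by blast
 note fa = incl_facts[OF d c]
 have "FD (%y. F c (trn d c y)) y v = FD (F c) (trn d c y) (FD (trn d c) y v)" for v
  by (rule FD_compose[OF smooth_incl[OF d c] f y fa(2)[OF y]])
 moreover have "FD (%y. F c (trn d c y)) y = FD (%_. 0) y"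
 proof (rule FD_cong[OF open_ovi[OF d c] y])
  fix z assume z: "z \<in> overlap d c"
  show "F c (trn d c z) = 0"
   using Z[OF c fa(2)[OF z]] fa(1)[OF z] Z.pt_points[OF d fa(3)[OF z]] by simp
 qed
 ultimately show t: "FD (F c) (trn d c y) (FD (trn d c) y v) = 0" for v by simp
 assume e: "FD (F c) (trn d c y) e ~= 0" and u: "FD (F c) (trn d c y) u = 0"
 let ?D = "FD (trn d c) y"
 have lD: "linear ?D" by (rule sm_linear_FD[OF smooth_incl[OF d c] y])
 have lF: "linear (FD (F c) (trn d c y))" by (rule sm_linear_FD[OF f fa(2)[OF y]])
 define g where "g = dualv (FD (F c) (trn d c y))"
 have g: "g \<bullet> v = FD (F c) (trn d c y) v" for v unfolding g_def by (rule inner_dualv[OF lF])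
 have "g ~= 0" using e g[of e] by auto
 have "range ?D = {x. g \<bullet> x = 0}"
 proof (rule subspace_dim_equal)
  show "subspace (range ?D)" using linear_subspace_image[OF lD subspace_UNIV] .
  show "range ?D \<subseteq> {x. g \<bullet> x = 0}" using t g by auto
  have "dim (range ?D) = DIM('f)" using dim_image_eq[OF lD, of UNIV] inj_incl[OF d c y] by simp
  then show "dim {x. g \<bullet> x = 0} <= dim (range ?D)" using dim_hyperplane[OF \<open>g ~= 0\<close>] dims by simp
 qed (rule subspace_hyperplane)
 then have "u \<in> range ?D" using u g by simp
 then show "\<exists>v. u = ?D v" by auto
qed

lemma incl_change_chart:
 assumes d: "d \<in> charts Z" and c: "c \<in> charts X" "c' \<in> charts X" and y: "y \<in> overlap d c" "y \<in> overlap d c'"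
 shows "trn d c y \<in> overlap c c'" "trn c c' (trn d c y) = trn d c' y"
  "FD (trn d c') y v = FD (trn c c') (trn d c y) (FD (trn d c) y v)"
proof -
 have ov: "trn d c z \<in> overlap c c'" "trn c c' (trn d c z) = trn d c' z"
  if "z \<in> overlap d c" "z \<in> overlap d c'" for z
  using incl_facts[OF d c(1) that(1)] incl_facts[OF d c(2) that(2)] unfolding X.overlap_eq[OF c(1)]
  by (auto simp: cset_def transition_def)
 show "trn d c y \<in> overlap c c'" "trn c c' (trn d c y) = trn d c' y" using ov[OF y] by auto
 have o: "open (overlap d c \<inter> overlap d c')" by (intro open_Int open_ovi d c)
 have "FD (%z. trn c c' (trn d c z)) y v = FD (trn c c') (trn d c y) (FD (trn d c) y v)"
  by (rule FD_compose[OF smooth_incl[OF d c(1)] X.sm_trn[OF c] y(1) ov(1)[OF y]])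
 moreover have "FD (%z. trn c c' (trn d c z)) y = FD (trn d c') y"
  by (rule FD_cong[OF o]) (use y ov(2) in auto)
 ultimately show "FD (trn d c') y v = FD (trn c c') (trn d c y) (FD (trn d c) y v)" by simp
qed

lemma restrict_dform:
 assumes L: "X.lexact W psi" and ZW: "points Z \<subseteq> W" and d: "d \<in> charts Z" and c: "c \<in> charts X" and y: "y \<in> overlap d c"
 shows "FD (%y'. psi (pt d y) (pt d y')) y v = X.dform psi c (trn d c y) (FD (trn d c) y v)"
proof -
 note fa = incl_facts[OF d c]
 let ?p = "pt d y"
 have "?p \<in> W" using Z.pt_points[OF d fa(3)[OF y]] ZW by blast
 obtain N where N: "opn X N" "?p \<in> N" "X.sfun N (psi ?p)"
  by (rule X.lexactE[OF L \<open>?p \<in> W\<close>], rule that)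
 have "FD (%y'. psi ?p (pt d y')) y v = FD (%y'. psi ?p (pt c (trn d c y'))) y v"
  by (rule fun_cong[OF FD_cong[OF open_ovi[OF d c] y]]) (simp add: fa(1))
 also have "FD (%y'. psi ?p (pt c (trn d c y'))) y v = FD (%x. psi ?p (pt c x)) (trn d c y) (FD (trn d c) y v)"
  by (rule FD_compose[OF smooth_incl[OF d c] X.sfunD[OF N(3) c] y]) (use fa[OF y] N(2) in \<open>simp add: cset_def\<close>)
 finally show ?thesis unfolding X.dform_def fa(1)[OF y] .
qed

text \<open>\<open>pullback_incl\<close> uses an unspecified chart; covariance of \<open>w\<close>
  moves the result to the chart \<open>c\<close>. On \<open>Z\<close> the form \<open>theta\<close>
  is the restriction of \<open>X.dform psi\<close>.\<close>

lemma field_wedge_restrict: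
 assumes w: "!!c x. c \<in> charts X ==> x \<in> cimg c ==> omega c x = bform (w c x)" "X.covariant w"
  and L: "X.lexact W psi" and ZW: "points Z \<subseteq> W" and theta: "closed_form 1 Z theta"
  and R: "!!d y v. d \<in> charts Z ==> y \<in> cimg d ==> FD (%y'. psi (pt d y) (pt d y')) y v = one_form theta d y v"
  and d: "d \<in> charts Z" and c: "c \<in> charts X" and y: "y \<in> overlap d c"
 shows "field_wedge 1 (2 * m) theta (pullback_incl X (field_power omega m)) d y v =
  wedge1 m (X.dform psi c (trn d c y)) (w c (trn d c y)) (%i. FD (trn d c) y (v i))"
proof -
 note fa = incl_facts[OF d c y]
 define c0 where "c0 = (SOME c. c \<in> charts X & pt d y \<in> dom_of c)"
 have "c0 \<in> charts X & pt d y \<in> dom_of c0" unfolding c0_def by (rule someI[of _ c]) (use c fa in blast)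
 then have c0: "c0 \<in> charts X" "y \<in> overlap d c0" using fa(3) overlap_incl[OF d, of c0] by (auto simp: cset_def)
 note ic = incl_change_chart[OF d c0(1) c c0(2) y]
 have pw: "pullback_incl X (field_power omega m) d y u = wedge_power (bform (w c (trn d c y))) m (%i. FD (trn d c) y (u i))" for u
 proof -
  have "pullback_incl X (field_power omega m) d y u = wedge_power (bform (w c0 (trn d c0 y))) m (%i. FD (trn d c0) y (u i))"
   unfolding pullback_incl_def Let_def c0_def[symmetric] field_power_def w(1)[OF c0(1) incl_facts(2)[OF d c0]] ..
  also have "w c0 (trn d c0 y) = (%a b. w c (trn d c y) (FD (trn c0 c) (trn d c0 y) a) (FD (trn c0 c) (trn d c0 y) b))"
   using w(2) c0(1) c ic(1) unfolding X.covariant_def ic(2)[symmetric] by blast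
  also have "wedge_power (bform (%a b. w c (trn d c y) (FD (trn c0 c) (trn d c0 y) a) (FD (trn c0 c) (trn d c0 y) b))) m (%i. FD (trn d c0) y (u i))
    = wedge_power (bform (w c (trn d c y))) m (%i. FD (trn d c) y (u i))"
   unfolding wedge_power_bform ic(3) ..
  finally show ?thesis .
 qed
 have th: "theta d y u = X.dform psi c (trn d c y) (FD (trn d c) y (u 0))" for u
  using closed_one_form(4)[OF theta d fa(3), of u] R[OF d fa(3), of "u 0"] restrict_dform[OF L ZW d c y, of "u 0"] by simp
 show ?thesis unfolding field_wedge_def wedge1_def wedge_def pw th ..
qed

end

section \<open>Closed two-forms on open subsets\<close>

lemma FD_rules:
 fixes f g :: "'a::real_normed_vector => real"
 assumes f: "f differentiable (at x)" and g: "g differentiable (at x)"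
 shows "FD (%y. f y * g y) x v = f x * FD g x v + FD f x v * g x"
  "FD (%y. f y + g y) x v = FD f x v + FD g x v" "FD (%y. f y - g y) x v = FD f x v - FD g x v"
proof -
 note d = iffD1[OF frechet_derivative_works f] iffD1[OF frechet_derivative_works g]
 show "FD (%y. f y * g y) x v = f x * FD g x v + FD f x v * g x" by (simp only: FD_eqI[OF has_derivative_mult[OF d]])
 show "FD (%y. f y + g y) x v = FD f x v + FD g x v" by (simp only: FD_eqI[OF has_derivative_add[OF d]])
 show "FD (%y. f y - g y) x v = FD f x v - FD g x v" by (simp only: FD_eqI[OF has_derivative_diff[OF d]])
qed

lemma FD_real:
 fixes h :: "real => real" and f :: "'a::euclidean_space => real"
 assumes f: "smo S f" and h: "(h has_real_derivative h') (at (f x))" and x: "x \<in> S"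
 shows "FD (%y. h (f y)) x v = h' * FD f x v"
proof -
 have "(h has_derivative (%s. h' * s)) (at (f x))" using h by (simp add: has_field_derivative_def)
 from FD_eqI[OF has_derivative_compose[OF sm_has_derivative[OF f x] this]] show ?thesis by simp
qed

lemma sm_ln: "smo {0<..} (ln :: real => real)"
proof (rule sm_I[OF open_greaterThan])
 fix x :: real assume "x \<in> {0<..}"
 then show "(ln has_derivative (%v. v / x)) (at x)"
  using DERIV_ln_divide[of x] by (simp add: has_field_derivative_def mult.commute[of "1 / x"] divide_inverse mult_commute_abs)
next
 fix v :: real
 show "smo {0<..} (%x. v / x)" by (intro sm_divide sm_const sm_id open_greaterThan) auto
qed

text \<open>\<open>cutoff\<close> is antitone because \<open>flat_exp 0\<close> is monotone, so its
  derivative is nonpositive. The derivative vanishes outside the interval from 1/2 to 1, and on that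
  interval compactness bounds it.\<close>

lemma cutoff_deriv:
 obtains C where "C > 0" "!!t. (cutoff has_real_derivative deriv cutoff t) (at t)" "!!t. deriv cutoff t <= 0"
  "!!t. \<bar>deriv cutoff t\<bar> <= C" "!!t. t < 1/2 ==> deriv cutoff t = 0" "!!t. 1 < t ==> deriv cutoff t = 0"
proof -
 have D: "(cutoff has_derivative FD cutoff t) (at t)" for t by (rule sm_has_derivative[OF smooth_cutoff UNIV_I])
 have h: "(cutoff has_real_derivative FD cutoff t 1) (at t)" for t
 proof -
  have "FD cutoff t = (%s. FD cutoff t 1 * s)"
  proof
   fix s
   have "FD cutoff t (s *\<^sub>R 1) = s *\<^sub>R FD cutoff t 1" by (rule linear_scale[OF has_derivative_linear[OF D]])
   then show "FD cutoff t s = FD cutoff t 1 * s" by simp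
  qed
  then show ?thesis using D[of t] unfolding has_field_derivative_def by metis
 qed
 then have e: "deriv cutoff t = FD cutoff t 1" for t by (rule DERIV_imp_deriv)
 have mono: "flat_exp 0 s <= flat_exp 0 t" if "s <= t" for s t
  using that by (auto simp: flat_exp_def le_imp_inverse_le)
 have le: "cutoff t <= cutoff s" if st: "s <= t" for s t
 proof -
  have "flat_exp 0 (1 - t) <= flat_exp 0 (1 - s)" "flat_exp 0 (s - 1/2) <= flat_exp 0 (t - 1/2)" by (auto intro!: mono st)
  moreover have "flat_exp 0 u >= 0" for u by (simp add: flat_exp_def)
  ultimately have "flat_exp 0 (1 - t) * flat_exp 0 (s - 1/2) <= flat_exp 0 (1 - s) * flat_exp 0 (t - 1/2)" by (intro mult_mono)
  then have "flat_exp 0 (1 - t) * (flat_exp 0 (1 - s) + flat_exp 0 (s - 1/2)) <= flat_exp 0 (1 - s) * (flat_exp 0 (1 - t) + flat_exp 0 (t - 1/2))"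
   by (simp add: algebra_simps)
  then show ?thesis using cutoff_denominator[of s] cutoff_denominator[of t] unfolding cutoff_def
   by (simp add: pos_divide_le_eq pos_le_divide_eq)
 qed
 have neg: "deriv cutoff t <= 0" for t
 proof (rule ccontr)
  assume "~  deriv cutoff t <= 0"
  then obtain d where "d > 0" "!!h. h > 0 ==> h < d ==> cutoff t < cutoff (t + h)"
   using DERIV_pos_inc_right[of cutoff "deriv cutoff t" t] h e by auto
  then have "cutoff t < cutoff (t + d / 2)" by simp
  then show False using le[of t "t + d / 2"] \<open>d > 0\<close> by simp
 qed
 have z1: "deriv cutoff t = 0" if "t < 1/2" for t
 proof -
  have "FD cutoff t = FD (%_. 1) t" by (rule FD_cong[OF open_lessThan[of "1/2"]]) (use that cutoff_eq_1 in auto)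
  then show ?thesis by (simp add: e)
 qed
 have z2: "deriv cutoff t = 0" if "1 < t" for t
 proof -
  have "FD cutoff t = FD (%_. 0) t" by (rule FD_cong[OF open_greaterThan[of 1]]) (use that cutoff_eq_0 in auto)
  then show ?thesis by (simp add: e)
 qed
 have "continuous_on {1/2..1} (%t. FD cutoff t 1)"
  by (rule continuous_on_subset[OF sm_cont[OF sm_FD[OF smooth_cutoff]]]) simp
 then have "bounded ((%t. FD cutoff t 1) ` {1/2..1})" by (intro compact_imp_bounded compact_continuous_image) auto
 then obtain B where B: "B > 0" "!!t. t \<in> {1/2..1} ==> \<bar>FD cutoff t 1\<bar> <= B" unfolding bounded_pos by auto
 have b: "\<bar>deriv cutoff t\<bar> <= B" for t
 proof (cases "t \<in> {1/2..1}")
  case False then have "t < 1/2 \<or> 1 < t" by auto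
  then show ?thesis using z1 z2 B(1) by auto
 qed (use B(2) e in simp)
 show thesis by (rule that[OF B(1) _ neg b z1 z2]) (simp_all add: e h)
qed

lemma dext_cong: "open S ==> x \<in> S ==> (!!y. y \<in> S ==> w y = w' y) ==> dext w x a b c = dext w' x a b c"
proof -
 assume S: "open S" "x \<in> S" "!!y. y \<in> S ==> w y = w' y"
 have "FD (%y. w y u v) x = FD (%y. w' y u v) x" for u v by (rule FD_cong[OF S(1,2)]) (simp add: S(3))
 then show ?thesis unfolding dext_def by simp
qed

text \<open>The exterior derivative of df wedge t is - df wedge dt: the second derivatives of
  \<open>f\<close> cancel by symmetry. \<open>D\<close> is dt.\<close>

lemma dext_upd:
 fixes w :: "'e::euclidean_space => 'e => 'e => real"
 assumes S: "open S" "x \<in> S" and w: "!!u v. smo S (%y. w y u v)" and f: "smo S f" and t: "!!v. smo S (%y. t y v)"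
 defines "D \<equiv> %u v. FD (%y. t y v) x u - FD (%y. t y u) x v"
 shows "dext (%y. upd (w y) 1 (FD f y) (t y)) x a b c = dext w x a b c - (FD f x a * D b c - FD f x b * D a c + FD f x c * D a b)"
proof -
 define H where "H u h = FD (%y. FD f y u) x h" for u h
 have H: "H u h = H h u" for u h unfolding H_def by (rule second_derivative_symmetric[OF S(1) f S(2)])
 have d: "(%y. w y u v) differentiable (at x)" "(%y. FD f y u) differentiable (at x)" "(%y. t y u) differentiable (at x)" for u v
  using sm_diffble[OF w S(2)] sm_diffble[OF sm_FD[OF f] S(2)] sm_diffble[OF t S(2)] by auto
 have e: "FD (%y. upd (w y) 1 (FD f y) (t y) u v) x h = FD (%y. w y u v) x h
   + ((FD f x u * FD (%y. t y v) x h + H u h * t x v) - (FD f x v * FD (%y. t y u) x h + H v h * t x u))" for u v h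
 proof -
  have m: "(%y. FD f y u * t y v) differentiable (at x)" for u v by (intro differentiable_mult d)
  have "FD (%y. w y u v + (FD f y u * t y v - FD f y v * t y u)) x h
   = FD (%y. w y u v) x h + ((FD f x u * FD (%y. t y v) x h + H u h * t x v) - (FD f x v * FD (%y. t y u) x h + H v h * t x u))"
   unfolding FD_rules(2)[OF d(1) differentiable_diff[OF m m]] FD_rules(3)[OF m m] FD_rules(1)[OF d(2,3)] H_def ..
  then show ?thesis by (simp add: upd_def)
 qed
 show ?thesis unfolding dext_def e D_def H[of b a] H[of c a] H[of c b] by algebra
qed

text \<open>The exterior derivative commutes with pullback: the second derivatives of
  \<open>T\<close> enter symmetrically in \<open>u\<close> and \<open>v\<close> and cancel.\<close>

lemma FD_pullback_one_form:
 fixes T :: "'f::euclidean_space => 'e::euclidean_space" and t :: "'e => 'e => real"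
 assumes S: "open S" "y \<in> S" and V: "open V" and T: "smo S T" "!!z. z \<in> S ==> T z \<in> V"
  and l: "!!x. x \<in> V ==> linear (t x)" and t: "!!v. smo V (%x. t x v)"
 shows "FD (%z. t (T z) (FD T z v)) y u - FD (%z. t (T z) (FD T z u)) y v =
  FD (%x. t x (FD T y v)) (T y) (FD T y u) - FD (%x. t x (FD T y u)) (T y) (FD T y v)"
proof -
 have Tb: "smo S (%z. T z \<bullet> b)" for b by (intro sm_inner sm_const T(1) S)
 have FTb: "FD (%z. T z \<bullet> b) z v = FD T z v \<bullet> b" if "z \<in> S" for z v b
  using FD_eqI[OF has_derivative_inner_left[OF sm_has_derivative[OF T(1) that]], of b] by simp
 have tT: "smo S (%z. t (T z) b)" for b by (rule sm_compose[OF S(1) V t T])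
 have FtT: "FD (%z. t (T z) b) y u = FD (%x. t x b) (T y) (FD T y u)" for b u
  by (rule FD_compose[OF T(1) t S(2) T(2)[OF S(2)]])
 define s where "s u v = (\<Sum>b\<in>Basis. FD (%z. FD (%w. T w \<bullet> b) z v) y u * t (T y) b)" for u v
 have sym: "s u v = s v u" for u v unfolding s_def second_derivative_symmetric[OF S(1) Tb S(2), of _ v u] ..
 have "FD (%z. t (T z) (FD T z v)) y u = s u v + FD (%x. t x (FD T y v)) (T y) (FD T y u)" for u v
 proof -
  have e: "t (T z) (FD T z v) = (\<Sum>b\<in>Basis. FD (%w. T w \<bullet> b) z v * t (T z) b)" if "z \<in> S" for z
   using linear_basis_expand[OF l[OF T(2)[OF that]], of "FD T z v"] FTb[OF that] by simp
  have d: "(%z. FD (%w. T w \<bullet> b) z v) differentiable (at y)" "(%z. t (T z) b) differentiable (at y)" for b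
   using sm_diffble[OF sm_FD[OF Tb] S(2)] sm_diffble[OF tT S(2)] by auto
  have "FD (%z. t (T z) (FD T z v)) y u = FD (%z. \<Sum>b\<in>Basis. FD (%w. T w \<bullet> b) z v * t (T z) b) y u"
   by (rule fun_cong[OF FD_cong[OF S e]])
  also have "... = (\<Sum>b\<in>Basis. FD (%z. FD (%w. T w \<bullet> b) z v * t (T z) b) y u)"
   using FD_sum_coeffs[of Basis "%b z. FD (%w. T w \<bullet> b) z v * t (T z) b" y "%_. 1" u] differentiable_mult[OF d] by simp
  also have "... = s u v + (\<Sum>b\<in>Basis. (FD T y v \<bullet> b) * FD (%x. t x b) (T y) (FD T y u))"
   unfolding FD_rules(1)[OF d] s_def FTb[OF S(2)] FtT by (simp add: sum.distrib)
  also have "(\<Sum>b\<in>Basis. (FD T y v \<bullet> b) * FD (%x. t x b) (T y) (FD T y u)) = FD (%x. t x (FD T y v)) (T y) (FD T y u)"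
   by (rule FD_linear_slot[OF V T(2)[OF S(2)] l sm_diffble[OF t T(2)[OF S(2)]], symmetric])
  finally show ?thesis .
 qed
 then show ?thesis using sym[of u v] by simp
qed

lemma sm_bilinear_family:
 fixes q :: "'a::euclidean_space => 'e::euclidean_space => 'e => real"
 assumes S: "open S" and q: "!!x. x \<in> S ==> alt2 (q x)" "!!u v. smo S (%x. q x u v)" and UV: "smo S U" "smo S V"
 shows "smo S (%x. q x (U x) (V x))"
proof (rule sm_linear_family[OF S _ _ UV(2), where L = "%x. q x (U x)"])
 show "linear (q x (U x))" if "x \<in> S" for x by (rule alt2D(1)[OF q(1)[OF that]])
 show "smo S (%x. q x (U x) v)" for v
  by (rule sm_linear_family[OF S _ q(2) UV(1)]) (rule alt2D(2)[OF q(1)])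
qed

text \<open>The value at a zero of \<open>F\<close> is the limit from outside the zero set. It
  depends on no choice of a smooth representative near the zero, so local extensions agree
  automatically.\<close>

definition ext0 :: "('a::euclidean_space => real) => ('a => real) => 'a => real" where
 "ext0 F g x = (if F x ~= 0 then g x else Lim (at x within {y. F y ~= 0}) g)"

lemma ext0_eq:
 assumes S: "open S" "x \<in> S" and nd: "!!y. y \<in> S ==> F y = 0 ==> \<exists>e. FD F y e ~= 0"
  and q: "continuous_on S q" and g: "!!y. y \<in> S ==> F y ~= 0 ==> g y = q y"
 shows "ext0 F g x = q x"
proof (cases "F x = 0")
 case True
 have "x islimpt {y. F y ~= 0}" unfolding islimpt_def
 proof (intro allI impI)
  fix T assume T: "x \<in> T" "open T"
  show "\<exists>y\<in>{y. F y ~= 0}. y \<in> T & y ~= x"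
  proof (rule ccontr)
   assume "~  ?thesis"
   then have "F y = 0" if "y \<in> T" for y using True that by auto
   then have "FD F x = FD (%_. 0) x" by (intro FD_cong[OF T(2,1)])
   then have "FD F x e = 0" for e by simp
   then show False using nd[OF S(2) True] by simp
  qed
 qed
 then have nt: "at x within {y. F y ~= 0} ~= bot" by (simp add: trivial_limit_within)
 have "(q \<longlongrightarrow> q x) (at x within {y. F y ~= 0})"
  using q S by (meson continuous_on_eq_continuous_at isCont_def tendsto_within_subset subset_UNIV)
 moreover have "eventually (%y. q y = g y) (at x within {y. F y ~= 0})"
  unfolding eventually_at_topological using S g by (intro exI[of _ S]) simp
 ultimately have "(g \<longlongrightarrow> q x) (at x within {y. F y ~= 0})" by (rule Lim_transform_eventually)
 then show ?thesis using True tendsto_Lim[OF nt] by (simp add: ext0_def)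
qed (simp add: ext0_def g S)

lemma alt2_iff:
 fixes w :: "'e::real_vector => 'e => real"
 shows "alt2 w \<longleftrightarrow> (\<forall>x u v. w x (u + v) - (w x u + w x v) = 0) & (\<forall>x k u. w x (k *\<^sub>R u) - k * w x u = 0) &
  (\<forall>x u v. w (u + v) x - (w u x + w v x) = 0) & (\<forall>x k u. w (k *\<^sub>R u) x - k * w u x = 0) & (\<forall>x. w x x = 0)"
 unfolding alt2_def linear_iff by auto

text \<open>A map intertwines two forms exactly when its transpose intertwines their inverses. This
  converts covariance of a form into contravariance of its inverse, and back.\<close>

lemma ipair_transform:
 fixes T :: "'e::euclidean_space => 'e"
 assumes T: "linear T" "inj T" and P: "alt2 P" "alt2 P'" "ipair P w" "ipair P' w'" and w: "alt2 w" "alt2 w'"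
 shows "(\<forall>u v. w u v = w' (T u) (T v)) \<longleftrightarrow> (\<forall>a b. P' a b = P (dualv (%u. a \<bullet> T u)) (dualv (%u. b \<bullet> T u)))"
proof -
 obtain R where R: "linear R" "!!x. R (T x) = x" "!!x. T (R x) = x"
  using linear_injective_isomorphism[OF T] by blast
 define A where "A a = dualv (%u. a \<bullet> T u)" for a
 have A: "A a \<bullet> u = a \<bullet> T u" for a u unfolding A_def
  by (rule inner_dualv) (rule linear_compose[OF T(1) linear_inner, unfolded o_def])
 have surj: "\<exists>b. y = A b" for y
 proof
  have "dualv (%z. y \<bullet> R z) \<bullet> T u = y \<bullet> u" for u
   using inner_dualv[OF linear_compose[OF R(1) linear_inner, unfolded o_def], of y "T u"] R(2) by simp
  then have "A (dualv (%z. y \<bullet> R z)) \<bullet> u = y \<bullet> u" for u by (simp only: A)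
  then show "y = A (dualv (%z. y \<bullet> R z))" by (metis vector_eq_rdot)
 qed
 have iP: "(\<forall>y. w u y = x \<bullet> y) \<longleftrightarrow> (\<forall>y. P x y = u \<bullet> y)" "(\<forall>y. w' u y = x \<bullet> y) \<longleftrightarrow> (\<forall>y. P' x y = u \<bullet> y)" for x u
  using P(3,4) unfolding ipair_def by blast+
 have 1: "P' a b = P (A a) (A b)" if w: "!!u v. w u v = w' (T u) (T v)" for a b
 proof -
  define s where "s = dualv (P' a)"
  have s: "P' a y = s \<bullet> y" for y unfolding s_def by (rule inner_dualv[OF alt2D(1)[OF P(2)], symmetric])
  then have "w' s y = a \<bullet> y" for y using iP(2) by blast
  then have "w (R s) v = A a \<bullet> v" for v by (simp add: w R A)
  then have "P (A a) y = R s \<bullet> y" for y using iP(1) by blast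
  then have "P (A a) (A b) = A b \<bullet> R s" by (simp add: inner_commute)
  then show ?thesis by (simp add: A R s inner_commute)
 qed
 have 2: "w u v = w' (T u) (T v)" if P': "!!a b. P' a b = P (A a) (A b)" for u v
 proof -
  define a where "a = dualv (w' (T u))"
  have a: "w' (T u) y = a \<bullet> y" for y unfolding a_def by (rule inner_dualv[OF alt2D(1)[OF w(2)], symmetric])
  then have "P' a y = T u \<bullet> y" for y using iP(2) by blast
  then have "P (A a) (A b) = u \<bullet> A b" for b using P'[of a b] A[of b u] by (simp add: inner_commute)
  then have "P (A a) y = u \<bullet> y" for y using surj[of y] by auto
  then have "w u y = A a \<bullet> y" for y using iP(1) by blast
  then show ?thesis by (simp add: A a)
 qed
 show ?thesis using 1 2 unfolding A_def by blast
qed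

context smooth_mfd
begin

lemma FD_sfun:
 assumes N: "opn M N" and f: "sfun N f" and c: "c \<in> charts M" "d \<in> charts M" "x \<in> overlap c d" and x: "pt c x \<in> N"
 shows "FD (%y. f (pt c y)) x v = FD (%y. f (pt d y)) (trn c d x) (FD (trn c d) x v)"
proof -
 have "FD (%y. f (pt c y)) x v = FD (%y. f (pt d (trn c d y))) x v"
  by (rule fun_cong[OF FD_cong[OF open_ov[OF c(1,2)] c(3)]]) (simp add: trn_ov(3)[OF c(1,2)])
 also have "FD (%y. f (pt d (trn c d y))) x v = FD (%y. f (pt d y)) (trn c d x) (FD (trn c d) x v)"
  by (rule FD_compose[OF sm_trn[OF c(1,2)] sfunD[OF f c(2)] c(3)])
   (use x trn_ov(3,5)[OF c] in \<open>simp add: cset_def\<close>)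
 finally show ?thesis .
qed

definition closed2 :: "'a set => (('a, 'e) chart => 'e => 'e => 'e => real) => bool" where
 "closed2 V w \<longleftrightarrow> (\<forall>c\<in>charts M. (\<forall>x\<in>cset c V. alt2 (w c x) & (\<forall>a b e. dext (w c) x a b e = 0)) &
   (\<forall>u v. smo (cset c V) (%x. w c x u v)) &
   (\<forall>d\<in>charts M. \<forall>x\<in>overlap c d. x \<in> cset c V -->
    (\<forall>u v. w c x u v = w d (trn c d x) (FD (trn c d) x u) (FD (trn c d) x v))))"

lemma closed2D:
 assumes "closed2 V w" "c \<in> charts M"
 shows "x \<in> cset c V ==> alt2 (w c x)" "x \<in> cset c V ==> dext (w c) x a b e = 0" "smo (cset c V) (%x. w c x u v)"
  "d \<in> charts M ==> x \<in> overlap c d ==> x \<in> cset c V ==>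
    w c x u v = w d (trn c d x) (FD (trn c d) x u) (FD (trn c d) x v)"
 using assms unfolding closed2_def by blast+

lemma closed2_mono: assumes "closed2 V w" "U \<subseteq> V" shows "closed2 U w"
proof -
 have "cset c U \<subseteq> cset c V" for c using assms(2) by (auto simp: cset_def)
 then show ?thesis using assms(1) sm_subset unfolding closed2_def by (meson subset_iff)
qed

lemma closed2_cong:
 assumes w: "closed2 V w" and V: "opn M V" and e: "!!c x. c \<in> charts M ==> x \<in> cset c V ==> w' c x = w c x"
 shows "closed2 V w'"
 unfolding closed2_def
proof (intro ballI conjI allI impI)
 fix c assume c: "c \<in> charts M"
 note o = open_cset[OF c V]
 show "smo (cset c V) (%x. w' c x u v)" for u v
  by (rule sm_eq[OF o closed2D(3)[OF w c, of u v]]) (simp add: e[OF c])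
 fix x assume x: "x \<in> cset c V"
 show "alt2 (w' c x)" unfolding e[OF c x] by (rule closed2D(1)[OF w c x])
 show "dext (w' c) x a b k = 0" for a b k
  using dext_cong[where a = a and b = b and c = k, OF o x e[OF c]] closed2D(2)[OF w c x] by simp
next
 fix c d x u v assume c: "c \<in> charts M" "d \<in> charts M" "x \<in> overlap c d" and x: "x \<in> cset c V"
 have "trn c d x \<in> cset d V" using x trn_ov(3,5)[OF c] by (simp add: cset_def)
 then show "w' c x u v = w' d (trn c d x) (FD (trn c d) x u) (FD (trn c d) x v)"
  using closed2D(4)[OF w c x] e[OF c(1) x] e[OF c(2)] by simp
qed

lemma closed2_points:
 "closed2 (points M) w \<longleftrightarrow> two_field w & covariant w & (\<forall>c\<in>charts M. \<forall>x\<in>cimg c. \<forall>a b e. dext (w c) x a b e = 0)"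
proof -
 have c: "cset c (points M) = cimg c" if "c \<in> charts M" for c by (rule cset_points[OF that])
 have o: "x \<in> cimg c" if "c \<in> charts M" "d \<in> charts M" "x \<in> overlap c d" for c d x by (rule trn_ov(4)[OF that])
 show ?thesis unfolding closed2_def two_field_def covariant_def using c o by (simp cong: ball_cong) blast
qed

lemma closed_form_closed2:
 "closed2 (points M) w ==> closed_form 2 M (unc w)" "closed_form 2 M omega ==> closed2 (points M) (cur omega)"
proof -
 assume "closed2 (points M) w"
 then have w: "two_field w" "covariant w" "\<forall>c\<in>charts M. \<forall>x\<in>cimg c. \<forall>a b e. dext (w c) x a b e = 0"
  unfolding closed2_points by auto
 show "closed_form 2 M (unc w)" using w(3) unfolding closed_form_2[OF diff_form_2I[OF w(1,2)]] cur_unc .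
next
 assume c: "closed_form 2 M omega"
 then have d: "diff_form 2 M omega" by (simp add: closed_form_def)
 show "closed2 (points M) (cur omega)" using c diff_form_2D(1,2)[OF d] unfolding closed_form_2[OF d] closed2_points by blast
qed

text \<open>The correction df wedge d psi, switched off outside the set \<open>W\<close> on which
  psi is given; \<open>f\<close> is meant to vanish near the points outside
  \<open>W\<close>.\<close>

definition add_exact :: "'a set => ('a => real) => ('a => 'a => real) => (('a, 'e) chart => 'e => 'e => 'e => real) =>
  ('a, 'e) chart => 'e => 'e => 'e => real" where
 "add_exact W f psi w c x = (if pt c x \<in> W then upd (w c x) 1 (FD (%y. f (pt c y)) x) (dform psi c x) else w c x)"

lemma add_exact_outside:
 assumes c: "c \<in> charts M" and N: "opn M N" "x \<in> cset c N" "!!q. q \<in> N ==> f q = 0"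
 shows "add_exact W f psi w c x = w c x"
proof -
 have "FD (%y. f (pt c y)) x = FD (%_. 0) x"
  by (rule FD_cong[OF open_cset[OF c N(1)] N(2)]) (use N(3) in \<open>simp add: cset_def\<close>)
 then show ?thesis by (simp add: add_exact_def upd_def)
qed

text \<open>Around every point of \<open>V\<close> the correction is d phi wedge d Psi with smooth
  functions on an open set; outside \<open>W\<close> both can be taken to be zero. Closedness is
  then \<open>dext_upd\<close> with an exact second factor.\<close>

lemma closed2_add_exact:
 assumes w: "closed2 V w" and V: "opn M V" and W: "opn M W" and L: "lexact W psi" and f: "sfun (V \<inter> W) f"
  and z: "!!p. p \<in> V ==> p \<notin> W ==> \<exists>N. opn M N & p \<in> N & (\<forall>q\<in>N. f q = 0)"
 shows "closed2 V (add_exact W f psi w)"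
proof -
 have VW: "opn M (V \<inter> W)" using V W by blast
 have loc: "\<exists>S phi Psi. open S & x \<in> S & S \<subseteq> cset c V & smo S phi & smo S Psi &
   (\<forall>y\<in>S. add_exact W f psi w c y = upd (w c y) 1 (FD phi y) (FD Psi y))" if c: "c \<in> charts M" and x: "x \<in> cset c V" for c x
 proof (cases "pt c x \<in> W")
  case True
  then have xW: "x \<in> cset c W" using x by (simp add: cset_def)
  obtain S Psi where S: "open S" "x \<in> S" "S \<subseteq> cset c W" "smo S Psi" "!!y. y \<in> S ==> dform psi c y = FD Psi y"
   by (rule dform_local[OF L c xW], rule that)
  let ?S = "S \<inter> cset c V"
  have sub: "?S \<subseteq> cset c (V \<inter> W)" using S(3) by (auto simp: cset_def)
  have "add_exact W f psi w c y = upd (w c y) 1 (FD (%y. f (pt c y)) y) (FD Psi y)" if "y \<in> ?S" for y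
   using that sub S(5)[of y] unfolding add_exact_def by (auto simp: cset_def)
  then show ?thesis using sm_subset[OF sfunD[OF f c] sub] sm_subset[OF S(4)] S(1,2) x open_cset[OF c V]
   by (intro exI[of _ ?S] exI[of _ "%y. f (pt c y)"] exI[of _ Psi]) (simp add: open_Int)
 next
  case False
  have "pt c x \<in> V" using x by (simp add: cset_def)
  from z[OF this False] obtain N where N: "opn M N" "pt c x \<in> N" "!!q. q \<in> N ==> f q = 0" by auto
  let ?S = "cset c N \<inter> cset c V"
  have "open ?S" using open_cset[OF c V] open_cset[OF c N(1)] by (simp add: open_Int)
  moreover have "add_exact W f psi w c y = upd (w c y) 1 (FD (%_. 0 :: real) y) (FD (%_. 0 :: real) y)" if "y \<in> ?S" for y
   using add_exact_outside[where x = y and W = W and psi = psi and w = w, OF c N(1) _ N(3)] that by (simp add: upd_def)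
  ultimately show ?thesis using x N(2)
   by (intro exI[of _ ?S] exI[of _ "%_. 0 :: real"] conjI ballI) (auto simp: cset_def intro: sm_const)
 qed
 show ?thesis unfolding closed2_def
 proof (intro ballI conjI allI impI)
  fix c x a b e assume c: "c \<in> charts M" and x: "x \<in> cset c V"
  from loc[OF this] obtain S phi Psi where S: "open S" "x \<in> S" "S \<subseteq> cset c V" "smo S phi" "smo S Psi"
   "!!y. y \<in> S ==> add_exact W f psi w c y = upd (w c y) 1 (FD phi y) (FD Psi y)" by auto
  show "alt2 (add_exact W f psi w c x)" unfolding S(6)[OF S(2)]
   by (rule alt2_upd[OF closed2D(1)[OF w c x] sm_linear_FD[OF S(4,2)] sm_linear_FD[OF S(5,2)]])
  have "dext (add_exact W f psi w c) x a b e = dext (%y. upd (w c y) 1 (FD phi y) (FD Psi y)) x a b e" by (rule dext_cong[OF S(1,2,6)])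
  also have "... = 0" unfolding dext_upd[OF S(1,2) sm_subset[OF closed2D(3)[OF w c] S(3)] S(4) sm_FD[OF S(5)]]
   using closed2D(2)[OF w c x] second_derivative_symmetric[OF S(1,5,2)] by simp
  finally show "dext (add_exact W f psi w c) x a b e = 0" .
 next
  fix c u v assume c: "c \<in> charts M"
  show "smo (cset c V) (%x. add_exact W f psi w c x u v)"
  proof (rule sm_local)
   fix x assume "x \<in> cset c V"
   from loc[OF c this] obtain S phi Psi where S: "open S" "x \<in> S" "S \<subseteq> cset c V" "smo S phi" "smo S Psi"
    "!!y. y \<in> S ==> add_exact W f psi w c y = upd (w c y) 1 (FD phi y) (FD Psi y)" by auto
   have "smo S (%y. upd (w c y) 1 (FD phi y) (FD Psi y) u v)" unfolding upd_def
    by (intro sm_add sm_mult sm_diff sm_const sm_FD S sm_subset[OF closed2D(3)[OF w c] S(3)])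
   then have "smo S (%x. add_exact W f psi w c x u v)" by (rule sm_eq[OF S(1)]) (simp add: S(6))
   then show "\<exists>T. open T & x \<in> T & smo T (%x. add_exact W f psi w c x u v)" using S(1,2) by blast
  qed
 next
  fix c d x u v assume c: "c \<in> charts M" "d \<in> charts M" "x \<in> overlap c d" and x: "x \<in> cset c V"
  have p: "pt d (trn c d x) = pt c x" by (rule trn_ov(3)[OF c])
  note w' = closed2D(4)[OF w c x]
  show "add_exact W f psi w c x u v = add_exact W f psi w d (trn c d x) (FD (trn c d) x u) (FD (trn c d) x v)"
  proof (cases "pt c x \<in> W")
   case True
   then have xW: "pt c x \<in> V \<inter> W" "x \<in> cset c W" using x by (auto simp: cset_def)
   show ?thesis unfolding add_exact_def p upd_def using True
    by (simp add: w'[of u v] FD_sfun[OF VW f c xW(1)] dform_transition[OF L c xW(2)])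
  qed (simp add: add_exact_def p w'[of u v])
 qed
qed

section \<open>Extension of fields across a regular zero set\<close>

definition cuts_out :: "(('a, 'e) chart => 'e => real) => 'a set => bool" where
 "cuts_out F A \<longleftrightarrow> density F & closedin (mtop M) A & (\<forall>c\<in>charts M. \<forall>x\<in>cimg c.
   (F c x = 0 \<longleftrightarrow> pt c x \<in> A) & (F c x = 0 --> (\<exists>e. FD (F c) x e ~= 0)))"

lemma cuts_outD:
 assumes "cuts_out F A"
 shows "density F" "closedin (mtop M) A" "c \<in> charts M ==> x \<in> cimg c ==> F c x = 0 \<longleftrightarrow> pt c x \<in> A"
  "c \<in> charts M ==> x \<in> cimg c ==> F c x = 0 ==> \<exists>e. FD (F c) x e ~= 0"
  "c \<in> charts M ==> smo (cimg c) (F c)" "opn M (points M - A)"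
  "c \<in> charts M ==> x \<in> cset c (points M - A) \<longleftrightarrow> x \<in> cimg c & F c x ~= 0"
proof -
 show 1: "density F" "closedin (mtop M) A" and 3: "c \<in> charts M ==> x \<in> cimg c ==> F c x = 0 \<longleftrightarrow> pt c x \<in> A"
  and "c \<in> charts M ==> x \<in> cimg c ==> F c x = 0 ==> \<exists>e. FD (F c) x e ~= 0" for c x
  using assms unfolding cuts_out_def by blast+
 show "c \<in> charts M ==> smo (cimg c) (F c)" for c using 1 unfolding density_def by blast
 show "opn M (points M - A)" using 1(2) by blast
 show "c \<in> charts M ==> x \<in> cset c (points M - A) \<longleftrightarrow> x \<in> cimg c & F c x ~= 0" for c x
  using 3[of c x] pt_points[of c x] unfolding cset_def by auto
qed

lemma dense0:
 fixes f :: "'e => real"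
 assumes Z: "cuts_out F A" and c: "c \<in> charts M" and S: "open S" "S \<subseteq> cimg c" "x \<in> S" and f: "continuous_on S f"
  and z: "!!y. y \<in> S ==> F c y ~= 0 ==> f y = 0"
 shows "f x = 0"
proof (rule zero_dense[where F = "F c", OF S(1) _ f _ S(3)])
 show "\<exists>e. FD (F c) y e ~= 0" if "y \<in> S" "F c y = 0" for y using cuts_outD(4)[OF Z c _ that(2)] S(2) that(1) by blast
qed (rule z)

definition ext2 :: "(('a, 'e) chart => 'e => real) => (('a, 'e) chart => 'e => 'e => 'e => real) =>
  ('a, 'e) chart => 'e => 'e => 'e => real" where
 "ext2 F w c x u v = ext0 (F c) (%y. w c y u v) x"

lemma ext2_off: "F c x ~= 0 ==> ext2 F w c x = w c x"
 by (rule ext, rule ext) (simp add: ext2_def ext0_def)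

text \<open>Near a zero of \<open>F\<close> the limit agrees with the given smooth \<open>q\<close>,
  which gives smoothness entry by entry. Bilinearity and skew-symmetry hold off the zeros and extend
  by density.\<close>

lemma two_field_ext2:
 assumes Z: "cuts_out F A" and alt: "!!c x. c \<in> charts M ==> x \<in> cimg c ==> F c x ~= 0 ==> alt2 (w c x)"
  and sm: "!!c u v. c \<in> charts M ==> smo (cset c (points M - A)) (%x. w c x u v)"
  and loc: "!!c x u v. c \<in> charts M ==> x \<in> cimg c ==> F c x = 0 ==> \<exists>S q. open S & x \<in> S & S \<subseteq> cimg c &
    smo S q & (\<forall>y\<in>S. F c y ~= 0 --> w c y u v = q y)"
 shows "two_field (ext2 F w)"
proof -
 let ?E = "ext2 F w"
 have s: "smo (cimg c) (%x. ?E c x u v)" if c: "c \<in> charts M" for c u v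
 proof (rule sm_local)
  fix x assume x: "x \<in> cimg c"
  show "\<exists>T. open T & x \<in> T & smo T (%x. ?E c x u v)"
  proof (cases "F c x = 0")
   case True
   from loc[OF c x this, of u v] obtain S q where S: "open S" "x \<in> S" "S \<subseteq> cimg c" "smo S q"
    and q: "\<forall>y\<in>S. F c y ~= 0 --> w c y u v = q y" by (elim exE conjE)
   have "smo S (%x. ?E c x u v)"
   proof (rule sm_eq[OF S(1,4)])
    fix y assume y: "y \<in> S"
    show "?E c y u v = q y" unfolding ext2_def
    proof (rule ext0_eq[OF S(1) y _ sm_cont[OF S(4)]])
    show "\<exists>e. FD (F c) z e ~= 0" if "z \<in> S" "F c z = 0" for z using cuts_outD(4)[OF Z c _ that(2)] S(3) that(1) by blast
    show "w c z u v = q z" if "z \<in> S" "F c z ~= 0" for z using q that by blast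
    qed
   qed
   then show ?thesis using S(1,2) by blast
  next
   case False
   let ?S = "cset c (points M - A)"
   have o: "open ?S" by (rule open_cset[OF c cuts_outD(6)[OF Z]])
   have "smo ?S (%x. ?E c x u v)"
    by (rule sm_eq[OF o sm[OF c]]) (simp add: ext2_off cuts_outD(7)[OF Z c])
   moreover have "x \<in> ?S" using x False by (simp add: cuts_outD(7)[OF Z c])
   ultimately show ?thesis using o by blast
  qed
 qed
 have a: "alt2 (?E c x)" if c: "c \<in> charts M" and x: "x \<in> cimg c" for c x
 proof -
  note sc = s[OF c] and o = open_coord[OF c]
  note D = dense0[OF Z c o order_refl x sm_cont]
  have off: "alt2 (?E c y)" if "y \<in> cimg c" "F c y ~= 0" for y using alt[OF c that] ext2_off[where F = F and c = c and x = y, OF that(2)] by simp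
  show ?thesis unfolding alt2_iff
  proof (intro conjI allI)
   fix x' u v :: 'e and k :: real
   show "?E c x x' (u + v) - (?E c x x' u + ?E c x x' v) = 0"
    by (rule D, intro sm_diff sm_add o sc) (use off in \<open>simp add: alt2_iff\<close>)
   show "?E c x x' (k *\<^sub>R u) - k * ?E c x x' u = 0"
    by (rule D, intro sm_diff sm_mult sm_const o sc) (use off in \<open>simp add: alt2_iff\<close>)
   show "?E c x (u + v) x' - (?E c x u x' + ?E c x v x') = 0"
    by (rule D, intro sm_diff sm_add o sc) (use off in \<open>simp add: alt2_iff\<close>)
   show "?E c x (k *\<^sub>R u) x' - k * ?E c x u x' = 0"
    by (rule D, intro sm_diff sm_mult sm_const o sc) (use off in \<open>simp add: alt2_iff\<close>)
   show "?E c x x' x' = 0"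
    by (rule D, rule sc) (use off in \<open>simp add: alt2_iff\<close>)
  qed
 qed
 show ?thesis unfolding two_field_def using a s by blast
qed

lemma sm_field_transition:
 assumes E: "two_field E" and c: "c \<in> charts M" "d \<in> charts M"
 shows "smo (overlap c d) (%x. E d (trn c d x) (FD (trn c d) x u) (FD (trn c d) x v))"
  "smo (overlap c d) (%x. E d (trn c d x) u v)"
  "smo (overlap c d) (%x. E c x (dualv (%u'. u \<bullet> FD (trn c d) x u')) (dualv (%u'. v \<bullet> FD (trn c d) x u')))"
proof -
 note o = open_ov[OF c] and T = sm_trn[OF c]
 have sub: "overlap c d \<subseteq> cimg c" using trn_ov(4)[OF c] by blast
 show 2: "smo (overlap c d) (%x. E d (trn c d x) u v)" for u v
  by (rule sm_compose[OF o open_coord[OF c(2)] two_fieldD(2)[OF E c(2)] T trn_ov(5)[OF c]])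
 show "smo (overlap c d) (%x. E d (trn c d x) (FD (trn c d) x u) (FD (trn c d) x v))"
  by (rule sm_bilinear_family[OF o _ 2 sm_FD[OF T] sm_FD[OF T]])
   (rule two_fieldD(1)[OF E c(2) trn_ov(5)[OF c]])
 have A: "smo (overlap c d) (%x. dualv (%u'. u \<bullet> FD (trn c d) x u'))" for u
  unfolding dualv_def by (intro sm_sum sm_scaleR sm_inner sm_const sm_FD[OF T] o)
 show "smo (overlap c d) (%x. E c x (dualv (%u'. u \<bullet> FD (trn c d) x u')) (dualv (%u'. v \<bullet> FD (trn c d) x u')))"
  by (rule sm_bilinear_family[OF o _ sm_subset[OF two_fieldD(2)[OF E c(1)] sub] A A])
   (rule two_fieldD(1)[OF E c(1) subsetD[OF sub]])
qed

text \<open>Covariance and closedness are equations between continuous functions, known on a dense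
  set.\<close>

lemma closed2_dense:
 assumes Z: "cuts_out F A" and E: "two_field E" and V: "closed2 (points M - A) E"
 shows "closed2 (points M) E"
 unfolding closed2_points
proof (intro conjI ballI allI E)
 show "covariant E" unfolding covariant_def
 proof (intro ballI allI)
  fix c d x u v assume c: "c \<in> charts M" "d \<in> charts M" and x: "x \<in> overlap c d"
  note o = open_ov[OF c]
  have sub: "overlap c d \<subseteq> cimg c" using trn_ov(4)[OF c] by blast
  have "E c x u v - E d (trn c d x) (FD (trn c d) x u) (FD (trn c d) x v) = 0"
  proof (rule dense0[OF Z c(1) o sub x sm_cont])
   show "smo (overlap c d) (%x. E c x u v - E d (trn c d x) (FD (trn c d) x u) (FD (trn c d) x v))"
    by (intro sm_diff o sm_field_transition E c sm_subset[OF two_fieldD(2)[OF E c(1)] sub])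
   fix y assume y: "y \<in> overlap c d" "F c y ~= 0"
   then have "y \<in> cset c (points M - A)" using sub cuts_outD(7)[OF Z c(1)] by blast
   from closed2D(4)[OF V c(1) c(2) y(1) this]
   show "E c y u v - E d (trn c d y) (FD (trn c d) y u) (FD (trn c d) y v) = 0" by simp
  qed
  then show "E c x u v = E d (trn c d x) (FD (trn c d) x u) (FD (trn c d) x v)" by simp
 qed
 fix c x a b e assume c: "c \<in> charts M" and x: "x \<in> cimg c"
 note o = open_coord[OF c]
 show "dext (E c) x a b e = 0"
 proof (rule dense0[OF Z c o order_refl x sm_cont])
  show "smo (cimg c) (%x. dext (E c) x a b e)"
   unfolding dext_def by (intro sm_add sm_diff o sm_FD two_fieldD(2)[OF E c])
  fix y assume "y \<in> cimg c" "F c y ~= 0"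
  then show "dext (E c) y a b e = 0" using closed2D(2)[OF V c] cuts_outD(7)[OF Z c] by blast
 qed
qed

context
 fixes n :: nat assumes dim: "DIM('e) = 2 * n"
begin

text \<open>Off the zeros the inverse form is smooth by the explicit formula \<open>pinv\<close>,
  closed by \<open>jac_eq_dext\<close> and covariant by \<open>ipair_transform\<close>.\<close>

lemma inverse_closed2:
 assumes P: "two_field P" "contravariant P" "!!c x a b e. c \<in> charts M ==> x \<in> cimg c ==> jac (P c) x a b e = 0"
  and Z: "cuts_out (%c x. Pf n (P c x)) A"
 shows "closed2 (points M - A) (%c x. pinv n (P c x))"
 unfolding closed2_def
proof (intro ballI conjI allI impI)
 let ?V = "points M - A"
 have nz: "Pf n (P c x) ~= 0" "alt2 (P c x)" "alt2 (pinv n (P c x))" "ipair (P c x) (pinv n (P c x))" if "c \<in> charts M" "x \<in> cset c ?V" for c x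
 proof -
  show 1: "Pf n (P c x) ~= 0" and 2: "alt2 (P c x)" using that cuts_outD(7)[OF Z that(1)] two_fieldD(1)[OF P(1) that(1)] by auto
  show "alt2 (pinv n (P c x))" by (rule alt2_pinv[OF dim 2])
  show "ipair (P c x) (pinv n (P c x))" by (rule ipair_sym[OF ipair_pinv[OF dim 2 1]])
 qed
 fix c assume c: "c \<in> charts M"
 have o: "open (cset c ?V)" by (rule open_cset[OF c cuts_outD(6)[OF Z]])
 have s: "smo (cset c ?V) (%x. P c x u v)" for u v by (rule sm_subset[OF two_fieldD(2)[OF P(1) c] cset_subset])
 show s': "smo (cset c ?V) (%x. pinv n (P c x) u v)" for u v
  unfolding pinv_def
  by (intro sm_divide sm_minus sm_dPf sm_Pf sm_const s o nz(1)[OF c])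
 {
  fix x assume x: "x \<in> cset c ?V"
  show "alt2 (pinv n (P c x))" by (rule nz(3)[OF c x])
  fix a b e
  have u: "pinv n (P c x) u z = dualv (pinv n (P c x) u) \<bullet> z" for u z
   by (rule inner_dualv[OF alt2D(1)[OF nz(3)[OF c x]], symmetric])
  have "jac (P c) x (dualv (pinv n (P c x) a)) (dualv (pinv n (P c x) b)) (dualv (pinv n (P c x) e)) = dext (%x. pinv n (P c x)) x a b e"
   by (rule jac_eq_dext[OF o x nz(2)[OF c] nz(3)[OF c] nz(4)[OF c] s s' u u u])
  then show "dext (%x. pinv n (P c x)) x a b e = 0" using P(3)[OF c subsetD[OF cset_subset x]] by simp
 }
 fix d x u v assume d: "d \<in> charts M" and x: "x \<in> overlap c d" "x \<in> cset c ?V"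
 let ?y = "trn c d x"
 have y: "?y \<in> cset d ?V" using x(2) trn_ov(3,5)[OF c d x(1)] by (simp add: cset_def)
 have "\<forall>a b. P d ?y a b = P c x (dualv (%u. a \<bullet> FD (trn c d) x u)) (dualv (%u. b \<bullet> FD (trn c d) x u))"
  using P(2) c d x(1) unfolding contravariant_def by blast
 from iffD2[OF ipair_transform[OF linear_transition_FD[OF c d x(1)] inj_transition_FD[OF c d x(1)] nz(2)[OF c x(2)] nz(2)[OF d y]
   nz(4)[OF c x(2)] nz(4)[OF d y] nz(3)[OF c x(2)] nz(3)[OF d y]] this]
 show "pinv n (P c x) u v = pinv n (P d ?y) (FD (trn c d) x u) (FD (trn c d) x v)" by blast
qed

text \<open>The passage in the other direction: contravariance and the Jacobi identity are first
  derived off \<open>A\<close> from \<open>w\<close> and then extended by density to the smooth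
  field \<open>P\<close>.\<close>

lemma inverse_poisson:
 assumes Z: "cuts_out F A" and w: "closed2 (points M - A) w"
  and nz: "!!c x. c \<in> charts M ==> x \<in> cimg c ==> F c x ~= 0 ==> Pf n (w c x) ~= 0"
  and P: "two_field P" "!!c x. c \<in> charts M ==> x \<in> cimg c ==> F c x ~= 0 ==> P c x = pinv n (w c x)"
 shows "contravariant P" "c \<in> charts M ==> x \<in> cimg c ==> jac (P c) x a b e = 0"
proof -
 let ?V = "points M - A"
 have V: "x \<in> cset c ?V" if "c \<in> charts M" "x \<in> cimg c" "F c x ~= 0" for c x using that cuts_outD(7)[OF Z that(1)] by blast
 have off: "alt2 (w c x)" "ipair (P c x) (w c x)" "alt2 (P c x)" "x \<in> cimg c" if "c \<in> charts M" "x \<in> cset c ?V" for c x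
 proof -
  have x: "x \<in> cimg c" "F c x ~= 0" using that cuts_outD(7)[OF Z that(1)] by auto
  show 1: "alt2 (w c x)" by (rule closed2D(1)[OF w that])
  show "ipair (P c x) (w c x)" unfolding P(2)[OF that(1) x] by (rule ipair_pinv[OF dim 1 nz[OF that(1) x]])
  show "alt2 (P c x)" "x \<in> cimg c" using two_fieldD(1)[OF P(1) that(1)] x by auto
 qed
 show "contravariant P" unfolding contravariant_def
 proof (intro ballI allI)
  fix c d x a b assume c: "c \<in> charts M" "d \<in> charts M" and x: "x \<in> overlap c d"
  let ?A = "%x a. dualv (%u. a \<bullet> FD (trn c d) x u)"
  note o = open_ov[OF c]
  have sub: "overlap c d \<subseteq> cimg c" using trn_ov(4)[OF c] by blast
  have "P d (trn c d x) a b - P c x (?A x a) (?A x b) = 0"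
  proof (rule dense0[OF Z c(1) o sub x sm_cont])
   show "smo (overlap c d) (%x. P d (trn c d x) a b - P c x (?A x a) (?A x b))"
    by (intro sm_diff o sm_field_transition P c)
   fix y assume y: "y \<in> overlap c d" "F c y ~= 0"
   then have y': "y \<in> cset c ?V" using sub V[OF c(1)] by blast
   have Ty: "trn c d y \<in> cset d ?V" using y' trn_ov(3,5)[OF c y(1)] by (simp add: cset_def)
   have "\<forall>u v. w c y u v = w d (trn c d y) (FD (trn c d) y u) (FD (trn c d) y v)"
    using closed2D(4)[OF w c(1) c(2) y(1) y'] by blast
   from iffD1[OF ipair_transform[OF linear_transition_FD[OF c y(1)] inj_transition_FD[OF c y(1)] off(3)[OF c(1) y'] off(3)[OF c(2) Ty]
    off(2)[OF c(1) y'] off(2)[OF c(2) Ty] off(1)[OF c(1) y'] off(1)[OF c(2) Ty]] this]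
   show "P d (trn c d y) a b - P c y (?A y a) (?A y b) = 0" by simp
  qed
  then show "P d (trn c d x) a b = P c x (?A x a) (?A x b)" by simp
 qed
 assume c: "c \<in> charts M" and x: "x \<in> cimg c"
 note o = open_coord[OF c]
 show "jac (P c) x a b e = 0"
 proof (rule dense0[OF Z c o order_refl x sm_cont])
  show "smo (cimg c) (%x. jac (P c) x a b e)"
   unfolding jac_def by (intro sm_sum sm_add sm_mult o sm_FD two_fieldD(2)[OF P(1) c])
  fix y assume "y \<in> cimg c" "F c y ~= 0"
  then have y: "y \<in> cset c ?V" by (rule V[OF c])
  have oV: "open (cset c ?V)" by (rule open_cset[OF c cuts_outD(6)[OF Z]])
  have sm: "smo (cset c ?V) (%x. P c x u v)" for u v by (rule sm_subset[OF two_fieldD(2)[OF P(1) c] cset_subset])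
  have ip: "(\<forall>z. w c y u z = s \<bullet> z) \<longleftrightarrow> (\<forall>z. P c y s z = u \<bullet> z)" for u s
   using off(2)[OF c y] unfolding ipair_def by blast
  have u: "w c y (dualv (P c y s)) z = s \<bullet> z" for s z
   using ip[of "dualv (P c y s)" s] inner_dualv[OF alt2D(1)[OF off(3)[OF c y]]] by simp
  have "jac (P c) y a b e = dext (w c) y (dualv (P c y a)) (dualv (P c y b)) (dualv (P c y e))"
   by (rule jac_eq_dext[OF oV y off(3)[OF c] off(1)[OF c] off(2)[OF c] sm closed2D(3)[OF w c] u u u])
  then show "jac (P c) y a b e = 0" using closed2D(2)[OF w c y] by simp
 qed
qed

end

end

section \<open>From folded-symplectic to log-symplectic structures\<close>

text \<open>\<open>h\<close> is half the logarithm near 0 and is switched off at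
  \<open>delta / 2\<close>. As \<open>delta <= 1\<close>, the logarithm is nonpositive where the
  cutoff decreases; the product of two nonpositive factors keeps \<open>h'\<close>
  nonnegative.\<close>

lemma log_cutoff:
 fixes delta :: real
 assumes delta: "0 < delta" "delta <= 1" and h_def: "h = (%t. cutoff (2 * t / delta) * ln t / 2)"
 obtains h' where "!!t. t > 0 ==> (h has_real_derivative h' t) (at t)" "!!t. t > 0 ==> h' t >= 0"
  "!!t. t > 0 ==> t < delta / 4 ==> h' t = 1 / (2 * t)" "!!t. t >= delta / 2 ==> h t = 0" "smo {0<..} h"
proof -
 obtain C where D: "!!t. (cutoff has_real_derivative deriv cutoff t) (at t)" "!!t. deriv cutoff t <= 0"
  "!!t. t < 1/2 ==> deriv cutoff t = 0" "!!t. 1 < t ==> deriv cutoff t = 0"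
  by (rule cutoff_deriv, rule that)
 define h' where "h' t = (deriv cutoff (2 * t / delta) * (2 / delta) * ln t + cutoff (2 * t / delta) / t) / 2" for t
 show thesis
 proof (rule that[of h'])
  fix t :: real assume t: "t > 0"
  have "((%t. cutoff (2 * t / delta)) has_real_derivative deriv cutoff (2 * t / delta) * (2 / delta)) (at t)"
   by (rule DERIV_chain2[OF D(1)]) (use delta in \<open>auto intro!: derivative_eq_intros\<close>)
  from DERIV_cdivide[OF DERIV_mult[OF this DERIV_ln_divide[OF t]], of 2]
  show "(h has_real_derivative h' t) (at t)" unfolding h_def h'_def by (simp add: mult.commute add.commute)
  have "deriv cutoff (2 * t / delta) * (2 / delta) * ln t >= 0"
  proof (cases "2 * t / delta > 1")
   case False
   then have "t <= 1" using delta by (simp add: field_simps)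
   then have "ln t <= 0" using t by simp
   moreover have "deriv cutoff (2 * t / delta) * (2 / delta) <= 0" using D(2) delta by (intro mult_nonpos_nonneg) auto
   ultimately show ?thesis by (rule mult_nonpos_nonpos[rotated])
  qed (simp add: D)
  then show "h' t >= 0" unfolding h'_def using cutoff_bounds[of "2 * t / delta"] t by simp
  assume "t < delta / 4"
  then have "2 * t / delta < 1/2" using delta by (simp add: field_simps)
  then show "h' t = 1 / (2 * t)" unfolding h'_def using D(3) cutoff_eq_1 by simp
 next
  fix t assume "t >= delta / 2"
  then have "2 * t / delta >= 1" using delta by (simp add: field_simps)
  then show "h t = 0" unfolding h_def using cutoff_eq_0 by simp
 next
  have "smo {0<..} (%t. cutoff (2 * t / delta))"
   by (rule sm_compose[OF open_greaterThan open_UNIV smooth_cutoff])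
    (use delta in \<open>auto intro!: sm_divide sm_mult sm_const sm_id\<close>)
  then show "smo {0<..} h" unfolding h_def
   by (intro sm_divide sm_mult sm_const sm_ln open_greaterThan) auto
 qed
qed

context hypersurface_in
begin

definition squares :: "(('a, 'e) chart => 'e => real) => ('a => real) => bool" where
 "squares F r \<longleftrightarrow> X.sfun (points X) r & (\<forall>p\<in>points X. r p >= 0 & (r p = 0 \<longleftrightarrow> p \<in> points Z)) &
   (\<forall>c\<in>charts X. \<forall>x\<in>cimg c. \<exists>S m. open S & x \<in> S & S \<subseteq> cimg c & smo S m &
    (\<forall>y\<in>S. m y > 0 & r (pt c y) = (F c y)\<^sup>2 * m y))"

lemma ex_squares:
 assumes F: "X.cuts_out F (points Z)"
 obtains r where "squares F r"
proof -
 have Zc: "F c x = 0 \<longleftrightarrow> pt c x \<in> points Z" if "c \<in> charts X" "x \<in> cimg c" for c x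
  by (rule X.cuts_outD(3)[OF F that])
 obtain r where r: "X.sfun (points X) r" "!!p. p \<in> points X ==> r p >= 0" "!!p. p \<in> points X ==> r p = 0 \<longleftrightarrow> p \<in> points Z"
  "!!c x. c \<in> charts X ==> x \<in> cimg c ==> \<exists>S m. open S & x \<in> S & S \<subseteq> cimg c & smo S m &
    (\<forall>y\<in>S. m y > 0 & r (pt c y) = (F c y)\<^sup>2 * m y)"
  by (rule squared_defining_function[where F = F, OF X.cuts_outD(1)[OF F] Zc], assumption, assumption, rule that)
 have "\<forall>c\<in>charts X. \<forall>x\<in>cimg c. \<exists>S m. open S & x \<in> S & S \<subseteq> cimg c & smo S m &
    (\<forall>y\<in>S. m y > 0 & r (pt c y) = (F c y)\<^sup>2 * m y)"
  by (rule ballI, rule ballI, rule r(4))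
 moreover have "\<forall>p\<in>points X. r p >= 0 & (r p = 0 \<longleftrightarrow> p \<in> points Z)" by (rule ballI, rule conjI, erule r(2), erule r(3))
 ultimately have "squares F r" unfolding squares_def using r(1) by (intro conjI)
 then show thesis by (rule that)
qed

lemma squaresD:
 assumes "squares F r"
 shows "X.sfun (points X) r" "p \<in> points X ==> r p >= 0" "p \<in> points X ==> r p = 0 \<longleftrightarrow> p \<in> points Z"
  "p \<in> points X - points Z ==> r p > 0"
  "c \<in> charts X ==> smo (cimg c) (%x. r (pt c x))"
proof -
 show 1: "X.sfun (points X) r" and 2: "p \<in> points X ==> r p >= 0" and 3: "p \<in> points X ==> r p = 0 \<longleftrightarrow> p \<in> points Z" for p
  using assms unfolding squares_def by blast+
 show "p \<in> points X - points Z ==> r p > 0" using 2[of p] 3[of p] by auto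
 show "c \<in> charts X ==> smo (cimg c) (%x. r (pt c x))" using X.sfunD[OF 1, of c] X.cset_points[of c] by simp
qed

text \<open>With \<open>r = F^2 * m\<close> the differential of \<open>r\<close> is \<open>F\<close>
  times \<open>kappa\<close>. Hence half of d log r is \<open>kappa / (2 * F * m)\<close>, a
  logarithmic form whose numerator is smooth across \<open>Z\<close> and equals \<open>2 * m\<close>
  times dF there.\<close>

lemma squares_local:
 assumes r: "squares F r" and F: "smo (cimg c) (F c)" and c: "c \<in> charts X" and x: "x \<in> cimg c"
 obtains S m kappa where "open S" "x \<in> S" "S \<subseteq> cimg c" "smo S m" "!!y. y \<in> S ==> m y > 0"
  "!!y. y \<in> S ==> r (pt c y) = (F c y)\<^sup>2 * m y"
  "!!y v. y \<in> S ==> kappa y v = 2 * m y * FD (F c) y v + F c y * FD m y v"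
  "!!y v. y \<in> S ==> FD (%y. r (pt c y)) y v = F c y * kappa y v"
  "!!y. y \<in> S ==> linear (kappa y)" "!!v. smo S (%y. kappa y v)"
proof -
 note ex = bspec[OF bspec[OF conjunct2[OF conjunct2[OF r[unfolded squares_def]]] c] x]
 obtain S m where S: "open S" "x \<in> S" "S \<subseteq> cimg c" "smo S m" and Sm: "\<forall>y\<in>S. m y > 0 & r (pt c y) = (F c y)\<^sup>2 * m y"
  using ex by (elim exE conjE)
 have S': "m y > 0" "r (pt c y) = (F c y)\<^sup>2 * m y" if "y \<in> S" for y using bspec[OF Sm that] by auto
 note S = S S'
 have FS: "smo S (F c)" by (rule sm_subset[OF F S(3)])
 define kappa where "kappa y v = 2 * m y * FD (F c) y v + F c y * FD m y v" for y v
 have k: "FD (%y. r (pt c y)) y v = F c y * kappa y v" if y: "y \<in> S" for y v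
 proof -
  note d = sm_diffble[OF FS y] sm_diffble[OF S(4) y]
  have "FD (%y. r (pt c y)) y v = FD (%y. (F c y * F c y) * m y) y v"
   by (rule fun_cong[OF FD_cong[OF S(1) y]]) (simp add: S(6) power2_eq_square)
  also have "... = F c y * kappa y v"
   unfolding FD_rules(1)[OF differentiable_mult[OF d(1,1)] d(2)] FD_rules(1)[OF d(1,1)] kappa_def by algebra
  finally show ?thesis .
 qed
 have l: "linear (kappa y)" if y: "y \<in> S" for y
  unfolding kappa_def using sm_linear_FD[OF FS y] sm_linear_FD[OF S(4) y]
  by (auto simp: linear_iff algebra_simps)
 have s: "smo S (%y. kappa y v)" for v unfolding kappa_def
  by (intro sm_add sm_mult sm_const sm_FD S FS)
 show thesis by (rule that[OF S kappa_def k l s])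
qed

lemma lexact_mono: "X.lexact W psi ==> opn X W' ==> W' \<subseteq> W ==> X.lexact W' psi"
 unfolding X.lexact_def
proof
 fix p assume L: "\<forall>p\<in>W. \<exists>N. opn X N & p \<in> N & N \<subseteq> W & X.sfun N (psi p) & (\<forall>q\<in>N. \<exists>k. \<forall>y\<in>N. psi q y = psi p y + k)"
  and W: "opn X W'" "W' \<subseteq> W" and p: "p \<in> W'"
 from L[rule_format, OF subsetD[OF W(2) p]] obtain N where N: "opn X N" "p \<in> N" "X.sfun N (psi p)"
  "\<forall>q\<in>N. \<exists>k. \<forall>y\<in>N. psi q y = psi p y + k" by (elim exE conjE)
 have "\<forall>q\<in>N \<inter> W'. \<exists>k. \<forall>y\<in>N \<inter> W'. psi q y = psi p y + k" using N(4) by (meson IntD1)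
 then show "\<exists>N. opn X N & p \<in> N & N \<subseteq> W' & X.sfun N (psi p) & (\<forall>q\<in>N. \<exists>k. \<forall>y\<in>N. psi q y = psi p y + k)"
  using N(1,2) W(1) p by (intro exI[of _ "N \<inter> W'"] conjI openin_Int X.sfun_subset[OF N(3)]) auto
qed

context
 fixes n :: nat assumes dim: "DIM('e) = 2 * n"
begin

text \<open>\<open>gamma\<close> changes by a square between charts, so its sign is independent of
  the chart. Near \<open>Z\<close> it is \<open>F^2\<close> times a function that does not vanish on
  \<open>Z\<close>; the sign is therefore locally constant across \<open>Z\<close>, and
  \<open>psi\<close> is multiplied by it.\<close>

lemma oriented_extension:
 assumes w: "X.two_field w" "X.covariant w" and F: "!!c x. F c x = Pf n (w c x)" "X.cuts_out F (points Z)" and r: "squares F r"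
  and W: "opn X W" "points Z \<subseteq> W" and L: "X.lexact W psi"
  and nz: "!!c x. c \<in> charts X ==> x \<in> cimg c ==> F c x = 0 ==> dPf n (w c x) (FD (F c) x) (X.dform psi c x) ~= 0"
 obtains W' psi' where "opn X W'" "points Z \<subseteq> W'" "X.lexact W' psi'"
  "!!c x. c \<in> charts X ==> x \<in> cset c W' ==> F c x ~= 0 ==>
    F c x * dPf n (w c x) (FD (%y. r (pt c y)) x) (X.dform psi' c x) > 0"
  "!!c x. c \<in> charts X ==> x \<in> cimg c ==> F c x = 0 ==> dPf n (w c x) (FD (F c) x) (X.dform psi' c x) ~= 0"
proof -
 define gamma where "gamma c x = F c x * dPf n (w c x) (FD (%y. r (pt c y)) x) (X.dform psi c x)" for c x
 define sg where "sg epsilon N \<longleftrightarrow> (\<forall>c\<in>charts X. \<forall>x\<in>cset c N. F c x ~= 0 --> epsilon * gamma c x > 0)" for epsilon :: real and N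
 \<comment> \<open>The value -1 is a default; on \<open>W'\<close> each point has a neighbourhood
   with one of the two signs, so \<open>s\<close> is the sign of \<open>gamma\<close> there.\<close>
 define s :: "'a => real" where "s p = (if \<exists>N. opn X N & p \<in> N & N \<subseteq> W & sg 1 N then 1 else -1)" for p
 define W' where "W' = \<Union> {N. opn X N & N \<subseteq> W & (sg 1 N \<or> sg (-1) N)}"
 note a2 = X.two_fieldD(1)[OF w(1)]
 have lr: "linear (FD (%y. r (pt c y)) x)" if "c \<in> charts X" "x \<in> cimg c" for c x
  by (rule sm_linear_FD[OF squaresD(5)[OF r that(1)] that(2)])
 have lF: "linear (FD (F c) x)" if "c \<in> charts X" "x \<in> cimg c" for c x
  by (rule sm_linear_FD[OF X.cuts_outD(5)[OF F(2) that(1)] that(2)])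
 have near: "\<exists>N. opn X N & p \<in> N & N \<subseteq> W & (sg 1 N \<or> sg (-1) N)" if p: "p \<in> points Z" for p
 proof -
  have pX: "p \<in> points X" using p Z_subset by blast
  from X.ex_chart[OF this] obtain c where c: "c \<in> charts X" "p \<in> dom_of c" by blast
  define x where "x = snd c p"
  have x: "x \<in> cimg c" "pt c x = p" using c X.pt_chart[OF c] by (auto simp: x_def)
  have Fx: "F c x = 0" using X.cuts_outD(3)[OF F(2) c(1) x(1)] x(2) p by simp
  obtain S m kappa where S: "open S" "x \<in> S" "S \<subseteq> cimg c" "smo S m" "!!y. y \<in> S ==> m y > 0"
   "!!y. y \<in> S ==> r (pt c y) = (F c y)\<^sup>2 * m y"
   and k: "!!y v. y \<in> S ==> kappa y v = 2 * m y * FD (F c) y v + F c y * FD m y v"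
   "!!y v. y \<in> S ==> FD (%y. r (pt c y)) y v = F c y * kappa y v"
   "!!y. y \<in> S ==> linear (kappa y)" "!!v. smo S (%y. kappa y v)"
   by (rule squares_local[where F = F, OF r X.cuts_outD(5)[OF F(2) c(1)] c(1) x(1)], rule that)
  define S1 where "S1 = S \<inter> cset c W"
  have S1: "open S1" "S1 \<subseteq> S" "S1 \<subseteq> cset c W" "S1 \<subseteq> cimg c" "x \<in> S1"
   using S X.open_cset[OF c(1) W(1)] x p W(2) by (auto simp: S1_def open_Int cset_def)
  define Gam where "Gam y = dPf n (w c y) (kappa y) (X.dform psi c y)" for y
  have l: "alt2 (w c y)" "linear (kappa y)" "linear (X.dform psi c y)" if "y \<in> S1" for y
   using that S1 a2[OF c(1)] k(3) X.dform_smooth(1)[OF L c(1)] by blast+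
  have sm: "smo S1 Gam" unfolding Gam_def
   by (intro sm_dPf S1 sm_subset[OF X.two_fieldD(2)[OF w(1) c(1)] S1(4)] sm_subset[OF k(4) S1(2)]
    sm_subset[OF X.dform_smooth(2)[OF L c(1)] S1(3)])
  have "kappa x = (%v. (2 * m x) * FD (F c) x v)" using k(1)[OF S(2)] Fx by auto
  then have "Gam x = 2 * m x * dPf n (w c x) (FD (F c) x) (X.dform psi c x)"
   unfolding Gam_def using dPf_scale2(2)[OF dim l(1)[OF S1(5)] lF[OF c(1) x(1)] l(3)[OF S1(5)]] by simp
  then have Gamx: "Gam x ~= 0" using nz[OF c(1) x(1) Fx] S(5)[OF S(2)] by simp
  define epsilon where "epsilon = sgn (Gam x)"
  have epsilon: "epsilon = 1 \<or> epsilon = -1" using Gamx by (simp add: epsilon_def sgn_if)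
  define S2 where "S2 = S1 \<inter> (%y. epsilon * Gam y) -` {0<..}"
  have S2: "open S2" unfolding S2_def
   by (rule continuous_open_preimage[OF _ S1(1) open_greaterThan]) (intro continuous_on_mult continuous_on_const sm_cont[OF sm])
  have xS2: "x \<in> S2" using S1(5) Gamx by (simp add: S2_def epsilon_def sgn_mult_self_eq flip: abs_sgn) (simp add: abs_sgn sgn_if)
  define N where "N = {q \<in> dom_of c. snd c q \<in> S2}"
  have N: "opn X N" unfolding N_def by (rule X.openin_chart_preimage[OF c(1) S2])
  have "N \<subseteq> W"
  proof
   fix q assume q: "q \<in> N"
   then have "snd c q \<in> cset c W" "q \<in> dom_of c" using S1(3) by (auto simp: N_def S2_def)
   then show "q \<in> W" using X.pt_chart[OF c(1)] by (simp add: cset_def)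
  qed
  moreover have "sg epsilon N" unfolding sg_def
  proof (intro ballI impI)
   fix d y assume d: "d \<in> charts X" and y: "y \<in> cset d N" and Fy: "F d y ~= 0"
   have y': "y \<in> cimg d" "pt d y \<in> dom_of c" "snd c (pt d y) \<in> S2" using y by (auto simp: cset_def N_def)
   have ov: "y \<in> overlap d c" unfolding X.overlap_eq[OF d] using y' by (simp add: cset_def)
   let ?z = "trn d c y"
   have z: "?z \<in> S2" using y'(3) by (simp add: transition_def)
   then have zS: "?z \<in> S1" "?z \<in> S" using S1(2) by (auto simp: S2_def)
   note pt = X.trn_ov(3)[OF d c(1) ov]
   have zW: "y \<in> cset d W" using y'(1) zS(1) S1(3) pt by (auto simp: cset_def)
   define J where "J = gram bas (%i. FD (trn d c) y (bas i))"
   have e: "w d y = (%u v. w c ?z (FD (trn d c) y u) (FD (trn d c) y v))"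
    using w(2) d c(1) ov unfolding X.covariant_def by blast
   have er: "FD (%y. r (pt d y)) y = (%u. FD (%y. r (pt c y)) ?z (FD (trn d c) y u))"
    by (rule ext, rule X.FD_global[OF squaresD(1)[OF r] d c(1) ov])
   have epsi: "X.dform psi d y = (%u. X.dform psi c ?z (FD (trn d c) y u))"
    by (rule ext, rule X.dform_transition[OF L d c(1) ov zW])
   have F1: "F d y = J * F c ?z" unfolding F(1) e J_def by (rule Pf_pullback[OF dim l(1)[OF zS(1)]])
   have g1: "gamma d y = J\<^sup>2 * gamma c ?z"
    unfolding gamma_def F1 e er epsi
    dPf_pullback[OF dim l(1)[OF zS(1)] lr[OF c(1) subsetD[OF S(3) zS(2)]] l(3)[OF zS(1)], of "FD (trn d c) y"] J_def[symmetric]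
    by algebra
   have J: "J ~= 0" "F c ?z ~= 0" using Fy F1 by auto
   have "FD (%y. r (pt c y)) ?z = (%v. F c ?z * kappa ?z v)" by (rule ext, rule k(2)[OF zS(2)])
   then have "gamma c ?z = (F c ?z)\<^sup>2 * Gam ?z"
    unfolding gamma_def Gam_def using dPf_scale2(2)[OF dim l[OF zS(1)]] by (simp add: power2_eq_square)
   moreover have "epsilon * Gam ?z > 0" using z by (simp add: S2_def)
   ultimately have eq: "epsilon * gamma d y = (J\<^sup>2 * (F c ?z)\<^sup>2) * (epsilon * Gam ?z)" and pos: "epsilon * Gam ?z > 0" unfolding g1 by (simp_all add: mult_ac)
   show "epsilon * gamma d y > 0" unfolding eq using J pos by (intro mult_pos_pos[OF _ pos]) simp
  qed
  moreover have "p \<in> N" using c(2) xS2 by (simp add: N_def x_def)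
  ultimately show ?thesis using N epsilon by (intro exI[of _ N]) auto
 qed
 have s_loc: "\<exists>N. opn X N & p \<in> N & (\<forall>q\<in>N. s q = s p) & sg (s p) N & (s p = 1 \<or> s p = -1)" if p: "p \<in> W'" for p
 proof -
  obtain N where N: "opn X N" "N \<subseteq> W" "p \<in> N" and g: "sg 1 N \<or> sg (-1) N" using p by (auto simp: W'_def)
  show ?thesis
  proof (cases "sg 1 N")
   case True
   have "s q = 1" if "q \<in> N" for q using True N that unfolding s_def by auto
   then show ?thesis using N True by (intro exI[of _ N]) simp
  next
   case False
   then have g: "sg (-1) N" using g by simp
   \<comment> \<open>Both signs cannot hold on a common open set, because such a set contains points
     off the zero set of \<open>F\<close>.\<close>
   have "s q = -1" if q: "q \<in> N" for q
   proof (rule ccontr)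
    assume "s q ~= -1"
    then obtain N' where N': "opn X N'" "q \<in> N'" "sg 1 N'" unfolding s_def by (auto split: if_splits)
    have o: "opn X (N \<inter> N')" using N N' by blast
    have "q \<in> points X" using q openin_subset[OF N(1)] by blast
    from X.ex_chart[OF this] obtain c where c: "c \<in> charts X" "q \<in> dom_of c" by blast
    let ?S = "cset c (N \<inter> N')"
    have "snd c q \<in> ?S" using c q N'(2) X.pt_chart[OF c] by (simp add: cset_def)
    from X.dense0[OF F(2) c(1) X.open_cset[OF c(1) o] X.cset_subset this continuous_on_const, of 1]
    obtain y where y: "y \<in> ?S" "F c y ~= 0" by auto
    then have "y \<in> cset c N" "y \<in> cset c N'" by (auto simp: cset_def)
    then show False using g N'(3) y(2) c(1) unfolding sg_def by fastforce
   qed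
   then show ?thesis using N g by (intro exI[of _ N]) simp
  qed
 qed
 have W'o: "opn X W'" unfolding W'_def by (rule openin_Union) blast
 have ZW': "points Z \<subseteq> W'" using near unfolding W'_def by blast
 have W'W: "W' \<subseteq> W" unfolding W'_def by blast
 have L': "X.lexact W' psi" by (rule lexact_mono[OF L W'o W'W])
 have s_const: "\<exists>N. opn X N & p \<in> N & (\<forall>q\<in>N. s q = s p)" if "p \<in> W'" for p using s_loc[OF that] by blast
 let ?psi = "%p y. s p * psi p y"
 have dps: "X.dform ?psi c x = (%v. s (pt c x) * X.dform psi c x v)" if "c \<in> charts X" "x \<in> cset c W'" for c x
  by (rule ext, rule X.dform_mult[OF L' that])
 have lps: "linear (X.dform psi c x)" if "c \<in> charts X" "x \<in> cset c W'" for c x by (rule X.dform_smooth(1)[OF L' that])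
 show thesis
 proof (rule that[OF W'o ZW' X.lexact_mult[OF L' s_const]])
  fix c x assume c: "c \<in> charts X" and x: "x \<in> cset c W'" and Fx: "F c x ~= 0"
  have xi: "x \<in> cimg c" "pt c x \<in> W'" using x by (auto simp: cset_def)
  from s_loc[OF xi(2)] obtain N where N: "pt c x \<in> N" "sg (s (pt c x)) N" by blast
  have "x \<in> cset c N" using xi N(1) by (simp add: cset_def)
  then have "s (pt c x) * gamma c x > 0" using N(2) Fx c unfolding sg_def by blast
  then show "F c x * dPf n (w c x) (FD (%y. r (pt c y)) x) (X.dform ?psi c x) > 0"
   unfolding dps[OF c x] gamma_def dPf_scale2(1)[OF dim a2[OF c xi(1)] lr[OF c xi(1)] lps[OF c x]] by (simp only: mult_ac)
 next
  fix c x assume c: "c \<in> charts X" and x: "x \<in> cimg c" and Fx: "F c x = 0"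
  have xi: "pt c x \<in> W'" "x \<in> cset c W'" using X.cuts_outD(3)[OF F(2) c x] Fx ZW' x by (auto simp: cset_def)
  have "s (pt c x) ~= 0" using s_loc[OF xi(1)] by auto
  then show "dPf n (w c x) (FD (F c) x) (X.dform ?psi c x) ~= 0"
   unfolding dps[OF c xi(2)] dPf_scale2(1)[OF dim a2[OF c x] lF[OF c x] lps[OF c xi(2)]] using nz[OF c x Fx] by simp
 qed
qed

end

end

context hypersurface_in
begin

context
 fixes n :: nat assumes dim: "DIM('e) = 2 * n"
begin

text \<open>The logarithm in \<open>f\<close> gives \<open>w1\<close> a simple pole along
  \<open>Z\<close>. Its inverse extends smoothly, and the Pfaffian of the inverse, a constant
  divided by that of \<open>w1\<close>, vanishes to first order.\<close>

lemma fold_to_log: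
 assumes w: "X.closed2 (points X) w" and F: "!!c x. F c x = Pf n (w c x)" "X.cuts_out F (points Z)" and U: "opn X U" "points Z \<subseteq> U"
  and W: "opn X W" "points Z \<subseteq> W" and L: "X.lexact W psi"
  and nz: "!!c x. c \<in> charts X ==> x \<in> cimg c ==> F c x = 0 ==> dPf n (w c x) (FD (F c) x) (X.dform psi c x) ~= 0"
 obtains P where "X.two_field P" "X.contravariant P" "!!c x a b e. c \<in> charts X ==> x \<in> cimg c ==> jac (P c) x a b e = 0"
  "X.regular_zeros n P" "X.zeros_at n P (points Z)"
  "!!c x. c \<in> charts X ==> x \<in> cimg c ==> pt c x \<notin> U ==> ipair (P c x) (w c x)"
proof -
 have w2: "X.two_field w" "X.covariant w" using w unfolding X.closed2_points by auto
 obtain r where r: "squares F r" by (rule ex_squares[OF F(2)])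
 obtain W' psi' where W': "opn X W'" "points Z \<subseteq> W'" and L': "X.lexact W' psi'"
  and pos: "!!c x. c \<in> charts X ==> x \<in> cset c W' ==> F c x ~= 0 ==>
    F c x * dPf n (w c x) (FD (%y. r (pt c y)) x) (X.dform psi' c x) > 0"
  and nz': "!!c x. c \<in> charts X ==> x \<in> cimg c ==> F c x = 0 ==> dPf n (w c x) (FD (F c) x) (X.dform psi' c x) ~= 0"
  by (rule oriented_extension[OF dim w2 F r W L nz], assumption, assumption, assumption, rule that)
 have o: "opn X (W' \<inter> U)" "points Z \<subseteq> W' \<inter> U" using W' U by auto
 obtain delta0 where delta0: "delta0 > 0" "!!p. p \<in> points X ==> r p < delta0 ==> p \<in> W' \<inter> U"
  by (rule small_values_near_Z[OF squaresD(1)[OF r] squaresD(2)[OF r] squaresD(3)[OF r] o], assumption, assumption, rule that)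
 define delta where "delta = min delta0 1"
 have delta: "0 < delta" "delta <= 1" "delta <= delta0" using delta0(1) by (auto simp: delta_def)
 define h where "h = (%t. cutoff (2 * t / delta) * ln t / 2)"
 obtain h' where h: "!!t. t > 0 ==> (h has_real_derivative h' t) (at t)" "!!t. t > 0 ==> h' t >= 0"
  "!!t. t > 0 ==> t < delta / 4 ==> h' t = 1 / (2 * t)" "!!t. t >= delta / 2 ==> h t = 0" "smo {0<..} h"
  by (rule log_cutoff[OF delta(1,2) h_def], rule that)
 define f where "f p = h (r p)" for p
 let ?V = "points X - points Z"
 note Vo = X.cuts_outD(6)[OF F(2)]
 have Vc: "x \<in> cset c ?V \<longleftrightarrow> x \<in> cimg c & F c x ~= 0" if "c \<in> charts X" for c x by (rule X.cuts_outD(7)[OF F(2) that])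
 have rpos: "r (pt c x) > 0" if "c \<in> charts X" "x \<in> cset c ?V" for c x
  by (rule squaresD(4)[OF r]) (use that in \<open>simp add: cset_def\<close>)
 have f: "X.sfun ?V f" unfolding X.sfun_def
 proof
  fix c assume c: "c \<in> charts X"
  show "smo (cset c ?V) (%x. f (pt c x))" unfolding f_def
   by (rule sm_compose[OF X.open_cset[OF c Vo] open_greaterThan h(5) sm_subset[OF squaresD(5)[OF r c] X.cset_subset]])
    (simp add: rpos[OF c])
 qed
 define w1 where "w1 = X.add_exact W' f psi' w"
 have far: "f q = 0" if "q \<in> {q \<in> points X. r q \<in> {delta / 2<..}}" for q
  using that h(4) by (auto simp: f_def)
 have far0: "opn X {q \<in> points X. r q \<in> {delta / 2<..}}" by (rule X.sfun_open[OF squaresD(1)[OF r] open_greaterThan])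
 have farp: "p \<in> {q \<in> points X. r q \<in> {delta / 2<..}}" if "p \<in> points X" "p \<notin> W' \<inter> U" for p
 proof -
  have "~  r p < delta0" using delta0(2)[OF that(1)] that(2) by blast
  then show ?thesis using delta that(1) by simp
 qed
 have w1c: "X.closed2 ?V w1" unfolding w1_def
 proof (rule X.closed2_add_exact[OF X.closed2_mono[OF w] Vo W'(1) L' X.sfun_subset[OF f]])
  fix p assume "p \<in> ?V" "p \<notin> W'"
  then have "p \<in> {q \<in> points X. r q \<in> {delta / 2<..}}" using farp by blast
  then show "\<exists>N. opn X N & p \<in> N & (\<forall>q\<in>N. f q = 0)"
   using far0 far by (intro exI[of _ "{q \<in> points X. r q \<in> {delta / 2<..}}"]) blast
 qed auto
 have a2: "alt2 (w c x)" if "c \<in> charts X" "x \<in> cimg c" for c x by (rule X.two_fieldD(1)[OF w2(1) that])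
 have df: "FD (%y. f (pt c y)) x = (%v. h' (r (pt c x)) * FD (%y. r (pt c y)) x v)"
  if c: "c \<in> charts X" and x: "x \<in> cset c ?V" for c x
  unfolding f_def by (rule ext, rule FD_real[OF squaresD(5)[OF r c] h(1)[OF rpos[OF c x]] subsetD[OF X.cset_subset x]])
 have lr: "linear (FD (%y. r (pt c y)) x)" if "c \<in> charts X" "x \<in> cimg c" for c x
  by (rule sm_linear_FD[OF squaresD(5)[OF r that(1)] that(2)])
 have w1W: "w1 c x = upd (w c x) 1 (%v. h' (r (pt c x)) * FD (%y. r (pt c y)) x v) (X.dform psi' c x)"
  if "c \<in> charts X" "x \<in> cset c ?V" "pt c x \<in> W'" for c x
  unfolding w1_def X.add_exact_def df[OF that(1,2)] using that(3) by simp
 \<comment> \<open>Multiplied by \<open>F\<close>, the Pfaffian of \<open>w1\<close> is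
   \<open>F^2\<close> plus \<open>h'\<close> times the quantity made positive by
   \<open>oriented_extension\<close>.\<close>
 have Pf1: "Pf n (w1 c x) ~= 0" if c: "c \<in> charts X" and x: "x \<in> cimg c" "F c x ~= 0" for c x
 proof (cases "pt c x \<in> W'")
  case True
  have V: "x \<in> cset c ?V" and xW: "x \<in> cset c W'" using Vc[OF c] x True by (auto simp: cset_def)
  let ?D = "dPf n (w c x) (FD (%y. r (pt c y)) x) (X.dform psi' c x)"
  have "Pf n (w1 c x) = F c x + dPf n (w c x) (%v. h' (r (pt c x)) * FD (%y. r (pt c y)) x v) (X.dform psi' c x)"
   unfolding w1W[OF c V True] F(1) dPf_def by simp
  then have "Pf n (w1 c x) = F c x + h' (r (pt c x)) * ?D"
   unfolding dPf_scale2(2)[OF dim a2[OF c x(1)] lr[OF c x(1)] X.dform_smooth(1)[OF L' c xW]] .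
  then have "F c x * Pf n (w1 c x) = (F c x)\<^sup>2 + h' (r (pt c x)) * (F c x * ?D)"
   by (simp add: power2_eq_square algebra_simps)
  moreover have "h' (r (pt c x)) * (F c x * ?D) >= 0"
   using h(2)[OF rpos[OF c V]] pos[OF c xW x(2)] by simp
  ultimately have "F c x * Pf n (w1 c x) > 0" using x(2) by (simp add: add_pos_nonneg)
  then show ?thesis by auto
 next
  case False
  then show ?thesis using x(2) unfolding w1_def X.add_exact_def F(1) by simp
 qed
 let ?g = "%c x. pinv n (w1 c x)"
 have loc: "\<exists>S q tau Gam. open S & x \<in> S & S \<subseteq> cimg c & (\<forall>u v. smo S (%y. q y u v)) & (\<forall>y\<in>S. F c y ~= 0 --> ?g c y = q y) &
   smo S tau & smo S Gam & (\<forall>y\<in>S. tau y > 0 & F c y * F c y * tau y + Gam y ~= 0 &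
    (F c y ~= 0 --> Pf n (w1 c y) = (F c y * F c y * tau y + Gam y) / (F c y * tau y)))"
  if c: "c \<in> charts X" and x: "x \<in> cimg c" and Fx: "F c x = 0" for c x
 proof -
  note Fs = X.cuts_outD(5)[OF F(2) c]
  obtain S0 m kappa where S0: "open S0" "x \<in> S0" "S0 \<subseteq> cimg c" "smo S0 m" "!!y. y \<in> S0 ==> m y > 0"
   "!!y. y \<in> S0 ==> r (pt c y) = (F c y)\<^sup>2 * m y"
   and k: "!!y v. y \<in> S0 ==> kappa y v = 2 * m y * FD (F c) y v + F c y * FD m y v"
   "!!y v. y \<in> S0 ==> FD (%y. r (pt c y)) y v = F c y * kappa y v"
   "!!y. y \<in> S0 ==> linear (kappa y)" "!!v. smo S0 (%y. kappa y v)"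
   by (rule squares_local[where F = F, OF r Fs c x], rule that)
  define S1 where "S1 = S0 \<inter> cset c W' \<inter> (cimg c \<inter> (%y. r (pt c y)) -` {..<delta / 4})"
  have pZ: "pt c x \<in> points Z" "pt c x \<in> points X" using X.cuts_outD(3)[OF F(2) c x] Fx X.pt_points[OF c x] by auto
  have rx: "r (pt c x) = 0" using squaresD(3)[OF r pZ(2)] pZ(1) by simp
  have S1: "open S1" unfolding S1_def
   by (intro open_Int S0 X.open_cset c W' continuous_open_preimage[OF sm_cont[OF squaresD(5)[OF r c]]] X.open_coord open_lessThan)
  have S1s: "S1 \<subseteq> S0" "S1 \<subseteq> cset c W'" "S1 \<subseteq> cimg c" by (auto simp: S1_def)
  have xS1: "x \<in> S1" using S0(2) x pZ W'(2) rx delta(1) by (auto simp: S1_def cset_def)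
  let ?Psi = "X.dform psi' c"
  have l: "alt2 (w c y)" "linear (kappa y)" "linear (?Psi y)" if "y \<in> S1" for y
   using a2[OF c subsetD[OF S1s(3) that]] k(3)[OF subsetD[OF S1s(1) that]] X.dform_smooth(1)[OF L' c subsetD[OF S1s(2) that]] by auto
  have sm: "smo S1 (%y. w c y u v)" "smo S1 (%y. kappa y u)" "smo S1 (%y. ?Psi y u)" "smo S1 (F c)" "smo S1 m" for u v
   using sm_subset[OF X.two_fieldD(2)[OF w2(1) c] S1s(3)] sm_subset[OF k(4) S1s(1)]
    sm_subset[OF X.dform_smooth(2)[OF L' c] S1s(2)] sm_subset[OF Fs S1s(3)] sm_subset[OF S0(4) S1s(1)] by auto
  \<comment> \<open>Close to \<open>Z\<close>, \<open>w1\<close> is \<open>w\<close> plus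
    \<open>1 / (F * tau)\<close> times kappa wedge d psi. Its Pfaffian is
    \<open>F + Gam / (F * tau) = D / (F * tau)\<close>, and \<open>D\<close> is nonzero on
    \<open>Z\<close> by \<open>nz'\<close>.\<close>
  define Gam where "Gam y = dPf n (w c y) (kappa y) (?Psi y)" for y
  define tau where "tau y = 2 * m y" for y
  define D where "D y = F c y * F c y * tau y + Gam y" for y
  have sGam: "smo S1 Gam" unfolding Gam_def by (intro sm_dPf S1 sm)
  have stau: "smo S1 tau" unfolding tau_def by (intro sm_mult sm_const S1 sm)
  have sD: "smo S1 D" unfolding D_def by (intro sm_mult sm_add S1 sm sGam stau)
  have "kappa x = (%v. (2 * m x) * FD (F c) x v)" using k(1)[OF S0(2)] Fx by auto
  then have "Gam x = 2 * m x * dPf n (w c x) (FD (F c) x) (?Psi x)"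
   unfolding Gam_def using dPf_scale2(2)[OF dim l(1)[OF xS1] sm_linear_FD[OF Fs x] l(3)[OF xS1]] by simp
  then have Dx: "D x ~= 0" using nz'[OF c x Fx] S0(5)[OF S0(2)] Fx by (simp add: D_def)
  define S where "S = S1 \<inter> D -` (- {0})"
  have S: "open S" unfolding S_def by (rule continuous_open_preimage[OF sm_cont[OF sD] S1]) auto
  have SS1: "S \<subseteq> S1" and xS: "x \<in> S" using xS1 Dx by (auto simp: S_def)
  have DS: "D y ~= 0" if "y \<in> S" for y using that by (simp add: S_def)
  \<comment> \<open>\<open>G\<close> and \<open>H\<close> are the coefficients of \<open>dPf\<close>
    of \<open>w1\<close> as an affine function of \<open>1 / (F * tau)\<close>. In the quotient
    \<open>pinv\<close> the poles of numerator and denominator cancel and leave the smooth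
    \<open>q\<close>.\<close>
  define G where "G y a b = dPf n (w c y) (%z. a \<bullet> z) (%z. b \<bullet> z)" for y a b
  define H where "H y a b = dPf n (upd (w c y) 1 (kappa y) (?Psi y)) (%z. a \<bullet> z) (%z. b \<bullet> z) - G y a b" for y a b
  define q where "q y a b = - (F c y * tau y * G y a b + H y a b) / D y" for y a b
  have su: "smo S (%y. upd (w c y) 1 (kappa y) (?Psi y) u v)" for u v
   unfolding upd_def by (intro sm_add sm_diff sm_mult sm_const S sm_subset[OF sm(1) SS1]
    sm_subset[OF sm(2) SS1] sm_subset[OF sm(3) SS1])
  have sG: "smo S (%y. G y a b)" for a b unfolding G_def by (intro sm_dPf S sm_const sm_subset[OF sm(1) SS1])
  have sH: "smo S (%y. H y a b)" for a b unfolding H_def by (intro sm_diff sG sm_dPf S sm_const su)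
  have sq: "smo S (%y. q y a b)" for a b unfolding q_def
   by (intro sm_divide sm_minus sm_add sm_mult sG sH S sm_subset[OF sm(4) SS1]
    sm_subset[OF stau SS1] sm_subset[OF sD SS1] DS)
  have tau: "tau y > 0" if "y \<in> S" for y using S0(5)[of y] that SS1 S1s by (auto simp: tau_def)
  have main: "Pf n (w1 c y) = D y / (F c y * tau y) & ?g c y = q y" if y: "y \<in> S" and Fy: "F c y ~= 0" for y
  proof -
   have yS1: "y \<in> S1" and yS0: "y \<in> S0" and yi: "y \<in> cimg c" and yW: "pt c y \<in> W'" and ry: "r (pt c y) < delta / 4"
    using y SS1 S1s by (auto simp: S1_def cset_def)
   have V: "y \<in> cset c ?V" using Vc[OF c] yi Fy by simp
   define T where "T = F c y * tau y"
   have T: "T ~= 0" using Fy tau[OF y] by (simp add: T_def)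
   have hr: "h' (r (pt c y)) = 1 / (2 * ((F c y)\<^sup>2 * m y))"
    using h(3)[OF rpos[OF c V] ry] unfolding S0(6)[OF yS0] .
   have "h' (r (pt c y)) * (F c y * kappa y v) = (1 / T) * kappa y v" for v
    unfolding hr T_def tau_def using Fy S0(5)[OF yS0] by (simp add: field_simps power2_eq_square)
   then have wy: "w1 c y = upd (w c y) (1 / T) (kappa y) (?Psi y)"
    unfolding w1W[OF c V yW] k(2)[OF yS0] upd_def by (simp add: algebra_simps)
   have P1: "Pf n (w1 c y) = F c y + Gam y / T"
    unfolding wy Pf_upd[OF dim l[OF yS1]] F(1) Gam_def by simp
   have DT: "D y = F c y * T + Gam y" by (simp add: D_def T_def)
   have P2: "Pf n (w1 c y) = D y / T" unfolding P1 DT using T by (simp add: field_simps)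
   have "?g c y a b = q y a b" for a b
   proof -
    have "dPf n (w1 c y) (%z. a \<bullet> z) (%z. b \<bullet> z) = G y a b + (1 / T) * H y a b"
    unfolding wy dPf_upd[OF dim l(1)[OF yS1] linear_inner linear_inner l(2,3)[OF yS1], where l = "1 / T"] G_def H_def ..
    also have "... = (T * G y a b + H y a b) / T" using T by (simp add: field_simps)
    finally show ?thesis unfolding pinv_def P2 q_def T_def[symmetric] using T DS[OF y] by (simp add: field_simps)
   qed
   then show ?thesis using P2 unfolding T_def by blast
  qed
  have SC: "S \<subseteq> cimg c" using SS1 S1s by blast
  show ?thesis
  proof (rule exI[of _ S], rule exI[of _ q], rule exI[of _ tau], rule exI[of _ Gam], intro conjI allI ballI impI S xS SC sq)
   show "smo S tau" "smo S Gam" by (rule sm_subset[OF stau SS1], rule sm_subset[OF sGam SS1])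
   fix y assume y: "y \<in> S"
   show "tau y > 0" by (rule tau[OF y])
   show "F c y * F c y * tau y + Gam y ~= 0" using DS[OF y] by (simp add: D_def)
   assume Fy: "F c y ~= 0"
   show "?g c y = q y" using main[OF y Fy] by blast
   show "Pf n (w1 c y) = (F c y * F c y * tau y + Gam y) / (F c y * tau y)" using main[OF y Fy] by (simp add: D_def)
  qed
 qed
 define P where "P = X.ext2 F ?g"
 have Poff: "P c x = ?g c x" if "F c x ~= 0" for c x unfolding P_def using X.ext2_off[where F = F, OF that] .
 have alt1: "alt2 (w1 c x)" if "c \<in> charts X" "x \<in> cimg c" "F c x ~= 0" for c x
  by (rule X.closed2D(1)[OF w1c that(1)]) (use Vc[OF that(1)] that in simp)
 have P2: "X.two_field P" unfolding P_def
 proof (rule X.two_field_ext2[OF F(2)])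
  fix c x assume c: "c \<in> charts X" and x: "x \<in> cimg c"
  show "alt2 (?g c x)" if "F c x ~= 0" by (rule alt2_pinv[OF dim alt1[OF c x that]])
  assume "F c x = 0"
  from loc[OF c x this] obtain S q where "open S & x \<in> S & S \<subseteq> cimg c & (\<forall>u v. smo S (%y. q y u v)) & (\<forall>y\<in>S. F c y ~= 0 --> ?g c y = q y)"
   by (elim exE conjE) blast
  then show "\<exists>S q. open S & x \<in> S & S \<subseteq> cimg c & smo S q & (\<forall>y\<in>S. F c y ~= 0 --> ?g c y u v = q y)" for u v
   by (intro exI[of _ S] exI[of _ "%y. q y u v"]) simp
 next
  fix c u v assume c: "c \<in> charts X"
  show "smo (cset c ?V) (%x. ?g c x u v)" unfolding pinv_def
   by (intro sm_divide sm_minus sm_dPf sm_Pf sm_const X.closed2D(3)[OF w1c c] X.open_cset[OF c Vo])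
    (use Pf1[OF c] Vc[OF c] in blast)
 qed
 note ip = X.inverse_poisson[OF dim F(2) w1c Pf1 P2 Poff]
 obtain C where C: "!!P w :: 'e => 'e => real. alt2 P ==> alt2 w ==> ipair P w ==> Pf n w ~= 0 ==> Pf n P * Pf n w = C & C ~= 0"
  by (rule Pf_mult_inverse[OF dim], rule that)
 have PC: "Pf n (P c x) * Pf n (w1 c x) = C & C ~= 0" if "c \<in> charts X" "x \<in> cimg c" "F c x ~= 0" for c x
  unfolding Poff[OF that(3)]
  by (rule C[OF alt2_pinv[OF dim alt1[OF that]] alt1[OF that] ipair_pinv[OF dim alt1[OF that] Pf1[OF that]] Pf1[OF that]])
 \<comment> \<open>Clearing denominators in \<open>Pf n (P c y) * Pf n (w1 c y) = C\<close> shows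
   that \<open>Pf n (P c y)\<close> is \<open>F c y\<close> times a nonvanishing \<open>u y\<close>,
   first off \<open>Z\<close> and then on \<open>S\<close> by density.\<close>
 have Pz: "Pf n (P c x) = 0 & (\<exists>e. FD (%y. Pf n (P c y)) x e ~= 0)" if c: "c \<in> charts X" and x: "x \<in> cimg c" and Fx: "F c x = 0" for c x
 proof -
  obtain S q tau Gam where S: "open S" "x \<in> S" "S \<subseteq> cimg c" "smo S tau" "smo S Gam"
   and b: "\<forall>y\<in>S. tau y > 0 & F c y * F c y * tau y + Gam y ~= 0 &
    (F c y ~= 0 --> Pf n (w1 c y) = (F c y * F c y * tau y + Gam y) / (F c y * tau y))"
   using loc[OF c x Fx] by (elim exE conjE)
  have FS: "smo S (F c)" by (rule sm_subset[OF X.cuts_outD(5)[OF F(2) c] S(3)])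
  have PS: "smo S (%y. Pf n (P c y))" by (intro sm_Pf S sm_subset[OF X.two_fieldD(2)[OF P2 c] S(3)])
  define D where "D y = F c y * F c y * tau y + Gam y" for y
  have D: "smo S D" unfolding D_def by (intro sm_add sm_mult S FS)
  have Dn: "D y ~= 0" "tau y > 0" if "y \<in> S" for y using b that unfolding D_def by auto
  obtain y where y: "y \<in> S" "F c y ~= 0" using X.dense0[OF F(2) c S(1,3,2) continuous_on_const, of 1] by auto
  have C0: "C ~= 0" using PC[OF c subsetD[OF S(3) y(1)] y(2)] by blast
  have e: "Pf n (P c y) * D y - C * (F c y * tau y) = 0" if "y \<in> S" for y
  proof (rule X.dense0[OF F(2) c S(1,3) that sm_cont])
   show "smo S (%y. Pf n (P c y) * D y - C * (F c y * tau y))"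
    by (intro sm_diff sm_mult sm_const S FS PS D)
   fix z assume z: "z \<in> S" "F c z ~= 0"
   have "Pf n (w1 c z) = D z / (F c z * tau z)" using bspec[OF b z(1)] z(2) unfolding D_def by blast
   then have "Pf n (P c z) * (D z / (F c z * tau z)) = C" using PC[OF c subsetD[OF S(3) z(1)] z(2)] by simp
   then show "Pf n (P c z) * D z - C * (F c z * tau z) = 0" using z(2) Dn(2)[OF z(1)] by (simp add: field_simps)
  qed
  define u where "u y = C * tau y / D y" for y
  have u: "smo S u" unfolding u_def by (intro sm_divide sm_mult sm_const S D Dn)
  have Pu: "Pf n (P c y) = F c y * u y" if "y \<in> S" for y using e[OF that] Dn(1)[OF that] by (simp add: u_def field_simps)
  obtain e where e: "FD (F c) x e ~= 0" using X.cuts_outD(4)[OF F(2) c x Fx] by blast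
  have "FD (%y. Pf n (P c y)) x e = FD (%y. F c y * u y) x e" by (rule fun_cong[OF FD_cong[OF S(1,2) Pu]])
  also have "... = FD (F c) x e * u x"
   unfolding FD_rules(1)[OF sm_diffble[OF FS S(2)] sm_diffble[OF u S(2)]] Fx by simp
  finally have "FD (%y. Pf n (P c y)) x e ~= 0" using e C0 Dn[OF S(2)] by (simp add: u_def)
  then show ?thesis using Pu[OF S(2)] Fx by auto
 qed
 show thesis
 proof (rule that[OF P2 ip])
  show "X.regular_zeros n P" unfolding X.regular_zeros_def
  proof (intro ballI impI)
   fix c x assume c: "c \<in> charts X" "x \<in> cimg c" "Pf n (P c x) = 0"
   then have "F c x = 0" using PC[OF c(1,2)] by auto
   then show "\<exists>e. FD (%y. Pf n (P c y)) x e ~= 0" using Pz[OF c(1,2)] by blast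
  qed
  show "X.zeros_at n P (points Z)" unfolding X.zeros_at_def
  proof (intro ballI)
   fix c x assume c: "c \<in> charts X" "x \<in> cimg c"
   show "Pf n (P c x) = 0 \<longleftrightarrow> pt c x \<in> points Z"
    using PC[OF c] Pz[OF c] X.cuts_outD(3)[OF F(2) c] by auto
  qed
  fix c x assume c: "c \<in> charts X" and x: "x \<in> cimg c" and U': "pt c x \<notin> U"
  have F0: "F c x ~= 0" using X.cuts_outD(3)[OF F(2) c x] U(2) U' by blast
  have xN: "x \<in> cset c {q \<in> points X. r q \<in> {delta / 2<..}}"
   using farp[OF X.pt_points[OF c x]] U' x unfolding cset_def by blast
  have e: "w1 c x = w c x" unfolding w1_def by (rule X.add_exact_outside[OF c far0 xN far])
  show "ipair (P c x) (w c x)" unfolding Poff[OF F0] e by (rule ipair_pinv[OF dim a2[OF c x]]) (use F0 F(1) in simp)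
 qed
qed

end

end

section \<open>The residue of a log-symplectic form\<close>

text \<open>For \<open>om = F w\<close> with \<open>w\<close> closed, d om is dF wedge w. Multiplied
  by \<open>F\<close> this involves only smooth quantities, so it persists at the zeros of
  \<open>F\<close>.\<close>

lemma residue_identity:
 fixes F :: "'e::euclidean_space => real" and om :: "'e => 'e => 'e => real"
 assumes S: "open S" and F: "smo S F" and om: "!!u v. smo S (%y. om y u v)"
  and nd: "!!y. y \<in> S ==> F y = 0 ==> \<exists>e. FD F y e ~= 0"
  and w: "!!y u v. y \<in> S ==> F y ~= 0 ==> om y u v = F y * w y u v"
  and ws: "!!y u v. y \<in> S ==> F y ~= 0 ==> (%y. w y u v) differentiable (at y)"
  and cl: "!!y a b c. y \<in> S ==> F y ~= 0 ==> dext w y a b c = 0" and x: "x \<in> S"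
 shows "F x * dext om x a b c = FD F x a * om x b c - FD F x b * om x a c + FD F x c * om x a b"
proof -
 let ?f = "%y. F y * dext om y a b c - (FD F y a * om y b c - FD F y b * om y a c + FD F y c * om y a b)"
 define S' where "S' = S \<inter> F -` (- {0})"
 have S': "open S'" unfolding S'_def by (rule continuous_open_preimage[OF sm_cont[OF F] S]) auto
 have "?f x = 0"
 proof (rule zero_dense[where F = F, OF S nd _ _ x])
  show "continuous_on S ?f" unfolding dext_def
   by (intro sm_cont sm_diff sm_add sm_mult S F om sm_FD)
  fix y assume y: "y \<in> S" "F y ~= 0"
  then have yS': "y \<in> S'" by (simp add: S'_def)
  have e: "FD (%z. om z u v) y h = F y * FD (%z. w z u v) y h + FD F y h * w y u v" for u v h
  proof -
   have "FD (%z. om z u v) y h = FD (%z. F z * w z u v) y h" by (rule fun_cong[OF FD_cong[OF S' yS']]) (simp add: S'_def w)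
   then show ?thesis unfolding FD_rules(1)[OF sm_diffble[OF F y(1)] ws[OF y]] .
  qed
  have "dext w y a b c = 0" by (rule cl[OF y])
  then show "?f y = 0" unfolding dext_def e w[OF y] by algebra
 qed
 then show ?thesis by simp
qed

text \<open>By \<open>id\<close>, \<open>om\<close> is \<open>F * B\<close> plus dF wedge t, where
  \<open>t\<close> and \<open>B\<close> are the contractions of om and d om with \<open>E\<close>.
  Taking the exterior derivative at a zero of \<open>F\<close> and evaluating on \<open>E\<close>,
  \<open>v\<close>, \<open>v'\<close> gives \<open>B x v v'\<close> on the left and the same value
  minus dt on the right, so dt vanishes on the kernel of dF.\<close>

lemma residue_closed:
 fixes F :: "'e::euclidean_space => real" and om :: "'e => 'e => 'e => real"
 assumes S: "open S" "x \<in> S" and F: "smo S F" and om: "!!u v. smo S (%y. om y u v)" and alt: "!!y. y \<in> S ==> alt2 (om y)"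
  and id: "!!y a b c. y \<in> S ==> F y * dext om y a b c = FD F y a * om y b c - FD F y b * om y a c + FD F y c * om y a b"
  and E: "smo S E" "!!y. y \<in> S ==> FD F y (E y) = 1" and 0: "F x = 0" "FD F x v = 0" "FD F x v' = 0"
 shows "FD (%y. om y (E y) v') x v = FD (%y. om y (E y) v) x v'"
proof -
 define t where "t y v = om y (E y) v" for y v
 define B where "B y u v = dext om y (E y) u v" for y u v
 have dom: "(%y. om y u v) differentiable (at y)" if "y \<in> S" for u v y by (rule sm_diffble[OF om that])
 have ts: "smo S (%y. t y v)" for v unfolding t_def
  by (rule sm_linear_family[where L = "%y u. om y u v" and V = E, OF S(1) _ om E(1)]) (rule alt2D(2)[OF alt])
 have s1: "smo S (%x. FD (%y. om y (E x) v) x u)" for u v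
 proof (rule sm_linear_family[where L = "%x a. FD (%y. om y a v) x u" and V = E, OF S(1) _ sm_FD[OF om] E(1)])
  show "linear (%a. FD (%y. om y a v) y u)" if y: "y \<in> S" for y
   by (rule FD_linear[where Q = "%y a. om y a v", OF S(1) y alt2D(2)[OF alt] dom[OF y]])
 qed
 have Bs: "smo S (%y. B y u v)" for u v unfolding B_def dext_def
  by (intro sm_add sm_diff S(1) s1 sm_FD_vec om E(1))
 have dec: "om y = upd (%u v. F y * B y u v) 1 (FD F y) (t y)" if y: "y \<in> S" for y
  by (rule ext, rule ext) (simp add: upd_def t_def B_def id[OF y] E(2)[OF y])
 have FB: "FD (%y. F y * B y a b) x h = FD F x h * B x a b" for a b h
  unfolding FD_rules(1)[OF sm_diffble[OF F S(2)] sm_diffble[OF Bs S(2)]] using 0 by simp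
 have FBs: "smo S (%y. F y * B y u v)" for u v by (intro sm_mult S(1) F Bs)
 have "B x v v' = dext (%y. upd (%u v. F y * B y u v) 1 (FD F y) (t y)) x (E x) v v'"
  unfolding B_def[of x] by (rule dext_cong[OF S dec])
 also have "... = dext (%y u v. F y * B y u v) x (E x) v v' - (FD (%y. t y v') x v - FD (%y. t y v) x v')"
  unfolding dext_upd[where w = "%y u v. F y * B y u v", OF S FBs F ts] using 0 E(2)[OF S(2)] by simp
 also have "dext (%y u v. F y * B y u v) x (E x) v v' = B x v v'"
  unfolding dext_def FB using 0 E(2)[OF S(2)] by simp
 finally show ?thesis by (simp add: t_def)
qed

context hypersurface_in
begin

lemma closed_one_formI:
 assumes lin: "!!d y. d \<in> charts Z ==> y \<in> cimg d ==> linear (t d y)"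
  and sm: "!!d v. d \<in> charts Z ==> smo (cimg d) (%y. t d y v)"
  and sym: "!!d y u v. d \<in> charts Z ==> y \<in> cimg d ==> FD (%y. t d y v) y u = FD (%y. t d y u) y v"
  and tr: "!!d d' y v. d \<in> charts Z ==> d' \<in> charts Z ==> y \<in> overlap d d' ==>
    t d y v = t d' (trn d d' y) (FD (trn d d') y v)"
 shows "closed_form 1 Z (%d y v. t d y (v 0))"
 unfolding closed_form_def diff_form_def tensor_field_def
proof (intro conjI ballI allI)
 fix d assume d: "d \<in> charts Z"
 show "alt_form 1 (%v. t d y (v 0))" if "y \<in> cimg d" for y
  using lin[OF d that] unfolding alt_form_def by auto
 show "smo (cimg d) (%y. t d y (v 0))" for v by (rule sm[OF d])
 show "t d y (v 0) = t d' (trn d d' y) (FD (trn d d') y (v 0))" if "d' \<in> charts Z" "y \<in> overlap d d'" for d' y v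
  by (rule tr[OF d that])
 show "ext_deriv 1 (%y v. t d y (v 0)) y = (%_. 0)" if y: "y \<in> cimg d" for y
 proof
  fix v
  have "ext_deriv 1 (%y v. t d y (v 0)) y v = FD (%y. t d y (v 1)) y (v 0) - FD (%y. t d y (v 0)) y (v 1)"
   by (simp add: ext_deriv_def)
  then show "ext_deriv 1 (%y v. t d y (v 0)) y v = 0" using sym[OF d y] by simp
 qed
qed

text \<open>The residue is the contraction of \<open>om\<close> with any vector on which dF is 1,
  restricted to \<open>Z\<close>. It is closed and independent of charts; with psi a primitive of
  its extension, \<open>om\<close> becomes dF wedge d psi at the points of \<open>Z\<close>.\<close>

lemma residue_extension:
 assumes F: "X.cuts_out F (points Z)" and w: "X.closed2 (points X - points Z) w" and om: "X.two_field om"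
  and omw: "!!c x u v. c \<in> charts X ==> x \<in> cimg c ==> F c x ~= 0 ==> om c x u v = F c x * w c x u v"
 obtains W psi theta where "opn X W" "points Z \<subseteq> W" "X.lexact W psi" "closed_form 1 Z theta"
  "!!d y v. d \<in> charts Z ==> y \<in> cimg d ==> FD (%y'. psi (pt d y) (pt d y')) y v = one_form theta d y v"
  "!!c x e u v. c \<in> charts X ==> x \<in> cimg c ==> F c x = 0 ==>
    om c x u v = FD (F c) x u * X.dform psi c x v - FD (F c) x v * X.dform psi c x u"
proof -
 let ?V = "points X - points Z"
 note Fs = X.cuts_outD(5)[OF F] and nd = X.cuts_outD(4)[OF F] and Fz = X.cuts_outD(3)[OF F] and Vc = X.cuts_outD(7)[OF F]
 have lF: "linear (FD (F c) x)" if "c \<in> charts X" "x \<in> cimg c" for c x by (rule sm_linear_FD[OF Fs[OF that(1)] that(2)])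
 have id: "F c x * dext (om c) x a b k = FD (F c) x a * om c x b k - FD (F c) x b * om c x a k + FD (F c) x k * om c x a b"
  if c: "c \<in> charts X" and x: "x \<in> cimg c" for c x a b k
 proof (rule residue_identity[where w = "w c", OF X.open_coord[OF c] Fs[OF c] X.two_fieldD(2)[OF om c] nd[OF c] omw[OF c] _ _ x])
  fix y u v assume "y \<in> cimg c" "F c y ~= 0"
  then have y: "y \<in> cset c ?V" using Vc[OF c] by blast
  show "(%y. w c y u v) differentiable (at y)" by (rule sm_diffble[OF X.closed2D(3)[OF w c] y])
  show "dext (w c) y a b k = 0" for a b k by (rule X.closed2D(2)[OF w c y])
 qed
 \<comment> \<open>At a zero of \<open>F\<close> the identity \<open>id\<close> says that
   \<open>om\<close> has the factor dF.\<close>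
 have split: "om c x u v = FD (F c) x u * om c x e v - FD (F c) x v * om c x e u"
  if "c \<in> charts X" "x \<in> cimg c" "F c x = 0" "FD (F c) x e = 1" for c x e u v
  using id[OF that(1,2), of e u v] that(3,4) by simp
 have ex_e: "\<exists>e. FD (F c) x e = 1" if c: "c \<in> charts X" and x: "x \<in> cimg c" and Fx: "F c x = 0" for c x
 proof -
  obtain e where e: "FD (F c) x e ~= 0" using nd[OF c x Fx] by blast
  have "FD (F c) x (inverse (FD (F c) x e) *\<^sub>R e) = 1" using linear_scale[OF lF[OF c x]] e by simp
  then show ?thesis by blast
 qed
 \<comment> \<open>A change of chart multiplies \<open>om\<close> and, on \<open>Z\<close>, also dF
   by the same factor \<open>j\<close>, so their quotient, the residue, does not change.\<close>
 have twist: "\<exists>j. j ~= 0 & (\<forall>u v. j * om c x u v = om d (trn c d x) (FD (trn c d) x u) (FD (trn c d) x v)) &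
   (F c x = 0 --> (\<forall>u. FD (F d) (trn c d x) (FD (trn c d) x u) = j * FD (F c) x u))"
  if c: "c \<in> charts X" "d \<in> charts X" and x: "x \<in> overlap c d" for c d x
 proof -
  obtain J where J: "smo (overlap c d) J" "!!x. x \<in> overlap c d ==> J x ~= 0"
   "!!x. x \<in> overlap c d ==> F d (trn c d x) = J x * F c x"
   by (rule X.densityE[OF X.cuts_outD(1)[OF F] c], rule that)
  note o = X.open_ov[OF c]
  have sub: "overlap c d \<subseteq> cimg c" using X.trn_ov(4)[OF c] by blast
  have "J x * om c x u v - om d (trn c d x) (FD (trn c d) x u) (FD (trn c d) x v) = 0" for u v
  proof (rule X.dense0[OF F c(1) o sub x sm_cont])
   show "smo (overlap c d) (%x. J x * om c x u v - om d (trn c d x) (FD (trn c d) x u) (FD (trn c d) x v))"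
    by (intro sm_diff sm_mult o J(1) X.sm_field_transition om c sm_subset[OF X.two_fieldD(2)[OF om c(1)] sub])
   fix y assume y: "y \<in> overlap c d" "F c y ~= 0"
   then have yi: "y \<in> cimg c" and yV: "y \<in> cset c ?V" using sub Vc[OF c(1)] by auto
   have ty: "trn c d y \<in> cimg d" by (rule X.trn_ov(5)[OF c y(1)])
   have nz: "F d (trn c d y) ~= 0" using J(2,3)[OF y(1)] y(2) by simp
   show "J y * om c y u v - om d (trn c d y) (FD (trn c d) y u) (FD (trn c d) y v) = 0"
    unfolding omw[OF c(1) yi y(2)] omw[OF c(2) ty nz] J(3)[OF y(1)] X.closed2D(4)[OF w c(1) c(2) y(1) yV, of u v] by simp
  qed
  moreover have "FD (F d) (trn c d x) (FD (trn c d) x u) = J x * FD (F c) x u" if Fx: "F c x = 0" for u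
  proof -
   have "FD (F d) (trn c d x) (FD (trn c d) x u) = FD (%y. F d (trn c d y)) x u"
    by (rule FD_compose[OF X.sm_trn[OF c] Fs[OF c(2)] x X.trn_ov(5)[OF c x], symmetric])
   also have "... = FD (%y. J y * F c y) x u" by (rule fun_cong[OF FD_cong[OF o x J(3)]])
   also have "... = J x * FD (F c) x u"
    unfolding FD_rules(1)[OF sm_diffble[OF J(1) x] sm_diffble[OF Fs[OF c(1)] subsetD[OF sub x]]] Fx by simp
   finally show ?thesis .
  qed
  ultimately show ?thesis using J(2)[OF x] by (intro exI[of _ "J x"]) simp
 qed
 have zZ: "F c (trn d c y) = 0" "trn d c y \<in> cimg c" if "d \<in> charts Z" "c \<in> charts X" "y \<in> overlap d c" for d c y
 proof -
  note fa = incl_facts[OF that]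
  show "trn d c y \<in> cimg c" by (rule fa(2))
  show "F c (trn d c y) = 0" using Fz[OF that(2) fa(2)] fa(1) Z.pt_points[OF that(1) fa(3)] by simp
 qed
 have tk: "FD (F c) (trn d c y) (FD (trn d c) y v) = 0" if "d \<in> charts Z" "c \<in> charts X" "y \<in> overlap d c" for d c y v
  by (rule tangent_kernel(1)[OF X.cuts_outD(1)[OF F] Fz that])
 have uniq: "om c (trn d c y) e (FD (trn d c) y v) = om c' (trn d c' y) e' (FD (trn d c') y v)"
  if d: "d \<in> charts Z" and c: "c \<in> charts X" "c' \<in> charts X" and y: "y \<in> overlap d c" "y \<in> overlap d c'"
   and e: "FD (F c) (trn d c y) e = 1" "FD (F c') (trn d c' y) e' = 1" for d c c' y e e' v
 proof -
  note ic = incl_change_chart[OF d c y]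
  obtain j where j: "j ~= 0" "\<forall>u v. j * om c (trn d c y) u v =
    om c' (trn c c' (trn d c y)) (FD (trn c c') (trn d c y) u) (FD (trn c c') (trn d c y) v)"
   "\<forall>u. FD (F c') (trn c c' (trn d c y)) (FD (trn c c') (trn d c y) u) = j * FD (F c) (trn d c y) u"
   using twist[OF c ic(1)] zZ(1)[OF d c(1) y(1)] by (elim exE conjE) simp
  have "j * om c (trn d c y) e (FD (trn d c) y v) =
    om c' (trn d c' y) (FD (trn c c') (trn d c y) e) (FD (trn d c') y v)"
   using j(2)[rule_format, of e "FD (trn d c) y v"] unfolding ic(2) ic(3)[symmetric] .
  also have "... = j * om c' (trn d c' y) e' (FD (trn d c') y v)"
   unfolding split[OF c(2) zZ(2)[OF d c(2) y(2)] zZ(1)[OF d c(2) y(2)] e(2), of "FD (trn c c') (trn d c y) e"]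
   using j(3) e(1) tk[OF d c(2) y(2)] unfolding ic(2) by simp
  finally show ?thesis using j(1) by simp
 qed
 \<comment> \<open>By \<open>uniq\<close> the value does not depend on the chart \<open>c\<close>
   and the vector \<open>e\<close>, so any choice may be taken.\<close>
 define t where "t d y v = (SOME k. \<exists>c e. c \<in> charts X & y \<in> overlap d c & FD (F c) (trn d c y) e = 1 &
   k = om c (trn d c y) e (FD (trn d c) y v))" for d :: "('a, 'f) chart" and y v
 have t: "t d y v = om c (trn d c y) e (FD (trn d c) y v)"
  if d: "d \<in> charts Z" and c: "c \<in> charts X" and y: "y \<in> overlap d c" and e: "FD (F c) (trn d c y) e = 1" for d c y e v
 proof -
  have "\<exists>c e. c \<in> charts X & y \<in> overlap d c & FD (F c) (trn d c y) e = 1 &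
    t d y v = om c (trn d c y) e (FD (trn d c) y v)"
   unfolding t_def by (rule someI_ex) (use c y e in blast)
  then obtain c' e' where ce: "c' \<in> charts X" "y \<in> overlap d c'" "FD (F c') (trn d c' y) e' = 1"
    "t d y v = om c' (trn d c' y) e' (FD (trn d c') y v)" by (elim exE conjE)
  show ?thesis unfolding ce(4) by (rule uniq[OF d ce(1) c ce(2) y ce(3) e])
 qed
 have ex_c: "\<exists>c\<in>charts X. y \<in> overlap d c" if d: "d \<in> charts Z" and y: "y \<in> cimg d" for d y
 proof -
  have "pt d y \<in> points X" using Z.pt_points[OF d y] Z_subset by blast
  from X.ex_chart[OF this] obtain c where "c \<in> charts X" "pt d y \<in> dom_of c" by blast
  then show ?thesis using y overlap_incl[OF d, of c] by (auto simp: cset_def)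
 qed
 have main: "linear (t d y) & (\<exists>S. open S & y \<in> S & (\<forall>v. smo S (%y. t d y v))) &
   (\<forall>u v. FD (%y. t d y v) y u = FD (%y. t d y u) y v)" if d: "d \<in> charts Z" and y: "y \<in> cimg d" for d y
 proof -
  obtain c where c: "c \<in> charts X" and yc: "y \<in> overlap d c" using ex_c[OF d y] by blast
  let ?T = "trn d c"
  define G where "G x = dualv (FD (F c) x)" for x
  have Gs: "smo (cimg c) G" unfolding G_def dualv_def
   by (intro sm_sum sm_scaleR sm_const sm_FD Fs c X.open_coord)
  have G: "G x \<bullet> v = FD (F c) x v" if "x \<in> cimg c" for x v unfolding G_def by (rule inner_dualv[OF lF[OF c that]])
  define V where "V = cimg c \<inter> G -` (- {0})"
  have V: "open V" unfolding V_def
   by (rule continuous_open_preimage[OF sm_cont[OF Gs] X.open_coord[OF c]]) auto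
  have VC: "V \<subseteq> cimg c" by (auto simp: V_def)
  have inV: "?T z \<in> V" if z: "z \<in> overlap d c" for z
  proof -
   obtain e where "FD (F c) (?T z) e = 1" using ex_e[OF c zZ(2)[OF d c z] zZ(1)[OF d c z]] by blast
   then have "G (?T z) ~= 0" using G[OF zZ(2)[OF d c z], of e] by auto
   then show ?thesis using zZ(2)[OF d c z] by (simp add: V_def)
  qed
  \<comment> \<open>The gradient of \<open>F\<close> divided by its squared length, a smooth field
    of vectors on which dF is 1.\<close>
  define E where "E x = (1 / (G x \<bullet> G x)) *\<^sub>R G x" for x
  have GV: "smo V G" by (rule sm_subset[OF Gs VC])
  have Es: "smo V E" unfolding E_def
   by (intro sm_scaleR sm_divide sm_const sm_inner V GV) (simp add: V_def)
  have E1: "FD (F c) x (E x) = 1" if "x \<in> V" for x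
   using G[OF subsetD[OF VC that], of "E x"] that by (simp add: E_def V_def)
  define th where "th x v = om c x (E x) v" for x v
  have omV: "smo V (%x. om c x u v)" for u v by (rule sm_subset[OF X.two_fieldD(2)[OF om c] VC])
  have aV: "alt2 (om c x)" if "x \<in> V" for x by (rule X.two_fieldD(1)[OF om c subsetD[OF VC that]])
  have thl: "linear (th x)" if "x \<in> V" for x unfolding th_def by (rule alt2D(1)[OF aV[OF that]])
  have ths: "smo V (%x. th x v)" for v unfolding th_def
   by (rule sm_linear_family[where L = "%y u. om c y u v" and V = E, OF V _ omV Es]) (rule alt2D(2)[OF aV])
  have tth: "t d z v = th (?T z) (FD ?T z v)" if z: "z \<in> overlap d c" for z v
   unfolding th_def by (rule t[OF d c z E1[OF inV[OF z]]])
  note o = open_ovi[OF d c] and Ts = smooth_incl[OF d c]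
  have "smo (overlap d c) (%z. th (?T z) (FD ?T z v))" for v
  proof (rule sm_linear_family[where L = "%z. th (?T z)" and V = "%z. FD ?T z v", OF o _ _ sm_FD[OF Ts]])
   show "linear (th (?T z))" if "z \<in> overlap d c" for z by (rule thl[OF inV[OF that]])
   show "smo (overlap d c) (%z. th (?T z) v)" for v by (rule sm_compose[OF o V ths Ts inV])
  qed
  then have sm: "smo (overlap d c) (%z. t d z v)" for v by (rule sm_eq[OF o]) (rule tth)
  have l: "linear (t d y)"
  proof -
   have e: "t d y = (%v. th (?T y) (FD ?T y v))" by (rule ext, rule tth[OF yc])
   show ?thesis unfolding e
    by (rule linear_compose[OF sm_linear_FD[OF Ts yc] thl[OF inV[OF yc]], unfolded o_def])
  qed
  have sy: "FD (%y. t d y v) y u = FD (%y. t d y u) y v" for u v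
  proof -
   have e: "FD (%y. t d y v) y u = FD (%z. th (?T z) (FD ?T z v)) y u" for u v
    by (rule fun_cong[OF FD_cong[OF o yc tth]])
   have "FD (%x. th x (FD ?T y v)) (?T y) (FD ?T y u) = FD (%x. th x (FD ?T y u)) (?T y) (FD ?T y v)"
    unfolding th_def
    by (rule residue_closed[where F = "F c", OF V inV[OF yc] sm_subset[OF Fs[OF c] VC] omV aV id[OF c subsetD[OF VC]] Es E1
    zZ(1)[OF d c yc] tk[OF d c yc] tk[OF d c yc]])
   then show ?thesis unfolding e using FD_pullback_one_form[OF o yc V Ts inV thl ths, of u v] by simp
  qed
  show ?thesis using l sm sy o yc by blast
 qed
 have tr: "t d y v = t d' (trn d d' y) (FD (trn d d') y v)"
  if d: "d \<in> charts Z" "d' \<in> charts Z" and y: "y \<in> overlap d d'" for d d' y v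
 proof -
  obtain c where c: "c \<in> charts X" and yc: "y \<in> overlap d c" using ex_c[OF d(1) Z.trn_ov(4)[OF d y]] by blast
  have ov: "trn d d' z \<in> overlap d' c" "trn d' c (trn d d' z) = trn d c z" if "z \<in> overlap d d' \<inter> overlap d c" for z
   using that Z.trn_ov(3,5)[OF d, of z] incl_facts[OF d(1) c, of z] unfolding overlap_incl[OF d(2) c]
   by (auto simp: cset_def transition_def)
  have o: "open (overlap d d' \<inter> overlap d c)" by (intro open_Int Z.open_ov open_ovi d c)
  have yy: "y \<in> overlap d d' \<inter> overlap d c" using y yc by simp
  have "FD (trn d c) y v = FD (%z. trn d' c (trn d d' z)) y v"
   by (rule fun_cong[OF FD_cong[OF o yy]]) (simp add: ov)
  also have "... = FD (trn d' c) (trn d d' y) (FD (trn d d') y v)"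
   by (rule FD_compose[OF Z.sm_trn[OF d] smooth_incl[OF d(2) c] y ov(1)[OF yy]])
  finally have D: "FD (trn d c) y v = FD (trn d' c) (trn d d' y) (FD (trn d d') y v)" .
  obtain e where e: "FD (F c) (trn d c y) e = 1" using ex_e[OF c zZ(2)[OF d(1) c yc] zZ(1)[OF d(1) c yc]] by blast
  have e': "FD (F c) (trn d' c (trn d d' y)) e = 1" unfolding ov(2)[OF yy] by (rule e)
  show ?thesis unfolding t[OF d(1) c yc e] t[OF d(2) c ov(1)[OF yy] e'] D ov(2)[OF yy] ..
 qed
 define theta where "theta d y v = t d y (v 0)" for d y and v :: "nat => 'f"
 have "closed_form 1 Z (%d y v. t d y (v 0))"
 proof (rule closed_one_formI[OF _ _ _ tr])
  fix d assume d: "d \<in> charts Z"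
  show "linear (t d y)" if "y \<in> cimg d" for y using main[OF d that] by blast
  show "FD (%y. t d y v) y u = FD (%y. t d y u) y v" if "y \<in> cimg d" for y u v using main[OF d that] by blast
  show "smo (cimg d) (%y. t d y v)" for v
  proof (rule sm_local)
   fix y assume "y \<in> cimg d"
   from main[OF d this] show "\<exists>T. open T & y \<in> T & smo T (%y. t d y v)" by blast
  qed
 qed
 then have theta: "closed_form 1 Z theta" unfolding theta_def[abs_def] .
 have otheta: "one_form theta d y v = t d y v" for d y v by (simp add: one_form_def theta_def)
 obtain W psi where W: "opn X W" "points Z \<subseteq> W" "X.lexact W psi"
  and R: "!!d y v. d \<in> charts Z ==> y \<in> cimg d ==> FD (%y'. psi (pt d y) (pt d y')) y v = one_form theta d y v"
  by (rule closed_extension[OF theta], rule that)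
 show thesis
 proof (rule that[OF W theta R])
  fix c x u v assume c: "c \<in> charts X" and x: "x \<in> cimg c" and Fx: "F c x = 0"
  have p: "pt c x \<in> points Z" using Fz[OF c x] Fx by simp
  from Z.ex_chart[OF p] obtain d where d: "d \<in> charts Z" "pt c x \<in> dom_of d" by blast
  define y where "y = snd d (pt c x)"
  have pd: "pt d y = pt c x" "y \<in> cimg d" using Z.pt_chart[OF d] d(2) by (auto simp: y_def)
  have y: "y \<in> overlap d c" unfolding overlap_incl[OF d(1) c] cset_def using pd X.pt_dom[OF c x] by simp
  have Ty: "trn d c y = x" using pd X.chart_point_of[OF c x] by (simp add: transition_def)
  obtain e where e: "FD (F c) x e = 1" using ex_e[OF c x Fx] by blast
  have xW: "x \<in> cset c W" using p W(2) x by (auto simp: cset_def)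
  have l: "linear (X.dform psi c x)" by (rule X.dform_smooth(1)[OF W(3) c xW])
  \<comment> \<open>On tangent vectors of \<open>Z\<close>, d psi is the residue; with
    \<open>split\<close> this determines \<open>om\<close> at the zeros of \<open>F\<close>.\<close>
  have tang: "X.dform psi c x u = om c x e u" if u: "FD (F c) x u = 0" for u
  proof -
   have "FD (F c) (trn d c y) e ~= 0" "FD (F c) (trn d c y) u = 0" using e u unfolding Ty by auto
   from tangent_kernel(2)[OF X.cuts_outD(1)[OF F] Fz d(1) c y this] obtain v where v: "u = FD (trn d c) y v" by auto
   have "X.dform psi c x u = t d y v"
    using restrict_dform[OF W(3,2) d(1) c y, of v] R[OF d(1) pd(2), of v] unfolding Ty v[symmetric] otheta by simp
   also have "... = om c x e u" using t[OF d(1) c y, of e v] e unfolding Ty v[symmetric] by simp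
   finally show ?thesis .
  qed
  have la: "linear (om c x e)" "om c x e e = 0" using alt2D[OF X.two_fieldD(1)[OF om c x]] by auto
  have oe: "om c x e u = X.dform psi c x u - FD (F c) x u * X.dform psi c x e" for u
  proof -
   have "FD (F c) x (u - FD (F c) x u *\<^sub>R e) = 0" using e by (simp add: linear_diff[OF lF[OF c x]] linear_scale[OF lF[OF c x]])
   from tang[OF this] show ?thesis using la by (simp add: linear_diff[OF l] linear_scale[OF l] linear_diff[OF la(1)] linear_scale[OF la(1)])
  qed
  show "om c x u v = FD (F c) x u * X.dform psi c x v - FD (F c) x v * X.dform psi c x u"
   unfolding split[OF c x Fx e, of u v] oe by algebra
 qed
qed

end

section \<open>From log-symplectic to folded-symplectic structures\<close>

text \<open>In \<open>log_to_fold\<close> the expression is \<open>F * Pf n w / C\<close>, with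
  \<open>zeta\<close> and \<open>c'\<close> the value and the derivative at \<open>r\<close> of a
  cutoff at scale \<open>eta\<close>. For \<open>r < eta / 2\<close> the two \<open>g\<close> cancel
  and \<open>r / (r + epsilon) * (1 - g)\<close> beats \<open>k\<close>. For larger \<open>r\<close>
  the main term is at least 1/8; the choice of \<open>rho\<close> limits the terms with a factor
  \<open>g\<close> outside it to 1/32 in total, and that of \<open>eta\<close> limits the term with
  \<open>k\<close> to 1/32. The choice of \<open>epsilon\<close> keeps \<open>epsilon * c'\<close>
  within 1/2 in absolute value.\<close>

lemma fold_estimate:
 fixes r g k zeta c' epsilon eta c1 K rho :: real
 assumes r: "0 < r" "r <= eta" and zeta: "0 <= zeta" "zeta <= 1" and c': "\<bar>c'\<bar> * eta <= c1" and c1: "c1 >= 1"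
  and epsilon: "epsilon = eta / (2 * c1)" and g: "\<bar>g\<bar> <= rho" and rho: "rho * (32 * (1 + 3 * c1)) = 1"
  and k: "\<bar>k\<bar> <= K * r" "K >= 0" and eta: "eta * (K + 1) <= 1 / 32" and s: "r < eta / 2 ==> zeta = 1 & c' = 0"
 shows "g + 2 * r * ((1 + epsilon * c') / (2 * (r + epsilon * zeta)) - c' * g) * (1 - g) - zeta * (k + g) > 0"
proof -
 have e0: "eta > 0" using r by simp
 have e1: "0 < epsilon" "epsilon <= eta / 2" using e0 c1 unfolding epsilon by (auto simp: field_simps)
 have "rho * (32 * (1 + 3 * 1)) <= rho * (32 * (1 + 3 * c1))"
 proof (rule mult_left_mono)
  show "0 <= rho" using g by linarith
 qed (use c1 in simp)
 then have rho2: "rho <= 1/2" using rho by simp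
 then have g2: "1/2 <= 1 - g" "1 - g <= 3/2" using g by linarith+
 show ?thesis
 proof (cases "r < eta / 2")
  case True
  note z = s[OF True]
  have pos: "r + epsilon > 0" "r + epsilon <= eta" using r e1 True by linarith+
  have "r / eta <= r / (r + epsilon)" using r pos by (intro divide_left_mono) auto
  then have "(r / eta) * (1/2) <= (r / (r + epsilon)) * (1 - g)" using g2 r e0 pos by (intro mult_mono) auto
  moreover have "K * r < (r / eta) * (1/2)"
  proof -
   have "eta * K <= 1/32" using eta e0 by (simp add: algebra_simps)
   then have "2 * (eta * K) < 1" by simp
   then have "r * (2 * (eta * K)) < r * 1" using r by (intro mult_strict_left_mono) auto
   then show ?thesis using e0 by (simp add: field_simps)
  qed
  moreover have "g + 2 * r * ((1 + epsilon * c') / (2 * (r + epsilon * zeta)) - c' * g) * (1 - g) - zeta * (k + g) = (r / (r + epsilon)) * (1 - g) - k"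
   using z pos by (simp add: field_simps)
  ultimately show ?thesis using k(1) by linarith
 next
  case False
  define a where "a = r * (1 + epsilon * c') / (r + epsilon * zeta)"
  have "\<bar>epsilon * c'\<bar> = (\<bar>c'\<bar> * eta) / (2 * c1)" using e1 c1 e0 unfolding epsilon by (simp add: abs_mult)
  also have "... <= c1 / (2 * c1)" using c' c1 by (intro divide_right_mono) auto
  finally have ec: "1/2 <= 1 + epsilon * c'" using c1 by (simp add: abs_le_iff)
  have ez: "epsilon * zeta <= epsilon * 1" "0 <= epsilon * zeta" using zeta e1 by (auto intro: mult_left_mono)
  have den: "0 < r + epsilon * zeta" "r + epsilon * zeta <= 2 * r" using r(1) ez e1(2) False by linarith+
  have "r * (1/2) / (2 * r) <= a" unfolding a_def using ec den r by (intro frac_le mult_left_mono) auto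
  then have a: "1/4 <= a" using r by simp
  have a1: "1/4 * (1/2) <= a * (1 - g)" using a g2 by (intro mult_mono) auto
  have b1: "\<bar>(1 - zeta) * g\<bar> <= 1 * rho" unfolding abs_mult using zeta g by (intro mult_mono) auto
  have "\<bar>r * c'\<bar> <= eta * \<bar>c'\<bar>" unfolding abs_mult using r by (intro mult_right_mono) auto
  then have "\<bar>r * c'\<bar> <= c1" using c' by (simp add: mult.commute)
  then have "\<bar>r * c'\<bar> * \<bar>g\<bar> <= c1 * rho" using g c1 by (intro mult_mono) auto
  moreover have "0 <= c1 * rho" "\<bar>1 - g\<bar> <= 3/2" using g g2 c1 by auto
  ultimately have "(\<bar>r * c'\<bar> * \<bar>g\<bar>) * \<bar>1 - g\<bar> <= (c1 * rho) * (3/2)" by (metis mult_mono abs_ge_zero)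
  then have b2: "\<bar>r * c' * g * (1 - g)\<bar> <= c1 * rho * (3/2)" by (simp add: abs_mult mult.assoc)
  have "\<bar>zeta * k\<bar> <= 1 * (K * r)" unfolding abs_mult using zeta k by (intro mult_mono) auto
  also have "... <= K * eta" using r k by (simp add: mult_left_mono)
  also have "... <= 1/32" using eta e0 by (simp add: algebra_simps)
  finally have b3: "\<bar>zeta * k\<bar> <= 1/32" .
  have b4: "rho + 3 * (c1 * rho) = 1/32" using rho by (simp add: algebra_simps)
  have ae: "2 * r * ((1 + epsilon * c') / (2 * (r + epsilon * zeta))) = a" unfolding a_def using den by (simp add: field_simps)
  have gen: "g + 2 * r * (q - c' * g) * (1 - g) - zeta * (k + g)
    = (1 - zeta) * g + (2 * r * q) * (1 - g) - 2 * (r * c' * g * (1 - g)) - zeta * k" for q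
   by (simp add: algebra_simps)
  have eq: "g + 2 * r * ((1 + epsilon * c') / (2 * (r + epsilon * zeta)) - c' * g) * (1 - g) - zeta * (k + g)
    = (1 - zeta) * g + a * (1 - g) - 2 * (r * c' * g * (1 - g)) - zeta * k" unfolding gen ae ..
  show ?thesis unfolding eq using a1 b1 b2 b3 b4 by linarith
 qed
qed

lemma dPf_add_left:
 fixes w :: "'e::euclidean_space => 'e => real"
 assumes dim: "DIM('e) = 2 * n" and w: "alt2 w" and l: "linear a" "linear b" "linear p"
 shows "dPf n w (%u. a u + k * b u) p = dPf n w a p + k * dPf n w b p"
proof -
 have lin: "linear (%u. a u + k * b u)" using l by (auto simp: linear_iff algebra_simps)
 show ?thesis
  unfolding dPf_antisym[OF dim w l(3) lin] dPf_linear[OF dim w l(3,1,2)] dPf_antisym[OF dim w l(1,3)] dPf_antisym[OF dim w l(2,3)]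
  by simp
qed

text \<open>The perturbation a wedge p shares the factor \<open>p\<close> with b wedge p, so the
  mixed term vanishes.\<close>

lemma dPf_upd_same:
 fixes w :: "'e::euclidean_space => 'e => real"
 assumes dim: "DIM('e) = 2 * n" and w: "alt2 w" and l: "linear a" "linear b" "linear p"
 shows "dPf n (upd w 1 a p) b p = dPf n w b p"
proof -
 have e: "upd (upd w 1 a p) 1 b p = upd w 1 (%u. a u + 1 * b u) p" unfolding upd_def by (auto simp: algebra_simps)
 have "dPf n (upd w 1 a p) b p = dPf n w (%u. a u + 1 * b u) p - dPf n w a p" unfolding dPf_def e by simp
 then show ?thesis unfolding dPf_add_left[OF dim w l] by simp
qed

lemma upd_cancel: "upd (upd w 1 (%v. - a v) p) 1 a p = w" "upd (upd w 1 a p) 1 (%v. - a v) p = w"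
 unfolding upd_def by auto

lemma alt2_uminus: "alt2 w ==> alt2 (%u v. - w u v)"
 unfolding alt2_def by (auto intro: linear_compose_neg)

context hypersurface_in
begin

context
 fixes n :: nat assumes dim: "DIM('e) = 2 * n"
begin

text \<open>The inverse \<open>wl\<close> of \<open>P\<close> has residue d psi along
  \<open>Z\<close>. Removing its logarithmic part leaves the smooth closed form \<open>B\<close>.
  Adding d phi wedge d psi to \<open>B\<close> restores \<open>wl\<close> beyond
  \<open>r = eta\<close> and puts a fold in place of the pole.\<close>

lemma log_to_fold:
 assumes P: "X.two_field P" "X.contravariant P" "!!c x a b e. c \<in> charts X ==> x \<in> cimg c ==> jac (P c) x a b e = 0"
  and F: "!!c x. F c x = Pf n (P c x)" "X.cuts_out F (points Z)" and U: "opn X U" "points Z \<subseteq> U"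
 obtains w W psi theta where "X.closed2 (points X) w" "X.regular_zeros n w" "X.zeros_at n w (points Z)"
  "opn X W" "points Z \<subseteq> W" "X.lexact W psi" "closed_form 1 Z theta"
  "!!d y v. d \<in> charts Z ==> y \<in> cimg d ==> FD (%y'. psi (pt d y) (pt d y')) y v = one_form theta d y v"
  "!!c x. c \<in> charts X ==> x \<in> cimg c ==> F c x = 0 ==> dPf n (w c x) (FD (F c) x) (X.dform psi c x) ~= 0"
  "!!c x. c \<in> charts X ==> x \<in> cimg c ==> pt c x \<notin> U ==> ipair (P c x) (w c x)"
proof -
 let ?V = "points X - points Z"
 note Fs = X.cuts_outD(5)[OF F(2)] and nd = X.cuts_outD(4)[OF F(2)] and Fz = X.cuts_outD(3)[OF F(2)]
  and Vc = X.cuts_outD(7)[OF F(2)] and Vo = X.cuts_outD(6)[OF F(2)]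
 have Feq: "F = (%c x. Pf n (P c x))" by (rule ext, rule ext, rule F(1))
 define wl where "wl = (%c x. pinv n (P c x))"
 have wlc: "X.closed2 ?V wl" unfolding wl_def by (rule X.inverse_closed2[OF dim P F(2)[unfolded Feq]])
 have aP: "alt2 (P c x)" if "c \<in> charts X" "x \<in> cimg c" for c x by (rule X.two_fieldD(1)[OF P(1) that])
 \<comment> \<open>The numerator of \<open>pinv\<close>: it is \<open>F\<close> times
   \<open>wl\<close> and smooth on all of \<open>X\<close>.\<close>
 define om where "om = (%c x u v. - dPf n (P c x) (%z. u \<bullet> z) (%z. v \<bullet> z))"
 have om: "X.two_field om" unfolding X.two_field_def
 proof (intro ballI conjI allI)
  fix c assume c: "c \<in> charts X"
  show "alt2 (om c x)" if "x \<in> cimg c" for x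
   unfolding om_def by (rule alt2_uminus[OF alt2_dPf[OF dim aP[OF c that]]])
  show "smo (cimg c) (%x. om c x u v)" for u v
   unfolding om_def by (intro sm_minus sm_dPf sm_const X.open_coord c X.two_fieldD(2)[OF P(1) c])
 qed
 have omw: "om c x u v = F c x * wl c x u v" if "c \<in> charts X" "x \<in> cimg c" "F c x ~= 0" for c x u v
  using that(3) unfolding om_def wl_def pinv_def F(1) by simp
 obtain W psi theta where W: "opn X W" "points Z \<subseteq> W" and L: "X.lexact W psi" and theta: "closed_form 1 Z theta"
  and R: "!!d y v. d \<in> charts Z ==> y \<in> cimg d ==> FD (%y'. psi (pt d y) (pt d y')) y v = one_form theta d y v"
  and spl: "!!c x e u v. c \<in> charts X ==> x \<in> cimg c ==> F c x = 0 ==>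
    om c x u v = FD (F c) x u * X.dform psi c x v - FD (F c) x v * X.dform psi c x u"
  by (rule residue_extension[OF F(2) wlc om omw], assumption, assumption, assumption, rule that)
 obtain r where r: "squares F r" by (rule ex_squares[OF F(2)])
 have o: "opn X (W \<inter> U)" "points Z \<subseteq> W \<inter> U" using W U by auto
 obtain delta0 where delta0: "delta0 > 0" "!!p. p \<in> points X ==> r p < delta0 ==> p \<in> W \<inter> U"
  by (rule small_values_near_Z[OF squaresD(1)[OF r] squaresD(2)[OF r] squaresD(3)[OF r] o], assumption, assumption, rule that)
 define delta where "delta = min delta0 1"
 have delta: "0 < delta" "delta <= 1" "delta <= delta0" using delta0(1) by (auto simp: delta_def)
 define h where "h = (%t. cutoff (2 * t / delta) * ln t / 2)"
 obtain h' where h: "!!t. t > 0 ==> (h has_real_derivative h' t) (at t)"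
  "!!t. t > 0 ==> t < delta / 4 ==> h' t = 1 / (2 * t)" "!!t. t >= delta / 2 ==> h t = 0" "smo {0<..} h"
  by (rule log_cutoff[OF delta(1,2) h_def], rule that)
 \<comment> \<open>The logarithmic part is subtracted here, hence the sign.\<close>
 define f where "f p = - h (r p)" for p
 have ri: "smo (cimg c) (%x. r (pt c x))" if "c \<in> charts X" for c by (rule squaresD(5)[OF r that])
 have rpos: "r (pt c x) > 0" if "c \<in> charts X" "x \<in> cimg c" "F c x ~= 0" for c x
  by (rule squaresD(4)[OF r]) (use that Fz X.pt_points[OF that(1,2)] in simp)
 have rz: "r (pt c x) = 0" if "c \<in> charts X" "x \<in> cimg c" "F c x = 0" for c x
  using squaresD(3)[OF r X.pt_points[OF that(1,2)]] Fz[OF that(1,2)] that(3) by simp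
 have lr: "linear (FD (%y. r (pt c y)) x)" if "c \<in> charts X" "x \<in> cimg c" for c x
  by (rule sm_linear_FD[OF ri[OF that(1)] that(2)])
 have lF: "linear (FD (F c) x)" if "c \<in> charts X" "x \<in> cimg c" for c x by (rule sm_linear_FD[OF Fs[OF that(1)] that(2)])
 have f: "X.sfun ?V f" unfolding X.sfun_def
 proof
  fix c assume c: "c \<in> charts X"
  have "smo (cset c ?V) (%x. h (r (pt c x)))"
   by (rule sm_compose[OF X.open_cset[OF c Vo] open_greaterThan h(4) sm_subset[OF ri[OF c] X.cset_subset]])
    (use rpos[OF c] Vc[OF c] in auto)
  then show "smo (cset c ?V) (%x. f (pt c x))" unfolding f_def by (intro sm_minus X.open_cset[OF c Vo])
 qed
 define w1 where "w1 = X.add_exact W f psi wl"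
 define far where "far = {q \<in> points X. r q \<in> {delta / 2<..}}"
 have faro: "opn X far" unfolding far_def by (rule X.sfun_open[OF squaresD(1)[OF r] open_greaterThan])
 have farf: "f q = 0" if "q \<in> far" for q using that h(3) by (auto simp: f_def far_def)
 have farp: "p \<in> far" if "p \<in> points X" "p \<notin> W \<inter> U" for p
 proof -
  have "~  r p < delta0" using delta0(2)[OF that(1)] that(2) by blast
  then show ?thesis using delta that(1) by (simp add: far_def)
 qed
 have w1c: "X.closed2 ?V w1" unfolding w1_def
 proof (rule X.closed2_add_exact[OF wlc Vo W(1) L X.sfun_subset[OF f]])
  fix p assume "p \<in> ?V" "p \<notin> W"
  then have "p \<in> far" using farp by blast
  then show "\<exists>N. opn X N & p \<in> N & (\<forall>q\<in>N. f q = 0)" using faro farf by (intro exI[of _ far]) blast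
 qed auto
 have df: "FD (%y. f (pt c y)) x = (%v. - (h' (r (pt c x)) * FD (%y. r (pt c y)) x v))"
  if c: "c \<in> charts X" and x: "x \<in> cimg c" "F c x ~= 0" for c x
 proof
  fix v
  show "FD (%y. f (pt c y)) x v = - (h' (r (pt c x)) * FD (%y. r (pt c y)) x v)"
   unfolding f_def using FD_real[OF ri[OF c] DERIV_minus[OF h(1)[OF rpos[OF c x]]] x(1), of v] by simp
 qed
 have w1W: "w1 c x = upd (wl c x) 1 (%v. - (h' (r (pt c x)) * FD (%y. r (pt c y)) x v)) (X.dform psi c x)"
  if "c \<in> charts X" "x \<in> cimg c" "F c x ~= 0" "pt c x \<in> W" for c x
  unfolding w1_def X.add_exact_def df[OF that(1,2,3)] using that(4) by simp
 have lps: "linear (X.dform psi c x)" if "c \<in> charts X" "x \<in> cimg c" "pt c x \<in> W" for c x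
  by (rule X.dform_smooth(1)[OF L that(1)]) (use that in \<open>simp add: cset_def\<close>)
 have inW: "pt c x \<in> W" if "c \<in> charts X" "x \<in> cimg c" "r (pt c x) < delta" for c x
  using delta0(2)[OF X.pt_points[OF that(1,2)]] that(3) delta(3) by simp
 have nbhd: "\<exists>S m kappa. open S & x \<in> S & S \<subseteq> cimg c & smo S m & (\<forall>y\<in>S. m y > 0 & r (pt c y) = (F c y)\<^sup>2 * m y &
    r (pt c y) < b & linear (kappa y) & (\<forall>v. kappa y v = 2 * m y * FD (F c) y v + F c y * FD m y v) &
    (\<forall>v. FD (%y. r (pt c y)) y v = F c y * kappa y v)) & (\<forall>v. smo S (%y. kappa y v))"
  if c: "c \<in> charts X" and x: "x \<in> cimg c" and Fx: "F c x = 0" and b: "b > 0" for c x b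
 proof -
  obtain S0 m kappa where S0: "open S0" "x \<in> S0" "S0 \<subseteq> cimg c" "smo S0 m" "!!y. y \<in> S0 ==> m y > 0"
   "!!y. y \<in> S0 ==> r (pt c y) = (F c y)\<^sup>2 * m y"
   and k: "!!y v. y \<in> S0 ==> kappa y v = 2 * m y * FD (F c) y v + F c y * FD m y v"
   "!!y v. y \<in> S0 ==> FD (%y. r (pt c y)) y v = F c y * kappa y v"
   "!!y. y \<in> S0 ==> linear (kappa y)" "!!v. smo S0 (%y. kappa y v)"
   by (rule squares_local[where F = F, OF r Fs[OF c] c x], rule that)
  define S where "S = S0 \<inter> (cimg c \<inter> (%y. r (pt c y)) -` {..<b})"
  have So: "open S" unfolding S_def
   by (intro open_Int S0 continuous_open_preimage[OF sm_cont[OF ri[OF c]]] X.open_coord c open_lessThan)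
  have xS: "x \<in> S" using S0(2) x rz[OF c x Fx] b by (simp add: S_def)
  have sub: "S \<subseteq> S0" "S \<subseteq> cimg c" by (auto simp: S_def)
  have "\<forall>y\<in>S. m y > 0 & r (pt c y) = (F c y)\<^sup>2 * m y &
    r (pt c y) < b & linear (kappa y) & (\<forall>v. kappa y v = 2 * m y * FD (F c) y v + F c y * FD m y v) &
    (\<forall>v. FD (%y. r (pt c y)) y v = F c y * kappa y v)"
  proof
   fix y assume y: "y \<in> S"
   then have y0: "y \<in> S0" "r (pt c y) < b" by (auto simp: S_def)
   show "m y > 0 & r (pt c y) = (F c y)\<^sup>2 * m y &
    r (pt c y) < b & linear (kappa y) & (\<forall>v. kappa y v = 2 * m y * FD (F c) y v + F c y * FD m y v) &
    (\<forall>v. FD (%y. r (pt c y)) y v = F c y * kappa y v)"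
    by (intro conjI allI S0(5)[OF y0(1)] S0(6)[OF y0(1)] y0(2) k(3)[OF y0(1)] k(1)[OF y0(1)] k(2)[OF y0(1)])
  qed
  moreover have "\<forall>v. smo S (%y. kappa y v)" by (intro allI sm_subset[OF k(4) sub(1)])
  ultimately show ?thesis
   by (intro exI[of _ S] exI[of _ m] exI[of _ kappa] conjI So xS sub sm_subset[OF S0(4) sub(1)])
 qed
 define B where "B = X.ext2 F w1"
 have Boff: "B c x = w1 c x" if "F c x ~= 0" for c x unfolding B_def using X.ext2_off[where F = F, OF that] .
 have B2: "X.two_field B" unfolding B_def
 proof (rule X.two_field_ext2[OF F(2)])
  fix c x assume c: "c \<in> charts X" and x: "x \<in> cimg c"
  show "alt2 (w1 c x)" if "F c x ~= 0" by (rule X.closed2D(1)[OF w1c c]) (use Vc[OF c] x that in simp)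
  fix u v assume Fx: "F c x = 0"
  have d4: "delta / 4 > 0" using delta by simp
  obtain S m kappa where S: "open S" "x \<in> S" "S \<subseteq> cimg c" "smo S m"
   and Sm: "\<forall>y\<in>S. m y > 0 & r (pt c y) = (F c y)\<^sup>2 * m y &
    r (pt c y) < delta / 4 & linear (kappa y) & (\<forall>v. kappa y v = 2 * m y * FD (F c) y v + F c y * FD m y v) &
    (\<forall>v. FD (%y. r (pt c y)) y v = F c y * kappa y v)" and ks: "\<forall>v. smo S (%y. kappa y v)"
   using nbhd[OF c x Fx d4] by (elim exE conjE)
  have yW: "pt c y \<in> W" if "y \<in> S" for y
  proof (rule inW[OF c subsetD[OF S(3) that]])
   show "r (pt c y) < delta" using bspec[OF Sm that] delta(1) by linarith
  qed
  have SW: "S \<subseteq> cset c W" using S(3) yW by (auto simp: cset_def)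
  have Psis: "smo S (%y. X.dform psi c y v)" for v by (rule sm_subset[OF X.dform_smooth(2)[OF L c] SW])
  \<comment> \<open>\<open>N\<close> is \<open>F\<close> times \<open>w1\<close>. It vanishes where
    \<open>F\<close> does, because \<open>om\<close> is dF wedge d psi there and
    \<open>kappa\<close> is \<open>2 * m\<close> times dF; Hadamard division by \<open>F\<close>
    extends \<open>w1\<close>.\<close>
  define N where "N y = om c y u v - (kappa y u * X.dform psi c y v - kappa y v * X.dform psi c y u) / (2 * m y)" for y
  have FS: "smo S (F c)" by (rule sm_subset[OF Fs[OF c] S(3)])
  have Ns: "smo S N" unfolding N_def
  proof (intro sm_diff sm_divide sm_mult sm_const S(1,4) Psis spec[OF ks])
   show "smo S (%y. om c y u v)" by (rule sm_subset[OF X.two_fieldD(2)[OF om c] S(3)])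
   show "2 * m y ~= 0" if "y \<in> S" for y using bspec[OF Sm that] by simp
  qed
  have Nz: "N y = 0" if y: "y \<in> S" and Fy: "F c y = 0" for y
  proof -
   have "kappa y v = 2 * m y * FD (F c) y v" "m y ~= 0" for v using bspec[OF Sm y] Fy by auto
   then show ?thesis unfolding N_def spl[OF c subsetD[OF S(3) y] Fy] by (simp add: field_simps)
  qed
  obtain e where e: "FD (F c) x e ~= 0" using nd[OF c x Fx] by blast
  obtain T q where T: "open T" "x \<in> T" "T \<subseteq> S" "smo T q" "!!y. y \<in> T ==> N y = F c y * q y"
   by (rule hadamard[where F = "F c", OF S(1,2) FS Ns Fx e Nz], assumption, assumption, rule that)
  have "w1 c y u v = q y" if y: "y \<in> T" and Fy: "F c y ~= 0" for y
  proof -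
   have yS: "y \<in> S" using y T(3) by blast
   note b = bspec[OF Sm yS]
   have yi: "y \<in> cimg c" using yS S(3) by blast
   have ry: "r (pt c y) = (F c y)\<^sup>2 * m y" "m y > 0" "r (pt c y) < delta / 4" using b by auto
   have kr: "FD (%y. r (pt c y)) y v = F c y * kappa y v" for v using b by blast
   have h1: "h' (r (pt c y)) = 1 / (2 * ((F c y)\<^sup>2 * m y))" using h(2)[OF rpos[OF c yi Fy] ry(3)] unfolding ry(1) .
   have hk: "h' (r (pt c y)) * (F c y * kappa y v) = kappa y v / (2 * F c y * m y)" for v
    unfolding h1 using Fy ry(2) by (simp add: field_simps power2_eq_square)
   have "F c y * w1 c y u v = N y"
    unfolding w1W[OF c yi Fy yW[OF yS]] kr upd_def hk N_def omw[OF c yi Fy] using Fy ry(2) by (simp add: field_simps)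
   then show ?thesis using T(5)[OF y] Fy by simp
  qed
  then have "\<forall>y\<in>T. F c y ~= 0 --> w1 c y u v = q y" by blast
  moreover have "T \<subseteq> cimg c" using T(3) S(3) by blast
  ultimately show "\<exists>S q. open S & x \<in> S & S \<subseteq> cimg c & smo S q & (\<forall>y\<in>S. F c y ~= 0 --> w1 c y u v = q y)"
   using T(1,2,4) by (intro exI[of _ T] exI[of _ q] conjI)
 next
  fix c u v assume c: "c \<in> charts X"
  show "smo (cset c ?V) (%x. w1 c x u v)" by (rule X.closed2D(3)[OF w1c c])
 qed
 have "X.closed2 ?V B"
 proof (rule X.closed2_cong[OF w1c Vo])
  show "B c x = w1 c x" if "c \<in> charts X" "x \<in> cset c ?V" for c x using Boff Vc[OF that(1)] that(2) by blast
 qed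
 then have Bc: "X.closed2 (points X) B" by (rule X.closed2_dense[OF F(2) B2])
 have aB: "alt2 (B c x)" if "c \<in> charts X" "x \<in> cimg c" for c x by (rule X.two_fieldD(1)[OF B2 that])
 have Bs: "smo (cimg c) (%x. B c x u v)" if "c \<in> charts X" for c u v by (rule X.two_fieldD(2)[OF B2 that])
 have PfBs: "smo (cimg c) (%x. Pf n (B c x))" if "c \<in> charts X" for c
  by (rule sm_Pf[OF X.open_coord[OF that] Bs[OF that]])
 obtain C where C: "!!P w :: 'e => 'e => real. alt2 P ==> alt2 w ==> ipair P w ==> Pf n w ~= 0 ==> Pf n P * Pf n w = C & C ~= 0"
  by (rule Pf_mult_inverse[OF dim], rule that)
 have wli: "ipair (wl c x) (P c x)" "Pf n (wl c x) * F c x = C & C ~= 0" "alt2 (wl c x)"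
  if c: "c \<in> charts X" and x: "x \<in> cimg c" "F c x ~= 0" for c x
 proof -
  have nz: "Pf n (P c x) ~= 0" using x F(1) by simp
  show 1: "ipair (wl c x) (P c x)" unfolding wl_def by (rule ipair_pinv[OF dim aP[OF c x(1)] nz])
  show 2: "alt2 (wl c x)" unfolding wl_def by (rule alt2_pinv[OF dim aP[OF c x(1)]])
  show "Pf n (wl c x) * F c x = C & C ~= 0" unfolding F(1) by (rule C[OF 2 aP[OF c x(1)] 1 nz])
 qed
 have C0: "C ~= 0" if c: "c \<in> charts X" and x: "x \<in> cimg c" for c x
 proof -
  have "\<exists>y\<in>cimg c. F c y ~= 0"
   using X.dense0[OF F(2) c X.open_coord[OF c] order_refl x continuous_on_const, of 1] by auto
  then show ?thesis using wli(2)[OF c] by blast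
 qed
 have Cwl: "F c x * Pf n (wl c x) = C" "Pf n (wl c x) ~= 0" if "c \<in> charts X" "x \<in> cimg c" "F c x ~= 0" for c x
  using wli(2)[OF that] by (auto simp: mult.commute)
 \<comment> \<open>Adding the logarithmic part back to \<open>B\<close> gives \<open>wl\<close>, and
   \<open>F * Pf n (wl c x) = C\<close>. Near \<open>Z\<close> its coefficient \<open>h'\<close> is
   \<open>1 / (2 * r)\<close>, so expanding \<open>Pf\<close> determines the term with dr.\<close>
 have key: "F c x * dPf n (B c x) (FD (%y. r (pt c y)) x) (X.dform psi c x) = 2 * r (pt c x) * (C - F c x * Pf n (B c x))"
  if c: "c \<in> charts X" and x: "x \<in> cimg c" and rx: "r (pt c x) < delta / 4" for c x
 proof (cases "F c x = 0")
  case False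
  have xW: "pt c x \<in> W" by (rule inW[OF c x]) (use rx delta(1) in simp)
  let ?d = "FD (%y. r (pt c y)) x" and ?Psi = "X.dform psi c x" and ?h = "h' (r (pt c x))"
  have "wl c x = upd (B c x) 1 (%v. ?h * ?d v) ?Psi"
   unfolding Boff[OF False] w1W[OF c x False xW] by (rule upd_cancel(1)[symmetric])
  then have "Pf n (wl c x) = Pf n (B c x) + dPf n (B c x) (%v. ?h * ?d v) ?Psi" by (simp add: dPf_def)
  then have "Pf n (wl c x) = Pf n (B c x) + ?h * dPf n (B c x) ?d ?Psi"
   unfolding dPf_scale2(2)[OF dim aB[OF c x] lr[OF c x] lps[OF c x xW]] .
  then have "C = F c x * (Pf n (B c x) + ?h * dPf n (B c x) ?d ?Psi)" using Cwl(1)[OF c x False] by simp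
  then show ?thesis unfolding h(2)[OF rpos[OF c x False] rx] using rpos[OF c x False] by (simp add: field_simps)
 qed (use rz[OF c x] in simp)
 \<comment> \<open>Off \<open>Z\<close> this is the quotient of the Pfaffians of \<open>B\<close>
   and \<open>wl\<close>, which scale by the same determinant. So it is a global function although
   \<open>F\<close> is not.\<close>
 define gg where "gg c x = F c x * Pf n (B c x) / C" for c x
 have jac: "F d (trn c d y) = F c y * gram bas (%i. FD (trn c d) y (bas i))"
  "B c y = (%u v. B d (trn c d y) (FD (trn c d) y u) (FD (trn c d) y v))"
  "trn c d y \<in> cimg d" "y \<in> cimg c" "F d (trn c d y) ~= 0"
  if c: "c \<in> charts X" "d \<in> charts X" and y: "y \<in> overlap c d" and Fy: "F c y ~= 0" for c d y
 proof -
  show yi: "y \<in> cimg c" and ty: "trn c d y \<in> cimg d" using X.trn_ov(4,5)[OF c y] by auto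
  have yV: "y \<in> cset c ?V" using Vc[OF c(1)] yi Fy by simp
  show nz: "F d (trn c d y) ~= 0"
   using Fz[OF c(2) ty] Fz[OF c(1) yi] Fy X.trn_ov(3)[OF c y] by simp
  have wlt: "wl c y = (%u v. wl d (trn c d y) (FD (trn c d) y u) (FD (trn c d) y v))"
   by (rule ext, rule ext, rule X.closed2D(4)[OF wlc c(1) c(2) y yV])
  let ?J = "gram bas (%i. FD (trn c d) y (bas i))"
  have "Pf n (wl c y) = ?J * Pf n (wl d (trn c d y))"
   unfolding wlt by (rule Pf_pullback[OF dim wli(3)[OF c(2) ty nz]])
  then have "F d (trn c d y) * Pf n (wl d (trn c d y)) = (F c y * ?J) * Pf n (wl d (trn c d y))"
   using Cwl(1)[OF c(1) yi Fy] Cwl(1)[OF c(2) ty nz] by simp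
  then show "F d (trn c d y) = F c y * ?J" using Cwl(2)[OF c(2) ty nz] by simp
  show "B c y = (%u v. B d (trn c d y) (FD (trn c d) y u) (FD (trn c d) y v))"
   by (rule ext, rule ext, rule X.closed2D(4)[OF Bc c(1) c(2) y]) (simp add: X.cset_points[OF c(1)] yi)
 qed
 have ggt: "gg d (trn c d y) = gg c y" if c: "c \<in> charts X" "d \<in> charts X" and y: "y \<in> overlap c d" for c d y
 proof (cases "F c y = 0")
  case True
  have "F d (trn c d y) = 0"
   using Fz[OF c(2) X.trn_ov(5)[OF c y]] Fz[OF c(1) X.trn_ov(4)[OF c y]] True X.trn_ov(3)[OF c y] by simp
  then show ?thesis using True by (simp add: gg_def)
 next
  case False
  note j = jac[OF c y False]
  have "Pf n (B c y) = gram bas (%i. FD (trn c d) y (bas i)) * Pf n (B d (trn c d y))"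
   unfolding j(2) by (rule Pf_pullback[OF dim aB[OF c(2) j(3)]])
  then show ?thesis unfolding gg_def j(1) by simp
 qed
 define g where "g p = (let c = SOME c. c \<in> charts X & p \<in> dom_of c in gg c (snd c p))" for p
 have gpt: "g (pt c x) = gg c x" if c: "c \<in> charts X" and x: "x \<in> cimg c" for c x
 proof -
  define c0 where "c0 = (SOME c0. c0 \<in> charts X & pt c x \<in> dom_of c0)"
  have c0: "c0 \<in> charts X & pt c x \<in> dom_of c0"
   unfolding c0_def by (rule someI[of _ c]) (use c X.pt_dom[OF c x] in simp)
  have "x \<in> overlap c c0" unfolding X.overlap_eq[OF c] using x c0 by (simp add: cset_def)
  from ggt[OF c conjunct1[OF c0] this] show ?thesis unfolding g_def c0_def[symmetric] Let_def by (simp add: transition_def)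
 qed
 have gs: "X.sfun (points X) g" unfolding X.sfun_def
 proof
  fix c assume c: "c \<in> charts X"
  have "smo (cimg c) (gg c)" unfolding gg_def[abs_def] divide_inverse
   by (intro sm_mult sm_const X.open_coord c Fs PfBs)
  then have "smo (cimg c) (%x. g (pt c x))" by (rule sm_eq[OF X.open_coord[OF c]]) (rule gpt[OF c])
  then show "smo (cset c (points X)) (%x. g (pt c x))" unfolding X.cset_points[OF c] .
 qed
 have gi: "smo (cimg c) (%x. g (pt c x))" if "c \<in> charts X" for c
  using X.sfunD[OF gs that] unfolding X.cset_points[OF that] .
 have lg: "linear (FD (%y. g (pt c y)) x)" if "c \<in> charts X" "x \<in> cimg c" for c x
  by (rule sm_linear_FD[OF gi[OF that(1)] that(2)])
 \<comment> \<open>\<open>kk + g\<close> is the contribution of dg wedge d psi, normalised by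
   \<open>F / C\<close>. To first order along \<open>Z\<close> it equals \<open>g\<close>; the
   defect \<open>kk\<close> turns out to be of order \<open>r\<close>.\<close>
 define kk where "kk c x = F c x * dPf n (B c x) (FD (%y. g (pt c y)) x) (X.dform psi c x) / C - g (pt c x)" for c x
 have kkt: "kk d (trn c d y) = kk c y"
  if c: "c \<in> charts X" "d \<in> charts X" and y: "y \<in> overlap c d" and Fy: "F c y ~= 0" and yW: "pt c y \<in> W" for c d y
 proof -
  note j = jac[OF c y Fy]
  let ?T = "FD (trn c d) y" and ?z = "trn c d y"
  have pt: "pt d ?z = pt c y" by (rule X.trn_ov(3)[OF c y])
  have e1: "FD (%y. g (pt c y)) y = (%u. FD (%y. g (pt d y)) ?z (?T u))"
   by (rule ext, rule X.FD_sfun[OF openin_topspace gs c y X.pt_points[OF c(1) j(4)]])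
  have e2: "X.dform psi c y = (%u. X.dform psi d ?z (?T u))"
   by (rule ext, rule X.dform_transition[OF L c y]) (use yW j(4) in \<open>simp add: cset_def\<close>)
  have lz: "linear (X.dform psi d ?z)" by (rule lps[OF c(2) j(3)]) (simp add: pt yW)
  have "dPf n (B c y) (FD (%y. g (pt c y)) y) (X.dform psi c y) =
    gram bas (%i. ?T (bas i)) * dPf n (B d ?z) (FD (%y. g (pt d y)) ?z) (X.dform psi d ?z)"
   unfolding e1 e2 j(2) by (rule dPf_pullback[OF dim aB[OF c(2) j(3)] lg[OF c(2) j(3)] lz])
  then show ?thesis unfolding kk_def j(1) pt by simp
 qed
 have locB: "\<exists>S m L'. open S & x \<in> S & S \<subseteq> cimg c & smo S m & smo S L' &
   (\<forall>y\<in>S. m y > 0 & r (pt c y) = (F c y)\<^sup>2 * m y & r (pt c y) < delta / 4 &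
    (F c y ~= 0 --> kk c y = r (pt c y) * L' y)) & dPf n (B c x) (FD (F c) x) (X.dform psi c x) = C"
  if c: "c \<in> charts X" and x: "x \<in> cimg c" and Fx: "F c x = 0" for c x
 proof -
  have d4: "delta / 4 > 0" using delta by simp
  obtain S m kappa where S: "open S" "x \<in> S" "S \<subseteq> cimg c" "smo S m"
   and Sm: "\<forall>y\<in>S. m y > 0 & r (pt c y) = (F c y)\<^sup>2 * m y &
    r (pt c y) < delta / 4 & linear (kappa y) & (\<forall>v. kappa y v = 2 * m y * FD (F c) y v + F c y * FD m y v) &
    (\<forall>v. FD (%y. r (pt c y)) y v = F c y * kappa y v)" and ks: "\<forall>v. smo S (%y. kappa y v)"
   using nbhd[OF c x Fx d4] by (elim exE conjE)
  note Cn = C0[OF c x]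
  have yi: "y \<in> cimg c" if "y \<in> S" for y using that S(3) by blast
  have yW: "pt c y \<in> W" if "y \<in> S" for y
  proof (rule inW[OF c yi[OF that]])
   show "r (pt c y) < delta" using bspec[OF Sm that] delta(1) by linarith
  qed
  have SW: "S \<subseteq> cset c W" using S(3) yW by (auto simp: cset_def)
  let ?Psi = "X.dform psi c"
  have Psis: "smo S (%y. ?Psi y v)" for v by (rule sm_subset[OF X.dform_smooth(2)[OF L c] SW])
  have FS: "smo S (F c)" and BS: "smo S (%y. B c y u v)" and PS: "smo S (%y. Pf n (B c y))" for u v
   using sm_subset[OF Fs[OF c] S(3)] sm_subset[OF Bs[OF c] S(3)] sm_subset[OF PfBs[OF c] S(3)] by auto
  define g1 where "g1 y = Pf n (B c y) / C" for y
  have g1s: "smo S g1" unfolding g1_def by (intro sm_divide sm_const S PS Cn)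
  define Dm where "Dm y = dPf n (B c y) (FD m y) (?Psi y)" for y
  define Dg where "Dg y = dPf n (B c y) (FD g1 y) (?Psi y)" for y
  define DF where "DF y = dPf n (B c y) (FD (F c) y) (?Psi y)" for y
  have ds: "smo S Dm" "smo S Dg" "smo S DF" unfolding Dm_def Dg_def DF_def
   by (intro sm_dPf S(1) BS sm_FD S(4) g1s FS Psis)+
  \<comment> \<open>Divided by \<open>2 * F^2 * m\<close>, \<open>key\<close> becomes
    \<open>DF = C - F * M\<close>; in particular \<open>DF\<close> has the value \<open>C\<close> on
    \<open>Z\<close>.\<close>
  define M where "M y = Pf n (B c y) + Dm y / (2 * m y)" for y
  have m0: "m y > 0" if "y \<in> S" for y using bspec[OF Sm that] by blast
  have Ms: "smo S M" unfolding M_def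
  proof (intro sm_add sm_divide sm_mult sm_const S(1,4) PS ds)
   show "2 * m y ~= 0" if "y \<in> S" for y using m0[OF that] by simp
  qed
  have lm: "linear (FD m y)" "linear (FD g1 y)" "linear (FD (F c) y)" "linear (?Psi y)" "alt2 (B c y)" if "y \<in> S" for y
   using sm_linear_FD[OF S(4) that] sm_linear_FD[OF g1s that] lF[OF c yi[OF that]] lps[OF c yi[OF that] yW[OF that]]
    aB[OF c yi[OF that]] by auto
  have DFe: "DF y = C - F c y * M y" if y: "y \<in> S" and Fy: "F c y ~= 0" for y
  proof -
   note b = bspec[OF Sm y]
   have ry: "r (pt c y) = (F c y)\<^sup>2 * m y" "r (pt c y) < delta / 4" using b by auto
   have k1: "FD (%y. r (pt c y)) y = (%v. F c y * (2 * m y * FD (F c) y v + F c y * FD m y v))"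
    using b by (intro ext) simp
   have l2: "linear (%v. 2 * m y * FD (F c) y v)" using lm(3)[OF y] by (auto simp: linear_iff algebra_simps)
   have l3: "linear (%v. 2 * m y * FD (F c) y v + F c y * FD m y v)" using l2 lm(1)[OF y] by (auto simp: linear_iff algebra_simps)
   have "dPf n (B c y) (FD (%y. r (pt c y)) y) (?Psi y) = F c y * (2 * m y * DF y + F c y * Dm y)"
    unfolding k1 dPf_scale2(2)[OF dim lm(5)[OF y] l3 lm(4)[OF y]] dPf_add_left[OF dim lm(5)[OF y] l2 lm(1)[OF y] lm(4)[OF y]]
    dPf_scale2(2)[OF dim lm(5)[OF y] lm(3)[OF y] lm(4)[OF y]] DF_def Dm_def ..
   then have "F c y * (F c y * (2 * m y * DF y + F c y * Dm y)) = 2 * ((F c y)\<^sup>2 * m y) * (C - F c y * Pf n (B c y))"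
    using key[OF c yi[OF y] ry(2)] unfolding ry(1) by simp
   then have "(F c y)\<^sup>2 * (2 * m y * DF y + F c y * Dm y) = (F c y)\<^sup>2 * (2 * m y * (C - F c y * Pf n (B c y)))" by algebra
   then have "2 * m y * DF y + F c y * Dm y = 2 * m y * (C - F c y * Pf n (B c y))" using Fy by simp
   then show ?thesis unfolding M_def using m0[OF y] by (simp add: field_simps)
  qed
  have "DF x - (C - F c x * M x) = 0"
  proof (rule X.dense0[OF F(2) c S(1,3,2) sm_cont])
   show "smo S (%y. DF y - (C - F c y * M y))" by (intro sm_diff sm_mult sm_const S(1) ds FS Ms)
  qed (simp add: DFe)
  then have DFx: "DF x = C" using Fx by simp
  \<comment> \<open>With \<open>g = F * g1\<close> the terms of first order in \<open>F\<close>
    cancel in \<open>kk\<close>, and this is the quotient of what remains by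
    \<open>r = F^2 * m\<close>.\<close>
  define L' where "L' y = (Dg y - g1 y * M y) / (C * m y)" for y
  have L's: "smo S L'" unfolding L'_def
  proof (intro sm_diff sm_divide sm_mult sm_const S(1,4) ds g1s Ms)
   show "C * m y ~= 0" if "y \<in> S" for y using m0[OF that] Cn by simp
  qed
  have ke: "kk c y = r (pt c y) * L' y" if y: "y \<in> S" and Fy: "F c y ~= 0" for y
  proof -
   have ry: "r (pt c y) = (F c y)\<^sup>2 * m y" using bspec[OF Sm y] by blast
   have ge: "g (pt c z) = F c z * g1 z" if "z \<in> S" for z unfolding gpt[OF c yi[OF that]] gg_def g1_def by simp
   have dg: "FD (%y. g (pt c y)) y = (%v. F c y * FD g1 y v + g1 y * FD (F c) y v)"
   proof
    fix v
    have "FD (%y. g (pt c y)) y v = FD (%y. F c y * g1 y) y v" by (rule fun_cong[OF FD_cong[OF S(1) y ge]])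
    then show "FD (%y. g (pt c y)) y v = F c y * FD g1 y v + g1 y * FD (F c) y v"
    unfolding FD_rules(1)[OF sm_diffble[OF FS y] sm_diffble[OF g1s y]] by simp
   qed
   have l2: "linear (%v. F c y * FD g1 y v)" using lm(2)[OF y] by (auto simp: linear_iff algebra_simps)
   have "dPf n (B c y) (FD (%y. g (pt c y)) y) (?Psi y) = F c y * Dg y + g1 y * DF y"
    unfolding dg dPf_add_left[OF dim lm(5)[OF y] l2 lm(3)[OF y] lm(4)[OF y]] dPf_scale2(2)[OF dim lm(5)[OF y] lm(2)[OF y] lm(4)[OF y]] DF_def Dg_def ..
   then have "kk c y = F c y * (F c y * Dg y + g1 y * (C - F c y * M y)) / C - F c y * g1 y"
    unfolding kk_def ge[OF y] DFe[OF y Fy, symmetric] by simp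
   also have "... = (F c y)\<^sup>2 * m y * L' y" unfolding L'_def using Cn m0[OF y] by (simp add: field_simps power2_eq_square)
   finally show ?thesis unfolding ry .
  qed
  have "\<forall>y\<in>S. m y > 0 & r (pt c y) = (F c y)\<^sup>2 * m y & r (pt c y) < delta / 4 & (F c y ~= 0 --> kk c y = r (pt c y) * L' y)"
  proof
   fix y assume y: "y \<in> S"
   show "m y > 0 & r (pt c y) = (F c y)\<^sup>2 * m y & r (pt c y) < delta / 4 & (F c y ~= 0 --> kk c y = r (pt c y) * L' y)"
    using bspec[OF Sm y] ke[OF y] by (intro conjI impI) (elim conjE, assumption)+
  qed
  then show ?thesis using DFx S L's unfolding DF_def by (intro exI[of _ S] exI[of _ m] exI[of _ L'] conjI)
 qed
 \<comment> \<open>Bounds by natural numbers can be combined by a maximum over a finite cover of the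
   compact set \<open>Z\<close>, which yields the uniform constant \<open>K\<close>.\<close>
 define bnd where "bnd j N \<longleftrightarrow> (\<forall>c\<in>charts X. \<forall>y\<in>cset c N. F c y ~= 0 --> \<bar>kk c y\<bar> <= real j * r (pt c y))" for j N
 have bnd_ex: "\<exists>N j. opn X N & p \<in> N & bnd j N" if p: "p \<in> points Z" for p
 proof -
  have "p \<in> points X" using p Z_subset by blast
  from X.ex_chart[OF this] obtain c where c: "c \<in> charts X" "p \<in> dom_of c" by blast
  define x where "x = snd c p"
  have x: "x \<in> cimg c" "pt c x = p" using c X.pt_chart[OF c] by (auto simp: x_def)
  have Fx: "F c x = 0" using Fz[OF c(1) x(1)] x(2) p by simp
  obtain S m L' where S: "open S" "x \<in> S" "S \<subseteq> cimg c" "smo S m" "smo S L'"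
   and Sm: "\<forall>y\<in>S. m y > 0 & r (pt c y) = (F c y)\<^sup>2 * m y & r (pt c y) < delta / 4 &
    (F c y ~= 0 --> kk c y = r (pt c y) * L' y)"
   using locB[OF c(1) x(1) Fx] by (elim exE conjE)
  obtain j :: nat where j: "\<bar>L' x\<bar> < real j" using reals_Archimedean2 by blast
  define S1 where "S1 = S \<inter> (%y. \<bar>L' y\<bar>) -` {..<real j}"
  have S1: "open S1" unfolding S1_def
   by (rule continuous_open_preimage[OF _ S(1) open_lessThan]) (intro continuous_on_rabs sm_cont[OF S(5)])
  define N where "N = {q \<in> dom_of c. snd c q \<in> S1}"
  have No: "opn X N" unfolding N_def by (rule X.openin_chart_preimage[OF c(1) S1])
  have pN: "p \<in> N" using c(2) S(2) j by (simp add: N_def S1_def x_def[symmetric])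
  have "bnd j N" unfolding bnd_def
  proof (intro ballI impI)
   fix d y assume d: "d \<in> charts X" and y: "y \<in> cset d N" and Fy: "F d y ~= 0"
   have y': "y \<in> cimg d" "pt d y \<in> dom_of c" "snd c (pt d y) \<in> S1" using y by (auto simp: cset_def N_def)
   have ov: "y \<in> overlap d c" unfolding X.overlap_eq[OF d] using y' by (simp add: cset_def)
   let ?z = "trn d c y"
   have z: "?z \<in> S" "\<bar>L' ?z\<bar> < real j" using y'(3) by (auto simp: transition_def S1_def)
   have pt: "pt c ?z = pt d y" by (rule X.trn_ov(3)[OF d c(1) ov])
   have b: "r (pt c ?z) < delta / 4" "F c ?z ~= 0 --> kk c ?z = r (pt c ?z) * L' ?z" using bspec[OF Sm z(1)] by auto
   have yW: "pt d y \<in> W" by (rule inW[OF d y'(1)]) (use b(1) pt delta(1) in simp)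
   have "kk d y = r (pt d y) * L' ?z"
    using b(2) jac(5)[OF d c(1) ov Fy] kkt[OF d c(1) ov Fy yW] unfolding pt by simp
   then have "\<bar>kk d y\<bar> = r (pt d y) * \<bar>L' ?z\<bar>" using rpos[OF d y'(1) Fy] by (simp add: abs_mult)
   also have "... <= r (pt d y) * real j" using rpos[OF d y'(1) Fy] z(2) by (intro mult_left_mono) auto
   finally show "\<bar>kk d y\<bar> <= real j * r (pt d y)" by (simp add: mult.commute)
  qed
  then show ?thesis using No pN by (intro exI[of _ N] exI[of _ j] conjI)
 qed
 obtain V1 K where V1: "opn X V1" "points Z \<subseteq> V1" "bnd K V1"
 proof -
  define \<N> where "\<N> = {N. opn X N & (\<exists>j. bnd j N)}"
  have cov: "points Z \<subseteq> \<Union>\<N>"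
  proof
   fix p assume "p \<in> points Z"
   from bnd_ex[OF this] obtain N j where "opn X N" "p \<in> N" "bnd j N" by (elim exE conjE)
   then show "p \<in> \<Union>\<N>" unfolding \<N>_def by (intro UnionI[of N]) auto
  qed
  have comp: "compactin (mtop X) (points Z)" by (rule closedin_compact_space[OF compact closed_Z])
  have op: "opn X N" if "N \<in> \<N>" for N using that by (simp add: \<N>_def)
  have "\<exists>\<F>. finite \<F> & \<F> \<subseteq> \<N> & points Z \<subseteq> \<Union>\<F>" by (rule compactinD[OF comp op cov])
  then obtain \<F> where \<F>: "finite \<F>" "\<F> \<subseteq> \<N>" "points Z \<subseteq> \<Union>\<F>" by (elim exE conjE)
  have "\<forall>N\<in>\<F>. \<exists>j. bnd j N" using \<F>(2) by (auto simp: \<N>_def)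
  from bchoice[OF this] obtain jf where jf: "\<forall>N\<in>\<F>. bnd (jf N) N" ..
  define K where "K = Max (insert 0 (jf ` \<F>))"
  have "bnd K (\<Union>\<F>)" unfolding bnd_def
  proof (intro ballI impI)
   fix c y assume c: "c \<in> charts X" and y: "y \<in> cset c (\<Union>\<F>)" and Fy: "F c y ~= 0"
   obtain N where N: "N \<in> \<F>" "y \<in> cset c N" using y by (auto simp: cset_def)
   have le: "jf N <= K" unfolding K_def using \<F>(1) N(1) by (intro Max_ge) auto
   have yi: "y \<in> cimg c" using y by (auto simp: cset_def)
   have "\<bar>kk c y\<bar> <= real (jf N) * r (pt c y)" using bspec[OF jf N(1)] c N(2) Fy unfolding bnd_def by blast
   also have "... <= real K * r (pt c y)" using le rpos[OF c yi Fy] by (intro mult_right_mono) auto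
   finally show "\<bar>kk c y\<bar> <= real K * r (pt c y)" .
  qed
  moreover have "opn X (\<Union>\<F>)" by (rule openin_Union) (use \<F>(2) op in blast)
  ultimately show thesis using that \<F>(3) by blast
 qed
 obtain c0 where c0: "c0 > 0" "!!t. (cutoff has_real_derivative deriv cutoff t) (at t)" "!!t. \<bar>deriv cutoff t\<bar> <= c0"
  "!!t. t < 1/2 ==> deriv cutoff t = 0"
  by (rule cutoff_deriv, rule that)
 \<comment> \<open>The summand 1 ensures \<open>c1 >= 1\<close>, as \<open>fold_estimate\<close>
   requires.\<close>
 define c1 where "c1 = c0 + 1"
 have c1: "c1 >= 1" "!!t. \<bar>deriv cutoff t\<bar> <= c1" using c0(1,3) by (auto simp: c1_def intro: order_trans[OF c0(3)])
 define rho where "rho = 1 / (32 * (1 + 3 * c1))"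
 have rho: "rho > 0" "rho * (32 * (1 + 3 * c1)) = 1" using c1(1) by (auto simp: rho_def)
 define V2 where "V2 = V1 \<inter> {p \<in> points X. g p \<in> {- rho<..<rho}}"
 have V2o: "opn X V2" unfolding V2_def by (intro openin_Int V1 X.sfun_open[OF gs open_greaterThanLessThan])
 have ZV2: "points Z \<subseteq> V2"
 proof
  fix p assume p: "p \<in> points Z"
  then have pX: "p \<in> points X" using Z_subset by blast
  from X.ex_chart[OF pX] obtain c where c: "c \<in> charts X" "p \<in> dom_of c" by blast
  have x: "snd c p \<in> cimg c" "pt c (snd c p) = p" using c X.pt_chart[OF c] by auto
  have "F c (snd c p) = 0" using Fz[OF c(1) x(1)] x(2) p by simp
  then have "g p = 0" using gpt[OF c(1) x(1)] x(2) by (simp add: gg_def)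
  then show "p \<in> V2" using p V1(2) pX rho(1) by (auto simp: V2_def)
 qed
 obtain delta1 where delta1: "delta1 > 0" "!!p. p \<in> points X ==> r p < delta1 ==> p \<in> V2"
  by (rule small_values_near_Z[OF squaresD(1)[OF r] squaresD(2)[OF r] squaresD(3)[OF r] V2o ZV2], assumption, assumption, rule that)
 \<comment> \<open>The three bounds keep the region \<open>r <= eta\<close> where the outer cutoff
   in \<open>phi\<close> is 1, inside \<open>V2\<close>, where \<open>g\<close> and
   \<open>kk\<close> are controlled, and make \<open>eta\<close> small against
   \<open>K\<close>.\<close>
 define eta where "eta = min (min (delta / 8) (delta1 / 2)) (1 / (32 * (real K + 1)))"
 have eta: "eta > 0" "eta <= delta / 8" "eta <= delta1 / 2" "eta <= 1 / (32 * (real K + 1))" using delta(1) delta1(1) by (auto simp: eta_def)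
 have etaK: "eta * (real K + 1) <= 1 / 32"
 proof -
  have "eta * (real K + 1) <= 1 / (32 * (real K + 1)) * (real K + 1)" using eta(4) by (intro mult_right_mono) auto
  also have "... = 1 / 32" by (simp add: field_simps)
  finally show ?thesis .
 qed
 have etadelta: "eta < delta / 4" "eta < delta" "eta < delta / 2" "eta < delta1" using eta delta(1) delta1(1) by linarith+
 define epsilon where "epsilon = eta / (2 * c1)"
 have epsilon: "epsilon > 0" using eta(1) c1(1) by (simp add: epsilon_def)
 define chi' where "chi' t = cutoff (t / eta)" for t
 have ch: "0 <= chi' t" "chi' t <= 1" "t <= eta / 2 ==> chi' t = 1" "t >= eta ==> chi' t = 0" for t
  using cutoff_bounds[of "t / eta"] cutoff_eq_1[of "t / eta"] cutoff_eq_0[of "t / eta"] eta(1) by (auto simp: chi'_def field_simps)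
 define dch where "dch t = deriv cutoff (t / eta) / eta" for t
 have dch: "(chi' has_real_derivative dch t) (at t)" for t
 proof -
  have "((%t. cutoff (t / eta)) has_real_derivative deriv cutoff (t / eta) * (1 / eta)) (at t)"
   by (rule DERIV_chain2[OF c0(2)]) (use eta(1) in \<open>auto intro!: derivative_eq_intros\<close>)
  then show ?thesis unfolding chi'_def[abs_def] dch_def by simp
 qed
 have dch1: "\<bar>dch t\<bar> * eta <= c1" "t < eta / 2 ==> dch t = 0" for t
  using c1(2)[of "t / eta"] c0(4)[of "t / eta"] eta(1) by (auto simp: dch_def abs_divide field_simps)
 have chs: "smo UNIV chi'" unfolding chi'_def[abs_def]
  by (rule sm_compose[OF open_UNIV open_UNIV smooth_cutoff])
   (use eta(1) in \<open>auto intro!: sm_divide sm_const sm_id\<close>)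
 have lpos: "t + epsilon * chi' t > 0" if "t >= 0" for t
 proof (cases "t = 0")
  case True
  then show ?thesis using ch(3)[of 0] eta(1) epsilon by simp
 next
  case False
  then show ?thesis using that ch(1)[of t] epsilon by (simp add: add_pos_nonneg)
 qed
 \<comment> \<open>Beyond \<open>eta\<close> this is \<open>h\<close> of \<open>r\<close>. Near
   \<open>Z\<close> the argument of the logarithm is at least \<open>epsilon\<close>, and
   subtracting \<open>g\<close> cancels the first-order part of
   \<open>F * Pf n (B c x)\<close>.\<close>
 define phi where "phi p = cutoff (2 * r p / delta) * ln (r p + epsilon * chi' (r p)) / 2 - chi' (r p) * g p" for p
 have rnn: "r (pt c x) >= 0" if "c \<in> charts X" "x \<in> cimg c" for c x by (rule squaresD(2)[OF r X.pt_points[OF that]])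
 have phis: "X.sfun (points X) phi" unfolding X.sfun_def
 proof
  fix c assume c: "c \<in> charts X"
  note o = X.open_coord[OF c]
  have s1: "smo (cimg c) (%x. chi' (r (pt c x)))"
   by (rule sm_compose[OF o open_UNIV chs ri[OF c]]) simp
  have s2: "smo (cimg c) (%x. r (pt c x) + epsilon * chi' (r (pt c x)))"
   by (intro sm_add sm_mult sm_const o ri c s1)
  have s3: "smo (cimg c) (%x. ln (r (pt c x) + epsilon * chi' (r (pt c x))))"
   by (rule sm_compose[OF o open_greaterThan sm_ln s2]) (simp add: lpos[OF rnn[OF c]])
  have s4: "smo (cimg c) (%x. 2 * r (pt c x) / delta)"
   by (intro sm_divide sm_mult sm_const o ri c) (use delta(1) in simp)
  have s5: "smo (cimg c) (%x. cutoff (2 * r (pt c x) / delta))"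
   by (rule sm_compose[OF o open_UNIV smooth_cutoff s4]) simp
  show "smo (cset c (points X)) (%x. phi (pt c x))" unfolding X.cset_points[OF c] phi_def
   by (intro sm_diff sm_divide sm_mult sm_const o s5 s3 s1 gi c) simp
 qed
 define w where "w = X.add_exact W phi psi B"
 have farphi: "phi q = 0" if "q \<in> far" for q
 proof -
  have "r q > delta / 2" using that by (simp add: far_def)
  then have "cutoff (2 * r q / delta) = 0" "chi' (r q) = 0"
   using cutoff_eq_0[of "2 * r q / delta"] ch(4)[of "r q"] delta(1) etadelta(3) by (auto simp: field_simps)
  then show ?thesis by (simp add: phi_def)
 qed
 have wc: "X.closed2 (points X) w" unfolding w_def
 proof (rule X.closed2_add_exact[OF Bc openin_topspace W(1) L X.sfun_subset[OF phis]])
  fix p assume "p \<in> points X" "p \<notin> W"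
  then have "p \<in> far" using farp by blast
  then show "\<exists>N. opn X N & p \<in> N & (\<forall>q\<in>N. phi q = 0)" using faro farphi by (intro exI[of _ far]) blast
 qed auto
 have wW: "w c x = upd (B c x) 1 (FD (%y. phi (pt c y)) x) (X.dform psi c x)" if "pt c x \<in> W" for c x
  unfolding w_def X.add_exact_def using that by simp
 \<comment> \<open>Beyond \<open>eta\<close> the removed and the added terms cancel, so
   \<open>w\<close> is the inverse of \<open>P\<close> there.\<close>
 have outer: "w c x = wl c x" if c: "c \<in> charts X" and x: "x \<in> cimg c" and rx: "r (pt c x) > eta" for c x
 proof -
  have Fx: "F c x ~= 0" using rz[OF c x] rx eta(1) by auto
  define S where "S = cimg c \<inter> (%y. r (pt c y)) -` {eta<..}"
  have S: "open S" unfolding S_def by (rule continuous_open_preimage[OF sm_cont[OF ri[OF c]] X.open_coord[OF c] open_greaterThan])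
  have xS: "x \<in> S" using x rx by (simp add: S_def)
  have e: "phi (pt c y) = - f (pt c y)" if "y \<in> S" for y
   using that ch(4)[of "r (pt c y)"] by (simp add: S_def phi_def f_def h_def)
  have dd: "FD (%y. phi (pt c y)) x = (%v. h' (r (pt c x)) * FD (%y. r (pt c y)) x v)"
  proof
   fix v
   have "FD (%y. phi (pt c y)) x v = FD (%y. h (r (pt c y))) x v"
    by (rule fun_cong[OF FD_cong[OF S xS]]) (simp add: e f_def)
   then show "FD (%y. phi (pt c y)) x v = h' (r (pt c x)) * FD (%y. r (pt c y)) x v"
    unfolding FD_real[OF ri[OF c] h(1)[OF rpos[OF c x Fx]] x] .
  qed
  show ?thesis
  proof (cases "pt c x \<in> W")
   case True
   show ?thesis unfolding wW[OF True] Boff[OF Fx] w1W[OF c x Fx True] dd by (rule upd_cancel(1))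
  next
   case False
   then show ?thesis unfolding w_def w1_def X.add_exact_def Boff[OF Fx] by simp
  qed
 qed
 \<comment> \<open>The expansion of \<open>Pf\<close> along d phi wedge d psi, rewritten by
   \<open>key\<close> and the definitions of \<open>g\<close> and \<open>kk\<close>; up to the
   factor \<open>C\<close> it is the expression in \<open>fold_estimate\<close>.\<close>
 have inner: "F c x * Pf n (w c x) = C * (g (pt c x) + 2 * r (pt c x) *
   ((1 + epsilon * dch (r (pt c x))) / (2 * (r (pt c x) + epsilon * chi' (r (pt c x)))) - dch (r (pt c x)) * g (pt c x)) *
   (1 - g (pt c x)) - chi' (r (pt c x)) * (kk c x + g (pt c x)))"
  if c: "c \<in> charts X" and x: "x \<in> cimg c" and rx: "r (pt c x) < delta / 4" for c x
 proof -
  have xW: "pt c x \<in> W" by (rule inW[OF c x]) (use rx delta(1) in simp)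
  let ?r = "r (pt c x)" and ?dr = "FD (%y. r (pt c y)) x" and ?dg = "FD (%y. g (pt c y)) x" and ?Psi = "X.dform psi c x"
  define S where "S = cimg c \<inter> (%y. r (pt c y)) -` {..<delta / 4}"
  have S: "open S" unfolding S_def by (rule continuous_open_preimage[OF sm_cont[OF ri[OF c]] X.open_coord[OF c] open_lessThan])
  have xS: "x \<in> S" using x rx by (simp add: S_def)
  define H where "H t = ln (t + epsilon * chi' t) / 2" for t
  have H: "(H has_real_derivative (1 + epsilon * dch ?r) / (2 * (?r + epsilon * chi' ?r))) (at ?r)"
  proof -
   have "((%t. t + epsilon * chi' t) has_real_derivative 1 + epsilon * dch ?r) (at ?r)" by (intro DERIV_add DERIV_ident DERIV_cmult dch)
   from DERIV_cdivide[OF DERIV_chain2[OF DERIV_ln_divide[OF lpos[OF rnn[OF c x]]] this], of 2]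
   show ?thesis unfolding H_def[abs_def] by (simp add: field_simps)
  qed
  have e: "phi (pt c y) = H (r (pt c y)) - chi' (r (pt c y)) * g (pt c y)" if "y \<in> S" for y
  proof -
   have "2 * r (pt c y) / delta <= 1/2" using that delta(1) by (simp add: S_def field_simps)
   then show ?thesis using cutoff_eq_1 by (simp add: phi_def H_def)
  qed
  have dg: "(%y. g (pt c y)) differentiable (at x)" by (rule sm_diffble[OF gi[OF c] x])
  have cd: "(%y. k (r (pt c y))) differentiable (at x)" if "(k has_real_derivative k') (at ?r)" for k k'
  proof -
   have "(k has_derivative (%s. k' * s)) (at ?r)" using that by (simp add: has_field_derivative_def)
   from has_derivative_compose[OF sm_has_derivative[OF ri[OF c] x] this] show ?thesis unfolding differentiable_def by blast
  qed
  define A where "A = (1 + epsilon * dch ?r) / (2 * (?r + epsilon * chi' ?r)) - dch ?r * g (pt c x)"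
  have dphi: "FD (%y. phi (pt c y)) x = (%v. A * ?dr v + (- chi' ?r) * ?dg v)"
  proof
   fix v
   have "FD (%y. phi (pt c y)) x v = FD (%y. H (r (pt c y)) - chi' (r (pt c y)) * g (pt c y)) x v"
    by (rule fun_cong[OF FD_cong[OF S xS e]])
   then show "FD (%y. phi (pt c y)) x v = A * ?dr v + (- chi' ?r) * ?dg v"
    unfolding FD_rules(3)[OF cd[OF H] differentiable_mult[OF cd[OF dch] dg]] FD_rules(1)[OF cd[OF dch] dg]
    FD_real[OF ri[OF c] H x] FD_real[OF ri[OF c] dch x] A_def by (simp add: algebra_simps)
  qed
  note la = aB[OF c x] lr[OF c x] lg[OF c x] lps[OF c x xW]
  have lA: "linear (%v. A * ?dr v)" using la(2) by (auto simp: linear_iff algebra_simps)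
  have "Pf n (w c x) = Pf n (B c x) + dPf n (B c x) (%v. A * ?dr v + (- chi' ?r) * ?dg v) ?Psi"
   unfolding wW[OF xW] dphi dPf_def by simp
  then have Pw: "Pf n (w c x) = Pf n (B c x) + (A * dPf n (B c x) ?dr ?Psi + (- chi' ?r) * dPf n (B c x) ?dg ?Psi)"
   unfolding dPf_add_left[OF dim la(1) lA la(3,4)] dPf_scale2(2)[OF dim la(1,2,4)] .
  have Cn: "C ~= 0" by (rule C0[OF c x])
  have gC: "F c x * Pf n (B c x) = C * g (pt c x)" unfolding gpt[OF c x] gg_def using Cn by simp
  have kC: "F c x * dPf n (B c x) ?dg ?Psi = C * (kk c x + g (pt c x))" unfolding kk_def using Cn by simp
  have rC: "F c x * dPf n (B c x) ?dr ?Psi = 2 * ?r * (C - C * g (pt c x))" unfolding key[OF c x rx] gC ..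
  have "F c x * Pf n (w c x) = F c x * Pf n (B c x) + A * (F c x * dPf n (B c x) ?dr ?Psi) - chi' ?r * (F c x * dPf n (B c x) ?dg ?Psi)"
   unfolding Pw by algebra
  then show ?thesis unfolding gC kC rC A_def[symmetric] by algebra
 qed
 have small: "\<bar>kk c x\<bar> <= real K * r (pt c x)" "\<bar>g (pt c x)\<bar> <= rho"
  if c: "c \<in> charts X" and x: "x \<in> cimg c" and Fx: "F c x ~= 0" and rx: "r (pt c x) <= eta" for c x
 proof -
  have p: "pt c x \<in> V2" by (rule delta1(2)[OF X.pt_points[OF c x]]) (use rx etadelta(4) in simp)
  then have "x \<in> cset c V1" using x by (simp add: V2_def cset_def)
  then show "\<bar>kk c x\<bar> <= real K * r (pt c x)" using V1(3) c Fx unfolding bnd_def by blast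
  show "\<bar>g (pt c x)\<bar> <= rho" using p by (simp add: V2_def abs_le_iff)
 qed
 have nonzero: "Pf n (w c x) ~= 0" if c: "c \<in> charts X" and x: "x \<in> cimg c" and Fx: "F c x ~= 0" for c x
 proof (cases "r (pt c x) <= eta")
  case True
  have r4: "r (pt c x) < delta / 4" using True etadelta(1) by simp
  have "r (pt c x) < eta / 2 ==> chi' (r (pt c x)) = 1 & dch (r (pt c x)) = 0" using ch(3) dch1(2) by simp
  from fold_estimate[OF rpos[OF c x Fx] True ch(1,2) dch1(1) c1(1) epsilon_def small(2)[OF c x Fx True] rho(2) small(1)[OF c x Fx True] _ etaK this]
  have "F c x * Pf n (w c x) ~= 0" unfolding inner[OF c x r4] using C0[OF c x] by simp
  then show ?thesis by auto
 next
  case False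
  then have "w c x = wl c x" by (intro outer[OF c x]) simp
  then show ?thesis using Cwl(2)[OF c x Fx] by simp
 qed
 have at_zero: "Pf n (w c x) = 0 & (\<exists>e. FD (%y. Pf n (w c y)) x e ~= 0) & dPf n (w c x) (FD (F c) x) (X.dform psi c x) = C"
  if c: "c \<in> charts X" and x: "x \<in> cimg c" and Fx: "F c x = 0" for c x
 proof -
  obtain S0 m L' where S0: "open S0" "x \<in> S0" "S0 \<subseteq> cimg c" "smo S0 m" "smo S0 L'"
   and Sm: "\<forall>y\<in>S0. m y > 0 & r (pt c y) = (F c y)\<^sup>2 * m y & r (pt c y) < delta / 4 &
    (F c y ~= 0 --> kk c y = r (pt c y) * L' y)" and dC: "dPf n (B c x) (FD (F c) x) (X.dform psi c x) = C"
   using locB[OF c x Fx] by (elim exE conjE)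
  note Cn = C0[OF c x]
  define S where "S = S0 \<inter> (cimg c \<inter> (%y. r (pt c y)) -` {..<eta / 2})"
  have S: "open S" unfolding S_def
   by (intro open_Int S0 continuous_open_preimage[OF sm_cont[OF ri[OF c]]] X.open_coord c open_lessThan)
  have xS: "x \<in> S" using S0(2) x rz[OF c x Fx] eta(1) by (simp add: S_def)
  have sub: "S \<subseteq> S0" "S \<subseteq> cimg c" by (auto simp: S_def)
  have yi: "y \<in> cimg c" if "y \<in> S" for y using that sub by blast
  have sms: "smo S m" "smo S L'" "smo S (F c)" "smo S (%y. r (pt c y))" "smo S (%y. g (pt c y))"
   "smo S (%y. Pf n (w c y))"
  proof -
   show "smo S (%y. Pf n (w c y))"
   proof (rule sm_Pf[OF S])
    show "smo S (%y. w c y u v)" for u v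
    using sm_subset[OF X.closed2D(3)[OF wc c] , of S] sub(2) unfolding X.cset_points[OF c] by blast
   qed
  qed (rule sm_subset[OF S0(4) sub(1)] sm_subset[OF S0(5) sub(1)] sm_subset[OF Fs[OF c] sub(2)]
    sm_subset[OF ri[OF c] sub(2)] sm_subset[OF gi[OF c] sub(2)])+
  have rS: "r (pt c y) < eta / 2" if "y \<in> S" for y using that by (simp add: S_def)
  have bm: "m y > 0" "r (pt c y) = (F c y)\<^sup>2 * m y" "r (pt c y) < delta / 4" if "y \<in> S" for y
   using bspec[OF Sm subsetD[OF sub(1) that]] by auto
  have kL: "kk c y = r (pt c y) * L' y" if "y \<in> S" "F c y ~= 0" for y
   using bspec[OF Sm subsetD[OF sub(1) that(1)]] that(2) by auto
  \<comment> \<open>Off \<open>Z\<close>, \<open>inner\<close> gives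
    \<open>Pf n (w c y) = F c y * u y\<close>, and this extends to \<open>Z\<close> by density. The
    zeros are regular once \<open>u x\<close> is nonzero.\<close>
  define u where "u y = C * m y * ((1 - g (pt c y)) / (r (pt c y) + epsilon) - L' y)" for y
  have re: "r (pt c y) + epsilon > 0" if "y \<in> S" for y using rnn[OF c yi[OF that]] epsilon by simp
  have us: "smo S u" unfolding u_def
  proof (intro sm_mult sm_diff sm_divide sm_add sm_const S sms)
   show "r (pt c y) + epsilon ~= 0" if "y \<in> S" for y using re[OF that] by simp
  qed
  have off: "Pf n (w c y) = F c y * u y" if y: "y \<in> S" and Fy: "F c y ~= 0" for y
  proof -
   have z: "chi' (r (pt c y)) = 1" "dch (r (pt c y)) = 0" using ch(3) dch1(2) rS[OF y] by auto
   have "F c y * Pf n (w c y) = C * (g (pt c y) + 2 * r (pt c y) * (1 / (2 * (r (pt c y) + epsilon))) * (1 - g (pt c y))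
    - (r (pt c y) * L' y + g (pt c y)))"
    unfolding inner[OF c yi[OF y] bm(3)[OF y]] z kL[OF y Fy] by simp
   also have "... = C * r (pt c y) * ((1 - g (pt c y)) / (r (pt c y) + epsilon) - L' y)"
    using re[OF y] by (simp add: field_simps)
   also have "... = C * ((F c y)\<^sup>2 * m y) * ((1 - g (pt c y)) / (r (pt c y) + epsilon) - L' y)" using bm(2)[OF y] by simp
   also have "... = F c y * (F c y * u y)" unfolding u_def by algebra
   finally show ?thesis using Fy by simp
  qed
  have Pu: "Pf n (w c y) = F c y * u y" if y: "y \<in> S" for y
  proof -
   have "Pf n (w c y) - F c y * u y = 0"
   proof (rule X.dense0[OF F(2) c S sub(2) y sm_cont])
    show "smo S (%y. Pf n (w c y) - F c y * u y)" by (intro sm_diff sm_mult S sms us)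
   qed (simp add: off)
   then show ?thesis by simp
  qed
  \<comment> \<open>The bound on \<open>kk\<close> passes to the limit on \<open>Z\<close>; taking
    \<open>max\<close> turns the inequality into an equation to which density applies.\<close>
  have LK: "L' x <= real K"
  proof -
   have "max (L' x - real K) 0 = 0"
   proof (rule X.dense0[OF F(2) c S sub(2) xS])
    show "continuous_on S (%y. max (L' y - real K) 0)" by (intro continuous_on_max continuous_on_diff continuous_on_const sm_cont sms)
    fix y assume y: "y \<in> S" and Fy: "F c y ~= 0"
    have "r (pt c y) <= eta" using rS[OF y] eta(1) by simp
    from small(1)[OF c yi[OF y] Fy this] have "r (pt c y) * L' y <= r (pt c y) * real K"
    unfolding kL[OF y Fy] by (simp add: abs_le_iff mult.commute)
    then show "max (L' y - real K) 0 = 0" using rpos[OF c yi[OF y] Fy] by simp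
   qed
   then show ?thesis by simp
  qed
  \<comment> \<open>This makes \<open>1 / epsilon - L' x\<close> positive, which is
    \<open>u x\<close> up to the nonzero factor \<open>C * m x\<close>.\<close>
  have "1 / epsilon > real K"
  proof -
   have "epsilon * real K <= eta * (real K + 1)"
   proof (rule mult_mono)
    show "epsilon <= eta" unfolding epsilon_def using eta(1) c1(1) by (simp add: field_simps)
   qed (use eta(1) in auto)
   then have "epsilon * real K < 1" using etaK by simp
   then show ?thesis using epsilon by (simp add: field_simps)
  qed
  moreover have "g (pt c x) = 0" using gpt[OF c x] Fx by (simp add: gg_def)
  ultimately have ux: "u x ~= 0" unfolding u_def using rz[OF c x Fx] LK Cn bm(1)[OF xS] by simp
  obtain e where e: "FD (F c) x e ~= 0" using nd[OF c x Fx] by blast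
  have "FD (%y. Pf n (w c y)) x e = FD (%y. F c y * u y) x e" by (rule fun_cong[OF FD_cong[OF S xS Pu]])
  also have "... = FD (F c) x e * u x"
   unfolding FD_rules(1)[OF sm_diffble[OF sms(3) xS] sm_diffble[OF us xS]] Fx by simp
  finally have fd: "FD (%y. Pf n (w c y)) x e ~= 0" using e ux by simp
  have xW: "pt c x \<in> W" by (rule inW[OF c x]) (use rz[OF c x Fx] delta(1) in simp)
  have lphi: "linear (FD (%y. phi (pt c y)) x)"
  proof (rule sm_linear_FD[OF _ x])
   show "smo (cimg c) (%y. phi (pt c y))" using X.sfunD[OF phis c] unfolding X.cset_points[OF c] .
  qed
  have "dPf n (w c x) (FD (F c) x) (X.dform psi c x) = C"
   unfolding wW[OF xW] dPf_upd_same[OF dim aB[OF c x] lphi lF[OF c x] lps[OF c x xW]] by (rule dC)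
  then show ?thesis using Pu[OF xS] Fx fd by auto
 qed
 show thesis
 proof (rule that[OF wc _ _ W L theta R])
  show "X.regular_zeros n w" unfolding X.regular_zeros_def
  proof (intro ballI impI)
   fix c x assume c: "c \<in> charts X" "x \<in> cimg c" "Pf n (w c x) = 0"
   then have "F c x = 0" using nonzero[OF c(1,2)] by auto
   then show "\<exists>e. FD (%y. Pf n (w c y)) x e ~= 0" using at_zero[OF c(1,2)] by blast
  qed
  show "X.zeros_at n w (points Z)" unfolding X.zeros_at_def
  proof (intro ballI)
   fix c x assume c: "c \<in> charts X" "x \<in> cimg c"
   show "Pf n (w c x) = 0 \<longleftrightarrow> pt c x \<in> points Z" using nonzero[OF c] at_zero[OF c] Fz[OF c] by auto
  qed
  fix c x assume c: "c \<in> charts X" and x: "x \<in> cimg c"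
  show "dPf n (w c x) (FD (F c) x) (X.dform psi c x) ~= 0" if "F c x = 0" using at_zero[OF c x that] C0[OF c x] by simp
  assume U': "pt c x \<notin> U"
  have "pt c x \<in> far" using farp[OF X.pt_points[OF c x]] U' by blast
  then have rx: "r (pt c x) > eta" using etadelta(3) by (simp add: far_def)
  have Fx: "F c x ~= 0" using Fz[OF c x] U(2) U' by blast
  show "ipair (P c x) (w c x)" unfolding outer[OF c x rx] by (rule ipair_sym[OF wli(1)[OF c x Fx]])
 qed
qed

end

end

section \<open>The main theorem\<close>

context hypersurface_in
begin

context
 fixes n :: nat assumes dim: "DIM('e) = 2 * n"
begin

text \<open>At a point of \<open>Z\<close> the kernel of dF is the tangent space of
  \<open>Z\<close>, so \<open>dPf_nonzero_iff\<close> translates the nonvanishing of theta wedge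
  omega^(n-1) on \<open>Z\<close> into the nonvanishing of \<open>dPf\<close> in the ambient
  chart.\<close>

lemma fold_form_iff:
 assumes F: "X.cuts_out F (points Z)" and w: "!!c x. c \<in> charts X ==> x \<in> cimg c ==> omega c x = bform (w c x)" "X.covariant w" "X.two_field w"
  and L: "X.lexact W psi" and ZW: "points Z \<subseteq> W" and theta: "closed_form 1 Z theta"
  and R: "!!d y v. d \<in> charts Z ==> y \<in> cimg d ==> FD (%y'. psi (pt d y) (pt d y')) y v = one_form theta d y v"
  and d: "d \<in> charts Z" and c: "c \<in> charts X" and y: "y \<in> overlap d c"
 shows "F c (trn d c y) = 0" "trn d c y \<in> cimg c"
  "dPf n (w c (trn d c y)) (FD (F c) (trn d c y)) (X.dform psi c (trn d c y)) ~= 0 \<longleftrightarrow>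
   field_wedge 1 (2 * (n - 1)) theta (pullback_incl X (field_power omega (n - 1))) d y ~= (%_. 0)"
proof -
 let ?x = "trn d c y"
 note fa = incl_facts[OF d c y]
 have pZ: "pt c ?x \<in> points Z" using fa(1) Z.pt_points[OF d fa(3)] by simp
 show Fx: "F c ?x = 0" using X.cuts_outD(3)[OF F c fa(2)] pZ by simp
 show "?x \<in> cimg c" by (rule fa(2))
 obtain m where n: "n = Suc m" using dim_Suc[OF dim] by blast
 have dimS: "DIM('e) = 2 * Suc m" using dim n by simp
 obtain e where e: "FD (F c) ?x e ~= 0" using X.cuts_outD(4)[OF F c fa(2) Fx] by blast
 have lF: "linear (FD (F c) ?x)" by (rule sm_linear_FD[OF X.cuts_outD(5)[OF F c] fa(2)])
 have xW: "?x \<in> cset c W" using pZ ZW fa(2) by (auto simp: cset_def)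
 have l: "linear (X.dform psi c ?x)" by (rule X.dform_smooth(1)[OF L c xW])
 have Fz: "F c x = 0 \<longleftrightarrow> pt c x \<in> points Z" if "c \<in> charts X" "x \<in> cimg c" for c x by (rule X.cuts_outD(3)[OF F that])
 have tk1: "FD (F c) ?x (FD (trn d c) y v) = 0" for v
  by (rule tangent_kernel(1)[OF X.cuts_outD(1)[OF F] Fz d c y])
 have tk2: "\<exists>v. u = FD (trn d c) y v" if "FD (F c) ?x u = 0" for u
  by (rule tangent_kernel(2)[OF X.cuts_outD(1)[OF F] Fz d c y e that])
 have i: "dPf (Suc m) (w c ?x) (FD (F c) ?x) (X.dform psi c ?x) ~= 0 \<longleftrightarrow>
   (\<exists>v. wedge1 m (X.dform psi c ?x) (w c ?x) (%i. FD (trn d c) y (v i)) ~= 0)"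
  by (rule dPf_nonzero_iff[OF dimS X.two_fieldD(1)[OF w(3) c fa(2)] lF e l tk1 tk2])
 have "field_wedge 1 (2 * (n - 1)) theta (pullback_incl X (field_power omega (n - 1))) d y =
   (%v. wedge1 m (X.dform psi c ?x) (w c ?x) (%i. FD (trn d c) y (v i)))"
  unfolding n diff_Suc_1 by (rule ext, rule field_wedge_restrict[OF w(1,2) L ZW theta R d c y])
 then show "dPf n (w c ?x) (FD (F c) ?x) (X.dform psi c ?x) ~= 0 \<longleftrightarrow>
   field_wedge 1 (2 * (n - 1)) theta (pullback_incl X (field_power omega (n - 1))) d y ~= (%_. 0)"
  using i unfolding n by (simp add: fun_eq_iff)
qed

lemma cuts_out_Pf:
 assumes "X.density (%c x. Pf n (w c x))" "X.regular_zeros n w" "X.zeros_at n w (points Z)"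
 shows "X.cuts_out (%c x. Pf n (w c x)) (points Z)"
 unfolding X.cuts_out_def using assms closed_Z unfolding X.regular_zeros_def X.zeros_at_def by blast

lemma chart_overlap_incl:
 assumes d: "d \<in> charts Z" and y: "y \<in> cimg d"
 obtains c where "c \<in> charts X" "y \<in> overlap d c"
proof -
 have "pt d y \<in> points X" using Z.pt_points[OF d y] Z_subset by blast
 from X.ex_chart[OF this] obtain c where c: "c \<in> charts X" "pt d y \<in> dom_of c" by blast
 have "y \<in> overlap d c" unfolding overlap_incl[OF d c(1)] cset_def using y c(2) by simp
 then show thesis by (rule that[OF c(1)])
qed

lemma log_symplectic_of_folded:
 assumes fs: "folded_symplectic_pair n X Z omega" "admits_fold_form n X Z omega" and U: "opn X U" "points Z \<subseteq> U"
 shows "\<exists>\<pi>. log_symplectic_pair n X Z \<pi> & inverse_outside X U \<pi> omega"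
proof -
 have cf: "closed_form 2 X omega" and tr: "transverse_to_zero (2 * n) X (field_power omega n)" and zl: "zero_locus X (field_power omega n) = points Z"
  using fs(1) unfolding folded_symplectic_pair_def by auto
 have df: "diff_form 2 X omega" using cf unfolding closed_form_def by blast
 note D = X.diff_form_2D[OF df]
 let ?w = "X.cur omega"
 let ?F = "%c x. Pf n (?w c x)"
 have reg: "X.regular_zeros n ?w" using tr X.fold_conditions(1)[OF dim df Z_subset] by blast
 have zer: "X.zeros_at n ?w (points Z)" using zl X.fold_conditions(2)[OF dim df Z_subset] by blast
 have F: "X.cuts_out ?F (points Z)" by (rule cuts_out_Pf[OF X.density_covariant[OF dim D(1,2)] reg zer])
 obtain theta where theta: "closed_form 1 Z theta"
  and nv: "nowhere_vanishing Z (field_wedge 1 (2 * (n - 1)) theta (pullback_incl X (field_power omega (n - 1))))"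
  using fs(2) unfolding admits_fold_form_def by blast
 obtain W psi where W: "opn X W" "points Z \<subseteq> W" and L: "X.lexact W psi"
  and R: "!!d y v. d \<in> charts Z ==> y \<in> cimg d ==> FD (%y'. psi (pt d y) (pt d y')) y v = one_form theta d y v"
  by (rule closed_extension[OF theta], rule that)
 have nz: "dPf n (?w c x) (FD (?F c) x) (X.dform psi c x) ~= 0" if c: "c \<in> charts X" and x: "x \<in> cimg c" and Fx: "Pf n (?w c x) = 0" for c x
 proof -
  have p: "pt c x \<in> points Z" using X.cuts_outD(3)[OF F c x] Fx by simp
  from Z.ex_chart[OF p] obtain d where d: "d \<in> charts Z" "pt c x \<in> dom_of d" by blast
  define y where "y = snd d (pt c x)"
  have pd: "pt d y = pt c x" "y \<in> cimg d" using Z.pt_chart[OF d] d(2) by (auto simp: y_def)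
  have y: "y \<in> overlap d c" unfolding overlap_incl[OF d(1) c] cset_def using pd X.pt_dom[OF c x] by simp
  have Ty: "trn d c y = x" using pd X.chart_point_of[OF c x] by (simp add: transition_def)
  have "field_wedge 1 (2 * (n - 1)) theta (pullback_incl X (field_power omega (n - 1))) d y ~= (%_. 0)"
   using nv d(1) pd(2) unfolding nowhere_vanishing_def by blast
  from iffD2[OF fold_form_iff(3)[OF F D(3,2,1) L W(2) theta R d(1) c y] this] show ?thesis unfolding Ty .
 qed
 obtain P where P: "X.two_field P" "X.contravariant P" "!!c x a b e. c \<in> charts X ==> x \<in> cimg c ==> jac (P c) x a b e = 0"
  "X.regular_zeros n P" "X.zeros_at n P (points Z)"
  "!!c x. c \<in> charts X ==> x \<in> cimg c ==> pt c x \<notin> U ==> ipair (P c x) (?w c x)"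
  by (rule fold_to_log[OF dim X.closed_form_closed2(2)[OF cf] refl F U W L nz], assumption, assumption, assumption, rule that)
 have mv: "multivector_field 2 X (X.uncp P)" by (rule X.multivector_2I[OF P(1,2)])
 have "poisson X (X.uncp P)" unfolding X.poisson_iff[OF mv] X.curp_uncp using P(3) by blast
 moreover have "transverse_to_zero (2 * n) X (field_power (X.uncp P) n)"
  unfolding X.log_conditions(1)[OF dim mv Z_subset] X.curp_uncp by (rule P(4))
 moreover have "zero_locus X (field_power (X.uncp P) n) = points Z"
  unfolding X.log_conditions(2)[OF dim mv Z_subset] X.curp_uncp by (rule P(5))
 moreover have "inverse_outside X U (X.uncp P) omega" unfolding inverse_outside_def
 proof (intro ballI)
  fix c p assume c: "c \<in> charts X" and p: "p \<in> dom_of c - U"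
  have x: "snd c p \<in> cimg c" "pt c (snd c p) \<notin> U" using p X.pt_chart[OF c] by auto
  show "mutually_inverse (X.uncp P c (snd c p)) (omega c (snd c p))"
   by (rule X.mutually_inverse_ipair[OF X.two_fieldD(1)[OF P(1) c x(1)] X.two_fieldD(1)[OF D(1) c x(1)] P(6)[OF c x]])
    (simp_all add: X.uncp_def D(3)[OF c x(1)] bform_def)
 qed
 ultimately show ?thesis unfolding log_symplectic_pair_def log_symplectic_def by blast
qed

lemma folded_symplectic_of_log:
 assumes ls: "log_symplectic_pair n X Z \<pi>" and U: "opn X U" "points Z \<subseteq> U"
 shows "\<exists>omega. folded_symplectic_pair n X Z omega & admits_fold_form n X Z omega & inverse_outside X U \<pi> omega"
proof -
 have po: "poisson X \<pi>" and tr: "transverse_to_zero (2 * n) X (field_power \<pi> n)" and zl: "zero_locus X (field_power \<pi> n) = points Z"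
  using ls unfolding log_symplectic_pair_def log_symplectic_def by auto
 have mv: "multivector_field 2 X \<pi>" using po unfolding poisson_def by blast
 note D = X.multivector_2D[OF mv]
 let ?P = "X.curp \<pi>"
 let ?F = "%c x. Pf n (?P c x)"
 have reg: "X.regular_zeros n ?P" using tr X.log_conditions(1)[OF dim mv Z_subset] by blast
 have zer: "X.zeros_at n ?P (points Z)" using zl X.log_conditions(2)[OF dim mv Z_subset] by blast
 have F: "X.cuts_out ?F (points Z)" by (rule cuts_out_Pf[OF X.density_contravariant[OF dim D(1,2)] reg zer])
 have jac: "jac (?P c) x a b e = 0" if "c \<in> charts X" "x \<in> cimg c" for c x a b e
  using po that unfolding X.poisson_iff[OF mv] by blast
 obtain w W psi theta where wc: "X.closed2 (points X) w" and w: "X.regular_zeros n w" "X.zeros_at n w (points Z)"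
  and W: "opn X W" "points Z \<subseteq> W" and L: "X.lexact W psi" and theta: "closed_form 1 Z theta"
  and R: "!!d y v. d \<in> charts Z ==> y \<in> cimg d ==> FD (%y'. psi (pt d y) (pt d y')) y v = one_form theta d y v"
  and nz: "!!c x. c \<in> charts X ==> x \<in> cimg c ==> ?F c x = 0 ==> dPf n (w c x) (FD (?F c) x) (X.dform psi c x) ~= 0"
  and ip: "!!c x. c \<in> charts X ==> x \<in> cimg c ==> pt c x \<notin> U ==> ipair (?P c x) (w c x)"
  by (rule log_to_fold[OF dim D(1,2) jac refl F U], assumption, assumption, rule that)
 have w2: "X.two_field w" "X.covariant w" using wc unfolding X.closed2_points by auto
 let ?omega = "X.unc w"
 have cf: "closed_form 2 X ?omega" by (rule X.closed_form_closed2(1)[OF wc])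
 have df: "diff_form 2 X ?omega" by (rule X.diff_form_2I[OF w2])
 have bf: "?omega c x = bform (w c x)" for c x by (simp add: X.unc_def)
 let ?pb = "pullback_incl X (field_power ?omega (n - 1)) :: ('a, 'f, 'f) field"
 have nv: "field_wedge 1 (2 * (n - 1)) theta ?pb d y ~= (%_. 0)" if d: "d \<in> charts Z" and y: "y \<in> cimg d" for d y
 proof -
  obtain c where c: "c \<in> charts X" "y \<in> overlap d c" by (rule chart_overlap_incl[OF d y])
  note ff = fold_form_iff[OF F bf w2(2,1) L W(2) theta R d c]
  show ?thesis by (rule iffD1[OF ff(3) nz[OF c(1) ff(2,1)]])
 qed
 \<comment> \<open>If the restriction of omega^(n-1) vanished at a point, so would its product with
   theta.\<close>
 have "nowhere_vanishing Z ?pb" unfolding nowhere_vanishing_def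
 proof (intro ballI notI)
  fix d y assume d: "d \<in> charts Z" "y \<in> cimg d" and z: "?pb d y = (%_. 0)"
  have "field_wedge 1 (2 * (n - 1)) theta ?pb d y = (%_. 0)" unfolding field_wedge_def z wedge_def by simp
  then show False using nv[OF d] by contradiction
 qed
 moreover have "transverse_to_zero (2 * n) X (field_power ?omega n)"
  unfolding X.fold_conditions(1)[OF dim df Z_subset] X.cur_unc by (rule w(1))
 moreover have "zero_locus X (field_power ?omega n) = points Z"
  unfolding X.fold_conditions(2)[OF dim df Z_subset] X.cur_unc by (rule w(2))
 ultimately have "folded_symplectic_pair n X Z ?omega" unfolding folded_symplectic_pair_def using cf by blast
 moreover have "admits_fold_form n X Z ?omega" unfolding admits_fold_form_def nowhere_vanishing_def
  using theta nv by (intro exI[of _ theta] conjI ballI)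
 moreover have "inverse_outside X U \<pi> ?omega" unfolding inverse_outside_def
 proof (intro ballI)
  fix c p assume c: "c \<in> charts X" and p: "p \<in> dom_of c - U"
  have x: "snd c p \<in> cimg c" "pt c (snd c p) \<notin> U" using p X.pt_chart[OF c] by auto
  show "mutually_inverse (\<pi> c (snd c p)) (?omega c (snd c p))"
   by (rule X.mutually_inverse_ipair[OF X.two_fieldD(1)[OF D(1) c x(1)] X.two_fieldD(1)[OF w2(1) c x(1)] ip[OF c x] D(3)[OF c x(1)]])
    (simp add: bf bform_def)
 qed
 ultimately show ?thesis by blast
qed

end

end

theorem mainTheorem3:
  fixes n :: nat
    and X :: "('a, 'e::euclidean_space) manifold"
    and Z :: "('a, 'f::euclidean_space) manifold"
  assumes "DIM('e) = 2 * n"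
    and "compact_manifold X"
    and "hypersurface X Z"
  shows "((\<exists>\<pi>. log_symplectic_pair n X Z \<pi>) \<longleftrightarrow>
          (\<exists>\<omega>. folded_symplectic_pair n X Z \<omega> \<and> admits_fold_form n X Z \<omega>))
    \<and> (\<forall>\<pi> U. log_symplectic_pair n X Z \<pi> \<and> openin (mtop X) U \<and> points Z \<subseteq> U \<longrightarrow>
          (\<exists>\<omega>. folded_symplectic_pair n X Z \<omega> \<and> admits_fold_form n X Z \<omega> \<and>
               inverse_outside X U \<pi> \<omega>))
    \<and> (\<forall>\<omega> U. folded_symplectic_pair n X Z \<omega> \<and> admits_fold_form n X Z \<omega> \<and>
             openin (mtop X) U \<and> points Z \<subseteq> U \<longrightarrow>
          (\<exists>\<pi>. log_symplectic_pair n X Z \<pi> \<and> inverse_outside X U \<pi> \<omega>))"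
proof -
 interpret hypersurface_in X Z
  using assms(2,3) by unfold_locales (auto simp: compact_manifold_def hypersurface_def)
 note A = folded_symplectic_of_log[OF assms(1)] and B = log_symplectic_of_folded[OF assms(1)]
 \<comment> \<open>The equivalence is the case where \<open>U\<close> is the whole manifold.\<close>
 have "(\<exists>\<pi>. log_symplectic_pair n X Z \<pi>) \<longleftrightarrow> (\<exists>omega. folded_symplectic_pair n X Z omega & admits_fold_form n X Z omega)"
  using A[OF _ openin_topspace Z_subset] B[OF _ _ openin_topspace Z_subset] by blast
 then show ?thesis using A B by blast
qed

end
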